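(* Consider the algorithm DAMA described in the context, under the following assumptions. Polyak–Łojasiewicz condition and lower-boundedness: for each $x$ the maximum defining $P(x)=\max_yJ(x,y)$ is attained, $\|\nabla_yJ(x,y)\|^2\ge2\nu(P(x)-J(x,y))$ for all $x,y$ with some $\nu>0$, and $P^\star=\inf_xP(x)>-\infty$. Expected smoothness: for each $k$ and $w\in\{x,y\}$, $\mathbb E\|\nabla_wQ_k(x_1,y_1;\xi)-\nabla_wQ_k(x_2,y_2;\xi)\|^2\le L_f^2(\|x_1-x_2\|^2+\|y_1-y_2\|^2)$, where $\xi$ is a random local sample of agent $k$. Stochastic gradients: samples are drawn i.i.d., independently over agents and iterations, and conditionally on the past, $\nabla_wQ_k(x_{k,i},y_{k,i};\xi_{k,i})$ is an unbiased estimate of $\nabla_wJ_k(x_{k,i},y_{k,i})$ with variance at most $\sigma^2$. Combination matrices: $W\in\mathbb R^{K\times K}$ is symmetric, doubly stochastic and primitive, $\mathcal A_x=A_x\otimes I_{d_1}$, $\mathcal B_x=B_x\otimes I_{d_1}$, $\mathcal C_x=C_x\otimes I_{d_1}$, where $A_x,B_x^2,C_x$ are polynomials in $W$, $A_x\mathbf 1=C_x\mathbf 1=\mathbf 1$, and $B_x$ is symmetric positive semidefinite with null space $\mathrm{span}\{\mathbf 1\}$, likewise for $\mathcal A_y,\mathcal B_y,\mathcal C_y$ with $d_2$, and the fixed factorizations $\mathcal P_x=\widehat{\mathcal Q}_x\mathcal T_x\widehat{\mathcal Q}_x^{-1}$, $\mathcal P_y=\widehat{\mathcal Q}_y\mathcal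 T_y\widehat{\mathcal Q}_y^{-1}$ satisfy $\|\mathcal T_x\|<1$, $\|\mathcal T_y\|<1$. Suppose $\beta_x=\beta_y=\beta\in[0,1]$, $p\in[0,1]$, set $\bar\beta=p+\beta-p\beta>0$ and $\beta'=p+\beta^2$, and suppose that $$\mu_x\le\min\Big\{\frac1{32L},\frac{\mu_y}{16\kappa^2},\frac{\sqrt{Kb\bar\beta}}{24\sqrt3\,\kappa L_f}\Big\},$$ $$\mu_y\le\min\Big\{\frac1\nu,\frac1{2L_f},\frac{\sqrt{Kb\bar\beta}}{12L_f},\frac{(1-\rho)\underline{\lambda_b}}{\sqrt{620}L_fv_1v_2\lambda_a},\frac{(1-\rho)\underline{\lambda_b}}{12L_fv_1v_2\lambda_a},\frac{(1-\rho)\underline{\lambda_b}}{24L_fv_1v_2\lambda_a}\sqrt{\frac{b\bar\beta}{p+\beta^2}},\frac{(1-\rho)^{2/3}\underline{\lambda_b}^{2/3}(bK\bar\beta)^{1/3}}{90L_f\kappa^{1/3}v_1^{2/3}v_2^{2/3}\lambda_a^{2/3}}\Big\},$$ $$\bar\beta\le\frac{\nu\mu_y}2,\quad b\bar\beta\le\frac1K,\quad p+\beta\le1,\quad \beta+bp\le b,\quad b\ge1,\quad \bar\beta\le1 .$$ Then for every $T\ge1$, $$\frac1T\sum_{i=0}^{T-1}\Big(\mathbb E\|\nabla_xJ(x_{c,i},y_{c,i})\|^2+\mathbb E\|\nabla_yJ(x_{c,i},y_{c,i})\|^2\Big)\le\mathcal O\Big(\frac{\mathbb E G_{p,0}}{T\mu_x}+\frac{\kappa^2\mathbb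 E\Delta_{c,0}}{T\mu_y}+\frac{\kappa^2(a'+c'\mu_y^2+f')\mu_y^2\zeta_0^2}{T}+\frac{\kappa^2b'\mu_y^2\sigma^2}{T}+\kappa^2(d'\mu_y^2+e')\sigma^2\Big),$$ where the constant hidden in $\mathcal O$ depends only on $v_1,v_2$, and $$a'=\frac{L_f^2}{bK\bar\beta(1-\rho)\underline{\lambda_b}^2},\quad b'=\frac{L_f^2\lambda_a^2\beta'}{bb_0K\bar\beta^2(1-\rho)^2\underline{\lambda_b}^2},\quad c'=\frac{L_f^4\lambda_a^2\beta'}{b^2K\bar\beta^2(1-\rho)^2\underline{\lambda_b}^4},$$ $$d'=\frac{L_f^2\lambda_a^2}{bK\bar\beta(1-\rho)^2\underline{\lambda_b}^2}\Big(\frac pB\mathbb I_{\rm online}+\frac{\beta^2}b\Big),\quad e'=\frac1{b_0\bar\beta KT}+\frac{\beta^2}{Kb\bar\beta}+\frac p{KB\bar\beta}\mathbb I_{\rm online},\quad f'=\frac{L_f^2}{bK\bar\beta\,\underline{\lambda_b}^2}.$$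
   Context: Problem. $K$ agents solve $\min_{x\in\mathbb R^{d_1}}\max_{y\in\mathbb R^{d_2}}J(x,y)$, $J=\frac1K\sum_{k=1}^KJ_k$, with $J_k(x,y)=\mathbb E[Q_k(x,y;\zeta_k)]$ (online scenario, $\mathbb I_{\rm online}=1$) or $J_k(x,y)=\frac1{N_k}\sum_{s=1}^{N_k}Q_k(x,y;\zeta_k(s))$ (offline scenario, $\mathbb I_{\rm online}=0$). Put $P(x)=\max_yJ(x,y)$. Assumptions. Polyak–Łojasiewicz and lower-boundedness: For each $x$ the maximum defining $P(x)$ is attained, $\|\nabla_yJ(x,y)\|^2\ge2\nu(P(x)-J(x,y))$ for all $x,y$ with some $\nu>0$, and $P^\star=\inf_xP(x)>-\infty$. Expected $L_f$-smoothness: for each $k$ and $w\in\{x,y\}$, $\mathbb E\|\nabla_wQ_k(x_1,y_1;\xi)-\nabla_wQ_k(x_2,y_2;\xi)\|^2\le L_f^2(\|x_1-x_2\|^2+\|y_1-y_2\|^2)$, where $\xi$ is a random local sample of agent $k$ (uniform over the local data set in the offline case). Stochastic gradients: Samples are drawn i.i.d., independently over agents and iterations; conditionally on the past, $\nabla_wQ_k(x_{k,i},y_{k,i};\xi_{k,i})$ is an unbiased estimate of $\nabla_wJ_k(x_{k,i},y_{k,i})$ with variance at most $\sigma^2$. Combination matrices: $W\in\mathbb R^{K\times K}$ is symmetric, doubly stochastic and primitive, $\mathcal A_x=A_x\otimes I_{d_1}$, $\mathcal B_x=B_x\otimes I_{d_1}$, $\mathcal C_x=C_x\otimes I_{d_1}$,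 where $A_x,B_x^2,C_x$ are polynomials in $W$, $A_x\mathbf 1=C_x\mathbf 1=\mathbf 1$, and $B_x$ is symmetric positive semidefinite with null space $\mathrm{span}\{\mathbf 1\}$; likewise for $\mathcal A_y,\mathcal B_y,\mathcal C_y$ with $d_2$. With $\widehat U\in\mathbb R^{K\times(K-1)}$ the orthonormal eigenvectors of $W$ orthogonal to $\mathbf 1$, let $\widehat{\mathcal U}_x=\widehat U\otimes I_{d_1}$, $\widehat\Lambda_{a_x}=\widehat{\mathcal U}_x^\top\mathcal A_x\widehat{\mathcal U}_x$, $\widehat\Lambda_{b_x}=\widehat{\mathcal U}_x^\top\mathcal B_x\widehat{\mathcal U}_x$, $\widehat\Lambda_{c_x}=\widehat{\mathcal U}_x^\top\mathcal C_x\widehat{\mathcal U}_x$ (and similarly for $y$). The matrix $\mathcal P_x=\begin{bmatrix}\widehat\Lambda_{a_x}\widehat\Lambda_{c_x}-\widehat\Lambda_{b_x}^2&-\widehat\Lambda_{b_x}\\\widehat\Lambda_{b_x}&I\end{bmatrix}$ has a factorization $\mathcal P_x=\widehat{\mathcal Q}_x\mathcal T_x\widehat{\mathcal Q}_x^{-1}$ with $\|\mathcal T_x\|<1$ (fixed once and for all), and similarly $\mathcal P_y=\widehat{\mathcal Q}_y\mathcal T_y\widehat{\mathcal Q}_y^{-1}$ with $\|\mathcal T_y\|<1$. Norms are Euclidean/spectral. Algorithm DAMA. Stack local variables as $\mathcal X_i=\mathrm{col}\{x_{1,i},\dots,x_{K,i}\}$, $\mathcal Y_i=\mathrm{col}\{y_{k,i}\}$,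 gradient estimates $\mathcal G_{x,i}=\mathrm{col}\{g^x_{k,i}\}$, $\mathcal G_{y,i}=\mathrm{col}\{g^y_{k,i}\}$ and dual variables $\mathcal D_{x,i},\mathcal D_{y,i}$. For $i\ge0$: $\mathcal X_{i+1}=\mathcal A_x(\mathcal C_x\mathcal X_i-\mu_x\mathcal G_{x,i})-\mathcal B_x\mathcal D_{x,i}$, $\mathcal Y_{i+1}=\mathcal A_y(\mathcal C_y\mathcal Y_i+\mu_y\mathcal G_{y,i})-\mathcal B_y\mathcal D_{y,i}$, $\mathcal D_{x,i+1}=\mathcal D_{x,i}+\mathcal B_x\mathcal X_{i+1}$, $\mathcal D_{y,i+1}=\mathcal D_{y,i}+\mathcal B_y\mathcal Y_{i+1}$, with step sizes $\mu_x,\mu_y>0$. Initialization is identical at all agents: $\mathcal X_0=\mathbf 1_K\otimes x_0$, $\mathcal Y_0=\mathbf 1_K\otimes y_0$, $\mathcal D_{x,0}=\mathbf 1_K\otimes d_{x,0}$, $\mathcal D_{y,0}=\mathbf 1_K\otimes d_{y,0}$. The estimator (GRACE): $g^w_{k,0}$ ($w\in\{x,y\}$) is a minibatch gradient with $b_0$ i.i.d. samples; for $i\ge1$ draw $\pi_i\sim\mathrm{Bernoulli}(p)$ independent of everything else and shared by all agents. If $\pi_i=1$, $g^w_{k,i}=\frac1{|\mathcal E_{k,i}|}\sum_{\xi\in\mathcal E_{k,i}}\nabla_wQ_k(x_{k,i},y_{k,i};\xi)$, where $\mathcal E_{k,i}$ consists of $B$ i.i.d. samples (online) or is the full local data set (offline).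 If $\pi_i=0$, with a minibatch $\mathcal E'_{k,i}$ of $b$ i.i.d. samples, $g^w_{k,i}=(1-\beta_w)\big(g^w_{k,i-1}-\frac1b\sum_{\xi\in\mathcal E'_{k,i}}\nabla_wQ_k(x_{k,i-1},y_{k,i-1};\xi)\big)+\frac1b\sum_{\xi\in\mathcal E'_{k,i}}\nabla_wQ_k(x_{k,i},y_{k,i};\xi)$. Notation. $x_{c,i}=\frac1K\sum_kx_{k,i}$, $y_{c,i}=\frac1K\sum_ky_{k,i}$; $\kappa=L_f/\nu$, $L=L_f+\kappa L_f/2$; $G_{p,0}=P(x_{c,0})-P^\star$; $\Delta_{c,0}=P(x_{c,0})-J(x_{c,0},y_{c,0})$; $\zeta_0^2=\frac1K\mathbb E\|(\mathcal A_x-\frac1K\mathbf 1\mathbf 1^\top\otimes I_{d_1})\mathcal G_{x,0}\|^2+\frac1K\mathbb E\|(\mathcal A_y-\frac1K\mathbf 1\mathbf 1^\top\otimes I_{d_2})\mathcal G_{y,0}\|^2$; $\rho=\max\{\|\mathcal T_x\|,\|\mathcal T_y\|\}$; $\lambda_a=\max\{\|\widehat\Lambda_{a_x}\|,\|\widehat\Lambda_{a_y}\|\}$; $1/\underline{\lambda_b}^2=\max\{\|\widehat\Lambda_{b_x}^{-1}\|^2,\|\widehat\Lambda_{b_y}^{-1}\|^2\}$; $v_1^2=\max\{\|\widehat{\mathcal Q}_x\|^2,\|\widehat{\mathcal Q}_y\|^2\}$, $v_2^2=\max\{\|\widehat{\mathcal Q}_x^{-1}\|^2,\|\widehat{\mathcal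 Q}_y^{-1}\|^2\}$. Bounds that divide by a vanishing quantity in a minimum are read as $+\infty$.
   Formalization: It is additionally assumed that ν ≤ L_f (κ ≥ 1); this follows from the other assumptions unless ∇_yJ vanishes identically, where the bound can fail for large ν. The constant in O is stated for each fixed choice of sample and outcome types. *)

theory Defs
  imports
    "HOL-Probability.Probability"
    "Jordan_Normal_Form.Gauss_Jordan_Elimination"
    "Jordan_Normal_Form.Char_Poly"
    "Jordan_Normal_Form.Matrix_Kernel"
begin

unbundle no vec_syntax and no inner_syntax

(* Vectors of R^d are elements of carrier_vec d. Numbers of agents and dimensions are natural
   numbers, not types, so that one constant can be claimed uniformly in all of them. *)

section \<open>Vectors and matrices\<close>

definition vnorm :: "'a::real_normed_vector vec \<Rightarrow> real" where
  "vnorm v = sqrt (\<Sum>i<dim_vec v. (norm (v $ i))\<^sup>2)"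

text \<open>Spectral norm. A matrix without rows or columns has norm 0 (this occurs for one agent).\<close>

definition opnorm :: "'a::real_normed_field mat \<Rightarrow> real" where
  "opnorm A = Sup {vnorm (A *\<^sub>v v) | v. v \<in> carrier_vec (dim_col A) \<and> vnorm v \<le> 1}"

definition minv :: "'a::field mat \<Rightarrow> 'a mat" where
  "minv A = the (mat_inverse A)"

definition ones :: "nat \<Rightarrow> real vec" where
  "ones K = vec K (\<lambda>_. 1)"

text \<open>The matrix \<open>(1/K) 1 1\<^sup>T\<close>.\<close>

definition avg_mat :: "nat \<Rightarrow> real mat" where
  "avg_mat K = mat K K (\<lambda>_. 1 / real K)"

text \<open>The Kronecker product of \<open>M\<close> with the identity matrix of size \<open>d\<close>.\<close>

definition kron :: "real mat \<Rightarrow> nat \<Rightarrow> real mat" where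
  "kron M d = mat (dim_row M * d) (dim_col M * d)
     (\<lambda>(i, j). if i mod d = j mod d then M $$ (i div d, j div d) else 0)"

text \<open>\<open>stack d K f\<close> is \<open>col{f 0, \<dots>, f (K - 1)}\<close>, and \<open>block d k\<close> extracts the \<open>k\<close>-th block.\<close>

definition stack :: "nat \<Rightarrow> nat \<Rightarrow> (nat \<Rightarrow> real vec) \<Rightarrow> real vec" where
  "stack d K f = vec (K * d) (\<lambda>j. f (j div d) $ (j mod d))"

definition block :: "nat \<Rightarrow> nat \<Rightarrow> real vec \<Rightarrow> real vec" where
  "block d k v = vec d (\<lambda>j. v $ (k * d + j))"

definition vmean :: "nat \<Rightarrow> nat \<Rightarrow> (nat \<Rightarrow> real vec) \<Rightarrow> real vec" where
  "vmean d n f = vec d (\<lambda>j. (\<Sum>s<n. f s $ j) / real n)"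

definition poly_mat :: "real poly \<Rightarrow> real mat \<Rightarrow> real mat" where
  "poly_mat q M = mat (dim_row M) (dim_row M)
     (\<lambda>(i, j). \<Sum>n\<le>degree q. coeff q n * (M ^\<^sub>m n) $$ (i, j))"

definition doubly_stochastic :: "nat \<Rightarrow> real mat \<Rightarrow> bool" where
  "doubly_stochastic K M \<longleftrightarrow> M \<in> carrier_mat K K \<and> (\<forall>i<K. \<forall>j<K. 0 \<le> M $$ (i, j)) \<and>
     (\<forall>i<K. (\<Sum>j<K. M $$ (i, j)) = 1) \<and> (\<forall>j<K. (\<Sum>i<K. M $$ (i, j)) = 1)"

definition primitive_mat :: "nat \<Rightarrow> real mat \<Rightarrow> bool" where
  "primitive_mat K M \<longleftrightarrow> M \<in> carrier_mat K K \<and> (\<forall>i<K. \<forall>j<K. 0 \<le> M $$ (i, j)) \<and>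
     (\<exists>m>0. \<forall>i<K. \<forall>j<K. 0 < (M ^\<^sub>m m) $$ (i, j))"

section \<open>Gradients\<close>

definition has_gradient :: "nat \<Rightarrow> (real vec \<Rightarrow> real) \<Rightarrow> real vec \<Rightarrow> real vec \<Rightarrow> bool" where
  "has_gradient d f x g \<longleftrightarrow> g \<in> carrier_vec d \<and>
     (\<forall>\<epsilon>>0. \<exists>\<delta>>0. \<forall>h\<in>carrier_vec d. vnorm h < \<delta> \<longrightarrow>
        \<bar>f (x + h) - f x - g \<bullet> h\<bar> \<le> \<epsilon> * vnorm h)"

definition gradient :: "nat \<Rightarrow> (real vec \<Rightarrow> real) \<Rightarrow> real vec \<Rightarrow> real vec" where
  "gradient d f x = (THE g. has_gradient d f x g)"

section \<open>The minimax problem\<close>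

text \<open>\<open>Vx\<close> and \<open>Vy\<close> stand for the index \<open>w \<in> {x, y}\<close>.\<close>

datatype var = Vx | Vy

text \<open>Agents are \<open>0, \<dots>, nagents - 1\<close>. The local distributions \<open>dist_of\<close> are used
  only in the online scenario, the local data sets only in the offline one.\<close>

record 'z problem =
  nagents :: nat
  xdim :: nat
  ydim :: nat
  online :: bool
  sample_space :: "'z measure"
  dist_of :: "nat \<Rightarrow> 'z measure"
  dsize :: "nat \<Rightarrow> nat"
  dataset :: "nat \<Rightarrow> nat \<Rightarrow> 'z"
  cost :: "nat \<Rightarrow> real vec \<Rightarrow> real vec \<Rightarrow> 'z \<Rightarrow> real"

definition vdim :: "'z problem \<Rightarrow> var \<Rightarrow> nat" where
  "vdim pb w = (case w of Vx \<Rightarrow> xdim pb | Vy \<Rightarrow> ydim pb)"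

definition online_ind :: "'z problem \<Rightarrow> real" where
  "online_ind pb = (if online pb then 1 else 0)"

text \<open>The law of one random local sample of agent \<open>k\<close>; offline it is uniform over the local
  data set (counted with multiplicity).\<close>

definition sample_law :: "'z problem \<Rightarrow> nat \<Rightarrow> 'z measure" where
  "sample_law pb k = (if online pb then dist_of pb k
     else distr (measure_pmf (pmf_of_set {..<dsize pb k})) (sample_space pb) (dataset pb k))"

definition local_obj :: "'z problem \<Rightarrow> nat \<Rightarrow> real vec \<Rightarrow> real vec \<Rightarrow> real" where
  "local_obj pb k x y = (if online pb then (\<integral>z. cost pb k x y z \<partial>dist_of pb k)
     else (\<Sum>s<dsize pb k. cost pb k x y (dataset pb k s)) / real (dsize pb k))"

definition obj :: "'z problem \<Rightarrow> real vec \<Rightarrow> real vec \<Rightarrow> real" where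
  "obj pb x y = (\<Sum>k<nagents pb. local_obj pb k x y) / real (nagents pb)"

definition primal :: "'z problem \<Rightarrow> real vec \<Rightarrow> real" where
  "primal pb x = (SUP y\<in>carrier_vec (ydim pb). obj pb x y)"

definition primal_inf :: "'z problem \<Rightarrow> real" where
  "primal_inf pb = (INF x\<in>carrier_vec (xdim pb). primal pb x)"

text \<open>Existence and value of the partial gradient with respect to the variable \<open>w\<close>.\<close>

definition has_pgrad ::
    "'z problem \<Rightarrow> var \<Rightarrow> (real vec \<Rightarrow> real vec \<Rightarrow> real) \<Rightarrow> real vec \<Rightarrow> real vec \<Rightarrow> bool" where
  "has_pgrad pb w f x y = (case w of
      Vx \<Rightarrow> (\<exists>g. has_gradient (xdim pb) (\<lambda>u. f u y) x g)
    | Vy \<Rightarrow> (\<exists>g. has_gradient (ydim pb) (\<lambda>v. f x v) y g))"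

definition pgrad ::
    "'z problem \<Rightarrow> var \<Rightarrow> (real vec \<Rightarrow> real vec \<Rightarrow> real) \<Rightarrow> real vec \<Rightarrow> real vec \<Rightarrow> real vec" where
  "pgrad pb w f x y = (case w of
      Vx \<Rightarrow> gradient (xdim pb) (\<lambda>u. f u y) x
    | Vy \<Rightarrow> gradient (ydim pb) (\<lambda>v. f x v) y)"

definition cost_grad ::
    "'z problem \<Rightarrow> var \<Rightarrow> nat \<Rightarrow> real vec \<Rightarrow> real vec \<Rightarrow> 'z \<Rightarrow> real vec" where
  "cost_grad pb w k x y z = pgrad pb w (\<lambda>u v. cost pb k u v z) x y"

text \<open>What has to hold for the objects of the problem to be meaningful: the data are well-formed,
  expectations and gradients exist, and stochastic gradients are jointly measurable
  (\<open>vec d\<close> turns a point of the product space into a vector).\<close>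

definition regular_problem :: "'z problem \<Rightarrow> bool" where
  "regular_problem pb \<longleftrightarrow>
     1 \<le> nagents pb \<and> 1 \<le> xdim pb \<and> 1 \<le> ydim pb \<and>
     (\<forall>k<nagents pb.
       (if online pb
        then prob_space (dist_of pb k) \<and> sets (dist_of pb k) = sets (sample_space pb)
        else 1 \<le> dsize pb k \<and> (\<forall>s<dsize pb k. dataset pb k s \<in> space (sample_space pb))) \<and>
       (\<forall>x\<in>carrier_vec (xdim pb). \<forall>y\<in>carrier_vec (ydim pb).
          (online pb \<longrightarrow> integrable (dist_of pb k) (cost pb k x y)) \<and>
          (\<forall>w. has_pgrad pb w (local_obj pb k) x y \<and>
             (\<forall>z\<in>space (sample_space pb). has_pgrad pb w (\<lambda>u v. cost pb k u v z) x y))) \<and>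
       (\<forall>w. \<forall>j<vdim pb w.
          (\<lambda>(u, v, z). cost_grad pb w k (vec (xdim pb) u) (vec (ydim pb) v) z $ j)
            \<in> borel_measurable ((\<Pi>\<^sub>M i\<in>{..<xdim pb}. borel) \<Otimes>\<^sub>M
                (\<Pi>\<^sub>M i\<in>{..<ydim pb}. borel) \<Otimes>\<^sub>M sample_space pb)))"

text \<open>If \<open>\<nabla>\<^sub>y J\<close> vanishes identically, the inequality holds for every \<open>\<nu>\<close>. Otherwise, together with
  \<open>L\<^sub>f\<close>-smoothness, it forces \<open>\<nu> \<le> L\<^sub>f\<close>.\<close>

definition pl_condition :: "'z problem \<Rightarrow> real \<Rightarrow> bool" where
  "pl_condition pb \<nu> \<longleftrightarrow> 0 < \<nu> \<and>
     (\<forall>x\<in>carrier_vec (xdim pb). \<exists>y\<in>carrier_vec (ydim pb).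
        \<forall>y'\<in>carrier_vec (ydim pb). obj pb x y' \<le> obj pb x y) \<and>
     (\<forall>x\<in>carrier_vec (xdim pb). \<forall>y\<in>carrier_vec (ydim pb).
        2 * \<nu> * (primal pb x - obj pb x y) \<le> (vnorm (pgrad pb Vy (obj pb) x y))\<^sup>2)"

definition primal_bounded_below :: "'z problem \<Rightarrow> bool" where
  "primal_bounded_below pb \<longleftrightarrow> bdd_below (primal pb ` carrier_vec (xdim pb))"

definition expected_smooth :: "'z problem \<Rightarrow> real \<Rightarrow> bool" where
  "expected_smooth pb L\<^sub>f \<longleftrightarrow> (\<forall>k<nagents pb. \<forall>w.
     \<forall>x\<^sub>1\<in>carrier_vec (xdim pb). \<forall>y\<^sub>1\<in>carrier_vec (ydim pb).
     \<forall>x\<^sub>2\<in>carrier_vec (xdim pb). \<forall>y\<^sub>2\<in>carrier_vec (ydim pb).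
       (\<integral>\<^sup>+z. ennreal ((vnorm (cost_grad pb w k x\<^sub>1 y\<^sub>1 z - cost_grad pb w k x\<^sub>2 y\<^sub>2 z))\<^sup>2)
          \<partial>sample_law pb k)
       \<le> ennreal (L\<^sub>f\<^sup>2 * ((vnorm (x\<^sub>1 - x\<^sub>2))\<^sup>2 + (vnorm (y\<^sub>1 - y\<^sub>2))\<^sup>2)))"

section \<open>Combination matrices\<close>

record network =
  wmat :: "real mat"
  umat :: "real mat"
  amat :: "var \<Rightarrow> real mat"
  bmat :: "var \<Rightarrow> real mat"
  cmat :: "var \<Rightarrow> real mat"
  qmat :: "var \<Rightarrow> complex mat"
  tmat :: "var \<Rightarrow> complex mat"

definition combination_matrices :: "nat \<Rightarrow> network \<Rightarrow> bool" where
  "combination_matrices K nw \<longleftrightarrow>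
     doubly_stochastic K (wmat nw) \<and> primitive_mat K (wmat nw) \<and>
     transpose_mat (wmat nw) = wmat nw \<and>
     (\<forall>w. amat nw w \<in> carrier_mat K K \<and> bmat nw w \<in> carrier_mat K K \<and>
        cmat nw w \<in> carrier_mat K K \<and>
        (\<exists>q. amat nw w = poly_mat q (wmat nw)) \<and>
        (\<exists>q. bmat nw w * bmat nw w = poly_mat q (wmat nw)) \<and>
        (\<exists>q. cmat nw w = poly_mat q (wmat nw)) \<and>
        amat nw w *\<^sub>v ones K = ones K \<and> cmat nw w *\<^sub>v ones K = ones K \<and>
        transpose_mat (bmat nw w) = bmat nw w \<and>
        (\<forall>v\<in>carrier_vec K. 0 \<le> v \<bullet> (bmat nw w *\<^sub>v v)) \<and>
        mat_kernel (bmat nw w) = range (\<lambda>c. c \<cdot>\<^sub>v ones K))"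

text \<open>The columns of \<open>umat\<close> are orthonormal eigenvectors of \<open>W\<close> orthogonal to \<open>1\<close>.\<close>

definition reduced_eigenbasis :: "nat \<Rightarrow> network \<Rightarrow> bool" where
  "reduced_eigenbasis K nw \<longleftrightarrow>
     umat nw \<in> carrier_mat K (K - 1) \<and>
     transpose_mat (umat nw) * umat nw = 1\<^sub>m (K - 1) \<and>
     (\<forall>j<K - 1. (\<exists>l. eigenvector (wmat nw) (col (umat nw) j) l) \<and> col (umat nw) j \<bullet> ones K = 0)"

definition reduce :: "'z problem \<Rightarrow> network \<Rightarrow> var \<Rightarrow> real mat \<Rightarrow> real mat" where
  "reduce pb nw w M = transpose_mat (kron (umat nw) (vdim pb w)) * kron M (vdim pb w)
     * kron (umat nw) (vdim pb w)"

definition lam_a :: "'z problem \<Rightarrow> network \<Rightarrow> var \<Rightarrow> real mat" where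
  "lam_a pb nw w = reduce pb nw w (amat nw w)"

definition lam_b :: "'z problem \<Rightarrow> network \<Rightarrow> var \<Rightarrow> real mat" where
  "lam_b pb nw w = reduce pb nw w (bmat nw w)"

definition lam_c :: "'z problem \<Rightarrow> network \<Rightarrow> var \<Rightarrow> real mat" where
  "lam_c pb nw w = reduce pb nw w (cmat nw w)"

definition pmat :: "'z problem \<Rightarrow> network \<Rightarrow> var \<Rightarrow> real mat" where
  "pmat pb nw w = four_block_mat
     (lam_a pb nw w * lam_c pb nw w - lam_b pb nw w * lam_b pb nw w) (- lam_b pb nw w)
     (lam_b pb nw w) (1\<^sub>m ((nagents pb - 1) * vdim pb w))"

text \<open>The factors may be complex, since \<open>pmat\<close> usually has non-real eigenvalues; for real
  factors the complex and the real spectral norm coincide.\<close>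

definition contractive_factorization :: "'z problem \<Rightarrow> network \<Rightarrow> bool" where
  "contractive_factorization pb nw \<longleftrightarrow> (\<forall>w.
     let n = 2 * ((nagents pb - 1) * vdim pb w) in
       qmat nw w \<in> carrier_mat n n \<and> tmat nw w \<in> carrier_mat n n \<and> invertible_mat (qmat nw w) \<and>
       map_mat complex_of_real (pmat pb nw w) = qmat nw w * tmat nw w * minv (qmat nw w) \<and>
       opnorm (tmat nw w) < 1)"

definition rho :: "network \<Rightarrow> real" where
  "rho nw = max (opnorm (tmat nw Vx)) (opnorm (tmat nw Vy))"

definition lambda_a :: "'z problem \<Rightarrow> network \<Rightarrow> real" where
  "lambda_a pb nw = max (opnorm (lam_a pb nw Vx)) (opnorm (lam_a pb nw Vy))"

definition lambda_b :: "'z problem \<Rightarrow> network \<Rightarrow> real" where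
  "lambda_b pb nw = 1 / sqrt (max ((opnorm (minv (lam_b pb nw Vx)))\<^sup>2)
                                 ((opnorm (minv (lam_b pb nw Vy)))\<^sup>2))"

definition v_one :: "network \<Rightarrow> real" where
  "v_one nw = sqrt (max ((opnorm (qmat nw Vx))\<^sup>2) ((opnorm (qmat nw Vy))\<^sup>2))"

definition v_two :: "network \<Rightarrow> real" where
  "v_two nw = sqrt (max ((opnorm (minv (qmat nw Vx)))\<^sup>2) ((opnorm (minv (qmat nw Vy)))\<^sup>2))"

section \<open>The algorithm\<close>

record params =
  mu :: "var \<Rightarrow> real"
  beta :: "var \<Rightarrow> real"
  coin_prob :: real
  batch0 :: nat
  batchB :: nat
  batchb :: nat

text \<open>The randomness: an initial \<open>\<sigma>\<close>-algebra, initial values measurable with respect to it, the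
  coins \<open>\<pi>\<^sub>i\<close>, and the samples, indexed by iteration, agent and position in the batch.
  \<open>mini\<close> holds the initial batch (iteration 0) and the batches used when \<open>\<pi>\<^sub>i = 0\<close>, \<open>big\<close>
  the online batches used when \<open>\<pi>\<^sub>i = 1\<close>.\<close>

record ('w, 'z) randomness =
  probM :: "'w measure"
  past0 :: "'w measure"
  init :: "var \<Rightarrow> 'w \<Rightarrow> real vec"
  dual0 :: "var \<Rightarrow> 'w \<Rightarrow> real vec"
  coin :: "nat \<Rightarrow> 'w \<Rightarrow> bool"
  mini :: "nat \<Rightarrow> nat \<Rightarrow> nat \<Rightarrow> 'w \<Rightarrow> 'z"
  big :: "nat \<Rightarrow> nat \<Rightarrow> nat \<Rightarrow> 'w \<Rightarrow> 'z"

record state =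
  prim :: "var \<Rightarrow> real vec"
  dual :: "var \<Rightarrow> real vec"
  est :: "var \<Rightarrow> real vec"

text \<open>\<open>agent_grad\<close> is the stochastic gradient of agent \<open>k\<close> at its own blocks of the stacked
  variables \<open>Z\<close>.\<close>

definition agent_grad :: "'z problem \<Rightarrow> var \<Rightarrow> nat \<Rightarrow> (var \<Rightarrow> real vec) \<Rightarrow> 'z \<Rightarrow> real vec" where
  "agent_grad pb w k Z z =
     cost_grad pb w k (block (xdim pb) k (Z Vx)) (block (ydim pb) k (Z Vy)) z"

text \<open>\<open>x\<close> descends and \<open>y\<close> ascends.\<close>

definition dir :: "var \<Rightarrow> real" where
  "dir w = (case w of Vx \<Rightarrow> - 1 | Vy \<Rightarrow> 1)"

definition init_state ::
    "'z problem \<Rightarrow> params \<Rightarrow> ('w, 'z) randomness \<Rightarrow> 'w \<Rightarrow> state" where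
  "init_state pb par rn \<omega> =
     (let Z = (\<lambda>w. stack (vdim pb w) (nagents pb) (\<lambda>k. init rn w \<omega>)) in
      \<lparr> prim = Z,
        dual = (\<lambda>w. stack (vdim pb w) (nagents pb) (\<lambda>k. dual0 rn w \<omega>)),
        est = (\<lambda>w. stack (vdim pb w) (nagents pb) (\<lambda>k.
          vmean (vdim pb w) (batch0 par) (\<lambda>s. agent_grad pb w k Z (mini rn 0 k s \<omega>)))) \<rparr>)"

definition grace ::
    "'z problem \<Rightarrow> params \<Rightarrow> ('w, 'z) randomness \<Rightarrow> 'w \<Rightarrow> nat \<Rightarrow>
     (var \<Rightarrow> real vec) \<Rightarrow> (var \<Rightarrow> real vec) \<Rightarrow> (var \<Rightarrow> real vec) \<Rightarrow> var \<Rightarrow> nat \<Rightarrow> real vec" where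
  "grace pb par rn \<omega> i G Z Z' w k =
     (let d = vdim pb w in
      if coin rn i \<omega> then
        (if online pb
         then vmean d (batchB par) (\<lambda>s. agent_grad pb w k Z' (big rn i k s \<omega>))
         else vmean d (dsize pb k) (\<lambda>s. agent_grad pb w k Z' (dataset pb k s)))
      else
        (1 - beta par w) \<cdot>\<^sub>v (block d k (G w)
            - vmean d (batchb par) (\<lambda>s. agent_grad pb w k Z (mini rn i k s \<omega>)))
          + vmean d (batchb par) (\<lambda>s. agent_grad pb w k Z' (mini rn i k s \<omega>)))"

definition dama_step ::
    "'z problem \<Rightarrow> network \<Rightarrow> params \<Rightarrow> ('w, 'z) randomness \<Rightarrow> 'w \<Rightarrow> nat \<Rightarrow> state \<Rightarrow> state" where
  "dama_step pb nw par rn \<omega> i st =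
     (let Z' = (\<lambda>w.
            kron (amat nw w) (vdim pb w) *\<^sub>v
              (kron (cmat nw w) (vdim pb w) *\<^sub>v prim st w + (dir w * mu par w) \<cdot>\<^sub>v est st w)
            - kron (bmat nw w) (vdim pb w) *\<^sub>v dual st w) in
      \<lparr> prim = Z',
        dual = (\<lambda>w. dual st w + kron (bmat nw w) (vdim pb w) *\<^sub>v Z' w),
        est = (\<lambda>w. stack (vdim pb w) (nagents pb)
                 (grace pb par rn \<omega> (Suc i) (est st) (prim st) Z' w)) \<rparr>)"

primrec dama ::
    "'z problem \<Rightarrow> network \<Rightarrow> params \<Rightarrow> ('w, 'z) randomness \<Rightarrow> 'w \<Rightarrow> nat \<Rightarrow> state" where
  "dama pb nw par rn \<omega> 0 = init_state pb par rn \<omega>"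
| "dama pb nw par rn \<omega> (Suc i) = dama_step pb nw par rn \<omega> i (dama pb nw par rn \<omega> i)"

definition local_it ::
    "'z problem \<Rightarrow> network \<Rightarrow> params \<Rightarrow> ('w, 'z) randomness \<Rightarrow> var \<Rightarrow> nat \<Rightarrow> nat \<Rightarrow> 'w \<Rightarrow> real vec" where
  "local_it pb nw par rn w k i \<omega> = block (vdim pb w) k (prim (dama pb nw par rn \<omega> i) w)"

definition centroid ::
    "'z problem \<Rightarrow> network \<Rightarrow> params \<Rightarrow> ('w, 'z) randomness \<Rightarrow> var \<Rightarrow> nat \<Rightarrow> 'w \<Rightarrow> real vec" where
  "centroid pb nw par rn w i \<omega> =
     vmean (vdim pb w) (nagents pb) (\<lambda>k. local_it pb nw par rn w k i \<omega>)"

section \<open>Sampling\<close>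

text \<open>The independent sources of randomness that the algorithm uses.\<close>

datatype source = Initial | Coin nat | Mini nat nat nat | Big nat nat nat

definition sources :: "'z problem \<Rightarrow> params \<Rightarrow> source set" where
  "sources pb par = {Initial} \<union> {Coin i | i. 1 \<le> i}
     \<union> {Mini i k s | i k s. k < nagents pb \<and> s < (if i = 0 then batch0 par else batchb par)}
     \<union> {Big i k s | i k s. online pb \<and> 1 \<le> i \<and> k < nagents pb \<and> s < batchB par}"

definition source_events ::
    "'z problem \<Rightarrow> ('w, 'z) randomness \<Rightarrow> source \<Rightarrow> 'w set set" where
  "source_events pb rn src = (case src of
      Initial \<Rightarrow> sets (past0 rn)
    | Coin i \<Rightarrow> sets (vimage_algebra (space (probM rn)) (coin rn i) (count_space UNIV))
    | Mini i k s \<Rightarrow> sets (vimage_algebra (space (probM rn)) (mini rn i k s) (sample_space pb))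
    | Big i k s \<Rightarrow> sets (vimage_algebra (space (probM rn)) (big rn i k s) (sample_space pb)))"

definition sampling :: "'z problem \<Rightarrow> params \<Rightarrow> ('w, 'z) randomness \<Rightarrow> bool" where
  "sampling pb par rn \<longleftrightarrow>
     prob_space (probM rn) \<and> subalgebra (probM rn) (past0 rn) \<and>
     (\<forall>w. \<forall>f\<in>{init rn w, dual0 rn w}.
        (\<forall>\<omega>\<in>space (probM rn). f \<omega> \<in> carrier_vec (vdim pb w)) \<and>
        (\<forall>j<vdim pb w. (\<lambda>\<omega>. f \<omega> $ j) \<in> borel_measurable (past0 rn))) \<and>
     (\<forall>i. Coin i \<in> sources pb par \<longrightarrow>
        coin rn i \<in> measurable (probM rn) (count_space UNIV) \<and>
        distr (probM rn) (count_space UNIV) (coin rn i)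
          = measure_pmf (bernoulli_pmf (coin_prob par))) \<and>
     (\<forall>i k s. Mini i k s \<in> sources pb par \<longrightarrow>
        mini rn i k s \<in> measurable (probM rn) (sample_space pb) \<and>
        distr (probM rn) (sample_space pb) (mini rn i k s) = sample_law pb k) \<and>
     (\<forall>i k s. Big i k s \<in> sources pb par \<longrightarrow>
        big rn i k s \<in> measurable (probM rn) (sample_space pb) \<and>
        distr (probM rn) (sample_space pb) (big rn i k s) = sample_law pb k) \<and>
     prob_space.indep_sets (probM rn) (source_events pb rn) (sources pb par)"

text \<open>Samples drawn at iteration \<open>i\<close> are independent of the past, which determines the iterates.
  Hence conditional expectations given the past are integrals over the sample law, with the
  iterates \<open>x\<^sub>k\<^sub>,\<^sub>i\<close>, \<open>y\<^sub>k\<^sub>,\<^sub>i\<close> kept fixed. Unbiasedness and the variance bound are required only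
  at the iterates.\<close>

definition stochastic_gradients ::
    "'z problem \<Rightarrow> network \<Rightarrow> params \<Rightarrow> ('w, 'z) randomness \<Rightarrow> real \<Rightarrow> bool" where
  "stochastic_gradients pb nw par rn \<sigma> \<longleftrightarrow> (\<forall>k<nagents pb. \<forall>i w. AE \<omega> in probM rn.
     let x = local_it pb nw par rn Vx k i \<omega>; y = local_it pb nw par rn Vy k i \<omega> in
       (\<forall>j<vdim pb w. integrable (sample_law pb k) (\<lambda>z. cost_grad pb w k x y z $ j) \<and>
          (\<integral>z. cost_grad pb w k x y z $ j \<partial>sample_law pb k)
            = pgrad pb w (local_obj pb k) x y $ j) \<and>
       (\<integral>\<^sup>+z. ennreal ((vnorm (cost_grad pb w k x y z - pgrad pb w (local_obj pb k) x y))\<^sup>2)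
          \<partial>sample_law pb k) \<le> ennreal (\<sigma>\<^sup>2))"

section \<open>Quantities in the bound\<close>

text \<open>All expectations of nonnegative quantities are extended nonnegative integrals.\<close>

definition exp_gap0 ::
    "'z problem \<Rightarrow> network \<Rightarrow> params \<Rightarrow> ('w, 'z) randomness \<Rightarrow> ennreal" where
  "exp_gap0 pb nw par rn =
     (\<integral>\<^sup>+\<omega>. ennreal (primal pb (centroid pb nw par rn Vx 0 \<omega>) - primal_inf pb) \<partial>probM rn)"

definition exp_delta0 ::
    "'z problem \<Rightarrow> network \<Rightarrow> params \<Rightarrow> ('w, 'z) randomness \<Rightarrow> ennreal" where
  "exp_delta0 pb nw par rn =
     (\<integral>\<^sup>+\<omega>. ennreal (primal pb (centroid pb nw par rn Vx 0 \<omega>)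
        - obj pb (centroid pb nw par rn Vx 0 \<omega>) (centroid pb nw par rn Vy 0 \<omega>)) \<partial>probM rn)"

definition zeta0_sq ::
    "'z problem \<Rightarrow> network \<Rightarrow> params \<Rightarrow> ('w, 'z) randomness \<Rightarrow> ennreal" where
  "zeta0_sq pb nw par rn = (\<Sum>w\<in>{Vx, Vy}. ennreal (1 / real (nagents pb)) *
     (\<integral>\<^sup>+\<omega>. ennreal ((vnorm
        ((kron (amat nw w) (vdim pb w) - kron (avg_mat (nagents pb)) (vdim pb w))
          *\<^sub>v est (dama pb nw par rn \<omega> 0) w))\<^sup>2) \<partial>probM rn))"

definition exp_grad_sq ::
    "'z problem \<Rightarrow> network \<Rightarrow> params \<Rightarrow> ('w, 'z) randomness \<Rightarrow> var \<Rightarrow> nat \<Rightarrow> ennreal" where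
  "exp_grad_sq pb nw par rn w i =
     (\<integral>\<^sup>+\<omega>. ennreal ((vnorm (pgrad pb w (obj pb)
        (centroid pb nw par rn Vx i \<omega>) (centroid pb nw par rn Vy i \<omega>)))\<^sup>2) \<partial>probM rn)"

text \<open>A bound in a minimum, read as \<open>\<infinity>\<close> when its denominator vanishes.\<close>

definition quot :: "real \<Rightarrow> real \<Rightarrow> ereal" where
  "quot a b = (if b = 0 then \<infinity> else ereal (a / b))"

end

theory Submission
  imports Defs
begin

text \<open>In the eigenbasis of \<open>W\<close>, after the change of coordinates \<open>\<Q>\<^sup>-\<^sup>1\<close>, the disagreement of the agents and
  the dual residual form a vector that is multiplied by \<open>\<T>\<close> and shifted by a multiple of the increment
  of the estimates; so the consensus error contracts by \<open>\<rho>\<close> up to that increment. The error of a GRACE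
  estimate is multiplied by \<open>0\<close> or \<open>1 - \<beta>\<close> and shifted by a sum of centred terms, one for each fresh
  sample. Freezing all samples but one shows that their second moments add up, which gives a factor
  \<open>1 - (p + \<beta> - p \<beta>)\<close> for the mean square error and a gain \<open>1 / K\<close> for its average over the agents;
  the new terms are controlled by the distance between consecutive iterates. The Lyapunov function
  \<open>P + \<alpha> (P - J)\<close> with \<open>\<alpha> = 16 \<kappa>\<^sup>2 \<mu>\<^sub>x / \<mu>\<^sub>y\<close>, taken at the centroids, decreases by the squared
  gradients and the squared directions up to the error of the averaged estimate. Summed over the
  iterations, these linear inequalities close because the step sizes make their feedback small.\<close>

section \<open>Vectors, norms and Kronecker products\<close>

text \<open>The network recursion holds for every outcome, the estimator recursion only in mean
  square; they meet after expectations are taken. Finite moments of later iterates are not given. If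
  an initial quantity with positive weight is infinite, the bound is trivial; otherwise
  integrability is carried along by the inequalities that later give the rate. Two regularity facts
  have to be derived. Unbiasedness is assumed at the iterates, but gradients are also compared at
  the centroids, which need not be iterates. Differentiation under the expectation gives it
  everywhere, and Jensen's inequality then makes the true gradients Lipschitz. Moreover no gradient
  of \<open>P\<close> is available; its descent inequality comes from a gradient ascent in
  \<open>y\<close> whose path length the PL inequality controls. In the weight \<alpha> the 16
  yields a decrease of \<open>8 * \<kappa>\<^sup>2\<close> times the squared
  \<open>y\<close>-gradient, of which 6 parts pay for replacing the gradient of \<open>P\<close> and
  2 remain. The loop between distances, increments and disagreement closes because the disagreement
  of iterate \<open>i + 1\<close> is bounded without the increment of the estimates from
  \<open>i\<close> to \<open>i + 1\<close>.\<close>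

lemma vnorm_L2_set: "vnorm v = L2_set (\<lambda>i. norm (v $ i)) {..<dim_vec v}"
  by (simp add: vnorm_def L2_set_def)

lemma vnorm_nonneg [simp]: "0 \<le> vnorm v"
  by (simp add: vnorm_L2_set)

lemma vnorm_sq: "(vnorm v)\<^sup>2 = (\<Sum>i<dim_vec v. (norm (v $ i))\<^sup>2)"
  by (simp add: vnorm_def sum_nonneg)

lemma vnorm_sq_real: "(vnorm (v :: real vec))\<^sup>2 = (\<Sum>i<dim_vec v. (v $ i)\<^sup>2)"
  by (simp add: vnorm_sq)

lemma vnorm_sq_scalar_prod: "(vnorm (v :: real vec))\<^sup>2 = v \<bullet> v"
  unfolding vnorm_sq_real scalar_prod_def by (simp add: power2_eq_square lessThan_atLeast0)

lemma vnorm_zero [simp]: "vnorm (0\<^sub>v n) = 0"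
  by (simp add: vnorm_def)

lemma vnorm_triangle:
  assumes "a \<in> carrier_vec n" "b \<in> carrier_vec n"
  shows "vnorm (a + b) \<le> vnorm a + vnorm b"
proof -
  have "vnorm (a + b) \<le> L2_set (\<lambda>i. norm (a $ i) + norm (b $ i)) {..<n}"
    using assms unfolding vnorm_L2_set
    by (auto intro!: L2_set_mono norm_triangle_ineq)
  also have "\<dots> \<le> L2_set (\<lambda>i. norm (a $ i)) {..<n} + L2_set (\<lambda>i. norm (b $ i)) {..<n}"
    by (rule L2_set_triangle_ineq)
  finally show ?thesis using assms by (simp add: vnorm_L2_set)
qed

lemma vnorm_smult: "vnorm (c \<cdot>\<^sub>v v) = norm (c :: 'a::real_normed_field) * vnorm v"
  by (simp add: vnorm_def norm_mult power_mult_distrib real_sqrt_mult flip: sum_distrib_left)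

lemma vnorm_uminus: "vnorm (- v) = vnorm (v :: 'a::real_normed_field vec)"
  by (simp add: vnorm_def)

lemma vnorm_add_sq_le:
  assumes "a \<in> carrier_vec n" "b \<in> carrier_vec n"
  shows "(vnorm (a + b))\<^sup>2 \<le> 2 * (vnorm a)\<^sup>2 + 2 * (vnorm b)\<^sup>2"
proof -
  have "(vnorm (a + b))\<^sup>2 \<le> (vnorm a + vnorm b)\<^sup>2"
    by (rule power_mono[OF vnorm_triangle[OF assms]]) simp
  moreover have "0 \<le> (vnorm a - vnorm b)\<^sup>2" by simp
  ultimately show ?thesis by (simp add: power2_eq_square algebra_simps)
qed

lemma vnorm_diff_sq_le:
  fixes a :: "'a::real_normed_field vec"
  assumes "a \<in> carrier_vec n" "b \<in> carrier_vec n"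
  shows "(vnorm (a - b))\<^sup>2 \<le> 2 * (vnorm a)\<^sup>2 + 2 * (vnorm b)\<^sup>2"
proof -
  have "a - b = a + - b" by (rule minus_add_uminus_vec[OF assms])
  thus ?thesis using vnorm_add_sq_le[of a n "- b"] assms by (simp add: vnorm_uminus)
qed

lemma scalar_prod_le_vnorm:
  fixes a :: "real vec"
  assumes "a \<in> carrier_vec n" "b \<in> carrier_vec n"
  shows "\<bar>a \<bullet> b\<bar> \<le> vnorm a * vnorm b"
proof -
  have "\<bar>a \<bullet> b\<bar> \<le> (\<Sum>i\<in>{0..<n}. \<bar>a $ i\<bar> * \<bar>b $ i\<bar>)"
    using assms by (auto simp: scalar_prod_def abs_mult[symmetric] intro!: sum_abs)
  also have "\<dots> \<le> vnorm a * vnorm b"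
    using L2_set_mult_ineq[of "\<lambda>i. a $ i" "\<lambda>i. b $ i" "{..<n}"] assms
    by (simp add: vnorm_L2_set lessThan_atLeast0 L2_set_def)
  finally show ?thesis .
qed

lemma scalar_prod_le_vnorm': 
  fixes a :: "real vec"
  assumes "a \<in> carrier_vec n" "b \<in> carrier_vec n"
  shows "a \<bullet> b \<le> vnorm a * vnorm b"
  using scalar_prod_le_vnorm[OF assms] by linarith

lemma vnorm_diff_sq_expand:
  fixes a :: "real vec"
  assumes "a \<in> carrier_vec n" "b \<in> carrier_vec n"
  shows "(vnorm (a - b))\<^sup>2 = (vnorm a)\<^sup>2 - 2 * (a \<bullet> b) + (vnorm b)\<^sup>2"
  using assms
  by (simp add: vnorm_sq_real scalar_prod_def power2_diff sum.distrib sum_subtractf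
      lessThan_atLeast0 sum_distrib_left mult.assoc)

lemma vnorm_append:
  assumes "a \<in> carrier_vec n" "b \<in> carrier_vec m"
  shows "(vnorm (a @\<^sub>v b))\<^sup>2 = (vnorm a)\<^sup>2 + (vnorm b)\<^sup>2"
proof -
  have "(\<Sum>i<n + m. (norm ((a @\<^sub>v b) $ i))\<^sup>2)
      = (\<Sum>i<n. (norm ((a @\<^sub>v b) $ i))\<^sup>2) + (\<Sum>i<m. (norm ((a @\<^sub>v b) $ (n + i)))\<^sup>2)"
    by (induction m) (simp_all add: add.assoc)
  thus ?thesis using assms by (simp add: vnorm_sq)
qed

lemma vnorm_of_real: "vnorm (map_vec complex_of_real v) = vnorm v"
  by (simp add: vnorm_def)

section \<open>Matrix products in coordinates and the spectral norm\<close>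

lemma index_mult_mat_sum:
  assumes "A \<in> carrier_mat m n" "B \<in> carrier_mat n l" "i < m" "j < l"
  shows "(A * B) $$ (i, j) = (\<Sum>q<n. A $$ (i, q) * B $$ (q, j))"
  using assms by (auto simp: scalar_prod_def lessThan_atLeast0 intro!: sum.cong)

lemma index_mult_mat_vec_sum:
  assumes "A \<in> carrier_mat m n" "v \<in> carrier_vec n" "i < m"
  shows "(A *\<^sub>v v) $ i = (\<Sum>q<n. A $$ (i, q) * v $ q)"
  using assms by (auto simp: scalar_prod_def lessThan_atLeast0 intro!: sum.cong)

text \<open>\<open>opnorm\<close> is a supremum of reals and is informative only if the set is
  bounded. Entries of a vector in the unit ball have modulus at most one, so coordinate
  \<open>i\<close> of the image is at most the sum of the moduli in row \<open>i\<close>.\<close>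

lemma opnorm_bdd:
  fixes A :: "'a::real_normed_field mat"
  shows "bdd_above {vnorm (A *\<^sub>v v) | v. v \<in> carrier_vec (dim_col A) \<and> vnorm v \<le> 1}"
proof -
  define M where "M = L2_set (\<lambda>i. \<Sum>j<dim_col A. norm (A $$ (i, j))) {..<dim_row A}"
  have "vnorm (A *\<^sub>v v) \<le> M" if v: "v \<in> carrier_vec (dim_col A)" "vnorm v \<le> 1" for v
  proof -
    have vj: "norm (v $ j) \<le> 1" if "j < dim_col A" for j
    proof -
      have "norm (v $ j) \<le> vnorm v" unfolding vnorm_L2_set
        by (rule member_le_L2_set) (use that v in auto)
      thus ?thesis using v by simp
    qed
    have "norm ((A *\<^sub>v v) $ i) \<le> (\<Sum>j<dim_col A. norm (A $$ (i, j)))" if "i < dim_row A" for i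
    proof -
      have "(A *\<^sub>v v) $ i = (\<Sum>j<dim_col A. A $$ (i, j) * v $ j)"
        by (rule index_mult_mat_vec_sum[OF _ v(1) that]) auto
      also have "norm \<dots> \<le> (\<Sum>j<dim_col A. norm (A $$ (i, j)))"
        by (rule order_trans[OF norm_sum]) 
          (auto intro!: sum_mono mult_left_le vj simp: norm_mult)
      finally show ?thesis .
    qed
    thus ?thesis unfolding M_def vnorm_L2_set
      by (auto intro!: L2_set_mono)
  qed
  thus ?thesis by (intro bdd_aboveI[of _ M]) auto
qed

lemma opnorm_nonneg [simp]: "0 \<le> opnorm (A :: 'a::real_normed_field mat)"
proof -
  have "vnorm (A *\<^sub>v 0\<^sub>v (dim_col A)) \<le> opnorm A"
    unfolding opnorm_def by (rule cSup_upper[OF _ opnorm_bdd]) (auto intro!: exI[of _ "0\<^sub>v (dim_col A)"])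
  thus ?thesis using vnorm_nonneg order_trans by blast
qed

lemma vnorm_mult_le_opnorm:
  fixes A :: "'a::real_normed_field mat"
  assumes A: "A \<in> carrier_mat m n" and v: "v \<in> carrier_vec n"
  shows "vnorm (A *\<^sub>v v) \<le> opnorm A * vnorm v"
proof (cases "vnorm v = 0")
  case True
  have "v $ j = 0" if "j < n" for j
  proof -
    have "norm (v $ j) \<le> vnorm v" unfolding vnorm_L2_set
      by (rule member_le_L2_set) (use that v in auto)
    thus ?thesis using True by simp
  qed
  hence "v = 0\<^sub>v n" using v by auto
  moreover have "A *\<^sub>v 0\<^sub>v n = 0\<^sub>v m" using A by auto
  ultimately show ?thesis by simp
next
  case False
  \<comment> \<open>The normalising factor has to be a scalar of the field of the matrix, which may
    be real or complex.\<close>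
  define c :: 'a where "c = of_real (inverse (vnorm v))"
  have nc: "norm c = inverse (vnorm v)" by (simp add: c_def norm_inverse)
  have "vnorm (A *\<^sub>v (c \<cdot>\<^sub>v v)) \<le> opnorm A"
    unfolding opnorm_def
    by (rule cSup_upper[OF _ opnorm_bdd])
      (use A v False in \<open>auto intro!: exI[of _ "c \<cdot>\<^sub>v v"] simp: vnorm_smult nc\<close>)
  moreover have "A *\<^sub>v (c \<cdot>\<^sub>v v) = c \<cdot>\<^sub>v (A *\<^sub>v v)"
    using A v by (simp add: mult_mat_vec)
  ultimately have "inverse (vnorm v) * vnorm (A *\<^sub>v v) \<le> opnorm A"
    by (simp add: vnorm_smult nc)
  moreover have "vnorm v > 0" using False vnorm_nonneg[of v] by linarith
  ultimately show ?thesis by (simp add: field_simps)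
qed

section \<open>Kronecker products with an identity, and stacked blocks\<close>

lemma sum_blocks: "(\<Sum>i<m * d. f i) = (\<Sum>a<m. \<Sum>r<d. f (a * d + r :: nat))"
proof -
  have "(\<Sum>i<m * d. f i) = (\<Sum>a<m. sum f {a * d ..< a * d + d})"
    by (rule sum.nat_group[symmetric])
  also have "\<dots> = (\<Sum>a<m. \<Sum>r<d. f (a * d + r))"
  proof (rule sum.cong[OF refl])
    fix a show "sum f {a * d ..< a * d + d} = (\<Sum>r<d. f (a * d + r))"
      using sum.shift_bounds_nat_ivl[of f 0 "a * d" d]
      by (simp only: lessThan_atLeast0 add.commute[of "a * d"] add_0_left)
  qed
  finally show ?thesis .
qed

lemma block_index_less: "a < m \<Longrightarrow> r < d \<Longrightarrow> a * d + r < m * (d :: nat)"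
proof -
  assume "a < m" "r < d"
  hence "a * d + r < Suc a * d" "Suc a * d \<le> m * d"
    using mult_le_mono1[of "Suc a" m d] by auto
  thus ?thesis by linarith
qed

lemma div_less_of_less_mult: "i < m * d \<Longrightarrow> i div d < (m :: nat)"
  by (simp add: less_mult_imp_div_less)

lemma mod_less_of_less_mult: "i < m * d \<Longrightarrow> i mod d < (d :: nat)"
  by (cases "d = 0") auto

lemma kron_dim [simp]: "dim_row (kron M d) = dim_row M * d" "dim_col (kron M d) = dim_col M * d"
  by (simp_all add: kron_def)

lemma kron_carrier [simp]: "M \<in> carrier_mat m n \<Longrightarrow> kron M d \<in> carrier_mat (m * d) (n * d)"
  by (rule carrier_matI) auto

lemma kron_index:
  "i < dim_row M * d \<Longrightarrow> j < dim_col M * d \<Longrightarrow>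
    kron M d $$ (i, j) = (if i mod d = j mod d then M $$ (i div d, j div d) else 0)"
  by (simp add: kron_def)

lemma kron_mult:
  assumes M: "M \<in> carrier_mat m n" and N: "N \<in> carrier_mat n l"
  shows "kron M d * kron N d = kron (M * N) d"
proof (rule eq_matI)
  fix i j assume "i < dim_row (kron (M * N) d)" "j < dim_col (kron (M * N) d)"
  hence i: "i < m * d" and j: "j < l * d" using M N by auto
  note id = div_less_of_less_mult[OF i] mod_less_of_less_mult[OF i]
  note jd = div_less_of_less_mult[OF j] mod_less_of_less_mult[OF j]
  have "(kron M d * kron N d) $$ (i, j) = (\<Sum>q<n * d. kron M d $$ (i, q) * kron N d $$ (q, j))"
    by (rule index_mult_mat_sum[OF kron_carrier[OF M] kron_carrier[OF N] i j])
  also have "\<dots> = (\<Sum>a<n. \<Sum>r<d. kron M d $$ (i, a * d + r) * kron N d $$ (a * d + r, j))"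
    by (rule sum_blocks)
  also have "\<dots> = (\<Sum>a<n. \<Sum>r<d. if r = i mod d then
      (if i mod d = j mod d then M $$ (i div d, a) * N $$ (a, j div d) else 0) else 0)"
    using M N i j by (intro sum.cong refl) (auto simp: kron_index block_index_less)
  also have "\<dots> = (if i mod d = j mod d then (\<Sum>a<n. M $$ (i div d, a) * N $$ (a, j div d)) else 0)"
    using id by (simp add: sum.delta)
  also have "\<dots> = kron (M * N) d $$ (i, j)"
    using M N i j by (simp add: kron_index index_mult_mat_sum[OF M N id(1) jd(1)] del: index_mult_mat(1))
  finally show "(kron M d * kron N d) $$ (i, j) = kron (M * N) d $$ (i, j)" .
qed (use M N in auto)

lemma kron_transpose: "transpose_mat (kron M d) = kron (transpose_mat M) d"
proof (rule eq_matI)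
  fix i j assume "i < dim_row (kron (transpose_mat M) d)" "j < dim_col (kron (transpose_mat M) d)"
  hence "i < dim_col M * d" "j < dim_row M * d" by auto
  thus "transpose_mat (kron M d) $$ (i, j) = kron (transpose_mat M) d $$ (i, j)"
    using div_less_of_less_mult[of i "dim_col M" d] div_less_of_less_mult[of j "dim_row M" d]
    by (simp add: kron_index)
qed auto

lemma kron_one: "kron (1\<^sub>m n) d = 1\<^sub>m (n * d)"
proof (rule eq_matI)
  fix i j assume "i < dim_row (1\<^sub>m (n * d) :: real mat)" "j < dim_col (1\<^sub>m (n * d) :: real mat)"
  hence ij: "i < n * d" "j < n * d" by auto
  moreover have "i div d < n" "j div d < n" using ij by (auto intro: div_less_of_less_mult)
  moreover have "i = j" if "i div d = j div d" "i mod d = j mod d"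
    using that by (metis div_mult_mod_eq)
  ultimately show "kron (1\<^sub>m n) d $$ (i, j) = 1\<^sub>m (n * d) $$ (i, j)"
    by (auto simp: kron_index)
qed auto

lemma kron_minus:
  assumes "M \<in> carrier_mat m n" "N \<in> carrier_mat m n"
  shows "kron (M - N) d = kron M d - kron N d"
proof (rule eq_matI)
  fix i j assume "i < dim_row (kron M d - kron N d)" "j < dim_col (kron M d - kron N d)"
  hence "i < m * d" "j < n * d" using assms by auto
  thus "kron (M - N) d $$ (i, j) = (kron M d - kron N d) $$ (i, j)"
    using div_less_of_less_mult[of i m d] div_less_of_less_mult[of j n d] assms
    by (simp add: kron_index)
qed (use assms in auto)

lemma dim_block [simp]: "dim_vec (block d k v) = d"
  by (simp add: block_def)

lemma block_carrier [simp]: "block d k v \<in> carrier_vec d"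
  by (rule carrier_vecI) simp

lemma vmean_carrier [simp]: "vmean d n f \<in> carrier_vec d"
  by (simp add: vmean_def)

lemma vmean_index: "j < d \<Longrightarrow> vmean d n f $ j = (\<Sum>s<n. f s $ j) / real n"
  by (simp add: vmean_def)

lemma stack_carrier [simp]: "stack d n f \<in> carrier_vec (n * d)"
  by (simp add: stack_def)

lemma block_stack: "k < n \<Longrightarrow> f k \<in> carrier_vec d \<Longrightarrow> block d k (stack d n f) = f k"
proof (rule eq_vecI)
  assume k: "k < n" and f: "f k \<in> carrier_vec d"
  show "block d k (stack d n f) $ j = f k $ j" if "j < dim_vec (f k)" for j
  proof -
    have "j < d" using that f by simp
    thus ?thesis using block_index_less[OF k, of j d] by (simp add: block_def stack_def)
  qed
qed simp

lemma vnorm_sq_blocks: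
  assumes "v \<in> carrier_vec (n * d)"
  shows "(vnorm (v :: real vec))\<^sup>2 = (\<Sum>k<n. (vnorm (block d k v))\<^sup>2)"
proof -
  have "dim_vec v = n * d" using assms by simp
  hence "(vnorm v)\<^sup>2 = (\<Sum>k<n. \<Sum>r<d. (v $ (k * d + r))\<^sup>2)"
    unfolding vnorm_sq_real by (simp only: sum_blocks)
  also have "\<dots> = (\<Sum>k<n. (vnorm (block d k v))\<^sup>2)"
    unfolding vnorm_sq_real by (simp add: block_def)
  finally show ?thesis .
qed

lemma block_kron_mult:
  assumes M: "M \<in> carrier_mat m n" and v: "v \<in> carrier_vec (n * d)" and k: "k < m" and j: "j < d"
  shows "block d k (kron M d *\<^sub>v v) $ j = (\<Sum>l<n. M $$ (k, l) * block d l v $ j)"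
proof -
  have i: "k * d + j < m * d" using k j by (rule block_index_less)
  have "block d k (kron M d *\<^sub>v v) $ j = (\<Sum>q<n * d. kron M d $$ (k * d + j, q) * v $ q)"
    using j unfolding block_def index_vec[OF j] by (intro index_mult_mat_vec_sum[OF kron_carrier[OF M] v i])
  also have "\<dots> = (\<Sum>a<n. \<Sum>r<d. kron M d $$ (k * d + j, a * d + r) * v $ (a * d + r))"
    by (rule sum_blocks)
  also have "\<dots> = (\<Sum>a<n. \<Sum>r<d. if r = j then M $$ (k, a) * v $ (a * d + r) else 0)"
    using M i j k by (intro sum.cong refl) (auto simp: kron_index block_index_less)
  also have "\<dots> = (\<Sum>l<n. M $$ (k, l) * block d l v $ j)"
    using j by (simp add: sum.delta block_def)
  finally show ?thesis .
qed

section \<open>Consensus error\<close>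

lemma pow_mat_commute:
  assumes "W \<in> carrier_mat n n"
  shows "W * (W ^\<^sub>m k) = (W ^\<^sub>m k) * (W :: real mat)"
proof (induction k)
  case (Suc k)
  have c: "W ^\<^sub>m k \<in> carrier_mat n n" using assms by simp
  show ?case using Suc assms c by (simp flip: assoc_mult_mat[of W n n "W ^\<^sub>m k" n W n])
qed (use assms in auto)

lemma transpose_pow_mat:
  assumes "W \<in> carrier_mat n n" "transpose_mat W = (W :: real mat)"
  shows "transpose_mat (W ^\<^sub>m k) = W ^\<^sub>m k"
proof (induction k)
  case (Suc k)
  have c: "W ^\<^sub>m k \<in> carrier_mat n n" using assms by simp
  show ?case using Suc assms c pow_mat_commute[OF assms(1), of k]
    by (simp add: transpose_mult[of _ n n])
qed (use assms in auto)

text \<open>The hypotheses on \<open>amat\<close> and \<open>cmat\<close> give row sums. Symmetry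
  turns them into column sums, and these are what averaging over the agents uses.\<close>

lemma poly_mat_symmetric:
  assumes "W \<in> carrier_mat n n" "transpose_mat W = W" "i < n" "j < n"
  shows "poly_mat q W $$ (i, j) = poly_mat q W $$ (j, i)"
proof -
  have "(W ^\<^sub>m k) $$ (i, j) = (W ^\<^sub>m k) $$ (j, i)" for k
  proof -
    have "transpose_mat (W ^\<^sub>m k) $$ (i, j) = (W ^\<^sub>m k) $$ (j, i)"
      using assms by (subst index_transpose_mat) auto
    thus ?thesis using transpose_pow_mat[OF assms(1,2)] by simp
  qed
  thus ?thesis using assms by (simp add: poly_mat_def)
qed

text \<open>Used with \<open>c = 1\<close> for \<open>amat\<close> and \<open>cmat\<close> and with
  \<open>c = 0\<close> for \<open>bmat\<close>: the mean over the agents then sees neither the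
  mixing nor the dual variables.\<close>

lemma vmean_kron:
  assumes M: "M \<in> carrier_mat n n" and cs: "\<And>l. l < n \<Longrightarrow> (\<Sum>k<n. M $$ (k, l)) = c"
    and v: "v \<in> carrier_vec (n * d)"
  shows "vmean d n (\<lambda>k. block d k (kron M d *\<^sub>v v)) = c \<cdot>\<^sub>v vmean d n (\<lambda>k. block d k v)"
proof (rule eq_vecI)
  fix j assume "j < dim_vec (c \<cdot>\<^sub>v vmean d n (\<lambda>k. block d k v))"
  hence j: "j < d" by (simp add: vmean_def)
  have "(\<Sum>k<n. block d k (kron M d *\<^sub>v v) $ j) = (\<Sum>k<n. \<Sum>l<n. M $$ (k, l) * block d l v $ j)"
    by (intro sum.cong refl block_kron_mult[OF M v _ j]) auto
  also have "\<dots> = (\<Sum>l<n. (\<Sum>k<n. M $$ (k, l)) * block d l v $ j)"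
    by (subst sum.swap) (simp add: sum_distrib_right)
  also have "\<dots> = c * (\<Sum>l<n. block d l v $ j)"
    using cs by (simp add: sum_distrib_left)
  finally show "vmean d n (\<lambda>k. block d k (kron M d *\<^sub>v v)) $ j
      = (c \<cdot>\<^sub>v vmean d n (\<lambda>k. block d k v)) $ j"
    using j by (simp add: vmean_def)
qed (simp add: vmean_def)

text \<open>Averaging is an orthogonal projection. Every block of the projected vector is the mean,
  so pairing with it collects the mean \<open>n\<close> times.\<close>

lemma scalar_prod_kron_avg:
  assumes v: "v \<in> carrier_vec (n * d)" and n: "1 \<le> n"
  shows "v \<bullet> (kron (avg_mat n) d *\<^sub>v v) = real n * (vnorm (vmean d n (\<lambda>k. block d k v)))\<^sup>2"
proof -
  have avg: "avg_mat n \<in> carrier_mat n n" by (simp add: avg_mat_def)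
  let ?u = "kron (avg_mat n) d *\<^sub>v v"
  let ?m = "vmean d n (\<lambda>k. block d k v)"
  have u: "block d k ?u $ j = ?m $ j" if "k < n" "j < d" for k j
    using block_kron_mult[OF avg v that] that
    by (simp add: avg_mat_def vmean_def sum_divide_distrib)
  have "v \<bullet> ?u = (\<Sum>i<n * d. v $ i * ?u $ i)"
    using avg by (simp add: scalar_prod_def lessThan_atLeast0)
  also have "\<dots> = (\<Sum>k<n. \<Sum>j<d. v $ (k * d + j) * ?u $ (k * d + j))" by (rule sum_blocks)
  also have "\<dots> = (\<Sum>k<n. \<Sum>j<d. block d k v $ j * ?m $ j)"
    using u by (intro sum.cong refl) (auto simp: block_def)
  also have "\<dots> = (\<Sum>j<d. (\<Sum>k<n. block d k v $ j) * ?m $ j)"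
    by (subst sum.swap) (simp add: sum_distrib_right)
  also have "\<dots> = (\<Sum>j<d. real n * (?m $ j)\<^sup>2)"
    using n by (intro sum.cong refl) (auto simp: vmean_def power2_eq_square)
  also have "\<dots> = real n * (vnorm ?m)\<^sup>2"
    by (simp add: vnorm_sq_real sum_distrib_left vmean_def)
  finally show ?thesis .
qed

text \<open>The variance decomposition. Set against \<open>vnorm_sq_hat\<close> it identifies the
  disagreement of the agents with a norm in the eigenbasis.\<close>

lemma vnorm_sq_deviation:
  assumes v: "v \<in> carrier_vec (n * d)" and n: "1 \<le> n"
  shows "(\<Sum>k<n. (vnorm (block d k v - vmean d n (\<lambda>k. block d k v)))\<^sup>2)
    = (vnorm v)\<^sup>2 - real n * (vnorm (vmean d n (\<lambda>k. block d k v)))\<^sup>2"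
proof -
  let ?m = "vmean d n (\<lambda>k. block d k v)"
  have "(\<Sum>k<n. (vnorm (block d k v - ?m))\<^sup>2)
      = (\<Sum>k<n. (vnorm (block d k v))\<^sup>2) - 2 * (\<Sum>k<n. block d k v \<bullet> ?m) + real n * (vnorm ?m)\<^sup>2"
    by (simp add: vnorm_diff_sq_expand[of _ d] sum.distrib sum_subtractf sum_distrib_left)
  also have "(\<Sum>k<n. block d k v \<bullet> ?m) = (\<Sum>k<n. \<Sum>j<d. block d k v $ j * ?m $ j)"
    by (simp add: scalar_prod_def lessThan_atLeast0 vmean_def)
  also have "\<dots> = (\<Sum>j<d. (\<Sum>k<n. block d k v $ j) * ?m $ j)"
    by (subst sum.swap) (simp add: sum_distrib_right)
  also have "\<dots> = (\<Sum>j<d. real n * (?m $ j)\<^sup>2)"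
    using n by (intro sum.cong refl) (auto simp: vmean_def power2_eq_square)
  also have "\<dots> = real n * (vnorm ?m)\<^sup>2"
    by (simp add: vnorm_sq_real sum_distrib_left vmean_def)
  finally show ?thesis using vnorm_sq_blocks[OF v] by simp
qed

text \<open>\<open>minv\<close> unwraps the option returned by \<open>mat_inverse\<close>. For
  square matrices a right inverse is also a left inverse, so \<open>A\<close> is a unit and the
  option cannot be \<open>None\<close>.\<close>

lemma minv_inverse:
  fixes A :: "'a::field mat"
  assumes A: "A \<in> carrier_mat n n" and B: "B \<in> carrier_mat n n" and AB: "A * B = 1\<^sub>m n"
  shows "A * minv A = 1\<^sub>m n \<and> minv A * A = 1\<^sub>m n \<and> minv A \<in> carrier_mat n n"
proof (cases "mat_inverse A")
  case None
  have "B * A = 1\<^sub>m n" by (rule mat_mult_left_right_inverse[OF A B AB])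
  hence "A \<in> Units (ring_mat TYPE('a) n ())"
    using A B AB by (auto simp: Units_def ring_mat_def)
  moreover have "A \<notin> Units (ring_mat TYPE('a) n ())" by (rule mat_inverse(1)[OF A None])
  ultimately show ?thesis by simp
next
  case (Some C)
  thus ?thesis using mat_inverse(2)[OF A Some] by (simp add: minv_def)
qed

lemma minv_invertible:
  fixes A :: "'a::field mat"
  assumes A: "A \<in> carrier_mat n n" and inv: "invertible_mat A"
  shows "A * minv A = 1\<^sub>m n" "minv A * A = 1\<^sub>m n" "minv A \<in> carrier_mat n n"
proof -
  obtain B where "A * B = 1\<^sub>m (dim_row A)" "B * A = 1\<^sub>m (dim_row B)"
    using inv by (auto simp: invertible_mat_def inverts_mat_def)
  moreover from this have "dim_row B = n" "dim_col B = n"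
    using A by (metis carrier_matD(2) index_mult_mat(3) index_one_mat(3),
      metis A carrier_matD(1) index_mult_mat(3) index_one_mat(3))
  ultimately have "B \<in> carrier_mat n n" "A * B = 1\<^sub>m n" using A by auto
  from minv_inverse[OF A this] show "A * minv A = 1\<^sub>m n" "minv A * A = 1\<^sub>m n"
    "minv A \<in> carrier_mat n n" by auto
qed

text \<open>Convexity of the square with weights \<rho> and 1 - \<rho> at the points
  \<open>x\<close> and \<open>y / (1 - \<rho>)\<close>. It keeps the contraction factor \<rho> for
  the squares, at the price of dividing the perturbation by 1 - \<rho>.\<close>

lemma convex_sq_le:
  assumes "0 \<le> \<rho>" "\<rho> < (1::real)"
  shows "(\<rho> * x + y)\<^sup>2 \<le> \<rho> * x\<^sup>2 + y\<^sup>2 / (1 - \<rho>)"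
proof -
  have "\<rho> * x\<^sup>2 + y\<^sup>2 / (1 - \<rho>) - (\<rho> * x + y)\<^sup>2 = \<rho> / (1 - \<rho>) * ((1 - \<rho>) * x - y)\<^sup>2"
    using assms by (simp add: field_simps power2_eq_square)
  moreover have "\<dots> \<ge> 0" using assms by simp
  ultimately show ?thesis by linarith
qed

text \<open>A scalar majorant for a squared error. Being defined by an equality it is linear in the
  start value and the numbers \<open>g\<close>, so its integrability and its sum can be read off the
  recursion.\<close>

primrec cons_bound :: "real \<Rightarrow> real \<Rightarrow> real \<Rightarrow> (nat \<Rightarrow> real) \<Rightarrow> nat \<Rightarrow> real" where
  "cons_bound \<rho> c r\<^sub>0 g 0 = r\<^sub>0"
| "cons_bound \<rho> c r\<^sub>0 g (Suc i) = \<rho> * cons_bound \<rho> c r\<^sub>0 g i + c * g i"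

section \<open>The network in coordinates orthogonal to consensus\<close>

locale network_matrices =
  fixes pb :: "'z problem" and nw :: network
  assumes comb: "combination_matrices (nagents pb) nw"
    and eig: "reduced_eigenbasis (nagents pb) nw"
    and fact: "contractive_factorization pb nw"
    and agents: "1 \<le> nagents pb"
begin

abbreviation "K \<equiv> nagents pb"

declare One_nat_def [simp del]

lemma wmat_carrier: "wmat nw \<in> carrier_mat K K"
  using comb by (simp add: combination_matrices_def doubly_stochastic_def)

lemma mats_carrier [simp]:
  "amat nw w \<in> carrier_mat K K" "bmat nw w \<in> carrier_mat K K" "cmat nw w \<in> carrier_mat K K"
  "umat nw \<in> carrier_mat K (K - 1)"
  using comb eig by (auto simp: combination_matrices_def reduced_eigenbasis_def)

lemma row_sums:
  assumes "i < K"
  shows "(\<Sum>l<K. amat nw w $$ (i, l)) = 1" "(\<Sum>l<K. bmat nw w $$ (i, l)) = 0"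
    "(\<Sum>l<K. cmat nw w $$ (i, l)) = 1"
proof -
  have one: "ones K \<in> carrier_vec K" by (simp add: ones_def)
  have sm: "(\<Sum>l<K. M $$ (i, l)) = (M *\<^sub>v ones K) $ i" if "M \<in> carrier_mat K K" for M
    using index_mult_mat_vec_sum[OF that one assms] by (simp add: ones_def)
  have "1 \<cdot>\<^sub>v ones K = ones K" by simp
  hence "ones K \<in> mat_kernel (bmat nw w)"
    using comb by (metis combination_matrices_def rangeI)
  hence "bmat nw w *\<^sub>v ones K = 0\<^sub>v K" using mat_kernelD mats_carrier(2) by blast
  thus "(\<Sum>l<K. bmat nw w $$ (i, l)) = 0" using assms sm[OF mats_carrier(2)] by simp
  have "amat nw w *\<^sub>v ones K = ones K" "cmat nw w *\<^sub>v ones K = ones K"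
    using comb by (auto simp: combination_matrices_def)
  thus "(\<Sum>l<K. amat nw w $$ (i, l)) = 1" "(\<Sum>l<K. cmat nw w $$ (i, l)) = 1"
    using assms sm[OF mats_carrier(1)] sm[OF mats_carrier(3)] by (simp_all add: ones_def)
qed

lemma col_sums:
  assumes "l < K"
  shows "(\<Sum>i<K. amat nw w $$ (i, l)) = 1" "(\<Sum>i<K. bmat nw w $$ (i, l)) = 0"
    "(\<Sum>i<K. cmat nw w $$ (i, l)) = 1"
proof -
  have W: "transpose_mat (wmat nw) = wmat nw" using comb by (simp add: combination_matrices_def)
  obtain qa where "amat nw w = poly_mat qa (wmat nw)"
    using comb unfolding combination_matrices_def by blast
  hence a: "amat nw w $$ (i, l) = amat nw w $$ (l, i)" if "i < K" for i
    using poly_mat_symmetric[OF wmat_carrier W that assms] by simp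
  obtain qc where "cmat nw w = poly_mat qc (wmat nw)"
    using comb unfolding combination_matrices_def by blast
  hence c: "cmat nw w $$ (i, l) = cmat nw w $$ (l, i)" if "i < K" for i
    using poly_mat_symmetric[OF wmat_carrier W that assms] by simp
  have tb: "transpose_mat (bmat nw w) = bmat nw w" using comb by (simp add: combination_matrices_def)
  have b: "bmat nw w $$ (i, l) = bmat nw w $$ (l, i)" if "i < K" for i
    using arg_cong[OF tb, of "\<lambda>M. M $$ (i, l)"] that assms carrier_matD[OF mats_carrier(2)]
    by (subst (asm) index_transpose_mat) auto
  show "(\<Sum>i<K. amat nw w $$ (i, l)) = 1" "(\<Sum>i<K. bmat nw w $$ (i, l)) = 0"
    "(\<Sum>i<K. cmat nw w $$ (i, l)) = 1"
    using row_sums[OF assms, of w] a b c by simp_all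
qed

lemma avg_carrier [simp]: "avg_mat n \<in> carrier_mat n n"
  by (simp add: avg_mat_def)

lemma UtU: "transpose_mat (umat nw) * umat nw = 1\<^sub>m (K - 1)"
  using eig by (simp add: reduced_eigenbasis_def)

lemma U_ones:
  assumes "j < K - 1" shows "(\<Sum>i<K. umat nw $$ (i, j)) = 0"
proof -
  have "col (umat nw) j \<bullet> ones K = 0" using eig assms by (simp add: reduced_eigenbasis_def)
  thus ?thesis using assms carrier_matD[OF mats_carrier(4)]
    by (simp add: scalar_prod_def ones_def lessThan_atLeast0)
qed

text \<open>Adding the constant column \<open>1 / sqrt K\<close> completes \<open>umat\<close> to a
  square matrix with orthonormal columns. Its rows are then orthonormal too, and the extra column
  contributes the \<open>1 / K\<close>.\<close>

lemma UUt_index: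
  assumes i: "i < K" and j: "j < K"
  shows "(\<Sum>l<K - 1. umat nw $$ (i, l) * umat nw $$ (j, l)) + 1 / real K = (if i = j then 1 else 0)"
proof -
  define N where "N = mat K K (\<lambda>(i, l). if l < K - 1 then umat nw $$ (i, l) else 1 / sqrt (real K))"
  have N: "N \<in> carrier_mat K K" by (simp add: N_def)
  have K1: "{..<K} = insert (K - 1) {..<K - 1}" using agents by auto
  have "transpose_mat N * N = 1\<^sub>m K"
  proof (rule eq_matI)
    fix a b assume "a < dim_row (1\<^sub>m K :: real mat)" "b < dim_col (1\<^sub>m K :: real mat)"
    hence ab: "a < K" "b < K" by auto
    have Nt: "transpose_mat N \<in> carrier_mat K K" using N by simp
    have e: "(transpose_mat N * N) $$ (a, b) = (\<Sum>q<K. N $$ (q, a) * N $$ (q, b))"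
      unfolding index_mult_mat_sum[OF Nt N ab]
      using N ab by (intro sum.cong refl) auto
    have U: "(\<Sum>q<K. umat nw $$ (q, a) * umat nw $$ (q, b)) = (if a = b then 1 else 0)"
      if "a < K - 1" "b < K - 1"
    proof -
      have "(transpose_mat (umat nw) * umat nw) $$ (a, b)
          = (\<Sum>q<K. transpose_mat (umat nw) $$ (a, q) * umat nw $$ (q, b))"
        by (rule index_mult_mat_sum[OF _ mats_carrier(4) that]) simp
      thus ?thesis using that carrier_matD[OF mats_carrier(4)] UtU by simp
    qed
    consider "a < K - 1" "b < K - 1" | "a = K - 1" "b < K - 1" | "a < K - 1" "b = K - 1"
      | "a = K - 1" "b = K - 1" using ab by linarith
    thus "(transpose_mat N * N) $$ (a, b) = 1\<^sub>m K $$ (a, b)"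
    proof cases
      case 1 thus ?thesis using e U ab by (simp add: N_def)
    next
      case 2 thus ?thesis using e ab U_ones[of b] by (simp add: N_def flip: sum_divide_distrib)
    next
      case 3 thus ?thesis using e ab U_ones[of a] by (simp add: N_def flip: sum_divide_distrib)
    next
      case 4 thus ?thesis using e ab by (simp add: N_def)
    qed
  qed (use N in auto)
  hence "N * transpose_mat N = 1\<^sub>m K"
    using mat_mult_left_right_inverse[of "transpose_mat N" K N] N by simp
  hence "(N * transpose_mat N) $$ (i, j) = (if i = j then 1 else 0)" using i j by simp
  moreover have "(N * transpose_mat N) $$ (i, j) = (\<Sum>l<K. N $$ (i, l) * N $$ (j, l))"
    using N i j by (subst index_mult_mat_sum[OF N _ i j]) auto
  moreover have "\<dots> = (\<Sum>l<K - 1. umat nw $$ (i, l) * umat nw $$ (j, l)) + 1 / real K"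
    unfolding K1 using i j agents by (simp add: N_def)
  ultimately show ?thesis by simp
qed

lemma UUt: "umat nw * transpose_mat (umat nw) = 1\<^sub>m K - avg_mat K"
proof (rule eq_matI)
  fix i j assume "i < dim_row (1\<^sub>m K - avg_mat K)" "j < dim_col (1\<^sub>m K - avg_mat K)"
  hence ij: "i < K" "j < K" by (auto simp: avg_mat_def)
  have "(umat nw * transpose_mat (umat nw)) $$ (i, j)
      = (\<Sum>l<K - 1. umat nw $$ (i, l) * transpose_mat (umat nw) $$ (l, j))"
    by (rule index_mult_mat_sum[OF mats_carrier(4) _ ij]) simp
  also have "\<dots> = (\<Sum>l<K - 1. umat nw $$ (i, l) * umat nw $$ (j, l))"
    using ij carrier_matD[OF mats_carrier(4)] by simp
  also have "\<dots> = (1\<^sub>m K - avg_mat K) $$ (i, j)"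
    using UUt_index[OF ij] ij by (simp add: avg_mat_def)
  finally show "(umat nw * transpose_mat (umat nw)) $$ (i, j) = (1\<^sub>m K - avg_mat K) $$ (i, j)" .
qed (auto simp: avg_mat_def carrier_matD[OF mats_carrier(4)])

lemma Ut_avg: "transpose_mat (umat nw) * (c \<cdot>\<^sub>m avg_mat K) = 0\<^sub>m (K - 1) K"
proof (rule eq_matI)
  fix i j assume "i < dim_row (0\<^sub>m (K - 1) K :: real mat)" "j < dim_col (0\<^sub>m (K - 1) K :: real mat)"
  hence ij: "i < K - 1" "j < K" by auto
  have "(transpose_mat (umat nw) * (c \<cdot>\<^sub>m avg_mat K)) $$ (i, j)
      = (\<Sum>l<K. transpose_mat (umat nw) $$ (i, l) * (c \<cdot>\<^sub>m avg_mat K) $$ (l, j))"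
    by (rule index_mult_mat_sum[OF _ _ ij]) auto
  also have "\<dots> = (\<Sum>l<K. umat nw $$ (l, i)) * (c / real K)"
    using ij carrier_matD[OF mats_carrier(4)]
    by (simp add: avg_mat_def sum_distrib_right sum_divide_distrib)
  finally show "(transpose_mat (umat nw) * (c \<cdot>\<^sub>m avg_mat K)) $$ (i, j) = 0\<^sub>m (K - 1) K $$ (i, j)"
    using U_ones[OF ij(1)] ij by simp
qed (auto simp: avg_mat_def carrier_matD[OF mats_carrier(4)])

lemma mult_avg:
  assumes M: "M \<in> carrier_mat K K" and rs: "\<And>i. i < K \<Longrightarrow> (\<Sum>l<K. M $$ (i, l)) = c"
  shows "M * avg_mat K = c \<cdot>\<^sub>m avg_mat K"
proof (rule eq_matI)
  fix i j assume "i < dim_row (c \<cdot>\<^sub>m avg_mat K)" "j < dim_col (c \<cdot>\<^sub>m avg_mat K)"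
  hence ij: "i < K" "j < K" by (auto simp: avg_mat_def)
  show "(M * avg_mat K) $$ (i, j) = (c \<cdot>\<^sub>m avg_mat K) $$ (i, j)"
    unfolding index_mult_mat_sum[OF M avg_carrier ij]
    using rs[OF ij(1)] ij by (simp add: avg_mat_def flip: sum_divide_distrib)
qed (use M in \<open>auto simp: avg_mat_def\<close>)

text \<open>The part of \<open>reduce\<close> that acts on the agents only. Kronecker products with
  an identity respect matrix products, so statements about \<open>reduce\<close> follow from
  statements about matrices of size \<open>K - 1\<close>.\<close>

definition small :: "real mat \<Rightarrow> real mat" where
  "small M = transpose_mat (umat nw) * M * umat nw"

lemma Ut_carrier [simp]: "transpose_mat (umat nw) \<in> carrier_mat (K - 1) K"
  by simp

lemma small_carrier [simp]: "M \<in> carrier_mat K K \<Longrightarrow> small M \<in> carrier_mat (K - 1) (K - 1)"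
  unfolding small_def by (intro mult_carrier_mat[of _ _ K]) auto

lemma reduce_eq:
  assumes M: "M \<in> carrier_mat K K"
  shows "reduce pb nw w M = kron (small M) (vdim pb w)"
proof -
  have "kron (transpose_mat (umat nw)) (vdim pb w) * kron M (vdim pb w)
      = kron (transpose_mat (umat nw) * M) (vdim pb w)"
    by (rule kron_mult[OF Ut_carrier M])
  moreover have "kron (transpose_mat (umat nw) * M) (vdim pb w) * kron (umat nw) (vdim pb w)
      = kron (small M) (vdim pb w)"
    unfolding small_def by (rule kron_mult[OF mult_carrier_mat[OF Ut_carrier M] mats_carrier(4)])
  ultimately show ?thesis by (simp add: reduce_def kron_transpose)
qed

lemma reduce_carrier [simp]:
  "M \<in> carrier_mat K K \<Longrightarrow> reduce pb nw w M \<in> carrier_mat ((K - 1) * vdim pb w) ((K - 1) * vdim pb w)"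
  by (simp add: reduce_eq del: One_nat_def)

text \<open>\<open>umat\<close> times its transpose is the identity up to averaging. Constant row
  sums keep the image of averaging spanned by the constants, and these are annihilated by the
  transpose of \<open>umat\<close>.\<close>

lemma small_intertwine:
  assumes M: "M \<in> carrier_mat K K" and rs: "\<And>i. i < K \<Longrightarrow> (\<Sum>l<K. M $$ (i, l)) = c"
  shows "small M * transpose_mat (umat nw) = transpose_mat (umat nw) * M"
proof -
  let ?U = "umat nw" and ?V = "transpose_mat (umat nw)"
  have VM: "?V * M \<in> carrier_mat (K - 1) K" by (rule mult_carrier_mat[OF Ut_carrier M])
  have "small M * ?V = ?V * M * (?U * ?V)"
    unfolding small_def by (rule assoc_mult_mat[OF VM mats_carrier(4) Ut_carrier])
  also have "\<dots> = ?V * M * 1\<^sub>m K - ?V * M * avg_mat K"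
    unfolding UUt by (rule mult_minus_distrib_mat[OF VM]) auto
  also have "?V * M * avg_mat K = ?V * (M * avg_mat K)"
    by (rule assoc_mult_mat[OF Ut_carrier M avg_carrier])
  also have "\<dots> = 0\<^sub>m (K - 1) K" using mult_avg[OF M rs] Ut_avg[of c] by simp
  also have "?V * M * 1\<^sub>m K = ?V * M" by (rule right_mult_one_mat[OF VM])
  also have "?V * M - 0\<^sub>m (K - 1) K = ?V * M"
  proof -
    have "Z - 0\<^sub>m (K - 1) K = Z" if "Z \<in> carrier_mat (K - 1) K" for Z :: "real mat"
      using that by (intro eq_matI) auto
    thus ?thesis using VM .
  qed
  finally show ?thesis .
qed

text \<open>Coordinates of the deviation from the mean in an orthonormal basis: consensus is sent to
  0 and the remaining part keeps its norm.\<close>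

definition hat :: "var \<Rightarrow> real vec \<Rightarrow> real vec" where
  "hat w v = kron (transpose_mat (umat nw)) (vdim pb w) *\<^sub>v v"

lemma kronUt_carrier [simp]:
  "kron (transpose_mat (umat nw)) d \<in> carrier_mat ((K - 1) * d) (K * d)"
  by (rule kron_carrier[OF Ut_carrier])

lemma hat_carrier [simp]: "hat w v \<in> carrier_vec ((K - 1) * vdim pb w)"
  unfolding hat_def by (rule carrier_vecI) (simp add: carrier_matD[OF mats_carrier(4)])

lemma hat_mult:
  assumes M: "M \<in> carrier_mat K K" and rs: "\<And>i. i < K \<Longrightarrow> (\<Sum>l<K. M $$ (i, l)) = c"
    and v: "v \<in> carrier_vec (K * vdim pb w)"
  shows "hat w (kron M (vdim pb w) *\<^sub>v v) = reduce pb nw w M *\<^sub>v hat w v"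
proof -
  let ?d = "vdim pb w"
  let ?V = "transpose_mat (umat nw)"
  have "hat w (kron M ?d *\<^sub>v v) = (kron ?V ?d * kron M ?d) *\<^sub>v v"
    unfolding hat_def by (rule assoc_mult_mat_vec[symmetric, OF kronUt_carrier kron_carrier[OF M] v])
  also have "kron ?V ?d * kron M ?d = kron (small M * ?V) ?d"
    using kron_mult[OF Ut_carrier M] small_intertwine[OF M rs] by simp
  also have "\<dots> = kron (small M) ?d * kron ?V ?d"
    by (rule kron_mult[symmetric, OF small_carrier[OF M] Ut_carrier])
  also have "\<dots> *\<^sub>v v = reduce pb nw w M *\<^sub>v hat w v"
    unfolding hat_def reduce_eq[OF M]
    by (rule assoc_mult_mat_vec[OF kron_carrier[OF small_carrier[OF M]] kronUt_carrier v])
  finally show ?thesis .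
qed

lemma hat_a: "v \<in> carrier_vec (K * vdim pb w) \<Longrightarrow>
    hat w (kron (amat nw w) (vdim pb w) *\<^sub>v v) = lam_a pb nw w *\<^sub>v hat w v"
  unfolding lam_a_def by (rule hat_mult[OF mats_carrier(1) row_sums(1)])

lemma hat_b: "v \<in> carrier_vec (K * vdim pb w) \<Longrightarrow>
    hat w (kron (bmat nw w) (vdim pb w) *\<^sub>v v) = lam_b pb nw w *\<^sub>v hat w v"
  unfolding lam_b_def by (rule hat_mult[OF mats_carrier(2) row_sums(2)])

lemma hat_c: "v \<in> carrier_vec (K * vdim pb w) \<Longrightarrow>
    hat w (kron (cmat nw w) (vdim pb w) *\<^sub>v v) = lam_c pb nw w *\<^sub>v hat w v"
  unfolding lam_c_def by (rule hat_mult[OF mats_carrier(3) row_sums(3)])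

lemma lam_carrier [simp]:
  "lam_a pb nw w \<in> carrier_mat ((K - 1) * vdim pb w) ((K - 1) * vdim pb w)"
  "lam_b pb nw w \<in> carrier_mat ((K - 1) * vdim pb w) ((K - 1) * vdim pb w)"
  "lam_c pb nw w \<in> carrier_mat ((K - 1) * vdim pb w) ((K - 1) * vdim pb w)"
  unfolding lam_a_def lam_b_def lam_c_def by (rule reduce_carrier[OF mats_carrier(1)]
      reduce_carrier[OF mats_carrier(2)] reduce_carrier[OF mats_carrier(3)])+

text \<open>Moving the transpose across the scalar product pairs \<open>v\<close> with its own
  deviation from the mean, because \<open>umat\<close> times its transpose removes the
  average.\<close>

lemma vnorm_sq_hat:
  assumes v: "v \<in> carrier_vec (K * vdim pb w)"
  shows "(vnorm (hat w v))\<^sup>2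
    = (vnorm v)\<^sup>2 - real K * (vnorm (vmean (vdim pb w) K (\<lambda>k. block (vdim pb w) k v)))\<^sup>2"
proof -
  let ?d = "vdim pb w"
  have ku: "kron (umat nw) ?d \<in> carrier_mat (K * ?d) ((K - 1) * ?d)" by (rule kron_carrier[OF mats_carrier(4)])
  have "kron (umat nw) ?d *\<^sub>v hat w v = (kron (umat nw) ?d * kron (transpose_mat (umat nw)) ?d) *\<^sub>v v"
    unfolding hat_def by (rule assoc_mult_mat_vec[symmetric, OF ku kronUt_carrier v])
  also have "kron (umat nw) ?d * kron (transpose_mat (umat nw)) ?d = kron (1\<^sub>m K - avg_mat K) ?d"
    unfolding kron_mult[OF mats_carrier(4) Ut_carrier] UUt ..
  also have "\<dots> = 1\<^sub>m (K * ?d) - kron (avg_mat K) ?d"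
    unfolding kron_minus[OF one_carrier_mat avg_carrier] kron_one ..
  also have "\<dots> *\<^sub>v v = v - kron (avg_mat K) ?d *\<^sub>v v"
    using minus_mult_distrib_mat_vec[OF one_carrier_mat kron_carrier[OF avg_carrier] v] v by simp
  finally have e: "kron (umat nw) ?d *\<^sub>v hat w v = v - kron (avg_mat K) ?d *\<^sub>v v" .
  have av: "kron (avg_mat K) ?d *\<^sub>v v \<in> carrier_vec (K * ?d)"
    by (rule mult_mat_vec_carrier[OF kron_carrier[OF avg_carrier] v])
  have "(vnorm (hat w v))\<^sup>2 = hat w v \<bullet> hat w v" by (rule vnorm_sq_scalar_prod)
  also have "\<dots> = v \<bullet> (kron (umat nw) ?d *\<^sub>v hat w v)"
    using transpose_vec_mult_scalar[OF ku hat_carrier v] by (simp add: hat_def kron_transpose)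
  also have "\<dots> = v \<bullet> v - v \<bullet> (kron (avg_mat K) ?d *\<^sub>v v)"
    unfolding e by (rule scalar_prod_minus_distrib[OF v v av])
  finally show ?thesis
    by (simp add: vnorm_sq_scalar_prod[symmetric] scalar_prod_kron_avg[OF v agents])
qed

lemma consensus_eq_hat:
  assumes "v \<in> carrier_vec (K * vdim pb w)"
  shows "(\<Sum>k<K. (vnorm (block (vdim pb w) k v - vmean (vdim pb w) K (\<lambda>k. block (vdim pb w) k v)))\<^sup>2)
    = (vnorm (hat w v))\<^sup>2"
  using vnorm_sq_hat[OF assms] vnorm_sq_deviation[OF assms agents] by simp

lemma hat_add:
  "u \<in> carrier_vec (K * vdim pb w) \<Longrightarrow> v \<in> carrier_vec (K * vdim pb w) \<Longrightarrow> hat w (u + v) = hat w u + hat w v"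
  unfolding hat_def by (rule mult_add_distrib_mat_vec[OF kronUt_carrier])

lemma hat_diff:
  "u \<in> carrier_vec (K * vdim pb w) \<Longrightarrow> v \<in> carrier_vec (K * vdim pb w) \<Longrightarrow> hat w (u - v) = hat w u - hat w v"
  unfolding hat_def by (rule mult_minus_distrib_mat_vec[OF kronUt_carrier])

lemma hat_smult:
  "v \<in> carrier_vec (K * vdim pb w) \<Longrightarrow> hat w (c \<cdot>\<^sub>v v) = c \<cdot>\<^sub>v hat w v"
  unfolding hat_def by (rule mult_mat_vec[OF kronUt_carrier])

lemma hat_norm_le: "v \<in> carrier_vec (K * vdim pb w) \<Longrightarrow> (vnorm (hat w v))\<^sup>2 \<le> (vnorm v)\<^sup>2"
  by (simp add: vnorm_sq_hat)

text \<open>Equal blocks do not deviate from their mean. As all agents start at the same point, the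
  initial error comes from the first estimates alone.\<close>

lemma hat_stack_const:
  assumes f: "f \<in> carrier_vec (vdim pb w)"
  shows "hat w (stack (vdim pb w) K (\<lambda>k. f)) = 0\<^sub>v ((K - 1) * vdim pb w)"
proof -
  let ?d = "vdim pb w" and ?v = "stack (vdim pb w) K (\<lambda>k. f)"
  have b: "block ?d k ?v = f" if "k < K" for k using block_stack[OF that] f by simp
  hence "vmean ?d K (\<lambda>k. block ?d k ?v) = f"
    using agents f by (intro eq_vecI) (auto simp: vmean_def)
  hence "(\<Sum>k<K. (vnorm (block ?d k ?v - vmean ?d K (\<lambda>k. block ?d k ?v)))\<^sup>2) = 0"
    using b f by simp
  hence "(vnorm (hat w ?v))\<^sup>2 = 0" using consensus_eq_hat[OF stack_carrier, of w "\<lambda>k. f"] by simp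
  hence "\<forall>i<(K - 1) * ?d. hat w ?v $ i = 0"
    using carrier_vecD[OF hat_carrier[of w ?v]]
    by (simp add: vnorm_sq_real sum_nonneg_eq_0_iff del: vnorm_nonneg)
  thus ?thesis using carrier_vecD[OF hat_carrier[of w ?v]] by (intro eq_vecI) auto
qed

text \<open>Suppose the reduced \<open>bmat\<close> annihilates \<open>v\<close>. Then
  \<open>bmat\<close> applied to \<open>umat *\<^sub>v v\<close> is orthogonal to the columns of
  \<open>umat\<close> and, by the column sums of \<open>bmat\<close>, to the constants; hence it is
  0. The null space of \<open>bmat\<close> makes \<open>umat *\<^sub>v v\<close> constant, but it is
  also orthogonal to the constants.\<close>

lemma small_b_inverse: "\<exists>S\<in>carrier_mat (K - 1) (K - 1). small (bmat nw w) * S = 1\<^sub>m (K - 1)"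
proof -
  let ?U = "umat nw" and ?V = "transpose_mat (umat nw)" and ?B = "bmat nw w"
  let ?S = "small ?B"
  have S: "?S \<in> carrier_mat (K - 1) (K - 1)" by (rule small_carrier[OF mats_carrier(2)])
  have "det ?S \<noteq> 0"
  proof
    assume "det ?S = 0"
    then obtain v where v: "v \<in> carrier_vec (K - 1)" "v \<noteq> 0\<^sub>v (K - 1)" "?S *\<^sub>v v = 0\<^sub>v (K - 1)"
      using det_0_iff_vec_prod_zero[OF S] by blast
    have Uv: "?U *\<^sub>v v \<in> carrier_vec K" by (rule mult_mat_vec_carrier[OF mats_carrier(4) v(1)])
    define b where "b = ?B *\<^sub>v (?U *\<^sub>v v)"
    have b: "b \<in> carrier_vec K" unfolding b_def by (rule mult_mat_vec_carrier[OF mats_carrier(2) Uv])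
    have "?S *\<^sub>v v = ?V *\<^sub>v b"
      unfolding small_def b_def
      using assoc_mult_mat_vec[OF mult_carrier_mat[OF Ut_carrier mats_carrier(2)] mats_carrier(4) v(1)]
        assoc_mult_mat_vec[OF Ut_carrier mats_carrier(2) Uv] by simp
    hence Vb: "?V *\<^sub>v b = 0\<^sub>v (K - 1)" using v by simp
    have sb: "(\<Sum>i<K. b $ i) = 0"
    proof -
      have "(\<Sum>i<K. b $ i) = (\<Sum>i<K. \<Sum>l<K. ?B $$ (i, l) * (?U *\<^sub>v v) $ l)"
        unfolding b_def by (intro sum.cong refl index_mult_mat_vec_sum[OF mats_carrier(2) Uv]) auto
      also have "\<dots> = (\<Sum>l<K. (\<Sum>i<K. ?B $$ (i, l)) * (?U *\<^sub>v v) $ l)"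
        by (subst sum.swap) (simp only: sum_distrib_right)
      finally show ?thesis by (simp add: col_sums(2))
    qed
    have "(1\<^sub>m K - avg_mat K) *\<^sub>v b = ?U *\<^sub>v (?V *\<^sub>v b)"
      unfolding UUt[symmetric] by (rule assoc_mult_mat_vec[OF mats_carrier(4) Ut_carrier b])
    also have "\<dots> = 0\<^sub>v K" unfolding Vb using carrier_matD[OF mats_carrier(4)]
      by (intro eq_vecI) auto
    finally have "b - avg_mat K *\<^sub>v b = 0\<^sub>v K"
      using minus_mult_distrib_mat_vec[OF one_carrier_mat avg_carrier b] b by simp
    moreover have "avg_mat K *\<^sub>v b = 0\<^sub>v K"
    proof (rule eq_vecI)
      fix i assume "i < dim_vec (0\<^sub>v K :: real vec)"
      hence i: "i < K" by simp
      show "(avg_mat K *\<^sub>v b) $ i = 0\<^sub>v K $ i"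
        unfolding index_mult_mat_vec_sum[OF avg_carrier b i] using i sb
        by (simp add: avg_mat_def flip: sum_divide_distrib)
    qed (simp add: avg_mat_def)
    ultimately have "b = 0\<^sub>v K" using b by simp
    hence "?U *\<^sub>v v \<in> mat_kernel ?B"
      using mat_kernelI[OF mats_carrier(2) Uv] by (simp add: b_def)
    then obtain c where c: "?U *\<^sub>v v = c \<cdot>\<^sub>v ones K"
      using comb by (auto simp: combination_matrices_def)
    have "v = (?V * ?U) *\<^sub>v v" using v UtU by simp
    also have "\<dots> = ?V *\<^sub>v (?U *\<^sub>v v)" by (rule assoc_mult_mat_vec[OF Ut_carrier mats_carrier(4) v(1)])
    also have "\<dots> = 0\<^sub>v (K - 1)"
    proof (rule eq_vecI)
      fix i assume "i < dim_vec (0\<^sub>v (K - 1) :: real vec)"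
      hence i: "i < K - 1" by simp
      have "(?V *\<^sub>v (?U *\<^sub>v v)) $ i = (\<Sum>q<K. ?U $$ (q, i) * c)"
        unfolding index_mult_mat_vec_sum[OF Ut_carrier Uv i] unfolding c
        using i carrier_matD[OF mats_carrier(4)] by (intro sum.cong refl) (auto simp: ones_def)
      thus "(?V *\<^sub>v (?U *\<^sub>v v)) $ i = 0\<^sub>v (K - 1) $ i"
        using i U_ones[OF i] by (simp flip: sum_distrib_right)
    qed (simp add: carrier_matD[OF mats_carrier(4)])
    finally show False using v by simp
  qed
  hence "?S \<in> Units (ring_mat TYPE(real) (K - 1) ())" by (rule det_non_zero_imp_unit[OF S])
  thus ?thesis by (auto simp: Units_def ring_mat_def)
qed

lemma lam_b_inverse:
  "lam_b pb nw w * minv (lam_b pb nw w) = 1\<^sub>m ((K - 1) * vdim pb w)"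
  "minv (lam_b pb nw w) \<in> carrier_mat ((K - 1) * vdim pb w) ((K - 1) * vdim pb w)"
proof -
  obtain S where S: "S \<in> carrier_mat (K - 1) (K - 1)" "small (bmat nw w) * S = 1\<^sub>m (K - 1)"
    using small_b_inverse by blast
  have "lam_b pb nw w * kron S (vdim pb w) = 1\<^sub>m ((K - 1) * vdim pb w)"
    unfolding lam_b_def reduce_eq[OF mats_carrier(2)]
      kron_mult[OF small_carrier[OF mats_carrier(2)] S(1)] S(2) kron_one ..
  from minv_inverse[OF lam_carrier(2) kron_carrier[OF S(1)] this]
  show "lam_b pb nw w * minv (lam_b pb nw w) = 1\<^sub>m ((K - 1) * vdim pb w)"
    "minv (lam_b pb nw w) \<in> carrier_mat ((K - 1) * vdim pb w) ((K - 1) * vdim pb w)" by auto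
qed

lemma opnorm_bound:
  fixes M :: "'a::real_normed_field mat"
  assumes "M \<in> carrier_mat m n" "v \<in> carrier_vec n" "opnorm M \<le> c" "vnorm v \<le> t"
  shows "vnorm (M *\<^sub>v v) \<le> c * t"
proof -
  have "vnorm (M *\<^sub>v v) \<le> opnorm M * vnorm v" by (rule vnorm_mult_le_opnorm[OF assms(1,2)])
  also have "\<dots> \<le> c * t"
    by (rule mult_mono[OF assms(3,4) order_trans[OF opnorm_nonneg assms(3)] vnorm_nonneg])
  finally show ?thesis .
qed

text \<open>The disagreement is driven by the estimates themselves, which need not become small.
  Shifting the dual variable by a rescaled estimate changes the forcing into the increment of the
  estimates. The second bound controls the disagreement of the next iterate by \<open>r i\<close>,
  into which the increment of step \<open>i\<close> has not entered yet; otherwise the later bound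
  on distances between iterates would be circular.\<close>

theorem consensus_error_bound:
  fixes X D G :: "nat \<Rightarrow> real vec" and s \<rho> m l v\<^sub>1 v\<^sub>2 :: real and w :: var
  defines "d \<equiv> vdim pb w"
  assumes c: "\<And>i. X i \<in> carrier_vec (K * d)" "\<And>i. D i \<in> carrier_vec (K * d)"
      "\<And>i. G i \<in> carrier_vec (K * d)"
    and stepX: "\<And>i. X (Suc i) = kron (amat nw w) d *\<^sub>v (kron (cmat nw w) d *\<^sub>v X i + s \<cdot>\<^sub>v G i)
      - kron (bmat nw w) d *\<^sub>v D i"
    and stepD: "\<And>i. D (Suc i) = D i + kron (bmat nw w) d *\<^sub>v X (Suc i)"
    and zero: "hat w (X 0) = 0\<^sub>v ((K - 1) * d)" "hat w (D 0) = 0\<^sub>v ((K - 1) * d)"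
    and bnd: "opnorm (qmat nw w) \<le> v\<^sub>1" "opnorm (minv (qmat nw w)) \<le> v\<^sub>2" "opnorm (tmat nw w) \<le> \<rho>"
      "\<rho> < 1" "opnorm (minv (lam_b pb nw w)) \<le> m" "opnorm (lam_a pb nw w) \<le> l"
  defines "r \<equiv> cons_bound \<rho> ((v\<^sub>2 * s * m * l)\<^sup>2 / (1 - \<rho>))
      ((v\<^sub>2 * s * m)\<^sup>2 * (vnorm ((kron (amat nw w) d - kron (avg_mat K) d) *\<^sub>v G 0))\<^sup>2)
      (\<lambda>i. (vnorm (G (Suc i) - G i))\<^sup>2)"
  shows "(vnorm (hat w (X i)))\<^sup>2 \<le> v\<^sub>1\<^sup>2 * r i" "(vnorm (hat w (X (Suc i))))\<^sup>2 \<le> v\<^sub>1\<^sup>2 * r i"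
proof -
  define n where "n = (K - 1) * d"
  let ?La = "lam_a pb nw w" and ?Lb = "lam_b pb nw w" and ?Lc = "lam_c pb nw w"
  let ?Bi = "minv (lam_b pb nw w)" and ?cv = "map_vec complex_of_real"
  let ?Q = "qmat nw w" and ?T = "tmat nw w" and ?Qi = "minv (qmat nw w)" and ?P = "pmat pb nw w"
  note L [simp] = lam_carrier[of w, folded d_def, folded n_def]
  have Bi [simp]: "?Bi \<in> carrier_mat n n" and LbBi: "?Lb * ?Bi = 1\<^sub>m n"
    using lam_b_inverse[of w] by (simp_all add: n_def d_def)
  have hatc [simp]: "hat w v \<in> carrier_vec n" for v using hat_carrier[of w v] by (simp add: n_def d_def)
  have Q: "?Q \<in> carrier_mat (2 * n) (2 * n)" and T: "?T \<in> carrier_mat (2 * n) (2 * n)"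
    and invQ: "invertible_mat ?Q" and PQ: "map_mat complex_of_real ?P = ?Q * ?T * ?Qi"
    using fact unfolding contractive_factorization_def Let_def by (simp_all add: n_def d_def)
  have Qi: "?Qi \<in> carrier_mat (2 * n) (2 * n)" and QiQ: "?Qi * ?Q = 1\<^sub>m (2 * n)"
    using minv_invertible[OF Q invQ] by auto
  have v: "0 \<le> v\<^sub>1" "0 \<le> v\<^sub>2" "0 \<le> \<rho>" "0 \<le> m" "0 \<le> l"
    using bnd by (meson opnorm_nonneg order_trans)+
  have LLc: "?La * ?Lc \<in> carrier_mat n n" "?Lb * ?Lb \<in> carrier_mat n n"
    by (rule mult_carrier_mat[OF L(1) L(3)], rule mult_carrier_mat[OF L(2) L(2)])
  have P: "?P \<in> carrier_mat (2 * n) (2 * n)"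
  proof -
    have "1\<^sub>m ((K - 1) * vdim pb w) = (1\<^sub>m n :: real mat)" by (simp add: n_def d_def)
    thus ?thesis unfolding pmat_def mult_2
      by (intro four_block_carrier_mat minus_carrier_mat) (simp_all add: LLc)
  qed
  define x where "x i = hat w (X i)" for i
  define y where "y i = hat w (D i)" for i
  \<comment> \<open>As \<open>?Lb\<close> is invertible, the forcing can be written as
    \<open>?Lb\<close> applied to a vector, and \<open>y\<close> enters the step through
    \<open>?Lb\<close> as well; so the two can be merged.\<close>
  define g where "g i = ?Bi *\<^sub>v (?La *\<^sub>v hat w (G i))" for i
  have La_hat [simp]: "?La *\<^sub>v hat w u \<in> carrier_vec n" for u by (rule mult_mat_vec_carrier[OF L(1) hatc])
  have xy [simp]: "x i \<in> carrier_vec n" "y i \<in> carrier_vec n" "g i \<in> carrier_vec n" for i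
    by (simp_all add: x_def y_def g_def mult_mat_vec_carrier[OF Bi La_hat])
  note cc = c[unfolded d_def]
  have Lx [simp]: "?Lb *\<^sub>v x i \<in> carrier_vec n" "?Lb *\<^sub>v y i \<in> carrier_vec n"
      "?Lc *\<^sub>v x i \<in> carrier_vec n" "?La *\<^sub>v (?Lc *\<^sub>v x i) \<in> carrier_vec n"
      "?Lb *\<^sub>v (?Lb *\<^sub>v x i) \<in> carrier_vec n" for i
    by (intro mult_mat_vec_carrier[OF L(1)] mult_mat_vec_carrier[OF L(2)] mult_mat_vec_carrier[OF L(3)] xy)+
  have Lbg: "?Lb *\<^sub>v g i = ?La *\<^sub>v hat w (G i)" for i
  proof -
    have "?Lb *\<^sub>v g i = (?Lb * ?Bi) *\<^sub>v (?La *\<^sub>v hat w (G i))"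
      unfolding g_def by (rule assoc_mult_mat_vec[symmetric, OF L(2) Bi La_hat])
    also have "\<dots> = ?La *\<^sub>v hat w (G i)" unfolding LbBi by (rule one_mult_mat_vec[OF La_hat])
    finally show ?thesis .
  qed
  have kc: "kron (amat nw w) (vdim pb w) *\<^sub>v u \<in> carrier_vec (K * vdim pb w)"
    "kron (bmat nw w) (vdim pb w) *\<^sub>v u \<in> carrier_vec (K * vdim pb w)"
    "kron (cmat nw w) (vdim pb w) *\<^sub>v u \<in> carrier_vec (K * vdim pb w)"
    if "u \<in> carrier_vec (K * vdim pb w)" for u
    using that by (auto intro!: mult_mat_vec_carrier kron_carrier)
  have sG: "s \<cdot>\<^sub>v G i \<in> carrier_vec (K * vdim pb w)" for i using cc(3) by simp
  have cX: "kron (cmat nw w) (vdim pb w) *\<^sub>v X i + s \<cdot>\<^sub>v G i \<in> carrier_vec (K * vdim pb w)" for i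
    using kc(3)[OF cc(1)] sG by simp
  have xS: "x (Suc i) = ?La *\<^sub>v (?Lc *\<^sub>v x i) + s \<cdot>\<^sub>v (?Lb *\<^sub>v g i) - ?Lb *\<^sub>v y i" for i
  proof -
    have "x (Suc i) = ?La *\<^sub>v (?Lc *\<^sub>v x i + s \<cdot>\<^sub>v hat w (G i)) - ?Lb *\<^sub>v y i"
      unfolding x_def y_def stepX d_def
      by (simp only: hat_diff[OF kc(1)[OF cX] kc(2)[OF cc(2)]] hat_a[OF cX] hat_b[OF cc(2)]
          hat_add[OF kc(3)[OF cc(1)] sG] hat_c[OF cc(1)] hat_smult[OF cc(3)])
    also have "?La *\<^sub>v (?Lc *\<^sub>v x i + s \<cdot>\<^sub>v hat w (G i))
        = ?La *\<^sub>v (?Lc *\<^sub>v x i) + s \<cdot>\<^sub>v (?Lb *\<^sub>v g i)"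
      unfolding Lbg using mult_add_distrib_mat_vec[OF L(1) Lx(3), of "s \<cdot>\<^sub>v hat w (G i)" i]
        mult_mat_vec[OF L(1) hatc] by simp
    finally show ?thesis .
  qed
  have yS: "y (Suc i) = y i + ?Lb *\<^sub>v x (Suc i)" for i
    unfolding x_def y_def stepD[unfolded d_def]
    by (simp only: hat_add[OF cc(2) kc(2)[OF cc(1)]] hat_b[OF cc(1)])
  \<comment> \<open>By the dual update, \<open>y - ?Lb *\<^sub>v x\<close> at step
    \<open>i + 1\<close> equals \<open>y\<close> at step \<open>i\<close>. Hence \<open>z\<close>
    changes by \<open>?Lb *\<^sub>v x i\<close> and by the change of the last summand only, which is
    the second row of \<open>pmat\<close>.\<close>
  define z where "z i = y i - ?Lb *\<^sub>v x i - s \<cdot>\<^sub>v g i" for i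
  define e where "e i = x i @\<^sub>v z i" for i
  define f where "f i = 0\<^sub>v n @\<^sub>v (- s) \<cdot>\<^sub>v (g (Suc i) - g i)" for i
  have z [simp]: "z i \<in> carrier_vec n" for i by (simp add: z_def)
  have ec: "e i \<in> carrier_vec (2 * n)" and fc: "f i \<in> carrier_vec (2 * n)" for i
    unfolding e_def f_def mult_2 by (auto intro!: append_carrier_vec)
  \<comment> \<open>The value that \<open>z (Suc i)\<close> would have if the estimate did not
    change.\<close>
  define z' where "z' i = ?Lb *\<^sub>v x i + z i" for i
  have z' [simp]: "z' i \<in> carrier_vec n" for i by (simp add: z'_def)
  have Pe: "?P *\<^sub>v e i = x (Suc i) @\<^sub>v z' i" for i
  proof -
    have 1: "(?La * ?Lc - ?Lb * ?Lb) *\<^sub>v x i = ?La *\<^sub>v (?Lc *\<^sub>v x i) - ?Lb *\<^sub>v (?Lb *\<^sub>v x i)"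
      using minus_mult_distrib_mat_vec[OF LLc xy(1)] assoc_mult_mat_vec[OF L(1) L(3) xy(1)]
        assoc_mult_mat_vec[OF L(2) L(2) xy(1)] by simp
    have 2: "(- ?Lb) *\<^sub>v z i = - (?Lb *\<^sub>v z i)"
      using L(2) z by (intro uminus_mult_mat_vec) (metis carrier_matD(2) carrier_vecD)
    have 3: "?Lb *\<^sub>v z i = ?Lb *\<^sub>v y i - ?Lb *\<^sub>v (?Lb *\<^sub>v x i) - s \<cdot>\<^sub>v (?Lb *\<^sub>v g i)"
      unfolding z_def
      using mult_minus_distrib_mat_vec[OF L(2), of "y i - ?Lb *\<^sub>v x i" "s \<cdot>\<^sub>v g i"]
        mult_minus_distrib_mat_vec[OF L(2) xy(2) Lx(1)] mult_mat_vec[OF L(2) xy(3)] by simp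
    have gL: "?Lb *\<^sub>v g i \<in> carrier_vec n" by (rule mult_mat_vec_carrier[OF L(2) xy(3)])
    have alg: "a - b + - (c - b - s \<cdot>\<^sub>v u) = a + s \<cdot>\<^sub>v u - c"
      if "a \<in> carrier_vec n" "b \<in> carrier_vec n" "c \<in> carrier_vec n" "u \<in> carrier_vec n"
      for a b c u :: "real vec"
      using that by (intro eq_vecI) auto
    have "?P *\<^sub>v e i = ((?La * ?Lc - ?Lb * ?Lb) *\<^sub>v x i + (- ?Lb) *\<^sub>v z i)
        @\<^sub>v (?Lb *\<^sub>v x i + 1\<^sub>m n *\<^sub>v z i)"
      unfolding pmat_def e_def d_def[symmetric] n_def[symmetric]
      by (rule four_block_mat_mult_vec[where ?nr1.0 = n and ?nr2.0 = n and ?nc1.0 = n and ?nc2.0 = n])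
        (simp_all add: minus_carrier_mat LLc)
    also have "1\<^sub>m n *\<^sub>v z i = z i" by (rule one_mult_mat_vec[OF z])
    also have "(?La * ?Lc - ?Lb * ?Lb) *\<^sub>v x i + (- ?Lb) *\<^sub>v z i = x (Suc i)"
      unfolding 1 2 3 xS by (rule alg[OF Lx(4) Lx(5) Lx(2) gL])
    finally show ?thesis by (simp add: z'_def)
  qed
  have eS: "e (Suc i) = ?P *\<^sub>v e i + f i" for i
  proof -
    have alg: "a + (b - a - s \<cdot>\<^sub>v u) + (- s) \<cdot>\<^sub>v (u' - u) = b + c - c - s \<cdot>\<^sub>v u'"
      if "a \<in> carrier_vec n" "b \<in> carrier_vec n" "c \<in> carrier_vec n" "u \<in> carrier_vec n"
        "u' \<in> carrier_vec n" for a b c u u' :: "real vec"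
      using that by (intro eq_vecI) (auto simp: algebra_simps)
    have "?P *\<^sub>v e i + f i = (x (Suc i) + 0\<^sub>v n) @\<^sub>v (z' i + (- s) \<cdot>\<^sub>v (g (Suc i) - g i))"
      unfolding Pe f_def by (rule append_vec_add[where n = n and m = n]) auto
    also have "x (Suc i) + 0\<^sub>v n = x (Suc i)" by simp
    also have "z' i + (- s) \<cdot>\<^sub>v (g (Suc i) - g i) = z (Suc i)"
      unfolding z'_def z_def yS by (rule alg[OF Lx(1) xy(2) Lx(1) xy(3) xy(3)])
    finally show ?thesis by (simp add: e_def)
  qed
  \<comment> \<open>The coordinates in which one step is multiplication by \<open>?T\<close>. They
    are complex because the factors of \<open>pmat\<close> may be.\<close>
  define h where "h i = ?Qi *\<^sub>v ?cv (e i)" for i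
  have cve: "?cv (e i) \<in> carrier_vec (2 * n)" and cvf: "?cv (f i) \<in> carrier_vec (2 * n)" for i
    using ec fc by simp_all
  have hc: "h i \<in> carrier_vec (2 * n)" for i
    unfolding h_def by (rule mult_mat_vec_carrier[OF Qi cve])
  have Th: "?T *\<^sub>v h i \<in> carrier_vec (2 * n)" for i by (rule mult_mat_vec_carrier[OF T hc])
  have cvP: "?cv (?P *\<^sub>v e i) = ?Q *\<^sub>v (?T *\<^sub>v h i)" for i
  proof -
    have "?cv (?P *\<^sub>v e i) = map_mat complex_of_real ?P *\<^sub>v ?cv (e i)"
      by (rule of_real_hom.mult_mat_vec_hom[OF P ec])
    also have "\<dots> = ?Q *\<^sub>v (?T *\<^sub>v h i)"
      unfolding PQ h_def assoc_mult_mat_vec[OF mult_carrier_mat[OF Q T] Qi cve]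
      by (rule assoc_mult_mat_vec[OF Q T mult_mat_vec_carrier[OF Qi cve]])
    finally show ?thesis .
  qed
  have hS: "h (Suc i) = ?T *\<^sub>v h i + ?Qi *\<^sub>v ?cv (f i)" for i
  proof -
    have "?cv (a + b) = ?cv a + ?cv b" if "a \<in> carrier_vec (2 * n)" "b \<in> carrier_vec (2 * n)" for a b
      using that by (intro eq_vecI) auto
    from this[OF mult_mat_vec_carrier[OF P ec] fc]
    have "?cv (?P *\<^sub>v e i + f i) = ?cv (?P *\<^sub>v e i) + ?cv (f i)" .
    hence "h (Suc i) = ?Qi *\<^sub>v (?Q *\<^sub>v (?T *\<^sub>v h i)) + ?Qi *\<^sub>v ?cv (f i)"
      unfolding h_def[of "Suc i"] eS cvP
      using mult_add_distrib_mat_vec[OF Qi mult_mat_vec_carrier[OF Q Th] cvf] cvP by simp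
    also have "?Qi *\<^sub>v (?Q *\<^sub>v (?T *\<^sub>v h i)) = (?Qi * ?Q) *\<^sub>v (?T *\<^sub>v h i)"
      by (rule assoc_mult_mat_vec[symmetric, OF Qi Q Th])
    also have "\<dots> = ?T *\<^sub>v h i" unfolding QiQ by (rule one_mult_mat_vec[OF Th])
    finally show ?thesis .
  qed
  have nf: "vnorm (f i) \<le> \<bar>s\<bar> * (m * (l * vnorm (G (Suc i) - G i)))" for i
  proof -
    have hd: "hat w (G (Suc i)) - hat w (G i) = hat w (G (Suc i) - G i)"
      using hat_diff[OF cc(3) cc(3)] by simp
    have gd: "g (Suc i) - g i = ?Bi *\<^sub>v (?La *\<^sub>v hat w (G (Suc i) - G i))"
      unfolding g_def hd[symmetric]
      using mult_minus_distrib_mat_vec[OF Bi La_hat La_hat] mult_minus_distrib_mat_vec[OF L(1) hatc hatc]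
      by simp
    have "vnorm (hat w (G (Suc i) - G i)) \<le> vnorm (G (Suc i) - G i)"
      using hat_norm_le[of "G (Suc i) - G i" w] cc(3) by (simp add: power2_le_iff_abs_le)
    hence "vnorm (?La *\<^sub>v hat w (G (Suc i) - G i)) \<le> l * vnorm (G (Suc i) - G i)"
      by (rule opnorm_bound[OF L(1) hatc bnd(6)])
    hence "vnorm (g (Suc i) - g i) \<le> m * (l * vnorm (G (Suc i) - G i))"
      unfolding gd by (rule opnorm_bound[OF Bi La_hat bnd(5)])
    moreover have "(vnorm (f i))\<^sup>2 = (\<bar>s\<bar> * vnorm (g (Suc i) - g i))\<^sup>2"
      unfolding f_def by (subst vnorm_append[where n = n and m = n])
        (auto simp: vnorm_smult power_mult_distrib)
    hence "vnorm (f i) = \<bar>s\<bar> * vnorm (g (Suc i) - g i)" by (rule power2_eq_imp_eq) auto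
    ultimately show ?thesis by (simp add: mult_left_mono)
  qed
  have nh: "vnorm (h (Suc i)) \<le> \<rho> * vnorm (h i) + v\<^sub>2 * (\<bar>s\<bar> * (m * (l * vnorm (G (Suc i) - G i))))" for i
  proof -
    have "vnorm (?T *\<^sub>v h i) \<le> \<rho> * vnorm (h i)" by (rule opnorm_bound[OF T hc bnd(3)]) simp
    moreover have "vnorm (?Qi *\<^sub>v ?cv (f i)) \<le> v\<^sub>2 * (\<bar>s\<bar> * (m * (l * vnorm (G (Suc i) - G i))))"
      by (rule opnorm_bound[OF Qi cvf bnd(2)]) (simp add: vnorm_of_real nf)
    ultimately show ?thesis
      unfolding hS using vnorm_triangle[OF Th mult_mat_vec_carrier[OF Qi cvf], of i i] by linarith
  qed
  have hr: "(vnorm (h i))\<^sup>2 \<le> r i" for i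
  proof (induction i)
    case 0
    \<comment> \<open>\<open>hat\<close> annihilates averages, so averaging may be subtracted from
      \<open>amat\<close> at no cost. This produces the quantity measured by
      \<open>zeta0_sq\<close>.\<close>
    have avg0: "vnorm (?La *\<^sub>v hat w (G 0)) \<le> vnorm ((kron (amat nw w) d - kron (avg_mat K) d) *\<^sub>v G 0)"
    proof -
      let ?u = "(kron (amat nw w) d - kron (avg_mat K) d) *\<^sub>v G 0"
      have M: "amat nw w - avg_mat K \<in> carrier_mat K K" by (rule minus_carrier_mat[OF avg_carrier])
      have rs: "(\<Sum>j<K. (amat nw w - avg_mat K) $$ (i, j)) = 0" if "i < K" for i
        using that row_sums(1)[OF that, of w] carrier_matD[OF mats_carrier(1)]
        by (simp add: avg_mat_def sum_subtractf)
      have u: "?u = kron (amat nw w - avg_mat K) (vdim pb w) *\<^sub>v G 0"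
        by (simp add: kron_minus[OF mats_carrier(1) avg_carrier] d_def)
      have uc: "?u \<in> carrier_vec (K * vdim pb w)"
        unfolding u by (rule mult_mat_vec_carrier[OF kron_carrier[OF M] cc(3)])
      have av: "kron (avg_mat K) (vdim pb w) *\<^sub>v G 0 \<in> carrier_vec (K * vdim pb w)"
        by (rule mult_mat_vec_carrier[OF kron_carrier[OF avg_carrier] cc(3)])
      have "hat w (kron (avg_mat K) (vdim pb w) *\<^sub>v G 0) = 0\<^sub>v n"
      proof -
        have "kron (transpose_mat (umat nw)) (vdim pb w) * kron (avg_mat K) (vdim pb w) = 0\<^sub>m n (K * d)"
        proof -
          have "1 \<cdot>\<^sub>m avg_mat K = avg_mat K" by (intro eq_matI) auto
          hence "transpose_mat (umat nw) * avg_mat K = 0\<^sub>m (K - 1) K" using Ut_avg[of 1] by simp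
          moreover have "kron (0\<^sub>m a b) c = 0\<^sub>m (a * c) (b * c)" for a b c
          proof (rule eq_matI)
            fix i j assume "i < dim_row (0\<^sub>m (a * c) (b * c) :: real mat)"
              "j < dim_col (0\<^sub>m (a * c) (b * c) :: real mat)"
            thus "kron (0\<^sub>m a b) c $$ (i, j) = 0\<^sub>m (a * c) (b * c) $$ (i, j)"
              using div_less_of_less_mult[of i a c] div_less_of_less_mult[of j b c] by (simp add: kron_index)
          qed auto
          ultimately show ?thesis
            using kron_mult[OF Ut_carrier avg_carrier, of "vdim pb w"] by (simp add: n_def d_def)
        qed
        hence "hat w (kron (avg_mat K) (vdim pb w) *\<^sub>v G 0) = 0\<^sub>m n (K * d) *\<^sub>v G 0"
          unfolding hat_def
          using assoc_mult_mat_vec[OF kronUt_carrier kron_carrier[OF avg_carrier] cc(3)] by simp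
        thus ?thesis using c(3)[of 0] by (intro eq_vecI) (auto simp: scalar_prod_def)
      qed
      hence "hat w ?u = ?La *\<^sub>v hat w (G 0)"
        unfolding d_def minus_mult_distrib_mat_vec[OF kron_carrier[OF mats_carrier(1)]
            kron_carrier[OF avg_carrier] cc(3)] hat_diff[OF kc(1)[OF cc(3)] av] hat_a[OF cc(3)]
        using La_hat[of "G 0"] by simp
      thus ?thesis using hat_norm_le[OF uc] by (simp add: power2_le_iff_abs_le)
    qed
    have "x 0 = 0\<^sub>v n" "y 0 = 0\<^sub>v n" using zero by (simp_all add: x_def y_def n_def)
    moreover have "?Lb *\<^sub>v 0\<^sub>v n = 0\<^sub>v n"
      using carrier_matD[OF L(2)] by (intro eq_vecI) (auto simp: scalar_prod_def)
    moreover have "0\<^sub>v n - 0\<^sub>v n - s \<cdot>\<^sub>v u = (- s) \<cdot>\<^sub>v u" if "u \<in> carrier_vec n" for u :: "real vec"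
      using that by (intro eq_vecI) auto
    ultimately have e0: "e 0 = 0\<^sub>v n @\<^sub>v (- s) \<cdot>\<^sub>v g 0"
      unfolding e_def z_def by simp
    have "vnorm (g 0) \<le> m * vnorm ((kron (amat nw w) d - kron (avg_mat K) d) *\<^sub>v G 0)"
      unfolding g_def by (rule opnorm_bound[OF Bi La_hat bnd(5) avg0])
    moreover have "(vnorm (e 0))\<^sup>2 = (\<bar>s\<bar> * vnorm (g 0))\<^sup>2"
      unfolding e0 by (subst vnorm_append[where n = n and m = n])
        (auto simp: vnorm_smult power_mult_distrib)
    hence "vnorm (e 0) = \<bar>s\<bar> * vnorm (g 0)" by (rule power2_eq_imp_eq) auto
    ultimately have "vnorm (?cv (e 0)) \<le> \<bar>s\<bar> * (m * vnorm ((kron (amat nw w) d - kron (avg_mat K) d) *\<^sub>v G 0))"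
      by (simp add: vnorm_of_real mult_left_mono)
    hence "vnorm (h 0) \<le> v\<^sub>2 * (\<bar>s\<bar> * (m * vnorm ((kron (amat nw w) d - kron (avg_mat K) d) *\<^sub>v G 0)))"
      unfolding h_def by (rule opnorm_bound[OF Qi cve bnd(2)])
    hence "(vnorm (h 0))\<^sup>2 \<le> (v\<^sub>2 * (\<bar>s\<bar> * (m * vnorm ((kron (amat nw w) d - kron (avg_mat K) d) *\<^sub>v G 0))))\<^sup>2"
      by (rule power_mono) simp
    thus ?case by (simp add: r_def power_mult_distrib mult.assoc)
  next
    case (Suc i)
    have "(vnorm (h (Suc i)))\<^sup>2 \<le> (\<rho> * vnorm (h i) + v\<^sub>2 * (\<bar>s\<bar> * (m * (l * vnorm (G (Suc i) - G i)))))\<^sup>2"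
      by (rule power_mono[OF nh]) simp
    also have "\<dots> \<le> \<rho> * (vnorm (h i))\<^sup>2 + (v\<^sub>2 * (\<bar>s\<bar> * (m * (l * vnorm (G (Suc i) - G i)))))\<^sup>2 / (1 - \<rho>)"
      by (rule convex_sq_le[OF v(3) bnd(4)])
    also have "\<dots> \<le> \<rho> * r i + (v\<^sub>2 * (\<bar>s\<bar> * (m * (l * vnorm (G (Suc i) - G i)))))\<^sup>2 / (1 - \<rho>)"
      using mult_left_mono[OF Suc v(3)] by simp
    also have "\<dots> = r (Suc i)" by (simp add: r_def power_mult_distrib mult.assoc)
    finally show ?case .
  qed
  have x_le: "(vnorm (x i))\<^sup>2 \<le> (vnorm (x i @\<^sub>v u))\<^sup>2" if "u \<in> carrier_vec n" for i u
    using vnorm_append[OF xy(1) that] by simp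
  show "(vnorm (hat w (X i)))\<^sup>2 \<le> v\<^sub>1\<^sup>2 * r i"
  proof -
    have "?cv (e i) = ?Q *\<^sub>v h i"
      unfolding h_def using assoc_mult_mat_vec[OF Q Qi cve, of i] minv_invertible(1)[OF Q invQ] cve[of i]
      by simp
    hence "vnorm (e i) \<le> v\<^sub>1 * vnorm (h i)"
      using opnorm_bound[OF Q hc bnd(1), of i "vnorm (h i)"] by (simp add: vnorm_of_real[symmetric])
    hence "(vnorm (e i))\<^sup>2 \<le> (v\<^sub>1 * vnorm (h i))\<^sup>2" by (rule power_mono) simp
    also have "\<dots> \<le> v\<^sub>1\<^sup>2 * r i" using hr[of i] by (simp add: power_mult_distrib mult_left_mono)
    finally show ?thesis
      using x_le[OF z, of i i] unfolding e_def x_def[symmetric] by linarith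
  qed
  show "(vnorm (hat w (X (Suc i))))\<^sup>2 \<le> v\<^sub>1\<^sup>2 * r i"
  proof -
    \<comment> \<open>The next disagreement is the first component of
      \<open>?P *\<^sub>v e i\<close>, that is, of \<open>?Q\<close> applied to
      \<open>?T *\<^sub>v h i\<close>. Dropping the factor of \<open>?T\<close> suffices, and the
      forcing of step \<open>i\<close> does not appear.\<close>
    have "vnorm (?T *\<^sub>v h i) \<le> 1 * vnorm (h i)"
      by (rule opnorm_bound[OF T hc]) (use bnd in auto)
    hence "vnorm (?P *\<^sub>v e i) \<le> v\<^sub>1 * vnorm (h i)"
      using opnorm_bound[OF Q Th bnd(1), of i "vnorm (h i)"] cvP[of i] by (simp add: vnorm_of_real[symmetric])
    hence "(vnorm (?P *\<^sub>v e i))\<^sup>2 \<le> (v\<^sub>1 * vnorm (h i))\<^sup>2" by (rule power_mono) simp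
    also have "\<dots> \<le> v\<^sub>1\<^sup>2 * r i" using hr[of i] by (simp add: power_mult_distrib mult_left_mono)
    finally show ?thesis
      using x_le[OF z', of "Suc i" i] unfolding Pe x_def[symmetric] by linarith
  qed
qed

end

section \<open>Gradients\<close>

lemma has_gradient_carrier: "has_gradient d f x g \<Longrightarrow> g \<in> carrier_vec d"
  by (simp add: has_gradient_def)

text \<open>The difference of two candidates is tested in its own direction. Uniqueness gives the
  definite description in \<open>gradient\<close> its meaning.\<close>

lemma has_gradient_unique:
  assumes "has_gradient d f x g" "has_gradient d f x g'"
  shows "g = g'"
proof -
  note gc = has_gradient_carrier[OF assms(1)] has_gradient_carrier[OF assms(2)]
  define u where "u = g - g'"
  have u: "u \<in> carrier_vec d" using gc by (simp add: u_def)
  have "vnorm u \<le> 0 + e" if e: "0 < e" for e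
  proof (cases "vnorm u = 0")
    case False
    hence un: "0 < vnorm u" using vnorm_nonneg[of u] by linarith
    obtain d1 where d1: "0 < d1" "\<And>h. h \<in> carrier_vec d \<Longrightarrow> vnorm h < d1 \<Longrightarrow>
        \<bar>f (x + h) - f x - g \<bullet> h\<bar> \<le> e / 2 * vnorm h"
      using assms(1) e unfolding has_gradient_def by (meson half_gt_zero)
    obtain d2 where d2: "0 < d2" "\<And>h. h \<in> carrier_vec d \<Longrightarrow> vnorm h < d2 \<Longrightarrow>
        \<bar>f (x + h) - f x - g' \<bullet> h\<bar> \<le> e / 2 * vnorm h"
      using assms(2) e unfolding has_gradient_def by (meson half_gt_zero)
    define t where "t = min d1 d2 / (2 * vnorm u)"
    have t: "0 < t" using d1 d2 un by (simp add: t_def)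
    have h: "t \<cdot>\<^sub>v u \<in> carrier_vec d" using u by simp
    have tn: "vnorm (t \<cdot>\<^sub>v u) = t * vnorm u" using t by (simp add: vnorm_smult)
    also have "\<dots> = min d1 d2 / 2" using un by (simp add: t_def)
    finally have "vnorm (t \<cdot>\<^sub>v u) < d1" "vnorm (t \<cdot>\<^sub>v u) < d2" using d1(1) d2(1) by linarith+
    hence "\<bar>f (x + t \<cdot>\<^sub>v u) - f x - g \<bullet> (t \<cdot>\<^sub>v u)\<bar> \<le> e / 2 * vnorm (t \<cdot>\<^sub>v u)"
      "\<bar>f (x + t \<cdot>\<^sub>v u) - f x - g' \<bullet> (t \<cdot>\<^sub>v u)\<bar> \<le> e / 2 * vnorm (t \<cdot>\<^sub>v u)"
      using d1(2)[OF h] d2(2)[OF h] by auto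
    hence "g \<bullet> (t \<cdot>\<^sub>v u) - g' \<bullet> (t \<cdot>\<^sub>v u) \<le> e * (t * vnorm u)" unfolding tn by linarith
    moreover have "g \<bullet> (t \<cdot>\<^sub>v u) - g' \<bullet> (t \<cdot>\<^sub>v u) = t * (vnorm u)\<^sup>2"
      using minus_scalar_prod_distrib[OF gc h] u by (simp add: u_def[symmetric] vnorm_sq_scalar_prod)
    ultimately have "(t * vnorm u) * vnorm u \<le> (t * vnorm u) * e"
      by (simp add: power2_eq_square mult.commute mult.left_commute)
    thus ?thesis using t un by simp
  qed (use e in simp)
  hence "vnorm u \<le> 0" by (rule field_le_epsilon)
  hence "(\<Sum>i<dim_vec u. (u $ i)\<^sup>2) = 0" using vnorm_sq_real[of u] vnorm_nonneg[of u] by simp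
  hence "u $ i = 0" if "i < d" for i using that u by (simp add: sum_nonneg_eq_0_iff)
  thus ?thesis using gc by (intro eq_vecI) (auto simp: u_def)
qed

lemma gradient_eq: "has_gradient d f x g \<Longrightarrow> gradient d f x = g"
  unfolding gradient_def by (rule the_equality) (auto intro: has_gradient_unique)

lemma has_gradient_derivative:
  assumes g: "has_gradient d f (x + t \<cdot>\<^sub>v h) g" and x: "x \<in> carrier_vec d" and h: "h \<in> carrier_vec d"
  shows "((\<lambda>s. f (x + s \<cdot>\<^sub>v h)) has_real_derivative g \<bullet> h) (at t)"
  unfolding DERIV_def
proof (rule LIM_I)
  fix e :: real assume e: "0 < e"
  \<comment> \<open>The added one keeps the quotient meaningful for a zero direction.\<close>
  define e' where "e' = e / (2 * (vnorm h + 1))"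
  have n: "0 < vnorm h + 1" using vnorm_nonneg[of h] by linarith
  have e': "0 < e'" using e n by (simp add: e'_def)
  then obtain \<delta> where \<delta>: "0 < \<delta>" "\<And>k. k \<in> carrier_vec d \<Longrightarrow> vnorm k < \<delta> \<Longrightarrow>
      \<bar>f (x + t \<cdot>\<^sub>v h + k) - f (x + t \<cdot>\<^sub>v h) - g \<bullet> k\<bar> \<le> e' * vnorm k"
    using g unfolding has_gradient_def by blast
  show "\<exists>s>0. \<forall>xa. xa \<noteq> 0 \<and> norm (xa - 0) < s \<longrightarrow>
      norm ((f (x + (t + xa) \<cdot>\<^sub>v h) - f (x + t \<cdot>\<^sub>v h)) / xa - g \<bullet> h) < e"
  proof (intro exI[of _ "\<delta> / (vnorm h + 1)"] conjI allI impI)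
    fix s :: real assume s: "s \<noteq> 0 \<and> norm (s - 0) < \<delta> / (vnorm h + 1)"
    have sh: "s \<cdot>\<^sub>v h \<in> carrier_vec d" using h by simp
    have "vnorm (s \<cdot>\<^sub>v h) = \<bar>s\<bar> * vnorm h" by (simp add: vnorm_smult)
    also have "\<dots> \<le> \<bar>s\<bar> * (vnorm h + 1)" by (simp add: mult_left_mono)
    also have "\<dots> < \<delta>" using s n by (simp add: field_simps)
    finally have "\<bar>f (x + t \<cdot>\<^sub>v h + s \<cdot>\<^sub>v h) - f (x + t \<cdot>\<^sub>v h) - g \<bullet> (s \<cdot>\<^sub>v h)\<bar> \<le> e' * vnorm (s \<cdot>\<^sub>v h)"
      using \<delta>(2)[OF sh] by blast
    moreover have "x + t \<cdot>\<^sub>v h + s \<cdot>\<^sub>v h = x + (t + s) \<cdot>\<^sub>v h"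
      using x h by (intro eq_vecI) (auto simp: algebra_simps)
    moreover have "g \<bullet> (s \<cdot>\<^sub>v h) = s * (g \<bullet> h)" using h has_gradient_carrier[OF g] by simp
    ultimately have b: "\<bar>f (x + (t + s) \<cdot>\<^sub>v h) - f (x + t \<cdot>\<^sub>v h) - s * (g \<bullet> h)\<bar> \<le> e' * (\<bar>s\<bar> * vnorm h)"
      by (simp add: vnorm_smult)
    have "\<bar>(f (x + (t + s) \<cdot>\<^sub>v h) - f (x + t \<cdot>\<^sub>v h)) / s - g \<bullet> h\<bar>
        = \<bar>f (x + (t + s) \<cdot>\<^sub>v h) - f (x + t \<cdot>\<^sub>v h) - s * (g \<bullet> h)\<bar> / \<bar>s\<bar>"
      using s by (simp add: abs_divide[symmetric] diff_divide_distrib)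
    also have "\<dots> \<le> e' * vnorm h" using b s by (simp add: divide_le_eq ac_simps)
    also have "\<dots> \<le> e / 2" using n e by (simp add: e'_def field_simps)
    finally show "norm ((f (x + (t + s) \<cdot>\<^sub>v h) - f (x + t \<cdot>\<^sub>v h)) / s - g \<bullet> h) < e" using e by simp
  qed (use \<delta> n in simp)
qed

section \<open>Gradients of sums and averages, and partial gradients\<close>

lemma has_gradient_add:
  fixes x :: "real vec"
  assumes "has_gradient d f x a" "has_gradient d g x b"
  shows "has_gradient d (\<lambda>u. f u + g u) x (a + b)"
  unfolding has_gradient_def
proof (intro conjI allI impI)
  note c = has_gradient_carrier[OF assms(1)] has_gradient_carrier[OF assms(2)]
  show "a + b \<in> carrier_vec d" using c by simp
  fix e :: real assume e: "0 < e"
  obtain d1 where d1: "0 < d1" "\<And>h. h \<in> carrier_vec d \<Longrightarrow> vnorm h < d1 \<Longrightarrow>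
      \<bar>f (x + h) - f x - a \<bullet> h\<bar> \<le> e / 2 * vnorm h"
    using assms(1) e unfolding has_gradient_def by (meson half_gt_zero)
  obtain d2 where d2: "0 < d2" "\<And>h. h \<in> carrier_vec d \<Longrightarrow> vnorm h < d2 \<Longrightarrow>
      \<bar>g (x + h) - g x - b \<bullet> h\<bar> \<le> e / 2 * vnorm h"
    using assms(2) e unfolding has_gradient_def by (meson half_gt_zero)
  show "\<exists>\<delta>>0. \<forall>h\<in>carrier_vec d. vnorm h < \<delta> \<longrightarrow>
      \<bar>f (x + h) + g (x + h) - (f x + g x) - (a + b) \<bullet> h\<bar> \<le> e * vnorm h"
  proof (intro exI[of _ "min d1 d2"] conjI ballI impI)
    fix h :: "real vec" assume h: "h \<in> carrier_vec d" "vnorm h < min d1 d2"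
    show "\<bar>f (x + h) + g (x + h) - (f x + g x) - (a + b) \<bullet> h\<bar> \<le> e * vnorm h"
    proof -
      have "vnorm h < d1" "vnorm h < d2" "e / 2 * vnorm h + e / 2 * vnorm h = e * vnorm h"
        using h by auto
      thus ?thesis
        using d1(2)[OF h(1)] d2(2)[OF h(1)] add_scalar_prod_distrib[OF c h(1)] by linarith
    qed
  qed (use d1 d2 in simp)
qed

lemma has_gradient_scale:
  assumes "has_gradient d f x a"
  shows "has_gradient d (\<lambda>u. f u / c) x ((1 / c) \<cdot>\<^sub>v a)"
  unfolding has_gradient_def
proof (intro conjI allI impI)
  note ca = has_gradient_carrier[OF assms]
  show "(1 / c) \<cdot>\<^sub>v a \<in> carrier_vec d" using ca by simp
  fix e :: real assume e: "0 < e"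
  define e' where "e' = e / (\<bar>1 / c\<bar> + 1)"
  have "0 < e'" unfolding e'_def using e by (intro divide_pos_pos add_nonneg_pos) auto
  then obtain d1 where d1: "0 < d1" "\<And>h. h \<in> carrier_vec d \<Longrightarrow> vnorm h < d1 \<Longrightarrow>
      \<bar>f (x + h) - f x - a \<bullet> h\<bar> \<le> e' * vnorm h"
    using assms unfolding has_gradient_def by blast
  show "\<exists>\<delta>>0. \<forall>h\<in>carrier_vec d. vnorm h < \<delta> \<longrightarrow>
      \<bar>f (x + h) / c - f x / c - ((1 / c) \<cdot>\<^sub>v a) \<bullet> h\<bar> \<le> e * vnorm h"
  proof (intro exI[of _ d1] conjI ballI impI)
    fix h :: "real vec" assume h: "h \<in> carrier_vec d" "vnorm h < d1"
    have "((1 / c) \<cdot>\<^sub>v a) \<bullet> h = (1 / c) * (a \<bullet> h)" using ca h by simp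
    hence "\<bar>f (x + h) / c - f x / c - ((1 / c) \<cdot>\<^sub>v a) \<bullet> h\<bar> = \<bar>1 / c\<bar> * \<bar>f (x + h) - f x - a \<bullet> h\<bar>"
      by (simp add: abs_mult[symmetric] algebra_simps diff_divide_distrib del: abs_divide)
    also have "\<dots> \<le> \<bar>1 / c\<bar> * (e' * vnorm h)" by (rule mult_left_mono[OF d1(2)[OF h]]) simp
    also have "\<dots> \<le> (\<bar>1 / c\<bar> + 1) * (e' * vnorm h)"
      using \<open>0 < e'\<close> by (intro mult_right_mono) auto
    also have "\<dots> = e * vnorm h"
    proof -
      have "\<bar>1 / c\<bar> + 1 \<noteq> 0" using abs_ge_zero[of "1 / c"] by linarith
      thus ?thesis by (simp add: e'_def)
    qed
    finally show "\<bar>f (x + h) / c - f x / c - ((1 / c) \<cdot>\<^sub>v a) \<bullet> h\<bar> \<le> e * vnorm h" .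
  qed (rule d1(1))
qed

lemma has_gradient_sum:
  fixes n :: nat
  assumes "\<And>k. k < n \<Longrightarrow> has_gradient d (f k) x (g k)"
  shows "has_gradient d (\<lambda>u. \<Sum>k<n. f k u) x (vec d (\<lambda>j. \<Sum>k<n. g k $ j))"
  using assms
proof (induction n arbitrary: f g)
  case 0
  have "vec d (\<lambda>j. 0) \<bullet> h = 0" if "h \<in> carrier_vec d" for h :: "real vec"
    using that by (simp add: scalar_prod_def)
  thus ?case by (auto simp: has_gradient_def intro!: exI[of _ 1])
next
  case (Suc n)
  have "vec d (\<lambda>j. \<Sum>k<Suc n. g k $ j) = vec d (\<lambda>j. \<Sum>k<n. g k $ j) + g n"
    using has_gradient_carrier[OF Suc.prems[of n]] by (intro eq_vecI) auto
  thus ?case using has_gradient_add[OF Suc.IH Suc.prems[of n]] Suc.prems by simp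
qed

lemma has_gradient_average:
  fixes n :: nat
  assumes "\<And>k. k < n \<Longrightarrow> has_gradient d (f k) x (g k)"
  shows "has_gradient d (\<lambda>u. (\<Sum>k<n. f k u) / real n) x (vmean d n g)"
proof -
  have "vmean d n g = (1 / real n) \<cdot>\<^sub>v vec d (\<lambda>j. \<Sum>k<n. g k $ j)"
    by (intro eq_vecI) (auto simp: vmean_def)
  thus ?thesis using has_gradient_scale[OF has_gradient_sum[of n d f x g]] assms by simp
qed

text \<open>\<open>sel\<close> picks the variable \<open>w\<close>; \<open>repx\<close> and
  \<open>repy\<close> put \<open>u\<close> in its place and keep the other variable. With them each
  fact about partial gradients is proved once for both variables.\<close>

definition sel :: "var \<Rightarrow> 'a \<Rightarrow> 'a \<Rightarrow> 'a" where
  "sel w x y = (case w of Vx \<Rightarrow> x | Vy \<Rightarrow> y)"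

definition repx :: "var \<Rightarrow> 'a \<Rightarrow> 'a \<Rightarrow> 'a" where
  "repx w u x = (case w of Vx \<Rightarrow> u | Vy \<Rightarrow> x)"

definition repy :: "var \<Rightarrow> 'a \<Rightarrow> 'a \<Rightarrow> 'a" where
  "repy w u y = (case w of Vx \<Rightarrow> y | Vy \<Rightarrow> u)"

lemmas var_defs = sel_def repx_def repy_def vdim_def

lemma pgrad_eq_gradient:
  "pgrad pb w f x y = gradient (vdim pb w) (\<lambda>u. f (repx w u x) (repy w u y)) (sel w x y)"
  by (cases w) (simp_all add: pgrad_def var_defs)

lemma has_pgrad_iff:
  "has_pgrad pb w f x y \<longleftrightarrow>
    (\<exists>g. has_gradient (vdim pb w) (\<lambda>u. f (repx w u x) (repy w u y)) (sel w x y) g)"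
  by (cases w) (simp_all add: has_pgrad_def var_defs)

lemma has_pgradD:
  "has_pgrad pb w f x y \<Longrightarrow>
    has_gradient (vdim pb w) (\<lambda>u. f (repx w u x) (repy w u y)) (sel w x y) (pgrad pb w f x y)"
  unfolding has_pgrad_iff pgrad_eq_gradient by (metis gradient_eq)

lemma pgradI:
  "has_gradient (vdim pb w) (\<lambda>u. f (repx w u x) (repy w u y)) (sel w x y) g \<Longrightarrow> pgrad pb w f x y = g"
  unfolding pgrad_eq_gradient by (rule gradient_eq)

lemma sel_carrier:
  "x \<in> carrier_vec (xdim pb) \<Longrightarrow> y \<in> carrier_vec (ydim pb) \<Longrightarrow> sel w x y \<in> carrier_vec (vdim pb w)"
  by (cases w) (simp_all add: var_defs)

lemma rep_carrier:
  "u \<in> carrier_vec (vdim pb w) \<Longrightarrow> x \<in> carrier_vec (xdim pb) \<Longrightarrow> repx w u x \<in> carrier_vec (xdim pb)"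
  "u \<in> carrier_vec (vdim pb w) \<Longrightarrow> y \<in> carrier_vec (ydim pb) \<Longrightarrow> repy w u y \<in> carrier_vec (ydim pb)"
  by (cases w; simp add: var_defs)+

lemma rep_rep [simp]:
  "repx w u (repx w v x) = repx w u x" "repy w u (repy w v y) = repy w u y"
  "sel w (repx w u x) (repy w u y) = u" "repx w (sel w x y) x = x" "repy w (sel w x y) y = y"
  by (cases w; simp add: var_defs)+

lemma rep_dist:
  assumes "u \<in> carrier_vec (vdim pb w)" "v \<in> carrier_vec (vdim pb w)"
    "x \<in> carrier_vec (xdim pb)" "y \<in> carrier_vec (ydim pb)"
  shows "(vnorm (repx w u x - repx w v x))\<^sup>2 + (vnorm (repy w u y - repy w v y))\<^sup>2
    = (vnorm (u - v :: real vec))\<^sup>2"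
  using assms by (cases w) (simp_all add: var_defs)

text \<open>The derivative of a differentiable function is Henstock--Kurzweil integrable; if it is
  not absolutely integrable, the right-hand side is infinite.\<close>

lemma ftc_abs_le:
  fixes \<phi> :: "real \<Rightarrow> real"
  assumes d: "\<And>t. (\<phi> has_real_derivative \<phi>' t) (at t)" and m: "\<phi>' \<in> borel_measurable borel"
    and s: "0 \<le> s"
  shows "ennreal \<bar>\<phi> s - \<phi> 0\<bar> \<le> (\<integral>\<^sup>+t. ennreal \<bar>\<phi>' t\<bar> * indicator {0..s} t \<partial>lborel)"
proof (cases "(\<integral>\<^sup>+t. ennreal \<bar>\<phi>' t\<bar> * indicator {0..s} t \<partial>lborel) < \<infinity>")
  case True
  have eq: "ennreal \<bar>\<phi>' t\<bar> * indicator {0..s} t = ennreal (norm (indicator {0..s} t *\<^sub>R \<phi>' t))" for t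
    by (auto simp: indicator_def)
  have si: "set_integrable lborel {0..s} \<phi>'"
    unfolding set_integrable_def using m True eq by (intro integrableI_bounded) auto
  have "(\<phi>' has_integral (LINT t:{0..s}|lborel. \<phi>' t)) {0..s}"
    using set_borel_integral_eq_integral[OF si] by (simp add: integrable_integral)
  moreover have "(\<phi>' has_integral (\<phi> s - \<phi> 0)) {0..s}"
    by (rule fundamental_theorem_of_calculus[OF s])
      (auto intro: has_field_derivative_at_within[OF d] simp flip: has_real_derivative_iff_has_vector_derivative)
  ultimately have "\<phi> s - \<phi> 0 = (LINT t:{0..s}|lborel. \<phi>' t)" by (rule has_integral_unique[rotated])
  hence "ennreal \<bar>\<phi> s - \<phi> 0\<bar> \<le> (\<integral>\<^sup>+t. ennreal (norm (indicator {0..s} t *\<^sub>R \<phi>' t)) \<partial>lborel)"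
    unfolding set_lebesgue_integral_def
    using integral_norm_bound_ennreal[OF si[unfolded set_integrable_def]] by simp
  thus ?thesis by (simp add: eq)
next
  case False
  hence "(\<integral>\<^sup>+t. ennreal \<bar>\<phi>' t\<bar> * indicator {0..s} t \<partial>lborel) = \<infinity>"
    unfolding infinity_ennreal_def less_top[symmetric] by blast
  thus ?thesis by simp
qed

text \<open>Differentiation under the integral sign: the first-order Taylor remainder along \<open>h\<close> is
  integrated over the path first and over the sample second.\<close>

lemma gradient_of_expectation:
  fixes Q :: "real vec \<Rightarrow> 'z \<Rightarrow> real"
  assumes N: "prob_space N" and x: "x \<in> carrier_vec d" and h: "h \<in> carrier_vec d"
    and grad: "\<And>u z. u \<in> carrier_vec d \<Longrightarrow> z \<in> space N \<Longrightarrow> has_gradient d (\<lambda>u. Q u z) u (G u z)"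
    and int: "\<And>u. u \<in> carrier_vec d \<Longrightarrow> integrable N (Q u)"
    and F: "has_gradient d (\<lambda>u. \<integral>z. Q u z \<partial>N) x g"
    and meas: "\<And>j. j < d \<Longrightarrow> (\<lambda>(t, z). G (x + t \<cdot>\<^sub>v h) z $ j) \<in> borel_measurable (borel \<Otimes>\<^sub>M N)"
    and lip: "\<And>u v. u \<in> carrier_vec d \<Longrightarrow> v \<in> carrier_vec d \<Longrightarrow>
      (\<integral>\<^sup>+z. ennreal ((vnorm (G u z - G v z))\<^sup>2) \<partial>N) \<le> ennreal (L\<^sup>2 * (vnorm (u - v))\<^sup>2)"
    and G0: "\<And>j. j < d \<Longrightarrow> integrable N (\<lambda>z. G x z $ j)"
  shows "g \<bullet> h = (\<integral>z. G x z \<bullet> h \<partial>N)"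
proof -
  interpret prob_space N by (rule N)
  \<comment> \<open>Strictly positive majorants of the Lipschitz constant and of the length of
    \<open>h\<close>: both are divided by below, and the originals may vanish.\<close>
  define L' where "L' = \<bar>L\<bar> + 1"
  define n where "n = vnorm h + 1"
  have L': "0 < L'" "L\<^sup>2 \<le> L'\<^sup>2" and n: "0 < n" "vnorm h \<le> n"
    using vnorm_nonneg[of h] by (auto simp: L'_def n_def power2_eq_square algebra_simps abs_mult[symmetric] intro: add_pos_nonneg add_nonneg_pos)
  have Gc: "G u z \<in> carrier_vec d" if "u \<in> carrier_vec d" "z \<in> space N" for u z
    using grad[OF that] by (rule has_gradient_carrier)
  have xt: "x + t \<cdot>\<^sub>v h \<in> carrier_vec d" for t using x h by simp
  have sp: "G u z \<bullet> h = (\<Sum>j<d. G u z $ j * h $ j)" for u z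
    using h by (simp add: scalar_prod_def lessThan_atLeast0)
  have Gh: "integrable N (\<lambda>z. G x z \<bullet> h)"
    unfolding sp using G0 by (intro Bochner_Integration.integrable_sum integrable_mult_left) auto
  define m where "m = (\<integral>z. G x z \<bullet> h \<partial>N)"
  \<comment> \<open>Along \<open>h\<close>, the expectation is affine with slope \<open>m\<close> up
    to a quadratic remainder. Since \<open>g\<close> is its gradient, the slope must be the pairing
    of \<open>g\<close> with \<open>h\<close>.\<close>
  have rem: "\<bar>(\<integral>z. Q (x + s \<cdot>\<^sub>v h) z \<partial>N) - (\<integral>z. Q x z \<partial>N) - s * m\<bar> \<le> L' * s\<^sup>2 * n\<^sup>2"
    if s: "0 < s" for s
  proof -
    define D where "D t z = G (x + t \<cdot>\<^sub>v h) z \<bullet> h - G x z \<bullet> h" for t z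
    define R where "R z = Q (x + s \<cdot>\<^sub>v h) z - Q x z - s * (G x z \<bullet> h)" for z
    have x0: "x + 0 \<cdot>\<^sub>v h = x" using x h by (intro eq_vecI) auto
    have Dm: "(\<lambda>(t, z). D t z) \<in> borel_measurable (borel \<Otimes>\<^sub>M N)"
    proof -
      have a: "(\<lambda>(t, z). G (x + t \<cdot>\<^sub>v h) z \<bullet> h) \<in> borel_measurable (borel \<Otimes>\<^sub>M N)"
        unfolding sp case_prod_beta using meas[unfolded case_prod_beta]
        by (intro borel_measurable_sum borel_measurable_times) auto
      have b: "(\<lambda>p. G x (snd p) \<bullet> h) \<in> borel_measurable (borel \<Otimes>\<^sub>M N)"
        by (rule measurable_compose[OF measurable_snd borel_measurable_integrable[OF Gh]])
      show ?thesis unfolding D_def using borel_measurable_diff[OF a b] by (simp add: case_prod_beta)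
    qed
    have Dsec: "(\<lambda>t. D t z) \<in> borel_measurable borel" if "z \<in> space N" for z
      using measurable_compose[OF measurable_Pair2'[OF that, of borel] Dm] by simp
    have R: "ennreal \<bar>R z\<bar> \<le> (\<integral>\<^sup>+t. ennreal \<bar>D t z\<bar> * indicator {0..s} t \<partial>lborel)" if z: "z \<in> space N" for z
    proof -
      have "((\<lambda>t. Q (x + t \<cdot>\<^sub>v h) z - t * (G x z \<bullet> h)) has_real_derivative D t z) (at t)" for t
        unfolding D_def
        using has_gradient_derivative[OF grad[OF xt z] x h] by (auto intro!: derivative_eq_intros)
      from ftc_abs_le[OF this Dsec[OF z], of s] s show ?thesis by (simp add: R_def x0 algebra_simps)
    qed
    \<comment> \<open>The square of \<open>c\<close> bounds the second moment of the change of the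
      gradient. As the weight in Young's inequality it makes both halves of the first moment equal
      to \<open>n * c / 2\<close>.\<close>
    define c where "c = L' * s * n"
    have c: "0 < c" using L' n s by (simp add: c_def)
    have inner: "(\<integral>\<^sup>+z. ennreal \<bar>D t z\<bar> \<partial>N) \<le> ennreal (n * c)" if t: "t \<in> {0..s}" for t
    proof -
      define q where "q z = (vnorm (G (x + t \<cdot>\<^sub>v h) z - G x z))\<^sup>2" for z
      have qm: "q \<in> borel_measurable N"
      proof -
        have "(\<lambda>z. \<Sum>j<d. (G (x + t \<cdot>\<^sub>v h) z $ j - G x z $ j)\<^sup>2) \<in> borel_measurable N"
        proof (intro borel_measurable_sum borel_measurable_power borel_measurable_diff)
          fix j assume "j \<in> {..<d}"
          hence j: "j < d" by simp
          show "(\<lambda>z. G (x + t \<cdot>\<^sub>v h) z $ j) \<in> borel_measurable N"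
            using measurable_compose[OF measurable_Pair1'[of t borel N] meas[OF j]] by simp
          show "(\<lambda>z. G x z $ j) \<in> borel_measurable N" using G0[OF j] by simp
        qed
        moreover have "q z = (\<Sum>j<d. (G (x + t \<cdot>\<^sub>v h) z $ j - G x z $ j)\<^sup>2)" if "z \<in> space N" for z
          using Gc[OF x that] Gc[OF xt that, of t] by (simp add: q_def vnorm_sq_real)
        ultimately show ?thesis by (simp cong: measurable_cong)
      qed
      have "\<bar>D t z\<bar> \<le> n * (1 / (2 * c) * q z + c / 2)" if z: "z \<in> space N" for z
      proof -
        have "D t z = (G (x + t \<cdot>\<^sub>v h) z - G x z) \<bullet> h"
          unfolding D_def using minus_scalar_prod_distrib[OF Gc[OF xt z] Gc[OF x z] h] by simp
        hence "\<bar>D t z\<bar> \<le> vnorm (G (x + t \<cdot>\<^sub>v h) z - G x z) * vnorm h"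
          using scalar_prod_le_vnorm[OF _ h, of "G (x + t \<cdot>\<^sub>v h) z - G x z"] Gc[OF xt z] Gc[OF x z] by simp
        also have "\<dots> \<le> vnorm (G (x + t \<cdot>\<^sub>v h) z - G x z) * n" using n by (intro mult_left_mono) auto
        also have "vnorm (G (x + t \<cdot>\<^sub>v h) z - G x z) \<le> 1 / (2 * c) * q z + c / 2"
        proof -
          define a where "a = vnorm (G (x + t \<cdot>\<^sub>v h) z - G x z)"
          have "0 \<le> (a - c)\<^sup>2" by simp
          hence "2 * c * a \<le> a\<^sup>2 + c\<^sup>2" by (simp add: power2_eq_square algebra_simps)
          thus ?thesis using c by (simp add: q_def a_def[symmetric] field_simps power2_eq_square)
        qed
        finally show ?thesis using n by (simp add: mult.commute mult_left_mono)
      qed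
      hence "(\<integral>\<^sup>+z. ennreal \<bar>D t z\<bar> \<partial>N) \<le> (\<integral>\<^sup>+z. ennreal (n * (1 / (2 * c) * q z + c / 2)) \<partial>N)"
        by (intro nn_integral_mono) (auto intro: ennreal_leI)
      also have "\<dots> = (\<integral>\<^sup>+z. ennreal (n / (2 * c)) * ennreal (q z) + ennreal (n * c / 2) \<partial>N)"
        using n c by (intro nn_integral_cong)
          (simp add: ennreal_mult'[symmetric] ennreal_plus[symmetric] q_def algebra_simps del: ennreal_plus)
      also have "\<dots> = ennreal (n / (2 * c)) * (\<integral>\<^sup>+z. ennreal (q z) \<partial>N) + ennreal (n * c / 2)"
        using qm by (subst nn_integral_add) (auto simp: nn_integral_cmult emeasure_space_1)
      also have "\<dots> \<le> ennreal (n / (2 * c)) * ennreal (c\<^sup>2) + ennreal (n * c / 2)"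
      proof (intro add_right_mono mult_left_mono)
        have "x + t \<cdot>\<^sub>v h - x = t \<cdot>\<^sub>v h" using x h by (intro eq_vecI) auto
        hence "(\<integral>\<^sup>+z. ennreal (q z) \<partial>N) \<le> ennreal (L\<^sup>2 * (t * vnorm h)\<^sup>2)"
          using lip[OF xt x, of t] t by (simp add: q_def vnorm_smult)
        also have "L\<^sup>2 * (t * vnorm h)\<^sup>2 \<le> L'\<^sup>2 * (s * n)\<^sup>2"
          using L' n t by (intro mult_mono[OF L'(2) power_mono[OF mult_mono]]) auto
        finally show "(\<integral>\<^sup>+z. ennreal (q z) \<partial>N) \<le> ennreal (c\<^sup>2)"
          by (simp add: c_def power_mult_distrib mult.assoc ennreal_leI)
      qed simp
      also have "\<dots> = ennreal (n * c)"
        using n c by (simp add: ennreal_mult'[symmetric] ennreal_plus[symmetric] power2_eq_square field_simps del: ennreal_plus)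
      finally show ?thesis .
    qed
    have Rint: "integrable N R"
      unfolding R_def using int[OF xt[of s]] int[OF x] Gh by (intro Bochner_Integration.integrable_diff integrable_mult_right) auto
    have lm: "(\<lambda>(z, t). ennreal \<bar>D t z\<bar> * indicator {0..s} t) \<in> borel_measurable (N \<Otimes>\<^sub>M lborel)"
    proof -
      have "(\<lambda>p. D (snd p) (fst p)) \<in> borel_measurable (N \<Otimes>\<^sub>M borel)"
        using measurable_compose[OF measurable_pair_swap' Dm] by (simp add: case_prod_beta)
      hence "(\<lambda>p. ennreal \<bar>D (snd p) (fst p)\<bar> * indicator {0..s} (snd p)) \<in> borel_measurable (N \<Otimes>\<^sub>M borel)"
        by measurable
      thus ?thesis by (simp add: case_prod_beta cong: measurable_cong_sets sets_pair_measure_cong)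
    qed
    have "ennreal \<bar>\<integral>z. R z \<partial>N\<bar> \<le> (\<integral>\<^sup>+z. ennreal \<bar>R z\<bar> \<partial>N)"
      using integral_norm_bound_ennreal[OF Rint] by simp
    also have "\<dots> \<le> (\<integral>\<^sup>+z. \<integral>\<^sup>+t. ennreal \<bar>D t z\<bar> * indicator {0..s} t \<partial>lborel \<partial>N)"
      by (intro nn_integral_mono R)
    also have "\<dots> = (\<integral>\<^sup>+t. \<integral>\<^sup>+z. ennreal \<bar>D t z\<bar> * indicator {0..s} t \<partial>N \<partial>lborel)"
    proof -
      interpret P: pair_sigma_finite N lborel ..
      show ?thesis using P.Fubini'[OF lm] by simp
    qed
    also have "\<dots> \<le> (\<integral>\<^sup>+t. ennreal (n * c) * indicator {0..s} t \<partial>lborel)"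
    proof (intro nn_integral_mono)
      fix t show "(\<integral>\<^sup>+z. ennreal \<bar>D t z\<bar> * indicator {0..s} t \<partial>N) \<le> ennreal (n * c) * indicator {0..s} t"
        using inner[of t] by (cases "t \<in> {0..s}") auto
    qed
    also have "\<dots> = ennreal (n * c) * ennreal s" using s by (simp add: nn_integral_cmult_indicator)
    also have "\<dots> = ennreal (L' * s\<^sup>2 * n\<^sup>2)"
      using n c s by (simp add: ennreal_mult'[symmetric] c_def power2_eq_square ac_simps)
    finally have "\<bar>\<integral>z. R z \<partial>N\<bar> \<le> L' * s\<^sup>2 * n\<^sup>2" using L' by (subst (asm) ennreal_le_iff) auto
    moreover have "(\<integral>z. R z \<partial>N) = (\<integral>z. Q (x + s \<cdot>\<^sub>v h) z \<partial>N) - (\<integral>z. Q x z \<partial>N) - s * m"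
      unfolding R_def m_def using int[OF xt[of s]] int[OF x] Gh by simp
    ultimately show ?thesis by simp
  qed
  have "\<bar>g \<bullet> h - m\<bar> \<le> 0 + e" if e: "0 < e" for e
  proof -
    define e' where "e' = e / (2 * n)"
    have "0 < e'" using e n by (simp add: e'_def)
    then obtain \<delta> where \<delta>: "0 < \<delta>" "\<And>k. k \<in> carrier_vec d \<Longrightarrow> vnorm k < \<delta> \<Longrightarrow>
        \<bar>(\<integral>z. Q (x + k) z \<partial>N) - (\<integral>z. Q x z \<partial>N) - g \<bullet> k\<bar> \<le> e' * vnorm k"
      using F unfolding has_gradient_def by blast
    \<comment> \<open>Small enough that the error in the definition of the gradient and the
      quadratic remainder are each at most \<open>s * e / 2\<close>; dividing by \<open>s\<close>
      leaves \<open>e\<close>.\<close>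
    define s where "s = min (\<delta> / (2 * n)) (e / (2 * (L' * n\<^sup>2)))"
    have s: "0 < s" using \<delta> n e L' by (simp add: s_def)
    have sh: "s \<cdot>\<^sub>v h \<in> carrier_vec d" using h by simp
    have "vnorm (s \<cdot>\<^sub>v h) = s * vnorm h" using s by (simp add: vnorm_smult)
    also have sn: "\<dots> \<le> s * n" using s n by (intro mult_left_mono) auto
    also have "\<dots> \<le> \<delta> / (2 * n) * n" using n by (intro mult_right_mono) (auto simp: s_def)
    also have "\<dots> < \<delta>" using n \<delta> by simp
    finally have "\<bar>(\<integral>z. Q (x + s \<cdot>\<^sub>v h) z \<partial>N) - (\<integral>z. Q x z \<partial>N) - g \<bullet> (s \<cdot>\<^sub>v h)\<bar> \<le> e' * vnorm (s \<cdot>\<^sub>v h)"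
      by (rule \<delta>(2)[OF sh])
    also have "\<dots> \<le> e' * (s * n)" using sn \<open>0 < e'\<close> s by (simp add: vnorm_smult)
    also have "\<dots> = s * (e / 2)" using n by (simp add: e'_def)
    finally have 1: "\<bar>(\<integral>z. Q (x + s \<cdot>\<^sub>v h) z \<partial>N) - (\<integral>z. Q x z \<partial>N) - s * (g \<bullet> h)\<bar> \<le> s * (e / 2)"
      using h has_gradient_carrier[OF F] by simp
    have "L' * n\<^sup>2 * s \<le> L' * n\<^sup>2 * (e / (2 * (L' * n\<^sup>2)))"
      using L' n by (intro mult_left_mono) (auto simp: s_def)
    also have "\<dots> = e / 2" using L' n by simp
    finally have "s * (L' * n\<^sup>2 * s) \<le> s * (e / 2)" using s by (intro mult_left_mono) auto
    hence 2: "L' * s\<^sup>2 * n\<^sup>2 \<le> s * (e / 2)" by (simp add: power2_eq_square ac_simps)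
    have "\<bar>s * (g \<bullet> h) - s * m\<bar> \<le> s * e" 
    proof -
      have "s * (e / 2) + s * (e / 2) = s * e" by simp
      thus ?thesis using 1 2 rem[OF s] by linarith
    qed
    hence "s * \<bar>g \<bullet> h - m\<bar> \<le> s * e" using s by (simp add: abs_mult flip: right_diff_distrib)
    thus ?thesis using s by simp
  qed
  hence "\<bar>g \<bullet> h - m\<bar> \<le> 0" by (rule field_le_epsilon)
  thus ?thesis by (simp add: m_def)
qed

section \<open>Smoothness of the objective\<close>

lemma sum_square_le:
  fixes a :: "nat \<Rightarrow> real" shows "(\<Sum>k<n. a k)\<^sup>2 \<le> real n * (\<Sum>k<n. (a k)\<^sup>2)"
  using Cauchy_Schwarz_ineq_sum[of "\<lambda>_. 1" a "{..<n}"] by simp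

lemma vmean_diff_sq_le:
  assumes "\<And>k. k < n \<Longrightarrow> f k \<in> carrier_vec d" "\<And>k. k < n \<Longrightarrow> g k \<in> carrier_vec d"
  shows "(vnorm (vmean d n f - vmean d n g))\<^sup>2 \<le> (\<Sum>k<n. (vnorm (f k - g k))\<^sup>2) / real n"
proof (cases "n = 0")
  case False
  have "(vnorm (vmean d n f - vmean d n g))\<^sup>2 = (\<Sum>j<d. ((\<Sum>k<n. f k $ j - g k $ j) / real n)\<^sup>2)"
    by (simp add: vnorm_sq_real vmean_def sum_subtractf diff_divide_distrib)
  also have "\<dots> \<le> (\<Sum>j<d. (\<Sum>k<n. (f k $ j - g k $ j)\<^sup>2) / real n)"
  proof (rule sum_mono)
    fix j
    show "((\<Sum>k<n. f k $ j - g k $ j) / real n)\<^sup>2 \<le> (\<Sum>k<n. (f k $ j - g k $ j)\<^sup>2) / real n"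
      using sum_square_le[of "\<lambda>k. f k $ j - g k $ j" n] False
      by (simp add: power_divide power2_eq_square divide_simps mult.commute)
  qed
  also have "\<dots> = (\<Sum>k<n. \<Sum>j<d. (f k $ j - g k $ j)\<^sup>2) / real n"
    by (subst sum.swap) (simp add: sum_divide_distrib)
  also have "(\<Sum>k<n. \<Sum>j<d. (f k $ j - g k $ j)\<^sup>2) = (\<Sum>k<n. (vnorm (f k - g k))\<^sup>2)"
  proof (rule sum.cong[OF refl])
    fix k assume "k \<in> {..<n}"
    hence "dim_vec (f k) = d" "dim_vec (g k) = d" using assms by auto
    thus "(\<Sum>j<d. (f k $ j - g k $ j)\<^sup>2) = (vnorm (f k - g k))\<^sup>2" by (simp add: vnorm_sq_real)
  qed
  finally show ?thesis .
qed (simp add: vmean_def vnorm_def)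

text \<open>Expected smoothness controls only differences of stochastic gradients. Integrability at
  one base point, for each agent and variable, spreads from there to all points; a run supplies such
  a point.\<close>

locale smooth_problem =
  fixes pb :: "'z problem" and L\<^sub>f :: real
  assumes reg: "regular_problem pb" and smooth: "expected_smooth pb L\<^sub>f"
    and base: "\<And>k w. k < nagents pb \<Longrightarrow> \<exists>x\<in>carrier_vec (xdim pb). \<exists>y\<in>carrier_vec (ydim pb).
      \<forall>j<vdim pb w. integrable (sample_law pb k) (\<lambda>z. cost_grad pb w k x y z $ j)"
begin

abbreviation "cx \<equiv> (carrier_vec (xdim pb) :: real vec set)"
abbreviation "cy \<equiv> (carrier_vec (ydim pb) :: real vec set)"

lemma agents_pos: "1 \<le> nagents pb" "0 < nagents pb"
  using reg by (auto simp: regular_problem_def)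

lemma cost_has_pgrad:
  assumes "k < nagents pb" "x \<in> cx" "y \<in> cy" "z \<in> space (sample_space pb)"
  shows "has_pgrad pb w (\<lambda>u v. cost pb k u v z) x y"
  using reg assms unfolding regular_problem_def by blast

lemma local_has_pgrad:
  assumes "k < nagents pb" "x \<in> cx" "y \<in> cy"
  shows "has_pgrad pb w (local_obj pb k) x y"
  using reg assms unfolding regular_problem_def by blast

lemma cost_grad_carrier [simp]:
  assumes "k < nagents pb" "x \<in> cx" "y \<in> cy" "z \<in> space (sample_space pb)"
  shows "cost_grad pb w k x y z \<in> carrier_vec (vdim pb w)"
  unfolding cost_grad_def using has_gradient_carrier[OF has_pgradD[OF cost_has_pgrad[OF assms]]] .

lemma local_grad_carrier [simp]:
  assumes "k < nagents pb" "x \<in> cx" "y \<in> cy"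
  shows "pgrad pb w (local_obj pb k) x y \<in> carrier_vec (vdim pb w)"
  using has_gradient_carrier[OF has_pgradD[OF local_has_pgrad[OF assms]]] .

text \<open>Indices beyond the data set are redirected to index 0, so that all values lie in the
  sample space and the map is measurable on a discrete space.\<close>

definition data :: "nat \<Rightarrow> nat \<Rightarrow> 'z" where
  "data k s = dataset pb k (if s < dsize pb k then s else 0)"

lemma offline_facts:
  assumes "\<not> online pb" "k < nagents pb"
  shows "1 \<le> dsize pb k" "\<And>s. data k s \<in> space (sample_space pb)"
    "sample_law pb k = distr (measure_pmf (pmf_of_set {..<dsize pb k})) (sample_space pb) (data k)"
proof -
  show n: "1 \<le> dsize pb k" using reg assms by (auto simp: regular_problem_def)
  have "\<forall>s<dsize pb k. dataset pb k s \<in> space (sample_space pb)"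
    using reg assms unfolding regular_problem_def by simp
  thus "data k s \<in> space (sample_space pb)" for s using n by (simp add: data_def)
  let ?p = "pmf_of_set {..<dsize pb k}"
  \<comment> \<open>The uniform distribution sees only indices inside the data set, so redirecting
    the others leaves the law unchanged.\<close>
  have "emeasure (measure_pmf ?p) (dataset pb k -` A) = emeasure (measure_pmf ?p) (data k -` A)" for A
  proof -
    have s: "set_pmf ?p = {..<dsize pb k}" using n by (intro set_pmf_of_set) (auto simp: lessThan_empty_iff)
    have "dataset pb k -` A \<inter> set_pmf ?p = data k -` A \<inter> set_pmf ?p"
      unfolding s by (auto simp: data_def)
    thus ?thesis by (metis emeasure_Int_set_pmf)
  qed
  thus "sample_law pb k = distr (measure_pmf ?p) (sample_space pb) (data k)"
    using assms by (simp add: sample_law_def distr_def)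
qed

lemma data_measurable [measurable]:
  "\<not> online pb \<Longrightarrow> k < nagents pb \<Longrightarrow> data k \<in> measurable (measure_pmf p) (sample_space pb)"
  using offline_facts(2) by (auto intro: measurableI)

lemma law_sets [simp]: "k < nagents pb \<Longrightarrow> sets (sample_law pb k) = sets (sample_space pb)"
  using reg by (auto simp: sample_law_def regular_problem_def)

lemma law_space [simp]: "k < nagents pb \<Longrightarrow> space (sample_law pb k) = space (sample_space pb)"
  by (rule sets_eq_imp_space_eq) simp

lemma law_measurable [simp]:
  "k < nagents pb \<Longrightarrow> borel_measurable (sample_law pb k) = borel_measurable (sample_space pb)"
  by (intro measurable_cong_sets) auto

lemma law_prob:
  assumes "k < nagents pb" shows "prob_space (sample_law pb k)"
proof (cases "online pb")
  case True
  thus ?thesis using reg assms by (auto simp: sample_law_def regular_problem_def)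
next
  case False
  thus ?thesis using offline_facts(3)[OF False assms] data_measurable[OF False assms]
    by (auto intro!: prob_space.prob_space_distr measure_pmf.prob_space_axioms)
qed

lemma offline_integral:
  assumes "\<not> online pb" "k < nagents pb" "f \<in> borel_measurable (sample_space pb)"
  shows "integrable (sample_law pb k) f"
    "(\<integral>z. f z \<partial>sample_law pb k) = (\<Sum>s<dsize pb k. f (dataset pb k s)) / real (dsize pb k)"
proof -
  note o = offline_facts[OF assms(1,2)]
  let ?p = "pmf_of_set {..<dsize pb k}"
  have fs: "finite (set_pmf ?p)" using o(1) by (subst set_pmf_of_set) (auto simp: lessThan_empty_iff)
  show "integrable (sample_law pb k) f"
    unfolding o(3)
    by (subst integrable_distr_eq[OF data_measurable[OF assms(1,2)] assms(3)])
      (rule integrable_measure_pmf_finite[OF fs])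
  have "(\<integral>z. f z \<partial>sample_law pb k) = (\<integral>s. f (data k s) \<partial>measure_pmf ?p)"
    unfolding o(3) using assms by (intro integral_distr data_measurable) auto
  also have "\<dots> = (\<Sum>s<dsize pb k. f (data k s)) / real (dsize pb k)"
    using o(1) by (subst integral_pmf_of_set) (auto simp: lessThan_empty_iff)
  finally show "(\<integral>z. f z \<partial>sample_law pb k) = (\<Sum>s<dsize pb k. f (dataset pb k s)) / real (dsize pb k)"
    by (simp add: data_def)
qed

text \<open>Joint measurability is assumed on products of coordinate spaces. The valid coordinates
  of \<open>X a\<close> and \<open>Y a\<close> form a point there, and \<open>vec\<close> recovers
  the vectors from it.\<close>

lemma cost_grad_measurable:
  assumes k: "k < nagents pb" and j: "j < vdim pb w"
    and X: "\<And>a. a \<in> space M \<Longrightarrow> X a \<in> cx" "\<And>i. i < xdim pb \<Longrightarrow> (\<lambda>a. X a $ i) \<in> borel_measurable M"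
    and Y: "\<And>a. a \<in> space M \<Longrightarrow> Y a \<in> cy" "\<And>i. i < ydim pb \<Longrightarrow> (\<lambda>a. Y a $ i) \<in> borel_measurable M"
    and Z: "Z \<in> measurable M (sample_space pb)"
  shows "(\<lambda>a. cost_grad pb w k (X a) (Y a) (Z a) $ j) \<in> borel_measurable M"
proof -
  let ?u = "\<lambda>a. restrict (\<lambda>i. X a $ i) {..<xdim pb}" and ?v = "\<lambda>a. restrict (\<lambda>i. Y a $ i) {..<ydim pb}"
  have 1: "?u \<in> measurable M (\<Pi>\<^sub>M i\<in>{..<xdim pb}. borel)"
    by (rule measurable_restrict) (use X in auto)
  have 2: "?v \<in> measurable M (\<Pi>\<^sub>M i\<in>{..<ydim pb}. borel)"
    by (rule measurable_restrict) (use Y in auto)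
  have m: "(\<lambda>(u, v, z). cost_grad pb w k (vec (xdim pb) u) (vec (ydim pb) v) z $ j)
            \<in> borel_measurable ((\<Pi>\<^sub>M i\<in>{..<xdim pb}. borel) \<Otimes>\<^sub>M
                (\<Pi>\<^sub>M i\<in>{..<ydim pb}. borel) \<Otimes>\<^sub>M sample_space pb)"
    using reg k j unfolding regular_problem_def by blast
  have "(\<lambda>a. (?u a, ?v a, Z a)) \<in> measurable M ((\<Pi>\<^sub>M i\<in>{..<xdim pb}. borel) \<Otimes>\<^sub>M
                (\<Pi>\<^sub>M i\<in>{..<ydim pb}. borel) \<Otimes>\<^sub>M sample_space pb)"
    using 1 2 Z by (intro measurable_Pair)
  from measurable_compose[OF this m]
  have "(\<lambda>a. cost_grad pb w k (vec (xdim pb) (?u a)) (vec (ydim pb) (?v a)) (Z a) $ j) \<in> borel_measurable M"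
    by simp
  moreover have "vec (xdim pb) (?u a) = X a" "vec (ydim pb) (?v a) = Y a" if "a \<in> space M" for a
    using X(1)[OF that] Y(1)[OF that] by (auto intro!: eq_vecI)
  ultimately show ?thesis by (simp cong: measurable_cong)
qed

lemma cost_grad_measurable_z:
  assumes "k < nagents pb" "j < vdim pb w" "x \<in> cx" "y \<in> cy"
  shows "(\<lambda>z. cost_grad pb w k x y z $ j) \<in> borel_measurable (sample_space pb)"
  using assms by (intro cost_grad_measurable) auto

lemma smooth_le:
  assumes "k < nagents pb" "x \<in> cx" "y \<in> cy" "x' \<in> cx" "y' \<in> cy"
  shows "(\<integral>\<^sup>+z. ennreal ((vnorm (cost_grad pb w k x y z - cost_grad pb w k x' y' z))\<^sup>2) \<partial>sample_law pb k)
    \<le> ennreal (L\<^sub>f\<^sup>2 * ((vnorm (x - x'))\<^sup>2 + (vnorm (y - y'))\<^sup>2))"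
  using smooth assms unfolding expected_smooth_def by blast

lemma vnorm_sq_cost_diff:
  assumes "k < nagents pb" "x \<in> cx" "y \<in> cy" "x' \<in> cx" "y' \<in> cy" "z \<in> space (sample_space pb)"
  shows "(vnorm (cost_grad pb w k x y z - cost_grad pb w k x' y' z))\<^sup>2
    = (\<Sum>j<vdim pb w. (cost_grad pb w k x y z $ j - cost_grad pb w k x' y' z $ j)\<^sup>2)"
  using cost_grad_carrier[OF assms(1-3,6), of w] cost_grad_carrier[OF assms(1,4-6), of w]
  by (simp add: vnorm_sq_real del: cost_grad_carrier)

lemma cost_diff_integrable:
  assumes k: "k < nagents pb" and j: "j < vdim pb w" and xy: "x \<in> cx" "y \<in> cy" "x' \<in> cx" "y' \<in> cy"
  shows "integrable (sample_law pb k) (\<lambda>z. (cost_grad pb w k x y z $ j - cost_grad pb w k x' y' z $ j)\<^sup>2)"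
    "integrable (sample_law pb k) (\<lambda>z. cost_grad pb w k x y z $ j - cost_grad pb w k x' y' z $ j)"
proof -
  interpret prob_space "sample_law pb k" by (rule law_prob[OF k])
  let ?f = "\<lambda>z. cost_grad pb w k x y z $ j - cost_grad pb w k x' y' z $ j"
  have m: "?f \<in> borel_measurable (sample_law pb k)"
    using k j xy by (auto intro!: borel_measurable_diff cost_grad_measurable_z)
  have "(\<integral>\<^sup>+z. ennreal (norm ((?f z)\<^sup>2)) \<partial>sample_law pb k)
      \<le> (\<integral>\<^sup>+z. ennreal ((vnorm (cost_grad pb w k x y z - cost_grad pb w k x' y' z))\<^sup>2) \<partial>sample_law pb k)"
  proof (intro nn_integral_mono ennreal_leI)
    fix z assume "z \<in> space (sample_law pb k)"
    hence z: "z \<in> space (sample_space pb)" using k by simp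
    show "norm ((?f z)\<^sup>2) \<le> (vnorm (cost_grad pb w k x y z - cost_grad pb w k x' y' z))\<^sup>2"
      unfolding vnorm_sq_cost_diff[OF k xy z] using j
      by (simp, intro member_le_sum[of j "{..<vdim pb w}"
            "\<lambda>j. (cost_grad pb w k x y z $ j - cost_grad pb w k x' y' z $ j)\<^sup>2"]) auto
  qed
  also have "\<dots> < \<infinity>" using smooth_le[OF k xy, of w] by (rule le_less_trans) simp
  finally show i: "integrable (sample_law pb k) (\<lambda>z. (?f z)\<^sup>2)"
    using m by (intro integrableI_bounded) auto
  show "integrable (sample_law pb k) ?f" by (rule square_integrable_imp_integrable[OF m i])
qed

lemma cost_grad_integrable:
  assumes k: "k < nagents pb" and j: "j < vdim pb w" and xy: "x \<in> cx" "y \<in> cy"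
  shows "integrable (sample_law pb k) (\<lambda>z. cost_grad pb w k x y z $ j)"
proof -
  obtain x' y' where b: "x' \<in> cx" "y' \<in> cy"
    "integrable (sample_law pb k) (\<lambda>z. cost_grad pb w k x' y' z $ j)"
    using base[OF k, of w] j by blast
  show ?thesis
    using Bochner_Integration.integrable_add[OF cost_diff_integrable(2)[OF k j xy b(1,2)] b(3)] by simp
qed

text \<open>The assumption gives this only almost surely and at iterates, while centroids and
  measurability arguments require it at every point. Offline the gradient of a finite average is
  taken term by term; online the gradient is moved under the integral and read off in the direction
  of a unit vector.\<close>

lemma unbiased:
  assumes k: "k < nagents pb" and j: "j < vdim pb w" and xy: "x \<in> cx" "y \<in> cy"
  shows "(\<integral>z. cost_grad pb w k x y z $ j \<partial>sample_law pb k) = pgrad pb w (local_obj pb k) x y $ j"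
proof (cases "online pb")
  case False
  note o = offline_facts[OF False k]
  let ?u = "sel w x y"
  have "has_gradient (vdim pb w) (\<lambda>u. (\<Sum>s<dsize pb k. cost pb k (repx w u x) (repy w u y) (dataset pb k s))
      / real (dsize pb k)) ?u (vmean (vdim pb w) (dsize pb k) (\<lambda>s. cost_grad pb w k x y (dataset pb k s)))"
  proof (rule has_gradient_average)
    fix s assume "s < dsize pb k"
    hence "dataset pb k s \<in> space (sample_space pb)" using o(2)[of s] by (simp add: data_def)
    from has_pgradD[OF cost_has_pgrad[OF k xy this, of w]]
    show "has_gradient (vdim pb w) (\<lambda>u. cost pb k (repx w u x) (repy w u y) (dataset pb k s)) ?u
        (cost_grad pb w k x y (dataset pb k s))" by (simp add: cost_grad_def)
  qed
  hence "pgrad pb w (local_obj pb k) x y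
      = vmean (vdim pb w) (dsize pb k) (\<lambda>s. cost_grad pb w k x y (dataset pb k s))"
    using False by (intro pgradI) (simp add: local_obj_def)
  thus ?thesis
    using offline_integral(2)[OF False k cost_grad_measurable_z[OF k j xy]] j by (simp add: vmean_def)
next
  case True
  have law: "sample_law pb k = dist_of pb k" using True by (simp add: sample_law_def)
  let ?d = "vdim pb w"
  have rc: "repx w u x \<in> cx" "repy w u y \<in> cy" if "u \<in> carrier_vec ?d" for u
    using rep_carrier that xy by blast+
  have e: "unit_vec ?d j \<in> carrier_vec ?d" by simp
  have "pgrad pb w (local_obj pb k) x y \<bullet> unit_vec ?d j
      = (\<integral>z. cost_grad pb w k (repx w (sel w x y) x) (repy w (sel w x y) y) z \<bullet> unit_vec ?d j \<partial>sample_law pb k)"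
  proof (rule gradient_of_expectation[where d = ?d and L = L\<^sub>f
        and Q = "\<lambda>u z. cost pb k (repx w u x) (repy w u y) z" and x = "sel w x y"
        and G = "\<lambda>u z. cost_grad pb w k (repx w u x) (repy w u y) z"])
    show "prob_space (sample_law pb k)" by (rule law_prob[OF k])
    show "sel w x y \<in> carrier_vec ?d" using xy by (rule sel_carrier)
    fix u :: "real vec" assume u: "u \<in> carrier_vec ?d"
    show "integrable (sample_law pb k) (cost pb k (repx w u x) (repy w u y))"
      unfolding law using reg k True rc[OF u] unfolding regular_problem_def by blast
    fix z assume "z \<in> space (sample_law pb k)"
    hence "z \<in> space (sample_space pb)" using k by simp
    from has_pgradD[OF cost_has_pgrad[OF k rc[OF u] this, of w]]
    show "has_gradient ?d (\<lambda>u. cost pb k (repx w u x) (repy w u y) z) u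
        (cost_grad pb w k (repx w u x) (repy w u y) z)"
      by (simp add: cost_grad_def)
  next
    show "has_gradient ?d (\<lambda>u. \<integral>z. cost pb k (repx w u x) (repy w u y) z \<partial>sample_law pb k)
        (sel w x y) (pgrad pb w (local_obj pb k) x y)"
      using has_pgradD[OF local_has_pgrad[OF k xy, of w]] True by (simp add: local_obj_def law)
  next
    fix i assume i: "i < ?d"
    let ?u = "\<lambda>t. sel w x y + t \<cdot>\<^sub>v unit_vec ?d j"
    have uc: "?u t \<in> carrier_vec ?d" for t using sel_carrier[OF xy, of w] by simp
    have um: "(\<lambda>p. ?u (fst p) $ i) \<in> borel_measurable (borel \<Otimes>\<^sub>M sample_law pb k)" if "i < ?d" for i
      using that sel_carrier[OF xy, of w] by simp
    have "(\<lambda>p. cost_grad pb w k (repx w (?u (fst p)) x) (repy w (?u (fst p)) y) (snd p) $ i)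
        \<in> borel_measurable (borel \<Otimes>\<^sub>M sample_law pb k)"
    proof (rule cost_grad_measurable[OF k i rc(1)[OF uc] _ rc(2)[OF uc]])
      show "(\<lambda>p. repx w (?u (fst p)) x $ i) \<in> borel_measurable (borel \<Otimes>\<^sub>M sample_law pb k)"
        if "i < xdim pb" for i using that um[of i] by (cases w) (auto simp: var_defs)
      show "(\<lambda>p. repy w (?u (fst p)) y $ i) \<in> borel_measurable (borel \<Otimes>\<^sub>M sample_law pb k)"
        if "i < ydim pb" for i using that um[of i] by (cases w) (auto simp: var_defs)
      show "snd \<in> borel \<Otimes>\<^sub>M sample_law pb k \<rightarrow>\<^sub>M sample_space pb"
        by (rule measurable_cong_sets[OF refl law_sets[OF k], THEN equalityD1, THEN subsetD,
              OF measurable_snd])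
    qed
    thus "(\<lambda>(t, z). cost_grad pb w k (repx w (?u t) x) (repy w (?u t) y) z $ i)
        \<in> borel_measurable (borel \<Otimes>\<^sub>M sample_law pb k)" by (simp add: case_prod_beta)
  next
    fix u v :: "real vec" assume uv: "u \<in> carrier_vec ?d" "v \<in> carrier_vec ?d"
    show "(\<integral>\<^sup>+z. ennreal ((vnorm (cost_grad pb w k (repx w u x) (repy w u y) z
        - cost_grad pb w k (repx w v x) (repy w v y) z))\<^sup>2) \<partial>sample_law pb k)
        \<le> ennreal (L\<^sub>f\<^sup>2 * (vnorm (u - v))\<^sup>2)"
      using smooth_le[OF k rc[OF uv(1)] rc[OF uv(2)], of w] unfolding rep_dist[OF uv xy] .
  next
    fix i assume "i < ?d"
    thus "integrable (sample_law pb k) (\<lambda>z. cost_grad pb w k (repx w (sel w x y) x) (repy w (sel w x y) y) z $ i)"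
      using cost_grad_integrable[OF k _ xy] by simp
  qed (rule e)
  moreover have "pgrad pb w (local_obj pb k) x y \<bullet> unit_vec ?d j = pgrad pb w (local_obj pb k) x y $ j"
    using j local_grad_carrier[OF k xy, of w] by (simp add: scalar_prod_right_unit)
  moreover have "(\<integral>z. cost_grad pb w k x y z \<bullet> unit_vec ?d j \<partial>sample_law pb k)
      = (\<integral>z. cost_grad pb w k x y z $ j \<partial>sample_law pb k)"
  proof (rule Bochner_Integration.integral_cong[OF refl])
    fix z assume "z \<in> space (sample_law pb k)"
    thus "cost_grad pb w k x y z \<bullet> unit_vec ?d j = cost_grad pb w k x y z $ j"
      using cost_grad_carrier[OF k xy, of z w] j k by (simp add: scalar_prod_right_unit)
  qed
  ultimately show ?thesis by simp
qed

text \<open>Jensen's inequality: by unbiasedness a difference of true gradients is a mean, and a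
  squared mean is at most the mean square because the variance is nonnegative.\<close>

lemma local_grad_lipschitz:
  assumes k: "k < nagents pb" and xy: "x \<in> cx" "y \<in> cy" "x' \<in> cx" "y' \<in> cy"
  shows "(vnorm (pgrad pb w (local_obj pb k) x y - pgrad pb w (local_obj pb k) x' y'))\<^sup>2
    \<le> L\<^sub>f\<^sup>2 * ((vnorm (x - x'))\<^sup>2 + (vnorm (y - y'))\<^sup>2)"
proof -
  interpret prob_space "sample_law pb k" by (rule law_prob[OF k])
  let ?f = "\<lambda>j z. cost_grad pb w k x y z $ j - cost_grad pb w k x' y' z $ j"
  note gc = local_grad_carrier[OF k xy(1,2), of w] local_grad_carrier[OF k xy(3,4), of w]
  have sq: "(\<integral>z. ?f j z \<partial>sample_law pb k)\<^sup>2 \<le> (\<integral>z. (?f j z)\<^sup>2 \<partial>sample_law pb k)" if j: "j < vdim pb w" for j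
    using variance_eq[OF cost_diff_integrable(2,1)[OF k j xy]] variance_positive[of "?f j"] by simp
  have "(vnorm (pgrad pb w (local_obj pb k) x y - pgrad pb w (local_obj pb k) x' y'))\<^sup>2
      = (\<Sum>j<vdim pb w. (pgrad pb w (local_obj pb k) x y $ j - pgrad pb w (local_obj pb k) x' y' $ j)\<^sup>2)"
    using gc by (simp add: vnorm_sq_real del: local_grad_carrier)
  also have "\<dots> = (\<Sum>j<vdim pb w. (\<integral>z. ?f j z \<partial>sample_law pb k)\<^sup>2)"
    by (intro sum.cong refl) (simp add: unbiased[OF k _ xy(1,2), symmetric] unbiased[OF k _ xy(3,4), symmetric]
        Bochner_Integration.integral_diff[OF cost_grad_integrable[OF k _ xy(1,2)] cost_grad_integrable[OF k _ xy(3,4)]])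
  also have "\<dots> \<le> (\<Sum>j<vdim pb w. \<integral>z. (?f j z)\<^sup>2 \<partial>sample_law pb k)" by (intro sum_mono sq) simp
  also have "\<dots> = (\<integral>z. (\<Sum>j<vdim pb w. (?f j z)\<^sup>2) \<partial>sample_law pb k)"
    using cost_diff_integrable(1)[OF k _ xy] by (subst Bochner_Integration.integral_sum) auto
  finally have le: "(vnorm (pgrad pb w (local_obj pb k) x y - pgrad pb w (local_obj pb k) x' y'))\<^sup>2
      \<le> (\<integral>z. (\<Sum>j<vdim pb w. (?f j z)\<^sup>2) \<partial>sample_law pb k)" .
  have "ennreal (\<integral>z. (\<Sum>j<vdim pb w. (?f j z)\<^sup>2) \<partial>sample_law pb k)
      = (\<integral>\<^sup>+z. ennreal (\<Sum>j<vdim pb w. (?f j z)\<^sup>2) \<partial>sample_law pb k)"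
    using cost_diff_integrable(1)[OF k _ xy]
    by (intro nn_integral_eq_integral[symmetric] Bochner_Integration.integrable_sum AE_I2)
      (auto intro!: sum_nonneg)
  also have "\<dots> = (\<integral>\<^sup>+z. ennreal ((vnorm (cost_grad pb w k x y z - cost_grad pb w k x' y' z))\<^sup>2) \<partial>sample_law pb k)"
    using k by (intro nn_integral_cong) (simp add: vnorm_sq_cost_diff[OF k xy])
  also have "\<dots> \<le> ennreal (L\<^sub>f\<^sup>2 * ((vnorm (x - x'))\<^sup>2 + (vnorm (y - y'))\<^sup>2))" by (rule smooth_le[OF k xy])
  finally show ?thesis using le by (subst (asm) ennreal_le_iff) auto
qed

abbreviation "J \<equiv> obj pb"
abbreviation "gJ w x y \<equiv> pgrad pb w (obj pb) x y"

lemma obj_grad: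
  assumes "x \<in> cx" "y \<in> cy"
  shows "has_gradient (vdim pb w) (\<lambda>u. J (repx w u x) (repy w u y)) (sel w x y) (gJ w x y)"
    and "gJ w x y = vmean (vdim pb w) (nagents pb) (\<lambda>k. pgrad pb w (local_obj pb k) x y)"
proof -
  have g: "has_gradient (vdim pb w) (\<lambda>u. J (repx w u x) (repy w u y)) (sel w x y)
     (vmean (vdim pb w) (nagents pb) (\<lambda>k. pgrad pb w (local_obj pb k) x y))"
    unfolding obj_def by (rule has_gradient_average) (rule has_pgradD[OF local_has_pgrad[OF _ assms]])
  show e: "gJ w x y = vmean (vdim pb w) (nagents pb) (\<lambda>k. pgrad pb w (local_obj pb k) x y)"
    by (rule pgradI[OF g])
  show "has_gradient (vdim pb w) (\<lambda>u. J (repx w u x) (repy w u y)) (sel w x y) (gJ w x y)"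
    unfolding e by (rule g)
qed

lemma gJ_carrier [simp]: "x \<in> cx \<Longrightarrow> y \<in> cy \<Longrightarrow> gJ w x y \<in> carrier_vec (vdim pb w)"
  by (simp add: obj_grad(2))

lemma gJ_lipschitz:
  assumes xy: "x \<in> cx" "y \<in> cy" "x' \<in> cx" "y' \<in> cy"
  shows "(vnorm (gJ w x y - gJ w x' y'))\<^sup>2 \<le> L\<^sub>f\<^sup>2 * ((vnorm (x - x'))\<^sup>2 + (vnorm (y - y'))\<^sup>2)"
proof -
  have "(vnorm (gJ w x y - gJ w x' y'))\<^sup>2
      \<le> (\<Sum>k<nagents pb. (vnorm (pgrad pb w (local_obj pb k) x y - pgrad pb w (local_obj pb k) x' y'))\<^sup>2) / real (nagents pb)"
    unfolding obj_grad(2)[OF xy(1,2)] obj_grad(2)[OF xy(3,4)]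
    by (rule vmean_diff_sq_le) (use xy in auto)
  also have "\<dots> \<le> (\<Sum>k<nagents pb. L\<^sub>f\<^sup>2 * ((vnorm (x - x'))\<^sup>2 + (vnorm (y - y'))\<^sup>2)) / real (nagents pb)"
    by (intro divide_right_mono sum_mono local_grad_lipschitz) (use xy in auto)
  finally show ?thesis using agents_pos by simp
qed

end

section \<open>Consequences of the Polyak-Lojasiewicz condition\<close>

locale pl_problem = smooth_problem +
  fixes \<nu> :: real
  assumes pl: "pl_condition pb \<nu>" and nu_le: "\<nu> \<le> L\<^sub>f"
begin

abbreviation "P \<equiv> primal pb"
abbreviation "\<kappa> \<equiv> L\<^sub>f / \<nu>"
abbreviation "L \<equiv> L\<^sub>f + \<kappa> * L\<^sub>f / 2"

lemma nu_pos: "0 < \<nu>" and Lf_pos: "0 < L\<^sub>f" and kappa_ge: "1 \<le> \<kappa>"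
  using pl nu_le by (auto simp: pl_condition_def)

lemma gJ_lip:
  assumes xy: "x \<in> cx" "y \<in> cy" and u: "u \<in> carrier_vec (vdim pb w')" and v: "v \<in> carrier_vec (vdim pb w')"
  shows "vnorm (gJ w (repx w' u x) (repy w' u y) - gJ w (repx w' v x) (repy w' v y)) \<le> L\<^sub>f * vnorm (u - v)"
proof -
  have "(vnorm (gJ w (repx w' u x) (repy w' u y) - gJ w (repx w' v x) (repy w' v y)))\<^sup>2 \<le> (L\<^sub>f * vnorm (u - v))\<^sup>2"
    using gJ_lipschitz[of "repx w' u x" "repy w' u y" "repx w' v x" "repy w' v y" w]
      rep_carrier(1)[OF u xy(1)] rep_carrier(2)[OF u xy(2)] rep_carrier(1)[OF v xy(1)]
      rep_carrier(2)[OF v xy(2)] rep_dist[OF u v xy] by (simp add: power_mult_distrib)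
  thus ?thesis using Lf_pos by (simp add: power2_le_iff_abs_le)
qed

text \<open>On the segment from \<open>u\<close> to \<open>u + h\<close> the slope differs from its
  initial value by at most the Lipschitz constant times \<open>t\<close> times the squared length of
  \<open>h\<close>. Subtracting or adding the corresponding parabola therefore gives a monotone
  function, which is compared at 0 and 1.\<close>

lemma taylor:
  assumes xy: "x \<in> cx" "y \<in> cy" and u: "u \<in> carrier_vec (vdim pb w)" and h: "h \<in> carrier_vec (vdim pb w)"
  shows "\<bar>J (repx w (u + h) x) (repy w (u + h) y) - J (repx w u x) (repy w u y)
      - gJ w (repx w u x) (repy w u y) \<bullet> h\<bar> \<le> L\<^sub>f / 2 * (vnorm h)\<^sup>2"
proof -
  let ?d = "vdim pb w"
  define \<phi> where "\<phi> t = J (repx w (u + t \<cdot>\<^sub>v h) x) (repy w (u + t \<cdot>\<^sub>v h) y)" for t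
  define \<phi>' where "\<phi>' t = gJ w (repx w (u + t \<cdot>\<^sub>v h) x) (repy w (u + t \<cdot>\<^sub>v h) y) \<bullet> h" for t
  have ut: "u + t \<cdot>\<^sub>v h \<in> carrier_vec ?d" for t using u h by simp
  have d: "(\<phi> has_real_derivative \<phi>' t) (at t)" for t
    unfolding \<phi>_def \<phi>'_def
    using obj_grad(1)[OF rep_carrier(1)[OF ut xy(1)] rep_carrier(2)[OF ut xy(2)], of w t t]
    by (intro has_gradient_derivative[where f = "\<lambda>u. J (repx w u x) (repy w u y)", OF _ u h]) simp
  have u0: "u + 0 \<cdot>\<^sub>v h = u" "u + 1 \<cdot>\<^sub>v h = u + h" using u h by (auto intro!: eq_vecI)
  have gc: "gJ w (repx w (u + t \<cdot>\<^sub>v h) x) (repy w (u + t \<cdot>\<^sub>v h) y) \<in> carrier_vec ?d" for t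
    by (rule gJ_carrier[OF rep_carrier(1)[OF ut xy(1)] rep_carrier(2)[OF ut xy(2)]])
  have l: "\<bar>\<phi>' t - \<phi>' 0\<bar> \<le> L\<^sub>f * t * (vnorm h)\<^sup>2" if t: "0 \<le> t" for t
  proof -
    have "u + t \<cdot>\<^sub>v h - (u + 0 \<cdot>\<^sub>v h) = t \<cdot>\<^sub>v h" using u h by (intro eq_vecI) auto
    hence n: "vnorm (gJ w (repx w (u + t \<cdot>\<^sub>v h) x) (repy w (u + t \<cdot>\<^sub>v h) y)
        - gJ w (repx w (u + 0 \<cdot>\<^sub>v h) x) (repy w (u + 0 \<cdot>\<^sub>v h) y)) \<le> L\<^sub>f * (t * vnorm h)"
      using gJ_lip[OF xy ut ut, of w t 0] t by (simp add: vnorm_smult)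
    have "\<bar>\<phi>' t - \<phi>' 0\<bar> \<le> vnorm (gJ w (repx w (u + t \<cdot>\<^sub>v h) x) (repy w (u + t \<cdot>\<^sub>v h) y)
        - gJ w (repx w (u + 0 \<cdot>\<^sub>v h) x) (repy w (u + 0 \<cdot>\<^sub>v h) y)) * vnorm h"
      unfolding \<phi>'_def minus_scalar_prod_distrib[OF gc gc h, symmetric]
      by (rule scalar_prod_le_vnorm[OF minus_carrier_vec[OF gc gc] h])
    also have "\<dots> \<le> L\<^sub>f * (t * vnorm h) * vnorm h" by (rule mult_right_mono[OF n]) simp
    finally show ?thesis by (simp add: power2_eq_square ac_simps)
  qed
  have up: "\<phi> 1 - \<phi>' 0 - L\<^sub>f / 2 * (vnorm h)\<^sup>2 \<le> \<phi> 0"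
  proof -
    have "(\<lambda>t. \<phi> t - t * \<phi>' 0 - L\<^sub>f / 2 * t\<^sup>2 * (vnorm h)\<^sup>2) 1 \<le> (\<lambda>t. \<phi> t - t * \<phi>' 0 - L\<^sub>f / 2 * t\<^sup>2 * (vnorm h)\<^sup>2) 0"
    proof (rule DERIV_nonpos_imp_nonincreasing[OF zero_le_one])
      fix t :: real assume t: "0 \<le> t" "t \<le> 1"
      have "((\<lambda>t. \<phi> t - t * \<phi>' 0 - L\<^sub>f / 2 * t\<^sup>2 * (vnorm h)\<^sup>2) has_real_derivative
          (\<phi>' t - \<phi>' 0 - L\<^sub>f * t * (vnorm h)\<^sup>2)) (at t)"
        by (auto intro!: derivative_eq_intros d)
      thus "\<exists>y. ((\<lambda>t. \<phi> t - t * \<phi>' 0 - L\<^sub>f / 2 * t\<^sup>2 * (vnorm h)\<^sup>2) has_real_derivative y) (at t) \<and> y \<le> 0"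
        using l[OF t(1)] by (intro exI conjI) auto
    qed
    thus ?thesis by simp
  qed
  have lo: "\<phi> 1 - \<phi>' 0 + L\<^sub>f / 2 * (vnorm h)\<^sup>2 \<ge> \<phi> 0"
  proof -
    have "(\<lambda>t. \<phi> t - t * \<phi>' 0 + L\<^sub>f / 2 * t\<^sup>2 * (vnorm h)\<^sup>2) 0 \<le> (\<lambda>t. \<phi> t - t * \<phi>' 0 + L\<^sub>f / 2 * t\<^sup>2 * (vnorm h)\<^sup>2) 1"
    proof (rule DERIV_nonneg_imp_nondecreasing[OF zero_le_one])
      fix t :: real assume t: "0 \<le> t" "t \<le> 1"
      have "((\<lambda>t. \<phi> t - t * \<phi>' 0 + L\<^sub>f / 2 * t\<^sup>2 * (vnorm h)\<^sup>2) has_real_derivative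
          (\<phi>' t - \<phi>' 0 + L\<^sub>f * t * (vnorm h)\<^sup>2)) (at t)"
        by (auto intro!: derivative_eq_intros d)
      thus "\<exists>y. ((\<lambda>t. \<phi> t - t * \<phi>' 0 + L\<^sub>f / 2 * t\<^sup>2 * (vnorm h)\<^sup>2) has_real_derivative y) (at t) \<and> 0 \<le> y"
        using l[OF t(1)] by (intro exI conjI) auto
    qed
    thus ?thesis by simp
  qed
  show ?thesis using up lo unfolding \<phi>_def \<phi>'_def u0 by linarith
qed

lemma taylor_x:
  assumes "x \<in> cx" "y \<in> cy" "h \<in> cx"
  shows "\<bar>J (x + h) y - J x y - gJ Vx x y \<bullet> h\<bar> \<le> L\<^sub>f / 2 * (vnorm h)\<^sup>2"
  using taylor[of x y x Vx h] assms by (simp add: var_defs)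

lemma taylor_y:
  assumes "x \<in> cx" "y \<in> cy" "h \<in> cy"
  shows "\<bar>J x (y + h) - J x y - gJ Vy x y \<bullet> h\<bar> \<le> L\<^sub>f / 2 * (vnorm h)\<^sup>2"
  using taylor[of x y y Vy h] assms by (simp add: var_defs)

lemma primal_upper_J: "x \<in> cx \<Longrightarrow> y \<in> cy \<Longrightarrow> J x y \<le> P x"
proof -
  assume x: "x \<in> cx" and y: "y \<in> cy"
  obtain y0 where "\<forall>y'\<in>cy. J x y' \<le> J x y0" using pl x unfolding pl_condition_def by blast
  thus ?thesis unfolding primal_def using y by (intro cSUP_upper bdd_aboveI[of _ "J x y0"]) auto
qed

lemma pl_ineq:
  assumes "x \<in> cx" "y \<in> cy" shows "2 * \<nu> * (P x - J x y) \<le> (vnorm (gJ Vy x y))\<^sup>2"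
  using pl assms unfolding pl_condition_def by blast

text \<open>Gradient ascent in \<open>y\<close> from a given point: its whole path has length \<open>O(sqrt (\<Delta> / \<nu>))\<close>.
  It replaces the projection onto the set of maximizers, whose existence is not needed.\<close>

primrec ascent :: "real vec \<Rightarrow> real vec \<Rightarrow> nat \<Rightarrow> real vec" where
  "ascent x y 0 = y"
| "ascent x y (Suc n) = ascent x y n + (1 / (3 * L\<^sub>f)) \<cdot>\<^sub>v gJ Vy x (ascent x y n)"

lemma ascent_carrier [simp]: "x \<in> cx \<Longrightarrow> y \<in> cy \<Longrightarrow> ascent x y n \<in> cy"
  using gJ_carrier[of x _ Vy] by (induction n) (auto simp: vdim_def)

text \<open>In units of the squared gradient over the smoothness constant, the step gains 1/3 to
  first order and loses at most 1/18 to second order; the difference is 5/18.\<close>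

lemma ascent_step:
  assumes x: "x \<in> cx" and y: "y \<in> cy"
  shows "P x - J x (ascent x y (Suc n)) \<le> P x - J x (ascent x y n)
    - 5 / (18 * L\<^sub>f) * (vnorm (gJ Vy x (ascent x y n)))\<^sup>2"
proof -
  let ?a = "ascent x y n" and ?g = "gJ Vy x (ascent x y n)" and ?e = "1 / (3 * L\<^sub>f)"
  have g: "?g \<in> cy" using gJ_carrier[OF x ascent_carrier[OF x y], of Vy] by (simp add: vdim_def)
  have "\<bar>J x (?a + ?e \<cdot>\<^sub>v ?g) - J x ?a - ?g \<bullet> (?e \<cdot>\<^sub>v ?g)\<bar> \<le> L\<^sub>f / 2 * (vnorm (?e \<cdot>\<^sub>v ?g))\<^sup>2"
    by (rule taylor_y[OF x ascent_carrier[OF x y]]) (use g in simp)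
  moreover have "?g \<bullet> (?e \<cdot>\<^sub>v ?g) = ?e * (vnorm ?g)\<^sup>2"
    unfolding vnorm_sq_scalar_prod using g by simp
  moreover have "L\<^sub>f / 2 * (vnorm (?e \<cdot>\<^sub>v ?g))\<^sup>2 = 1 / (18 * L\<^sub>f) * (vnorm ?g)\<^sup>2"
    using Lf_pos by (simp add: vnorm_smult power_mult_distrib power2_eq_square)
  moreover have "?e * (vnorm ?g)\<^sup>2 - 1 / (18 * L\<^sub>f) * (vnorm ?g)\<^sup>2 = 5 / (18 * L\<^sub>f) * (vnorm ?g)\<^sup>2"
    using Lf_pos by (simp add: field_simps)
  ultimately show ?thesis unfolding ascent.simps by linarith
qed

text \<open>The Lojasiewicz argument. Let \<open>a\<close> and \<open>b\<close> be the roots of two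
  consecutive gaps. Then \<open>(a - b) * (2 * a)\<close> is at least the difference of the gaps,
  which is quadratic in the gradient norm \<open>G\<close>, while PL bounds \<open>2 * q * a\<close>
  by \<open>G\<close>. So the decrease of the root pays for the length of the step, and the roots
  telescope.\<close>

lemma ascent_length:
  assumes x: "x \<in> cx" and y: "y \<in> cy"
  shows "5 / 6 * sqrt (\<nu> / 2) * vnorm (ascent x y n - y)
    \<le> sqrt (P x - J x y) - sqrt (P x - J x (ascent x y n))"
proof (induction n)
  case 0
  have "y - y = 0\<^sub>v (ydim pb)" using y by simp
  thus ?case by simp
next
  case (Suc n)
  let ?a = "ascent x y n"
  define G where "G = vnorm (gJ Vy x ?a)"
  have g: "gJ Vy x ?a \<in> cy" using gJ_carrier[OF x ascent_carrier[OF x y], of Vy] by (simp add: vdim_def)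
  have ac: "?a \<in> cy" by (rule ascent_carrier[OF x y])
  define a b where "a = sqrt (P x - J x ?a)" and "b = sqrt (P x - J x (ascent x y (Suc n)))"
  have F: "0 \<le> P x - J x (ascent x y m)" for m using primal_upper_J[OF x ascent_carrier[OF x y]] by simp
  have a2: "a\<^sup>2 = P x - J x ?a" and b2: "b\<^sup>2 = P x - J x (ascent x y (Suc n))"
    and ab0: "0 \<le> a" "0 \<le> b" using F[of n] F[of "Suc n"] by (simp_all add: a_def b_def del: ascent.simps)
  have s: "5 / (18 * L\<^sub>f) * G\<^sup>2 \<le> a\<^sup>2 - b\<^sup>2" using ascent_step[OF x y, of n] a2 b2 by (simp add: G_def del: ascent.simps)
  have G0: "0 \<le> G" by (simp add: G_def)
  define q where "q = sqrt (\<nu> / 2)"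
  have q: "0 < q" "q\<^sup>2 = \<nu> / 2" using nu_pos by (simp_all add: q_def)
  have "(2 * q * a)\<^sup>2 = 2 * \<nu> * a\<^sup>2" using q by (simp add: power_mult_distrib)
  hence "(2 * q * a)\<^sup>2 \<le> G\<^sup>2" using pl_ineq[OF x ac] a2 by (simp add: G_def)
  hence Ga: "2 * q * a \<le> G" using G0 by (rule power2_le_imp_le)
  have ba: "b \<le> a"
  proof -
    have "0 \<le> 5 / (18 * L\<^sub>f) * G\<^sup>2" using Lf_pos by simp
    hence "b\<^sup>2 \<le> a\<^sup>2" using s by linarith
    thus ?thesis using ab0(1) by (rule power2_le_imp_le)
  qed
  have step: "5 / 6 * q * (1 / (3 * L\<^sub>f) * G) \<le> a - b"
  proof (cases "G = 0")
    case False
    have "5 / (18 * L\<^sub>f) * G\<^sup>2 \<le> (a - b) * (a + b)" using s by (simp add: power2_eq_square algebra_simps)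
    also have "\<dots> \<le> (a - b) * (2 * a)" using ba by (intro mult_left_mono) auto
    finally have "q * (5 / (18 * L\<^sub>f) * G\<^sup>2) \<le> q * ((a - b) * (2 * a))" using q by (intro mult_left_mono) auto
    also have "\<dots> = (a - b) * (2 * q * a)" by (simp add: ac_simps)
    also have "\<dots> \<le> (a - b) * G" using ba Ga by (intro mult_left_mono) auto
    finally have "(5 / 6 * q * (1 / (3 * L\<^sub>f) * G)) * G \<le> (a - b) * G"
      by (simp add: power2_eq_square ac_simps)
    moreover have "0 < G" using False G0 by simp
    ultimately show ?thesis by (rule mult_right_le_imp_le)
  qed (use ba in simp)
  have "ascent x y (Suc n) - y = (?a - y) + (1 / (3 * L\<^sub>f)) \<cdot>\<^sub>v gJ Vy x ?a"
    using ac y g by (intro eq_vecI) auto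
  hence "vnorm (ascent x y (Suc n) - y) \<le> vnorm (?a - y) + vnorm ((1 / (3 * L\<^sub>f)) \<cdot>\<^sub>v gJ Vy x ?a)"
    using ac y g by (simp del: ascent.simps) (intro vnorm_triangle[of _ "ydim pb"], auto)
  also have "vnorm ((1 / (3 * L\<^sub>f)) \<cdot>\<^sub>v gJ Vy x ?a) = 1 / (3 * L\<^sub>f) * G"
    using Lf_pos by (simp add: vnorm_smult G_def)
  finally have "5 / 6 * q * vnorm (ascent x y (Suc n) - y)
      \<le> 5 / 6 * q * vnorm (?a - y) + 5 / 6 * q * (1 / (3 * L\<^sub>f) * G)"
    using q mult_left_mono[of "vnorm (ascent x y (Suc n) - y)"
      "vnorm (?a - y) + 1 / (3 * L\<^sub>f) * G" "5 / 6 * q"] by (simp only: distrib_left)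
  thus ?case using Suc step unfolding q_def[symmetric] a_def[symmetric] b_def[symmetric] by linarith
qed

lemma ascent_gradients:
  assumes x: "x \<in> cx" and y: "y \<in> cy"
  shows "5 / (18 * L\<^sub>f) * (\<Sum>n<N. (vnorm (gJ Vy x (ascent x y n)))\<^sup>2)
    \<le> (P x - J x y) - (P x - J x (ascent x y N))"
proof (induction N)
  case (Suc N)
  show ?case using Suc ascent_step[OF x y, of N] by (simp add: distrib_left del: ascent.simps)
qed simp

text \<open>The squared gradients along the ascent have a bounded sum, so one of them is as small as
  required, and \<open>ascent_length\<close> keeps that point near \<open>y\<close>. The factor 3 is
  72/25 rounded up. Stopping at a small gradient avoids any passage to a limit point.\<close>

lemma near_stationary:
  assumes x: "x \<in> cx" and y: "y \<in> cy" and e: "0 < e"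
  shows "\<exists>y'\<in>cy. vnorm (gJ Vy x y') \<le> e \<and> vnorm (y' - y) \<le> sqrt (3 * (P x - J x y) / \<nu>)"
proof -
  define F where "F = P x - J x y"
  have F: "0 \<le> F" using primal_upper_J[OF x y] by (simp add: F_def)
  have "\<exists>n. vnorm (gJ Vy x (ascent x y n)) \<le> e"
  proof (rule ccontr)
    assume "\<not> ?thesis"
    hence big: "e\<^sup>2 \<le> (vnorm (gJ Vy x (ascent x y n)))\<^sup>2" for n
      using e by (intro power_mono) (auto simp: not_le intro: less_imp_le)
    have b: "5 / (18 * L\<^sub>f) * (real N * e\<^sup>2) \<le> F" for N
    proof -
      have "real N * e\<^sup>2 \<le> (\<Sum>n<N. (vnorm (gJ Vy x (ascent x y n)))\<^sup>2)"
        using sum_bounded_below[of "{..<N}" "e\<^sup>2"] big by simp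
      hence "5 / (18 * L\<^sub>f) * (real N * e\<^sup>2) \<le> 5 / (18 * L\<^sub>f) * (\<Sum>n<N. (vnorm (gJ Vy x (ascent x y n)))\<^sup>2)"
        using Lf_pos by (intro mult_left_mono) auto
      thus ?thesis
        using ascent_gradients[OF x y, of N] primal_upper_J[OF x ascent_carrier[OF x y], of N]
        by (simp add: F_def)
    qed
    obtain N where "F * (18 * L\<^sub>f) / (5 * e\<^sup>2) < real N" using reals_Archimedean2 by blast
    hence "F < 5 / (18 * L\<^sub>f) * (real N * e\<^sup>2)" using e Lf_pos by (simp add: field_simps)
    thus False using b[of N] by simp
  qed
  then obtain n where n: "vnorm (gJ Vy x (ascent x y n)) \<le> e" by blast
  let ?t = "vnorm (ascent x y n - y)"
  have "5 / 6 * sqrt (\<nu> / 2) * ?t \<le> sqrt F"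
  proof -
    have "0 \<le> sqrt (P x - J x (ascent x y n))"
      using primal_upper_J[OF x ascent_carrier[OF x y], of n] by simp
    thus ?thesis using ascent_length[OF x y, of n] unfolding F_def by linarith
  qed
  hence "(5 / 6 * sqrt (\<nu> / 2) * ?t)\<^sup>2 \<le> (sqrt F)\<^sup>2" using nu_pos by (intro power_mono) auto
  hence "25 / 36 * (\<nu> / 2) * ?t\<^sup>2 \<le> F" using F nu_pos by (simp add: power_mult_distrib power_divide)
  hence "\<nu> * ?t\<^sup>2 \<le> 3 * F" using F by simp
  hence "?t\<^sup>2 \<le> 3 * F / \<nu>" using nu_pos by (simp add: pos_le_divide_eq mult.commute)
  hence "?t \<le> sqrt (3 * F / \<nu>)" by (rule real_le_rsqrt)
  thus ?thesis using n ascent_carrier[OF x y, of n] by (auto simp: F_def)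
qed

text \<open>A substitute for smoothness of \<open>P\<close>. At a nearly stationary
  \<open>y'\<close> the \<open>y\<close>-gradient at \<open>x + h\<close> is at most about the
  Lipschitz constant times the length of \<open>h\<close>, so PL bounds the gap of \<open>y'\<close>
  at \<open>x + h\<close> by a quadratic in \<open>h\<close>. The Taylor estimate of
  \<open>J\<close> at \<open>y'\<close> gives the rest, and exchanging \<open>y'\<close> for
  \<open>y\<close> in the \<open>x\<close>-gradient costs the term with the square root.\<close>

lemma primal_descent:
  assumes x: "x \<in> cx" and y: "y \<in> cy" and h: "h \<in> cx"
  shows "P (x + h) \<le> P x + gJ Vx x y \<bullet> h + L\<^sub>f * vnorm h * sqrt (3 * (P x - J x y) / \<nu>) + L * (vnorm h)\<^sup>2"
proof (rule field_le_epsilon)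
  fix \<delta> :: real assume \<delta>: "0 < \<delta>"
  let ?s = "sqrt (3 * (P x - J x y) / \<nu>)"
  define c where "c = 2 * L\<^sub>f * vnorm h + 1"
  have c: "0 < c" using Lf_pos by (simp add: c_def add_nonneg_pos)
  \<comment> \<open>As \<open>e\<close> is at most 1, squaring the sum of the Lipschitz term and
    \<open>e\<close> adds at most \<open>e * c\<close> to the square of the former. The choice makes
    this at most \<open>2 * \<nu> * \<delta>\<close>, so that dividing by \<open>2 * \<nu>\<close>
    leaves \<delta>.\<close>
  define e where "e = min 1 (\<delta> * (2 * \<nu>) / c)"
  have e: "0 < e" "e \<le> 1" using \<delta> nu_pos c by (auto simp: e_def)
  obtain y' where y': "y' \<in> cy" "vnorm (gJ Vy x y') \<le> e" "vnorm (y' - y) \<le> ?s"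
    using near_stationary[OF x y e(1)] by blast
  have xh: "x + h \<in> cx" using x h by simp
  have gc: "gJ Vy (x + h) y' \<in> cy" "gJ Vy x y' \<in> cy" "gJ Vx x y' \<in> cx" "gJ Vx x y \<in> cx"
    using gJ_carrier[OF xh y'(1), of Vy] gJ_carrier[OF x y'(1), of Vy]
      gJ_carrier[OF x y'(1), of Vx] gJ_carrier[OF x y, of Vx] by (simp_all add: vdim_def)
  have "vnorm (gJ Vy (x + h) y') \<le> L\<^sub>f * vnorm h + e"
  proof -
    have "gJ Vy (x + h) y' = (gJ Vy (x + h) y' - gJ Vy x y') + gJ Vy x y'" using gc by (intro eq_vecI) auto
    hence "vnorm (gJ Vy (x + h) y') \<le> vnorm (gJ Vy (x + h) y' - gJ Vy x y') + vnorm (gJ Vy x y')"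
      using vnorm_triangle[of "gJ Vy (x + h) y' - gJ Vy x y'" "ydim pb" "gJ Vy x y'"] gc by simp
    moreover have "vnorm (gJ Vy (x + h) y' - gJ Vy x y') \<le> L\<^sub>f * vnorm (x + h - x)"
      using gJ_lip[OF x y'(1), of "x + h" Vx x Vy] xh x by (simp add: var_defs)
    moreover have "x + h - x = h" using x h by (intro eq_vecI) auto
    ultimately show ?thesis using y'(2) by simp
  qed
  hence "(vnorm (gJ Vy (x + h) y'))\<^sup>2 \<le> (L\<^sub>f * vnorm h + e)\<^sup>2" by (intro power_mono) auto
  hence "2 * \<nu> * (P (x + h) - J (x + h) y') \<le> (L\<^sub>f * vnorm h + e)\<^sup>2"
    using pl_ineq[OF xh y'(1)] by linarith
  also have "\<dots> \<le> (L\<^sub>f * vnorm h)\<^sup>2 + e * c"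
  proof -
    have "e * e \<le> e * 1" using e by (intro mult_left_mono) auto
    thus ?thesis by (simp add: c_def power2_eq_square algebra_simps)
  qed
  also have "e * c \<le> \<delta> * (2 * \<nu>)"
  proof -
    have "e \<le> \<delta> * (2 * \<nu>) / c" by (simp add: e_def)
    thus ?thesis using c by (simp add: pos_le_divide_eq)
  qed
  finally have "P (x + h) - J (x + h) y' \<le> ((L\<^sub>f * vnorm h)\<^sup>2 + \<delta> * (2 * \<nu>)) / (2 * \<nu>)"
    using nu_pos by (simp add: pos_le_divide_eq mult.commute)
  also have "\<dots> = \<kappa> * L\<^sub>f / 2 * (vnorm h)\<^sup>2 + \<delta>"
    using nu_pos by (simp add: field_simps power2_eq_square)
  finally have 1: "P (x + h) - J (x + h) y' \<le> \<kappa> * L\<^sub>f / 2 * (vnorm h)\<^sup>2 + \<delta>" .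
  have 2: "J (x + h) y' \<le> P x + gJ Vx x y' \<bullet> h + L\<^sub>f / 2 * (vnorm h)\<^sup>2"
    using taylor_x[OF x y'(1) h] primal_upper_J[OF x y'(1)] by linarith
  have "gJ Vx x y' \<bullet> h - gJ Vx x y \<bullet> h = (gJ Vx x y' - gJ Vx x y) \<bullet> h"
    by (rule minus_scalar_prod_distrib[OF gc(3,4) h, symmetric])
  also have "\<dots> \<le> vnorm (gJ Vx x y' - gJ Vx x y) * vnorm h"
    by (rule scalar_prod_le_vnorm'[OF minus_carrier_vec[OF gc(3,4)] h])
  also have "vnorm (gJ Vx x y' - gJ Vx x y) \<le> L\<^sub>f * vnorm (y' - y)"
    using gJ_lip[OF x y, of y' Vy y Vx] y' y by (simp add: var_defs)
  also have "L\<^sub>f * vnorm (y' - y) \<le> L\<^sub>f * ?s" using y'(3) Lf_pos by (intro mult_left_mono) auto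
  finally have 3: "gJ Vx x y' \<bullet> h - gJ Vx x y \<bullet> h \<le> L\<^sub>f * vnorm h * ?s"
    by (simp add: mult_right_mono ac_simps)
  have 4: "L\<^sub>f / 2 * (vnorm h)\<^sup>2 \<le> L\<^sub>f * (vnorm h)\<^sup>2" using Lf_pos by (intro mult_right_mono) auto
  show "P (x + h) \<le> P x + gJ Vx x y \<bullet> h + L\<^sub>f * vnorm h * ?s + L * (vnorm h)\<^sup>2 + \<delta>"
    using 1 2 3 4 by (simp add: distrib_right)
qed

text \<open>The weight \<open>\<alpha>\<close> lets the decrease of \<open>P - J\<close> pay, through the PL inequality, for the error
  made by using \<open>\<nabla>\<^sub>x J(x, y)\<close> in place of \<open>\<nabla> P(x)\<close>.\<close>

definition lyapunov :: "real \<Rightarrow> real vec \<Rightarrow> real vec \<Rightarrow> real" where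
  "lyapunov \<alpha> x y = P x + \<alpha> * (P x - J x y)"

text \<open>A budget in units of \<open>\<mu>\<^sub>x\<close>. The \<open>x\<close>-step yields half
  of the squared \<open>x\<close>-gradient and of \<open>A\<^sup>2\<close>, the
  \<open>y\<close>-step \<open>8 * \<kappa>\<^sup>2\<close> of the squared \<open>y\<close>-gradient
  and of \<open>B\<^sup>2\<close>. Of \<open>A\<^sup>2\<close> the error terms take 1/4, 1/16, 1/64
  and 1/32, which leaves 9/64 and hence 1/10. Of \<open>B\<^sup>2\<close> they take 4 and 2 of the 8
  parts, of the squared \<open>y\<close>-gradient 6 of the 8.\<close>

lemma lyapunov_descent:
  fixes \<mu>\<^sub>x \<mu>\<^sub>y :: real
  assumes x: "x \<in> cx" and y: "y \<in> cy" and a: "a \<in> cx" and b: "b \<in> cy"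
    and mx: "0 < \<mu>\<^sub>x" "\<mu>\<^sub>x * (32 * L) \<le> 1" "\<mu>\<^sub>x * (16 * \<kappa>\<^sup>2) \<le> \<mu>\<^sub>y" and my: "0 < \<mu>\<^sub>y" "\<mu>\<^sub>y * (2 * L\<^sub>f) \<le> 1"
  defines "\<alpha> \<equiv> 16 * \<kappa>\<^sup>2 * \<mu>\<^sub>x / \<mu>\<^sub>y"
  shows "lyapunov \<alpha> (x - \<mu>\<^sub>x \<cdot>\<^sub>v a) (y + \<mu>\<^sub>y \<cdot>\<^sub>v b)
      + \<mu>\<^sub>x * ((vnorm (gJ Vx x y))\<^sup>2 / 2 + 2 * \<kappa>\<^sup>2 * (vnorm (gJ Vy x y))\<^sup>2
          + (vnorm a)\<^sup>2 / 10 + 2 * \<kappa>\<^sup>2 * (vnorm b)\<^sup>2)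
    \<le> lyapunov \<alpha> x y + \<mu>\<^sub>x * ((vnorm (a - gJ Vx x y))\<^sup>2 / 2 + 8 * \<kappa>\<^sup>2 * (vnorm (b - gJ Vy x y))\<^sup>2)"
proof -
  have gx: "gJ Vx x y \<in> cx" and gy: "gJ Vy x y \<in> cy"
    using gJ_carrier[OF x y, of Vx] gJ_carrier[OF x y, of Vy] by (simp_all add: vdim_def)
  define h where "h = - (\<mu>\<^sub>x \<cdot>\<^sub>v a)"
  have h: "h \<in> cx" using a by (simp add: h_def)
  have xh: "x - \<mu>\<^sub>x \<cdot>\<^sub>v a = x + h" using x a unfolding h_def by (intro eq_vecI) auto
  have xhc: "x + h \<in> cx" using x h by simp
  have nh: "vnorm h = \<mu>\<^sub>x * vnorm a" using mx by (simp add: h_def vnorm_uminus vnorm_smult)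
  define k where "k = \<mu>\<^sub>y \<cdot>\<^sub>v b"
  have k: "k \<in> cy" using b by (simp add: k_def)
  have nk: "vnorm k = \<mu>\<^sub>y * vnorm b" using my by (simp add: k_def vnorm_smult)
  define \<Delta> where "\<Delta> = P x - J x y"
  define S where "S = sqrt (3 * \<Delta> / \<nu>)"
  have \<Delta>: "0 \<le> \<Delta>" using primal_upper_J[OF x y] by (simp add: \<Delta>_def)
  have S: "0 \<le> S" "S\<^sup>2 = 3 * \<Delta> / \<nu>" using \<Delta> nu_pos by (simp_all add: S_def)
  define A B ga gb eA eB where "A = vnorm a" and "B = vnorm b" and "ga = (vnorm (gJ Vx x y))\<^sup>2"
    and "gb = (vnorm (gJ Vy x y))\<^sup>2" and "eA = (vnorm (a - gJ Vx x y))\<^sup>2" and "eB = (vnorm (b - gJ Vy x y))\<^sup>2"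
  have AB: "0 \<le> A" "0 \<le> B" by (simp_all add: A_def B_def)
  have al: "0 \<le> \<alpha>" "\<alpha> \<le> 1" "\<alpha> * \<mu>\<^sub>y = 16 * \<kappa>\<^sup>2 * \<mu>\<^sub>x" using mx my by (simp_all add: \<alpha>_def divide_le_eq ac_simps)
  have ipa: "gJ Vx x y \<bullet> a = (ga + A\<^sup>2 - eA) / 2"
    using vnorm_diff_sq_expand[OF a gx] comm_scalar_prod[OF a gx] by (simp add: ga_def A_def eA_def)
  have ipb: "gJ Vy x y \<bullet> b = (gb + B\<^sup>2 - eB) / 2"
    using vnorm_diff_sq_expand[OF b gy] comm_scalar_prod[OF b gy] by (simp add: gb_def B_def eB_def)
  have ih: "gJ Vx x y \<bullet> h = - (\<mu>\<^sub>x * ((ga + A\<^sup>2 - eA) / 2))"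
    using gx a by (simp add: h_def ipa[symmetric])
  have 1: "P (x + h) \<le> P x - \<mu>\<^sub>x * ((ga + A\<^sup>2 - eA) / 2) + L\<^sub>f * (\<mu>\<^sub>x * A) * S + L * (\<mu>\<^sub>x * A)\<^sup>2"
    using primal_descent[OF x y h] unfolding ih nh \<Delta>_def[symmetric] S_def[symmetric] A_def[symmetric] by simp
  have 2: "J x y - \<mu>\<^sub>x * ((ga + A\<^sup>2 - eA) / 2) - L\<^sub>f / 2 * (\<mu>\<^sub>x * A)\<^sup>2 \<le> J (x + h) y"
    using taylor_x[OF x y h] unfolding ih nh A_def[symmetric] by linarith
  have g': "gJ Vy (x + h) y \<in> cy" using gJ_carrier[OF xhc y, of Vy] by (simp add: vdim_def)
  have 3: "J (x + h) y + gJ Vy (x + h) y \<bullet> k - L\<^sub>f / 2 * (\<mu>\<^sub>y * B)\<^sup>2 \<le> J (x + h) (y + k)"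
    using taylor_y[OF xhc y k] unfolding nk B_def[symmetric] by linarith
  have "vnorm (gJ Vy x y - gJ Vy (x + h) y) \<le> L\<^sub>f * (\<mu>\<^sub>x * A)"
  proof -
    have "x - (x + h) = - h" using x h by (intro eq_vecI) auto
    thus ?thesis using gJ_lip[OF x y, of x Vx "x + h" Vy] xhc x by (simp add: var_defs vnorm_uminus nh A_def)
  qed
  hence "vnorm (gJ Vy x y - gJ Vy (x + h) y) * vnorm k \<le> L\<^sub>f * (\<mu>\<^sub>x * A) * (\<mu>\<^sub>y * B)"
    unfolding nk B_def using my by (intro mult_right_mono) auto
  hence "gJ Vy x y \<bullet> k - gJ Vy (x + h) y \<bullet> k \<le> L\<^sub>f * (\<mu>\<^sub>x * A) * (\<mu>\<^sub>y * B)"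
    using scalar_prod_le_vnorm'[OF minus_carrier_vec[OF gy g'] k] minus_scalar_prod_distrib[OF gy g' k] by linarith
  moreover have "gJ Vy x y \<bullet> k = \<mu>\<^sub>y * ((gb + B\<^sup>2 - eB) / 2)"
    using gy b by (simp add: k_def ipb[symmetric])
  ultimately have 4: "\<mu>\<^sub>y * ((gb + B\<^sup>2 - eB) / 2) - L\<^sub>f * (\<mu>\<^sub>x * A) * (\<mu>\<^sub>y * B) \<le> gJ Vy (x + h) y \<bullet> k" by linarith
  \<comment> \<open>Moving \<open>x\<close> changes the bounds on \<open>P\<close> and on
    \<open>J\<close> by the same first-order term, so the difference keeps only the term with
    \<open>S\<close> and the quadratic ones.\<close>
  have 5: "P (x + h) - J (x + h) (y + k) \<le> \<Delta> + L\<^sub>f * (\<mu>\<^sub>x * A) * S + L * (\<mu>\<^sub>x * A)\<^sup>2 + L\<^sub>f / 2 * (\<mu>\<^sub>x * A)\<^sup>2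
      - \<mu>\<^sub>y * ((gb + B\<^sup>2 - eB) / 2) + L\<^sub>f * (\<mu>\<^sub>x * A) * (\<mu>\<^sub>y * B) + L\<^sub>f / 2 * (\<mu>\<^sub>y * B)\<^sup>2"
    using 1 2 3 4 unfolding \<Delta>_def by linarith
  have LL: "L\<^sub>f \<le> L" "0 < L" using Lf_pos nu_pos by (simp_all add: add_pos_pos)
  define u where "u = L\<^sub>f * (\<mu>\<^sub>x * A) * S"
  have u0: "0 \<le> u" using Lf_pos mx AB S by (simp add: u_def)
  \<comment> \<open>Young's inequality separates \<open>A\<close> from \<open>S\<close>, and PL
    bounds \<open>S\<^sup>2\<close>, which is a multiple of the gap, by the squared
    \<open>y\<close>-gradient. This is the term that fixes the size of \<alpha>.\<close>
  have T1: "(1 + \<alpha>) * u \<le> \<mu>\<^sub>x * (A\<^sup>2 / 4 + 6 * \<kappa>\<^sup>2 * gb)"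
  proof -
    have "(1 + \<alpha>) * u \<le> 2 * u" using al u0 by (intro mult_right_mono) auto
    also have "\<dots> = \<mu>\<^sub>x * (2 * L\<^sub>f * A * S)" by (simp add: u_def)
    also have "\<dots> \<le> \<mu>\<^sub>x * (A\<^sup>2 / 4 + 6 * \<kappa>\<^sup>2 * gb)"
    proof (rule mult_left_mono)
      have "0 \<le> (A / 2 - 2 * L\<^sub>f * S)\<^sup>2" by simp
      hence "2 * L\<^sub>f * A * S \<le> A\<^sup>2 / 4 + 4 * L\<^sub>f\<^sup>2 * S\<^sup>2" by (simp add: power2_eq_square algebra_simps)
      moreover have "4 * L\<^sub>f\<^sup>2 * S\<^sup>2 = 6 * \<kappa>\<^sup>2 * (2 * \<nu> * \<Delta>)"
        unfolding S(2) using nu_pos by (simp add: power_divide power2_eq_square)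
      moreover have "6 * \<kappa>\<^sup>2 * (2 * \<nu> * \<Delta>) \<le> 6 * \<kappa>\<^sup>2 * gb"
        using pl_ineq[OF x y] by (intro mult_left_mono) (auto simp: gb_def \<Delta>_def)
      ultimately show "2 * L\<^sub>f * A * S \<le> A\<^sup>2 / 4 + 6 * \<kappa>\<^sup>2 * gb" by linarith
    qed (use mx in simp)
    finally show ?thesis .
  qed
  have T2: "(1 + \<alpha>) * (L * (\<mu>\<^sub>x * A)\<^sup>2) \<le> \<mu>\<^sub>x * (A\<^sup>2 / 16)"
  proof -
    have "(1 + \<alpha>) * (L * (\<mu>\<^sub>x * A)\<^sup>2) \<le> 2 * (L * (\<mu>\<^sub>x * A)\<^sup>2)" using al LL by (intro mult_right_mono) auto
    also have "\<dots> = (\<mu>\<^sub>x * (32 * L)) * (\<mu>\<^sub>x * (A\<^sup>2 / 16))" by (simp add: power_mult_distrib power2_eq_square)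
    also have "\<dots> \<le> 1 * (\<mu>\<^sub>x * (A\<^sup>2 / 16))" using mx by (intro mult_right_mono) auto
    finally show ?thesis by simp
  qed
  have T3: "\<alpha> * (L\<^sub>f / 2 * (\<mu>\<^sub>x * A)\<^sup>2) \<le> \<mu>\<^sub>x * (A\<^sup>2 / 64)"
  proof -
    have "\<alpha> * (L\<^sub>f / 2 * (\<mu>\<^sub>x * A)\<^sup>2) \<le> 1 * (L / 2 * (\<mu>\<^sub>x * A)\<^sup>2)"
      using al LL Lf_pos by (intro mult_mono mult_right_mono) auto
    also have "\<dots> = (\<mu>\<^sub>x * (32 * L)) * (\<mu>\<^sub>x * (A\<^sup>2 / 64))" by (simp add: power_mult_distrib power2_eq_square)
    also have "\<dots> \<le> 1 * (\<mu>\<^sub>x * (A\<^sup>2 / 64))" using mx by (intro mult_right_mono) auto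
    finally show ?thesis by simp
  qed
  have T4: "\<alpha> * (L\<^sub>f * (\<mu>\<^sub>x * A) * (\<mu>\<^sub>y * B)) \<le> \<mu>\<^sub>x * (A\<^sup>2 / 32 + 2 * B\<^sup>2)"
  proof -
    have "\<alpha> * (L\<^sub>f * (\<mu>\<^sub>x * A) * (\<mu>\<^sub>y * B)) = (16 * \<kappa>\<^sup>2 * \<mu>\<^sub>x) * (L\<^sub>f * (\<mu>\<^sub>x * (A * B)))"
      unfolding al(3)[symmetric] by (simp add: ac_simps)
    also have "\<dots> \<le> \<mu>\<^sub>y * (L\<^sub>f * (\<mu>\<^sub>x * (A * B)))"
      using mx AB Lf_pos by (intro mult_right_mono) (auto simp: ac_simps)
    also have "\<dots> = (\<mu>\<^sub>y * (2 * L\<^sub>f)) * (\<mu>\<^sub>x * (A * B / 2))" by simp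
    also have "\<dots> \<le> 1 * (\<mu>\<^sub>x * (A * B / 2))" using my mx AB by (intro mult_right_mono) auto
    also have "A * B / 2 \<le> A\<^sup>2 / 32 + 2 * B\<^sup>2"
    proof -
      have "0 \<le> (A - 8 * B)\<^sup>2" by simp
      thus ?thesis by (simp add: power2_eq_square algebra_simps)
    qed
    finally show ?thesis using mx by simp
  qed
  have T5: "\<alpha> * (L\<^sub>f / 2 * (\<mu>\<^sub>y * B)\<^sup>2) \<le> \<mu>\<^sub>x * (4 * \<kappa>\<^sup>2 * B\<^sup>2)"
  proof -
    have "\<alpha> * (L\<^sub>f / 2 * (\<mu>\<^sub>y * B)\<^sup>2) = (\<alpha> * \<mu>\<^sub>y) * (L\<^sub>f / 2 * \<mu>\<^sub>y * B\<^sup>2)"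
      by (simp add: power_mult_distrib power2_eq_square)
    also have "\<dots> = (\<mu>\<^sub>y * (2 * L\<^sub>f)) * (\<mu>\<^sub>x * (4 * \<kappa>\<^sup>2 * B\<^sup>2))" unfolding al(3) by simp
    also have "\<dots> \<le> 1 * (\<mu>\<^sub>x * (4 * \<kappa>\<^sup>2 * B\<^sup>2))" using my mx by (intro mult_right_mono) auto
    finally show ?thesis by simp
  qed
  have T6: "\<alpha> * (\<mu>\<^sub>y * ((gb + B\<^sup>2 - eB) / 2)) = \<mu>\<^sub>x * (8 * \<kappa>\<^sup>2 * (gb + B\<^sup>2 - eB))"
    by (simp add: al(3) mult.assoc[symmetric] del: times_divide_eq_right) simp
  have k1: "\<mu>\<^sub>x * (2 * B\<^sup>2) \<le> \<mu>\<^sub>x * (2 * \<kappa>\<^sup>2 * B\<^sup>2)"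
    using kappa_ge mx by (intro mult_left_mono mult_right_mono) (auto simp: one_le_power)
  have "\<alpha> * (P (x + h) - J (x + h) (y + k)) \<le> \<alpha> * (\<Delta> + u + L * (\<mu>\<^sub>x * A)\<^sup>2 + L\<^sub>f / 2 * (\<mu>\<^sub>x * A)\<^sup>2
      - \<mu>\<^sub>y * ((gb + B\<^sup>2 - eB) / 2) + L\<^sub>f * (\<mu>\<^sub>x * A) * (\<mu>\<^sub>y * B) + L\<^sub>f / 2 * (\<mu>\<^sub>y * B)\<^sup>2)"
    using 5 al(1) unfolding u_def by (intro mult_left_mono) auto
  also have "\<dots> = \<alpha> * \<Delta> + \<alpha> * u + \<alpha> * (L * (\<mu>\<^sub>x * A)\<^sup>2) + \<alpha> * (L\<^sub>f / 2 * (\<mu>\<^sub>x * A)\<^sup>2)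
      - \<alpha> * (\<mu>\<^sub>y * ((gb + B\<^sup>2 - eB) / 2)) + \<alpha> * (L\<^sub>f * (\<mu>\<^sub>x * A) * (\<mu>\<^sub>y * B)) + \<alpha> * (L\<^sub>f / 2 * (\<mu>\<^sub>y * B)\<^sup>2)"
    by (simp only: distrib_left right_diff_distrib)
  finally have 6: "\<alpha> * (P (x + h) - J (x + h) (y + k)) \<le> \<alpha> * \<Delta> + \<alpha> * u + \<alpha> * (L * (\<mu>\<^sub>x * A)\<^sup>2)
      + \<alpha> * (L\<^sub>f / 2 * (\<mu>\<^sub>x * A)\<^sup>2) - \<mu>\<^sub>x * (8 * \<kappa>\<^sup>2 * (gb + B\<^sup>2 - eB))
      + \<alpha> * (L\<^sub>f * (\<mu>\<^sub>x * A) * (\<mu>\<^sub>y * B)) + \<alpha> * (L\<^sub>f / 2 * (\<mu>\<^sub>y * B)\<^sup>2)" unfolding T6 .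
  define p q where "p = \<mu>\<^sub>x * A\<^sup>2" and "q = \<mu>\<^sub>x * (\<kappa>\<^sup>2 * B\<^sup>2)"
  define r t where "r = \<mu>\<^sub>x * (\<kappa>\<^sup>2 * gb)" and "t = \<mu>\<^sub>x * (\<kappa>\<^sup>2 * eB)"
  define m n where "m = \<mu>\<^sub>x * ga" and "n = \<mu>\<^sub>x * eA"
  define B2 where "B2 = \<mu>\<^sub>x * B\<^sup>2"
  have p0: "0 \<le> p" using mx by (simp add: p_def)
  have E1: "P (x + h) \<le> P x - (m + p - n) / 2 + u + L * (\<mu>\<^sub>x * A)\<^sup>2"
    using 1 by (simp add: u_def m_def n_def p_def algebra_simps)
  have E6: "\<alpha> * (P (x + h) - J (x + h) (y + k)) \<le> \<alpha> * \<Delta> + \<alpha> * u + \<alpha> * (L * (\<mu>\<^sub>x * A)\<^sup>2)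
      + \<alpha> * (L\<^sub>f / 2 * (\<mu>\<^sub>x * A)\<^sup>2) - (8 * r + 8 * q - 8 * t)
      + \<alpha> * (L\<^sub>f * (\<mu>\<^sub>x * A) * (\<mu>\<^sub>y * B)) + \<alpha> * (L\<^sub>f / 2 * (\<mu>\<^sub>y * B)\<^sup>2)"
  proof -
    have "\<mu>\<^sub>x * (8 * \<kappa>\<^sup>2 * (gb + B\<^sup>2 - eB)) = 8 * r + 8 * q - 8 * t"
      by (simp add: r_def q_def t_def algebra_simps)
    thus ?thesis using 6 by simp
  qed
  have F1: "u + \<alpha> * u \<le> p / 4 + 6 * r" using T1 by (simp add: p_def r_def algebra_simps)
  have F2: "L * (\<mu>\<^sub>x * A)\<^sup>2 + \<alpha> * (L * (\<mu>\<^sub>x * A)\<^sup>2) \<le> p / 16" using T2 unfolding p_def by (simp only: distrib_right) simp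
  have F3: "\<alpha> * (L\<^sub>f / 2 * (\<mu>\<^sub>x * A)\<^sup>2) \<le> p / 64" using T3 by (simp add: p_def)
  have F4: "\<alpha> * (L\<^sub>f * (\<mu>\<^sub>x * A) * (\<mu>\<^sub>y * B)) \<le> p / 32 + 2 * B2"
    using T4 by (simp add: p_def B2_def algebra_simps)
  have F5: "\<alpha> * (L\<^sub>f / 2 * (\<mu>\<^sub>y * B)\<^sup>2) \<le> 4 * q" using T5 by (simp add: q_def ac_simps)
  have F6: "2 * B2 \<le> 2 * q" using k1 by (simp add: B2_def q_def ac_simps)
  have "P (x + h) + \<alpha> * (P (x + h) - J (x + h) (y + k)) + (m / 2 + 2 * r + p / 10 + 2 * q)
      \<le> P x + \<alpha> * \<Delta> + (n / 2 + 8 * t)"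
  proof -
    \<comment> \<open>With the products named, what remains is a linear inequality between the
      names.\<close>
    define c1 c2 c3 c4 c5 c6 c7 where "c1 = L * (\<mu>\<^sub>x * A)\<^sup>2" and "c2 = \<alpha> * (L * (\<mu>\<^sub>x * A)\<^sup>2)"
      and "c3 = \<alpha> * (L\<^sub>f / 2 * (\<mu>\<^sub>x * A)\<^sup>2)" and "c4 = \<alpha> * (L\<^sub>f * (\<mu>\<^sub>x * A) * (\<mu>\<^sub>y * B))"
      and "c5 = \<alpha> * (L\<^sub>f / 2 * (\<mu>\<^sub>y * B)\<^sup>2)" and "c6 = \<alpha> * u"
      and "c7 = \<alpha> * (P (x + h) - J (x + h) (y + k))"
    note c = c2_def c1_def c3_def c4_def c5_def c6_def c7_def
    show ?thesis
      using E1 E6 F1 F2 F3 F4 F5 F6 p0 unfolding c[symmetric]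
      by (argo | linarith | smt (verit))
  qed
  moreover have "m / 2 + 2 * r + p / 10 + 2 * q = \<mu>\<^sub>x * (ga / 2 + 2 * \<kappa>\<^sup>2 * gb + A\<^sup>2 / 10 + 2 * \<kappa>\<^sup>2 * B\<^sup>2)"
    by (simp add: m_def r_def p_def q_def algebra_simps)
  moreover have "n / 2 + 8 * t = \<mu>\<^sub>x * (eA / 2 + 8 * \<kappa>\<^sup>2 * eB)"
    by (simp add: n_def t_def algebra_simps)
  ultimately show ?thesis
    unfolding lyapunov_def xh k_def[symmetric] ga_def[symmetric] gb_def[symmetric] A_def[symmetric]
      B_def[symmetric] eA_def[symmetric] eB_def[symmetric] \<Delta>_def[symmetric] by simp
qed

end

section \<open>Summation of the coupled recursions\<close>

text \<open>The recursion telescopes, and the last value is dropped because it is nonnegative.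
  Dividing by \<open>a\<close> later turns a contraction rate into a bound on the sum.\<close>

lemma contraction_sum_le:
  fixes x f :: "nat \<Rightarrow> real"
  assumes "\<And>i. x (Suc i) \<le> (1 - a) * x i + f i" "\<And>i. 0 \<le> x i"
  shows "a * (\<Sum>i<T. x i) \<le> x 0 + (\<Sum>i<T. f i)"
proof -
  have "a * (\<Sum>i<T. x i) \<le> x 0 - x T + (\<Sum>i<T. f i)"
  proof (induction T)
    case (Suc T)
    show ?case using Suc assms(1)[of T] by (simp add: algebra_simps)
  qed simp
  thus ?thesis using assms(2)[of T] by linarith
qed

text \<open>The sequences are expectations: \<open>V\<close> the Lyapunov function,
  \<open>nx\<close> and \<open>ny\<close> the squared gradients at the centroids, \<open>gx\<close>
  and \<open>gy\<close> the squared mean directions, \<open>cc\<close> the error of the mean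
  estimate, \<open>ss\<close> the summed errors of the agents, \<open>hr\<close> the consensus
  majorant, \<open>dd\<close> and \<open>dG\<close> the squared changes of iterates and estimates.
  There is one loop: \<open>dd\<close> drives \<open>ss\<close> and \<open>dG\<close>, these drive
  \<open>hr\<close>, and \<open>hr\<close> drives \<open>dd\<close>; its gain is governed by
  \<epsilon>. The rest of \<open>dd\<close> consists of directions, which the decrease of
  \<open>V\<close> absorbs.\<close>

lemma summed_recursions:
  fixes V nx ny gx gy cc ss hr dd dG :: "nat \<Rightarrow> real"
    and K b b\<^sub>0 \<beta>\<^sub>m \<beta>\<^sub>q \<rho> m l v\<^sub>1 v\<^sub>2 L\<^sub>f \<kappa> \<mu>\<^sub>x \<mu>\<^sub>y \<sigma>2 N G\<^sub>0 D\<^sub>0 Z :: real and T :: nat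
  assumes nonneg: "\<And>i. 0 \<le> V i" "\<And>i. 0 \<le> gx i" "\<And>i. 0 \<le> gy i" "\<And>i. 0 \<le> cc i" "\<And>i. 0 \<le> ss i"
      "\<And>i. 0 \<le> hr i" "\<And>i. 0 \<le> dd i" "\<And>i. 0 \<le> nx i" "\<And>i. 0 \<le> ny i"
    and H1: "\<And>i. V (Suc i) + \<mu>\<^sub>x * (nx i / 2 + 2 * \<kappa>\<^sup>2 * ny i + gx i / 10 + 2 * \<kappa>\<^sup>2 * gy i)
      \<le> V i + \<mu>\<^sub>x * (16 * \<kappa>\<^sup>2 * cc i + 17 * \<kappa>\<^sup>2 * (L\<^sub>f\<^sup>2 * v\<^sub>1\<^sup>2 * hr i) / K)"
    and H2: "\<And>i. hr (Suc i) \<le> \<rho> * hr i + (v\<^sub>2 * \<mu>\<^sub>y * m * l)\<^sup>2 / (1 - \<rho>) * dG i"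
    and H3: "\<And>i. dG i \<le> 8 * L\<^sub>f\<^sup>2 * dd i + 2 * \<beta>\<^sub>q * ss i + 4 * K * N"
    and H4: "\<And>i. ss (Suc i) \<le> (1 - \<beta>\<^sub>m) * ss i + (4 * L\<^sub>f\<^sup>2 * dd i / b + 4 * K * N)"
    and H5: "\<And>i. cc (Suc i) \<le> (1 - \<beta>\<^sub>m) * cc i + (4 * L\<^sub>f\<^sup>2 * dd i / b + 4 * K * N) / K\<^sup>2"
    and H6: "\<And>i. dd i \<le> K * (\<mu>\<^sub>x\<^sup>2 * gx i + \<mu>\<^sub>y\<^sup>2 * gy i) + 4 * v\<^sub>1\<^sup>2 * hr i"
    and I: "V 0 \<le> G\<^sub>0 + 16 * \<kappa>\<^sup>2 * \<mu>\<^sub>x / \<mu>\<^sub>y * D\<^sub>0" "hr 0 \<le> (v\<^sub>2 * \<mu>\<^sub>y * m)\<^sup>2 * (K * Z)"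
      "ss 0 \<le> 2 * K * \<sigma>2 / b\<^sub>0" "cc 0 \<le> 2 * \<sigma>2 / (K * b\<^sub>0)"
    and pos: "1 \<le> K" "1 \<le> b" "1 \<le> b\<^sub>0" "0 < \<beta>\<^sub>m" "0 \<le> \<beta>\<^sub>q" "\<rho> < 1" "1 \<le> \<kappa>" "0 < \<mu>\<^sub>x" "0 < \<mu>\<^sub>y"
      "0 \<le> \<sigma>2" "0 \<le> N" "0 \<le> G\<^sub>0" "0 \<le> D\<^sub>0" "0 \<le> Z"
    and \<epsilon>: "\<epsilon> = (v\<^sub>1 * v\<^sub>2 * \<mu>\<^sub>y * l * L\<^sub>f * m)\<^sup>2 / (1 - \<rho>)\<^sup>2" "\<epsilon> \<le> 1 / 620" "\<epsilon> * \<beta>\<^sub>q \<le> b * \<beta>\<^sub>m / 576"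
    and E: "\<mu>\<^sub>y\<^sup>2 * L\<^sub>f\<^sup>2 \<le> K * b * \<beta>\<^sub>m / 144" "\<kappa>\<^sup>2 * \<mu>\<^sub>x\<^sup>2 * L\<^sub>f\<^sup>2 \<le> K * b * \<beta>\<^sub>m / 1728"
      "K * (b * \<beta>\<^sub>m) \<le> 1" "\<beta>\<^sub>q \<le> 2 * \<beta>\<^sub>m"
  shows "(\<Sum>i<T. nx i + ny i) \<le> 13120 * (1 + v\<^sub>1\<^sup>2 * v\<^sub>2\<^sup>2) *
    (G\<^sub>0 / \<mu>\<^sub>x + \<kappa>\<^sup>2 * D\<^sub>0 / \<mu>\<^sub>y + \<kappa>\<^sup>2 * (L\<^sub>f\<^sup>2 * m\<^sup>2 / (b * K * \<beta>\<^sub>m * (1 - \<rho>))) * \<mu>\<^sub>y\<^sup>2 * Z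
      + \<kappa>\<^sup>2 * (L\<^sub>f\<^sup>2 * l\<^sup>2 * \<beta>\<^sub>q * m\<^sup>2 / (b * b\<^sub>0 * K * \<beta>\<^sub>m\<^sup>2 * (1 - \<rho>)\<^sup>2)) * \<mu>\<^sub>y\<^sup>2 * \<sigma>2
      + \<kappa>\<^sup>2 * (L\<^sub>f\<^sup>2 * l\<^sup>2 * m\<^sup>2 / (b * K * \<beta>\<^sub>m * (1 - \<rho>)\<^sup>2)) * \<mu>\<^sub>y\<^sup>2 * (real T * N)
      + \<kappa>\<^sup>2 * (\<sigma>2 / (b\<^sub>0 * \<beta>\<^sub>m * K) + real T * N / (K * \<beta>\<^sub>m)))"
proof -
  define S C Hr D Gx Gy where "S = (\<Sum>i<T. ss i)" and "C = (\<Sum>i<T. cc i)" and "Hr = (\<Sum>i<T. hr i)"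
    and "D = (\<Sum>i<T. dd i)" and "Gx = (\<Sum>i<T. gx i)" and "Gy = (\<Sum>i<T. gy i)"
  define nX nY where "nX = (\<Sum>i<T. nx i)" and "nY = (\<Sum>i<T. ny i)"
  have nn: "0 \<le> S" "0 \<le> C" "0 \<le> Hr" "0 \<le> D" "0 \<le> Gx" "0 \<le> Gy" "0 \<le> nX" "0 \<le> nY"
    unfolding S_def C_def Hr_def D_def Gx_def Gy_def nX_def nY_def by (intro sum_nonneg nonneg)+
  define q where "q = b * \<beta>\<^sub>m"
  have q: "0 < q" "K * q \<le> 1" using pos E(3) by (simp_all add: q_def)
  have K: "0 < K" and b: "0 < b" and b0: "0 < b\<^sub>0" and r: "0 < 1 - \<rho>" using pos by auto
  define Dn where "Dn = L\<^sub>f\<^sup>2 * D"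
  define TN where "TN = real T * N"
  have Dn: "0 \<le> Dn" and TN: "0 \<le> TN" using nn pos by (simp_all add: Dn_def TN_def)
  define Hh where "Hh = L\<^sub>f\<^sup>2 * v\<^sub>1\<^sup>2 * Hr"
  have Hh: "0 \<le> Hh" using nn by (simp add: Hh_def)
  have sF: "(\<Sum>i<T. 4 * L\<^sub>f\<^sup>2 * dd i / b + 4 * K * N) = 4 * Dn / b + 4 * K * TN"
    by (simp add: sum.distrib Dn_def D_def TN_def sum_distrib_left sum_divide_distrib mult.assoc)
  have bS: "\<beta>\<^sub>m * S \<le> 2 * K * \<sigma>2 / b\<^sub>0 + (4 * Dn / b + 4 * K * TN)"
    using contraction_sum_le[of ss \<beta>\<^sub>m "\<lambda>i. 4 * L\<^sub>f\<^sup>2 * dd i / b + 4 * K * N" T] H4 nonneg(5) I(3) sF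
    by (simp add: S_def)
  have sF2: "(\<Sum>i<T. (4 * L\<^sub>f\<^sup>2 * dd i / b + 4 * K * N) / K\<^sup>2) = (4 * Dn / b + 4 * K * TN) / K\<^sup>2"
    by (simp add: sum_divide_distrib[symmetric] sF)
  have bC: "\<beta>\<^sub>m * C \<le> 2 * \<sigma>2 / (K * b\<^sub>0) + (4 * Dn / b + 4 * K * TN) / K\<^sup>2"
    using contraction_sum_le[of cc \<beta>\<^sub>m "\<lambda>i. (4 * L\<^sub>f\<^sup>2 * dd i / b + 4 * K * N) / K\<^sup>2" T] H5 nonneg(4) I(4) sF2
    by (simp add: C_def)
  define c2 where "c2 = (v\<^sub>2 * \<mu>\<^sub>y * m * l)\<^sup>2 / (1 - \<rho>)"
  have c2: "0 \<le> c2" using r by (simp add: c2_def)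
  have rH: "(1 - \<rho>) * Hr \<le> (v\<^sub>2 * \<mu>\<^sub>y * m)\<^sup>2 * (K * Z) + c2 * (8 * Dn + 2 * \<beta>\<^sub>q * S + 4 * K * TN)"
  proof -
    have "hr (Suc i) \<le> (1 - (1 - \<rho>)) * hr i + c2 * (8 * L\<^sub>f\<^sup>2 * dd i + 2 * \<beta>\<^sub>q * ss i + 4 * K * N)" for i
      using H2[of i] mult_left_mono[OF H3[of i] c2] by (simp add: c2_def)
    from contraction_sum_le[of hr, OF this nonneg(6), of T]
    have "(1 - \<rho>) * Hr \<le> hr 0 + c2 * (\<Sum>i<T. 8 * L\<^sub>f\<^sup>2 * dd i + 2 * \<beta>\<^sub>q * ss i + 4 * K * N)"
      by (simp only: Hr_def sum_distrib_left[symmetric])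
    moreover have "(\<Sum>i<T. 8 * L\<^sub>f\<^sup>2 * dd i + 2 * \<beta>\<^sub>q * ss i + 4 * K * N) = 8 * Dn + 2 * \<beta>\<^sub>q * S + 4 * K * TN"
      by (simp add: sum.distrib Dn_def D_def S_def TN_def sum_distrib_left mult.assoc)
    ultimately have "(1 - \<rho>) * Hr \<le> hr 0 + c2 * (8 * Dn + 2 * \<beta>\<^sub>q * S + 4 * K * TN)"
      by simp
    thus ?thesis using I(2) by linarith
  qed
  define A0 where "A0 = L\<^sub>f\<^sup>2 * v\<^sub>1\<^sup>2 * ((v\<^sub>2 * \<mu>\<^sub>y * m)\<^sup>2 * (K * Z)) / (1 - \<rho>)"
  have A0: "0 \<le> A0" using K pos r by (simp add: A0_def)
  have e0: "0 \<le> \<epsilon>" using \<epsilon>(1) by simp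
  have H: "Hh \<le> A0 + \<epsilon> * (8 * Dn + 2 * \<beta>\<^sub>q * S + 4 * K * TN)"
  proof -
    have "Hr \<le> ((v\<^sub>2 * \<mu>\<^sub>y * m)\<^sup>2 * (K * Z) + c2 * (8 * Dn + 2 * \<beta>\<^sub>q * S + 4 * K * TN)) / (1 - \<rho>)"
      using rH r by (simp add: pos_le_divide_eq mult.commute)
    hence "Hh \<le> L\<^sub>f\<^sup>2 * v\<^sub>1\<^sup>2 * (((v\<^sub>2 * \<mu>\<^sub>y * m)\<^sup>2 * (K * Z) + c2 * (8 * Dn + 2 * \<beta>\<^sub>q * S + 4 * K * TN)) / (1 - \<rho>))"
      unfolding Hh_def by (intro mult_left_mono) auto
    also have "\<dots> = A0 + (L\<^sub>f\<^sup>2 * v\<^sub>1\<^sup>2 * c2 / (1 - \<rho>)) * (8 * Dn + 2 * \<beta>\<^sub>q * S + 4 * K * TN)"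
      using r by (simp add: A0_def add_divide_distrib distrib_left)
    also have "L\<^sub>f\<^sup>2 * v\<^sub>1\<^sup>2 * c2 / (1 - \<rho>) = \<epsilon>"
      unfolding \<epsilon>(1) c2_def by (simp add: power_mult_distrib power2_eq_square ac_simps)
    finally show ?thesis .
  qed
  define A1 where "A1 = 4 * \<epsilon> * \<beta>\<^sub>q * K * \<sigma>2 / (b\<^sub>0 * \<beta>\<^sub>m)"
  have A1: "0 \<le> A1" using e0 pos by (simp add: A1_def)
  \<comment> \<open>Solving the recursion of \<open>ss\<close> costs a factor
    \<open>1 / \<beta>\<^sub>m\<close>. The last bound on \<epsilon> turns the coefficient of
    \<open>Dn\<close> into 8/576, and \<open>\<beta>\<^sub>q \<le> 2 * \<beta>\<^sub>m\<close> turns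
    that of the noise into 16.\<close>
  have S2: "2 * \<epsilon> * \<beta>\<^sub>q * S \<le> A1 + 8 / 576 * Dn + 16 * \<epsilon> * K * TN"
  proof -
    have "S \<le> (2 * K * \<sigma>2 / b\<^sub>0 + (4 * Dn / b + 4 * K * TN)) / \<beta>\<^sub>m"
      using bS pos by (simp add: pos_le_divide_eq mult.commute)
    hence "2 * \<epsilon> * \<beta>\<^sub>q * S \<le> 2 * \<epsilon> * \<beta>\<^sub>q * ((2 * K * \<sigma>2 / b\<^sub>0 + (4 * Dn / b + 4 * K * TN)) / \<beta>\<^sub>m)"
      using e0 pos by (intro mult_left_mono) auto
    also have "\<dots> = A1 + 8 * (\<epsilon> * \<beta>\<^sub>q / q) * Dn + 8 * (\<beta>\<^sub>q / \<beta>\<^sub>m) * (\<epsilon> * K * TN)"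
      using pos by (simp add: A1_def q_def add_divide_distrib distrib_left ac_simps)
    also have "\<epsilon> * \<beta>\<^sub>q / q \<le> 1 / 576" using \<epsilon>(3) q by (simp add: q_def divide_le_eq)
    also have "\<beta>\<^sub>q / \<beta>\<^sub>m \<le> 2" using E(4) pos by (simp add: divide_le_eq)
    finally show ?thesis using Dn e0 K TN by (simp add: mult_right_mono ac_simps)
  qed
  define X where "X = L\<^sub>f\<^sup>2 * (\<mu>\<^sub>x\<^sup>2 * Gx + \<mu>\<^sub>y\<^sup>2 * Gy)"
  have X: "0 \<le> X" using nn by (simp add: X_def)
  have DX: "Dn \<le> K * X + 4 * Hh"
  proof -
    have "D \<le> (\<Sum>i<T. K * (\<mu>\<^sub>x\<^sup>2 * gx i + \<mu>\<^sub>y\<^sup>2 * gy i) + 4 * v\<^sub>1\<^sup>2 * hr i)"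
      unfolding D_def by (rule sum_mono) (rule H6)
    also have "\<dots> = K * (\<mu>\<^sub>x\<^sup>2 * Gx + \<mu>\<^sub>y\<^sup>2 * Gy) + 4 * v\<^sub>1\<^sup>2 * Hr"
      by (simp add: sum.distrib Gx_def Gy_def Hr_def flip: sum_distrib_left)
    finally have "Dn \<le> L\<^sub>f\<^sup>2 * (K * (\<mu>\<^sub>x\<^sup>2 * Gx + \<mu>\<^sub>y\<^sup>2 * Gy) + 4 * v\<^sub>1\<^sup>2 * Hr)"
      unfolding Dn_def by (intro mult_left_mono) auto
    thus ?thesis by (simp add: X_def Hh_def distrib_left ac_simps)
  qed
  define R where "R = A0 + A1 + 20 * \<epsilon> * K * TN"
  have R: "0 \<le> R" using A0 A1 e0 K TN by (simp add: R_def)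
  \<comment> \<open>The coefficient of \<open>Dn\<close> is at most 8/620 + 8/576, about 0.0268.
    Inserting \<open>DX\<close> moves four times this to the left and leaves about 0.893 of
    \<open>Hh\<close> there. The inverse of 0.893 is below 6/5, and 0.0268 / 0.893 is below
    1/32.\<close>
  have HhR: "Hh \<le> 6 / 5 * R + K * X / 32"
  proof -
    have "\<epsilon> * (8 * Dn) \<le> 1 / 620 * (8 * Dn)" using \<epsilon>(2) Dn by (intro mult_right_mono) auto
    moreover have "\<epsilon> * (8 * Dn + 2 * \<beta>\<^sub>q * S + 4 * K * TN) = \<epsilon> * (8 * Dn) + 2 * \<epsilon> * \<beta>\<^sub>q * S + 4 * \<epsilon> * K * TN"
      by (simp add: distrib_left ac_simps)
    moreover have "0 \<le> K * X" using K X by simp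
    moreover have "16 * \<epsilon> * K * TN = 16 * (\<epsilon> * K * TN)" "4 * \<epsilon> * K * TN = 4 * (\<epsilon> * K * TN)"
      "20 * \<epsilon> * K * TN = 20 * (\<epsilon> * K * TN)" by auto
    ultimately show ?thesis using H S2 DX R unfolding R_def by argo
  qed
  have Csum: "16 * \<kappa>\<^sup>2 * C \<le> 32 * \<kappa>\<^sup>2 * \<sigma>2 / (K * b\<^sub>0 * \<beta>\<^sub>m) + 64 * (\<kappa>\<^sup>2 / (K\<^sup>2 * q)) * Dn + 64 * \<kappa>\<^sup>2 * TN / (K * \<beta>\<^sub>m)"
  proof -
    have "C \<le> (2 * \<sigma>2 / (K * b\<^sub>0) + (4 * Dn / b + 4 * K * TN) / K\<^sup>2) / \<beta>\<^sub>m"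
      using bC pos by (simp add: pos_le_divide_eq mult.commute)
    hence "16 * \<kappa>\<^sup>2 * C \<le> 16 * \<kappa>\<^sup>2 * ((2 * \<sigma>2 / (K * b\<^sub>0) + (4 * Dn / b + 4 * K * TN) / K\<^sup>2) / \<beta>\<^sub>m)"
      by (intro mult_left_mono) auto
    also have "\<dots> = 32 * \<kappa>\<^sup>2 * \<sigma>2 / (K * b\<^sub>0 * \<beta>\<^sub>m) + 64 * (\<kappa>\<^sup>2 / (K\<^sup>2 * q)) * Dn + 64 * \<kappa>\<^sup>2 * TN / (K * \<beta>\<^sub>m)"
      using K b pos by (simp add: q_def field_simps power2_eq_square)
    finally show ?thesis .
  qed
  \<comment> \<open>The weight with which \<open>dd\<close> enters through the error of the mean
    estimate. Since \<open>K * q \<le> 1\<close>, it also dominates the weight of the direct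
    consensus error.\<close>
  define w where "w = \<kappa>\<^sup>2 / (K\<^sup>2 * q)"
  have w: "0 \<le> w" using q by (simp add: w_def)
  have Kw: "\<kappa>\<^sup>2 / K \<le> w"
  proof -
    have "K\<^sup>2 * q \<le> K" using q K mult_left_mono[of "K * q" 1 K] by (simp add: power2_eq_square)
    thus ?thesis unfolding w_def using q K by (intro divide_left_mono) auto
  qed
  have main: "nX / 2 + 2 * \<kappa>\<^sup>2 * nY + Gx / 10 + 2 * \<kappa>\<^sup>2 * Gy \<le> V 0 / \<mu>\<^sub>x + (16 * \<kappa>\<^sup>2 * C + 17 * (\<kappa>\<^sup>2 / K) * Hh)"
  proof -
    have "V T + \<mu>\<^sub>x * (\<Sum>i<T. nx i / 2 + 2 * \<kappa>\<^sup>2 * ny i + gx i / 10 + 2 * \<kappa>\<^sup>2 * gy i)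
      \<le> V 0 + \<mu>\<^sub>x * (\<Sum>i<T. 16 * \<kappa>\<^sup>2 * cc i + 17 * \<kappa>\<^sup>2 * (L\<^sub>f\<^sup>2 * v\<^sub>1\<^sup>2 * hr i) / K)"
    proof (induction T)
      case (Suc T)
      show ?case using Suc H1[of T] by (simp add: distrib_left)
    qed simp
    hence "\<mu>\<^sub>x * (\<Sum>i<T. nx i / 2 + 2 * \<kappa>\<^sup>2 * ny i + gx i / 10 + 2 * \<kappa>\<^sup>2 * gy i)
      \<le> \<mu>\<^sub>x * (V 0 / \<mu>\<^sub>x + (\<Sum>i<T. 16 * \<kappa>\<^sup>2 * cc i + 17 * \<kappa>\<^sup>2 * (L\<^sub>f\<^sup>2 * v\<^sub>1\<^sup>2 * hr i) / K))"
      using nonneg(1)[of T] pos by (simp add: distrib_left)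
    hence "(\<Sum>i<T. nx i / 2 + 2 * \<kappa>\<^sup>2 * ny i + gx i / 10 + 2 * \<kappa>\<^sup>2 * gy i)
      \<le> V 0 / \<mu>\<^sub>x + (\<Sum>i<T. 16 * \<kappa>\<^sup>2 * cc i + 17 * \<kappa>\<^sup>2 * (L\<^sub>f\<^sup>2 * v\<^sub>1\<^sup>2 * hr i) / K)"
      using pos by simp
    moreover have "(\<Sum>i<T. nx i / 2 + 2 * \<kappa>\<^sup>2 * ny i + gx i / 10 + 2 * \<kappa>\<^sup>2 * gy i)
      = nX / 2 + 2 * \<kappa>\<^sup>2 * nY + Gx / 10 + 2 * \<kappa>\<^sup>2 * Gy"
      by (simp add: sum.distrib nX_def nY_def Gx_def Gy_def sum_divide_distrib sum_distrib_left)
    moreover have "(\<Sum>i<T. 16 * \<kappa>\<^sup>2 * cc i + 17 * \<kappa>\<^sup>2 * (L\<^sub>f\<^sup>2 * v\<^sub>1\<^sup>2 * hr i) / K) = 16 * \<kappa>\<^sup>2 * C + 17 * (\<kappa>\<^sup>2 / K) * Hh"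
    proof -
      have "17 * \<kappa>\<^sup>2 * (L\<^sub>f\<^sup>2 * v\<^sub>1\<^sup>2 * hr i) / K = 17 * (\<kappa>\<^sup>2 / K) * (L\<^sub>f\<^sup>2 * v\<^sub>1\<^sup>2) * hr i" for i by simp
      hence "(\<Sum>i<T. 16 * \<kappa>\<^sup>2 * cc i + 17 * \<kappa>\<^sup>2 * (L\<^sub>f\<^sup>2 * v\<^sub>1\<^sup>2 * hr i) / K)
          = (\<Sum>i<T. 16 * \<kappa>\<^sup>2 * cc i) + (\<Sum>i<T. 17 * (\<kappa>\<^sup>2 / K) * (L\<^sub>f\<^sup>2 * v\<^sub>1\<^sup>2) * hr i)"
        by (simp only: sum.distrib)
      also have "\<dots> = 16 * \<kappa>\<^sup>2 * C + 17 * (\<kappa>\<^sup>2 / K) * (L\<^sub>f\<^sup>2 * v\<^sub>1\<^sup>2) * Hr"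
        unfolding C_def Hr_def by (simp only: sum_distrib_left)
      finally show ?thesis by (simp add: Hh_def mult.assoc)
    qed
    ultimately show ?thesis by simp
  qed
  define E0 where "E0 = 32 * \<kappa>\<^sup>2 * \<sigma>2 / (K * b\<^sub>0 * \<beta>\<^sub>m) + 64 * \<kappa>\<^sup>2 * TN / (K * \<beta>\<^sub>m)"
  \<comment> \<open>There are 256 + 17 = 273 copies of \<open>w * Hh\<close>. Six fifths of 273 is
    below 328, and 64 + 273/32 is below 73.\<close>
  have tot: "16 * \<kappa>\<^sup>2 * C + 17 * (\<kappa>\<^sup>2 / K) * Hh \<le> E0 + 328 * (w * R) + 73 * (w * (K * X))"
  proof -
    have a: "64 * (w * Dn) \<le> 64 * (w * (K * X)) + 256 * (w * Hh)"
      using mult_left_mono[OF DX w] by (simp add: distrib_left)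
    define y where "y = 17 * (\<kappa>\<^sup>2 / K) * Hh"
    have c: "y \<le> 17 * (w * Hh)" using mult_right_mono[OF Kw Hh] by (simp add: y_def)
    have d: "273 * (w * Hh) \<le> 1638 / 5 * (w * R) + 273 / 32 * (w * (K * X))"
      using mult_left_mono[OF HhR w] by (simp add: distrib_left)
    have e: "16 * \<kappa>\<^sup>2 * C \<le> E0 + 64 * (w * Dn)"
      using Csum by (simp add: E0_def w_def)
    have "0 \<le> w * R" "0 \<le> w * (K * X)" using w R K X by auto
    thus ?thesis using a c d e unfolding y_def[symmetric] by linarith
  qed
  \<comment> \<open>73/1728 is below 1/10 and 73/144 is below 2, so the directions fed back are
    covered by those on the left of \<open>main\<close>.\<close>
  have Xle: "73 * (w * (K * X)) \<le> Gx / 10 + 2 * \<kappa>\<^sup>2 * Gy"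
  proof -
    have wK: "w * (K * X) = (\<kappa>\<^sup>2 * \<mu>\<^sub>x\<^sup>2 * L\<^sub>f\<^sup>2) / (K * q) * Gx + (\<mu>\<^sub>y\<^sup>2 * L\<^sub>f\<^sup>2) / (K * q) * (\<kappa>\<^sup>2 * Gy)"
      using K q by (simp add: w_def X_def field_simps power2_eq_square)
    have "(\<kappa>\<^sup>2 * \<mu>\<^sub>x\<^sup>2 * L\<^sub>f\<^sup>2) / (K * q) \<le> 1 / 1728" "(\<mu>\<^sub>y\<^sup>2 * L\<^sub>f\<^sup>2) / (K * q) \<le> 1 / 144"
      using E(1,2) K q by (simp_all add: divide_le_eq q_def mult.assoc)
    hence "w * (K * X) \<le> 1 / 1728 * Gx + 1 / 144 * (\<kappa>\<^sup>2 * Gy)"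
      unfolding wK using nn by (intro add_mono mult_right_mono) auto
    moreover have "0 \<le> \<kappa>\<^sup>2 * Gy" using nn by simp
    ultimately show ?thesis using nn(5) by simp
  qed
  have k1: "2 * nY \<le> 2 * \<kappa>\<^sup>2 * nY" using pos nn by (intro mult_right_mono) (auto simp: one_le_power)
  have half: "(nX + nY) / 2 \<le> V 0 / \<mu>\<^sub>x + E0 + 328 * (w * R)"
    using main tot Xle k1 nn(7,8) by argo
  define v where "v = v\<^sub>1\<^sup>2 * v\<^sub>2\<^sup>2"
  have v: "0 \<le> v" by (simp add: v_def)
  define B1 B2 B3 B4 where "B1 = \<kappa>\<^sup>2 * (L\<^sub>f\<^sup>2 * m\<^sup>2 / (b * K * \<beta>\<^sub>m * (1 - \<rho>))) * \<mu>\<^sub>y\<^sup>2 * Z"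
    and "B2 = \<kappa>\<^sup>2 * (L\<^sub>f\<^sup>2 * l\<^sup>2 * \<beta>\<^sub>q * m\<^sup>2 / (b * b\<^sub>0 * K * \<beta>\<^sub>m\<^sup>2 * (1 - \<rho>)\<^sup>2)) * \<mu>\<^sub>y\<^sup>2 * \<sigma>2"
    and "B3 = \<kappa>\<^sup>2 * (L\<^sub>f\<^sup>2 * l\<^sup>2 * m\<^sup>2 / (b * K * \<beta>\<^sub>m * (1 - \<rho>)\<^sup>2)) * \<mu>\<^sub>y\<^sup>2 * TN"
    and "B4 = \<kappa>\<^sup>2 * (\<sigma>2 / (b\<^sub>0 * \<beta>\<^sub>m * K) + TN / (K * \<beta>\<^sub>m))"
  have Bnn: "0 \<le> B1" "0 \<le> B2" "0 \<le> B3" "0 \<le> B4"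
    using pos r K b b0 TN by (simp_all add: B1_def B2_def B3_def B4_def)
  have wR: "w * R = v * (B1 + 4 * B2 + 20 * B3)"
  proof -
    have "w * A0 = v * B1"
      using K q r pos by (simp add: w_def A0_def v_def B1_def q_def field_simps power2_eq_square)
    moreover have "w * A1 = v * (4 * B2)"
      using K q r pos b b0 unfolding A1_def \<epsilon>(1)
      by (simp add: w_def v_def B2_def q_def divide_simps power2_eq_square)
    moreover have "w * (20 * \<epsilon> * K * TN) = v * (20 * B3)"
      using K q r pos b unfolding \<epsilon>(1)
      by (simp add: w_def v_def B3_def q_def divide_simps power2_eq_square)
    ultimately show ?thesis by (simp add: R_def distrib_left)
  qed
  have E0B: "E0 \<le> 64 * B4"
  proof -
    define e1 e2 where "e1 = \<kappa>\<^sup>2 * (\<sigma>2 / (b\<^sub>0 * \<beta>\<^sub>m * K))" and "e2 = \<kappa>\<^sup>2 * (TN / (K * \<beta>\<^sub>m))"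
    have "E0 = 32 * e1 + 64 * e2" by (simp add: E0_def e1_def e2_def ac_simps)
    moreover have "0 \<le> e1" using pos K b0 by (simp add: e1_def)
    moreover have "B4 = e1 + e2" by (simp add: B4_def e1_def e2_def distrib_left)
    ultimately show ?thesis by simp
  qed
  define V1 V2 where "V1 = G\<^sub>0 / \<mu>\<^sub>x" and "V2 = \<kappa>\<^sup>2 * D\<^sub>0 / \<mu>\<^sub>y"
  have Vnn: "0 \<le> V1" "0 \<le> V2" using pos by (simp_all add: V1_def V2_def)
  have V0: "V 0 / \<mu>\<^sub>x \<le> V1 + 16 * V2"
  proof -
    have "V 0 / \<mu>\<^sub>x \<le> (G\<^sub>0 + 16 * \<kappa>\<^sup>2 * \<mu>\<^sub>x / \<mu>\<^sub>y * D\<^sub>0) / \<mu>\<^sub>x" using I(1) pos by (intro divide_right_mono) auto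
    also have "\<dots> = V1 + 16 * V2" using pos by (simp add: V1_def V2_def add_divide_distrib)
    finally show ?thesis .
  qed
  have "nX + nY \<le> 2 * (V1 + 16 * V2 + 64 * B4 + 328 * (v * (B1 + 4 * B2 + 20 * B3)))"
    using half V0 E0B unfolding wR by argo
  \<comment> \<open>The largest coefficient is 2 * 328 * 20 = 13120. The terms from the consensus
    error carry the factor \<open>v\<close> and the others do not; the two products cover both
    kinds.\<close>
  also have "\<dots> \<le> 13120 * (V1 + V2 + B1 + B2 + B3 + B4) + 13120 * (v * (V1 + V2 + B1 + B2 + B3 + B4))"
  proof -
    have "0 \<le> v * V1" "0 \<le> v * V2" "0 \<le> v * B1" "0 \<le> v * B2" "0 \<le> v * B3" "0 \<le> v * B4"
      using v Vnn Bnn by auto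
    thus ?thesis using Vnn Bnn by (simp add: algebra_simps)
  qed
  also have "\<dots> = 13120 * (1 + v) * (V1 + V2 + B1 + B2 + B3 + B4)" by (simp add: algebra_simps)
  finally show ?thesis
    unfolding v_def V1_def V2_def B1_def B2_def B3_def B4_def TN_def nX_def nY_def
    by (simp add: sum.distrib)
qed

section \<open>Freezing independent samples\<close>

text \<open>For a centred random vector the mixed terms with a fixed shift integrate to 0, so the
  second moments add. The bound is allowed to be infinite; if it is finite it supplies the square
  integrability that the expansion requires.\<close>

lemma translated_second_moment:
  fixes f :: "nat \<Rightarrow> 'z \<Rightarrow> real" and u :: "nat \<Rightarrow> real"
  assumes N: "prob_space N" and int: "\<And>j. j < d \<Longrightarrow> integrable N (f j)"
    and zero: "\<And>j. j < d \<Longrightarrow> (\<integral>z. f j z \<partial>N) = 0"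
    and V: "(\<integral>\<^sup>+z. ennreal (\<Sum>j<d. (f j z)\<^sup>2) \<partial>N) \<le> V"
  shows "(\<integral>\<^sup>+z. ennreal (\<Sum>j<d. (u j + f j z)\<^sup>2) \<partial>N) \<le> ennreal (\<Sum>j<d. (u j)\<^sup>2) + V"
proof (cases "V = \<infinity>")
  case False
  interpret prob_space N by (rule N)
  have fin: "(\<integral>\<^sup>+z. ennreal (\<Sum>j<d. (f j z)\<^sup>2) \<partial>N) < \<infinity>"
    using V False by (simp add: less_top le_less_trans)
  have m: "f j \<in> borel_measurable N" if "j < d" for j using int[OF that] by simp
  have sq: "integrable N (\<lambda>z. (f j z)\<^sup>2)" if j: "j < d" for j
  proof (rule integrableI_bounded)
    have "(\<integral>\<^sup>+z. ennreal (norm ((f j z)\<^sup>2)) \<partial>N) \<le> (\<integral>\<^sup>+z. ennreal (\<Sum>j<d. (f j z)\<^sup>2) \<partial>N)"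
      using j by (intro nn_integral_mono ennreal_leI)
        (simp, intro member_le_sum[of j "{..<d}" "\<lambda>j. (f j _)\<^sup>2"], auto)
    thus "(\<integral>\<^sup>+z. ennreal (norm ((f j z)\<^sup>2)) \<partial>N) < \<infinity>" using fin by (rule le_less_trans)
  qed (use m[OF j] in simp)
  have e: "(\<Sum>j<d. (u j + f j z)\<^sup>2) = (\<Sum>j<d. (u j)\<^sup>2) + (\<Sum>j<d. 2 * u j * f j z) + (\<Sum>j<d. (f j z)\<^sup>2)" for z
    by (simp add: power2_sum sum.distrib ac_simps)
  have i1: "integrable N (\<lambda>z. \<Sum>j<d. 2 * u j * f j z)" and i2: "integrable N (\<lambda>z. \<Sum>j<d. (f j z)\<^sup>2)"
    using int sq by (auto intro!: Bochner_Integration.integrable_sum)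
  have i3: "integrable N (\<lambda>z. \<Sum>j<d. (u j + f j z)\<^sup>2)"
    unfolding e by (intro Bochner_Integration.integrable_add i1 i2) simp
  have "(\<integral>z. (\<Sum>j<d. (u j + f j z)\<^sup>2) \<partial>N)
      = (\<Sum>j<d. (u j)\<^sup>2) + (\<integral>z. (\<Sum>j<d. 2 * u j * f j z) \<partial>N) + (\<integral>z. (\<Sum>j<d. (f j z)\<^sup>2) \<partial>N)"
    unfolding e using i1 i2 by (simp add: prob_space)
  also have "(\<integral>z. (\<Sum>j<d. 2 * u j * f j z) \<partial>N) = 0"
    using int zero by (subst Bochner_Integration.integral_sum) auto
  finally have v: "(\<integral>z. (\<Sum>j<d. (u j + f j z)\<^sup>2) \<partial>N) = (\<Sum>j<d. (u j)\<^sup>2) + (\<integral>z. (\<Sum>j<d. (f j z)\<^sup>2) \<partial>N)" by simp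
  have "(\<integral>\<^sup>+z. ennreal (\<Sum>j<d. (u j + f j z)\<^sup>2) \<partial>N) = ennreal (\<integral>z. (\<Sum>j<d. (u j + f j z)\<^sup>2) \<partial>N)"
    by (rule nn_integral_eq_integral[OF i3]) (auto intro!: AE_I2 sum_nonneg)
  also have "\<dots> = ennreal (\<Sum>j<d. (u j)\<^sup>2) + ennreal (\<integral>z. (\<Sum>j<d. (f j z)\<^sup>2) \<partial>N)"
    unfolding v by (intro ennreal_plus sum_nonneg integral_nonneg_AE AE_I2) auto
  also have "ennreal (\<integral>z. (\<Sum>j<d. (f j z)\<^sup>2) \<partial>N) = (\<integral>\<^sup>+z. ennreal (\<Sum>j<d. (f j z)\<^sup>2) \<partial>N)"
    by (rule nn_integral_eq_integral[symmetric, OF i2]) (auto intro!: AE_I2 sum_nonneg)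
  finally show ?thesis using V by (simp add: add_left_mono)
qed simp

section \<open>Sigma-algebras generated by sets of sources\<close>

locale sampled_problem =
  fixes pb :: "'z problem" and par :: params and rn :: "('w, 'z) randomness"
  assumes samp: "sampling pb par rn"
begin

abbreviation "M \<equiv> probM rn"
abbreviation "srcs \<equiv> sources pb par"
abbreviation "evts \<equiv> source_events pb rn"

sublocale prob_space M
  using samp by (simp add: sampling_def)

text \<open>Only the measurable sets of this space matter. Indexing by sets of sources, and not by
  time, makes it possible to separate the samples of one iteration from each other.\<close>

definition alg :: "source set \<Rightarrow> 'w measure" where
  "alg S = sigma (space M) (\<Union>src\<in>S. evts src)"

lemma vimage_events:
  assumes "f \<in> measurable M N"
  shows "sets (vimage_algebra (space M) f N) = {f -` A \<inter> space M | A. A \<in> sets N}"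
  by (rule sets_vimage_algebra2) (use assms in \<open>auto dest: measurable_space\<close>)

lemma mini_measurable [measurable]:
  "Mini i k s \<in> srcs \<Longrightarrow> mini rn i k s \<in> measurable M (sample_space pb)"
  and mini_distr: "Mini i k s \<in> srcs \<Longrightarrow> distr M (sample_space pb) (mini rn i k s) = sample_law pb k"
  and big_measurable [measurable]:
  "Big i k s \<in> srcs \<Longrightarrow> big rn i k s \<in> measurable M (sample_space pb)"
  and big_distr: "Big i k s \<in> srcs \<Longrightarrow> distr M (sample_space pb) (big rn i k s) = sample_law pb k"
  and coin_measurable: "Coin i \<in> srcs \<Longrightarrow> coin rn i \<in> measurable M (count_space UNIV)"
  and coin_distr: "Coin i \<in> srcs \<Longrightarrow>
    distr M (count_space UNIV) (coin rn i) = measure_pmf (bernoulli_pmf (coin_prob par))"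
  and indep: "indep_sets evts srcs"
  using samp unfolding sampling_def by blast+

lemma past0_sub: "subalgebra M (past0 rn)"
  using samp by (simp add: sampling_def)

lemma event_cases:
  assumes "src \<in> srcs"
  obtains "src = Initial" "evts src = sets (past0 rn)"
  | i where "src = Coin i" "evts src = {coin rn i -` A \<inter> space M | A. A \<in> sets (count_space UNIV)}"
  | i k s where "src = Mini i k s" "evts src = {mini rn i k s -` A \<inter> space M | A. A \<in> sets (sample_space pb)}"
  | i k s where "src = Big i k s" "evts src = {big rn i k s -` A \<inter> space M | A. A \<in> sets (sample_space pb)}"
proof (cases src)
  case Initial
  thus ?thesis using that(1) by (simp add: source_events_def)
next
  case (Coin i)
  thus ?thesis using that(2) assms vimage_events[OF coin_measurable] by (simp add: source_events_def)
next
  case (Mini i k s)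
  thus ?thesis using that(3) assms vimage_events[OF mini_measurable] by (simp add: source_events_def)
next
  case (Big i k s)
  thus ?thesis using that(4) assms vimage_events[OF big_measurable] by (simp add: source_events_def)
qed

lemma events_sub:
  assumes src: "src \<in> srcs" shows "evts src \<subseteq> sets M"
  using src
proof (cases rule: event_cases)
  case 1
  thus ?thesis using past0_sub by (simp add: subalgebra_def)
next
  case (2 i)
  thus ?thesis using src measurable_sets[OF coin_measurable] by auto
next
  case (3 i k s)
  thus ?thesis using src measurable_sets[OF mini_measurable] by auto
next
  case (4 i k s)
  thus ?thesis using src measurable_sets[OF big_measurable] by auto
qed

lemma events_Int_stable: "src \<in> srcs \<Longrightarrow> Int_stable (evts src)"
  by (cases src) (auto simp: source_events_def sets.Int_stable)

lemma events_Pow: "S \<subseteq> srcs \<Longrightarrow> (\<Union>src\<in>S. evts src) \<subseteq> Pow (space M)"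
  using events_sub sets.sets_into_space by blast

lemma space_alg [simp]: "space (alg S) = space M"
  by (simp add: alg_def space_measure_of_conv)

lemma sets_alg: "S \<subseteq> srcs \<Longrightarrow> sets (alg S) = sigma_sets (space M) (\<Union>src\<in>S. evts src)"
  by (simp add: alg_def events_Pow)

lemma alg_mono: "S \<subseteq> S' \<Longrightarrow> S' \<subseteq> srcs \<Longrightarrow> sets (alg S) \<subseteq> sets (alg S')"
  by (subst (1 2) sets_alg) (auto intro!: sigma_sets_mono' )

lemma alg_sub: "S \<subseteq> srcs \<Longrightarrow> sets (alg S) \<subseteq> sets M"
  unfolding sets_alg by (intro sets.sigma_sets_subset) (use events_sub in blast)

lemma measurable_alg_mono:
  assumes "f \<in> measurable (alg S) N" "S \<subseteq> S'" "S' \<subseteq> srcs"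
  shows "f \<in> measurable (alg S') N"
  using assms alg_mono[OF assms(2,3)] by (auto simp: measurable_def)

lemma measurable_alg_M:
  assumes "f \<in> measurable (alg S) N" "S \<subseteq> srcs" shows "f \<in> measurable M N"
  using assms alg_sub[OF assms(2)] by (auto simp: measurable_def)

lemma measurable_from_events:
  assumes "src \<in> S" "S \<subseteq> srcs" "f \<in> space M \<rightarrow> space N" "\<And>A. A \<in> sets N \<Longrightarrow> f -` A \<inter> space M \<in> evts src"
  shows "f \<in> measurable (alg S) N"
proof (rule measurableI)
  fix A assume "A \<in> sets N"
  hence "f -` A \<inter> space M \<in> (\<Union>src\<in>S. evts src)" using assms by blast
  thus "f -` A \<inter> space (alg S) \<in> sets (alg S)" using sets_alg[OF assms(2)] by auto
qed (use assms in auto)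

lemma coin_alg: "Coin i \<in> S \<Longrightarrow> S \<subseteq> srcs \<Longrightarrow> coin rn i \<in> measurable (alg S) (count_space UNIV)"
  by (rule measurable_from_events[where src = "Coin i"])
    (auto simp: source_events_def vimage_events[OF coin_measurable] subset_iff)

lemma mini_alg: "Mini i k s \<in> S \<Longrightarrow> S \<subseteq> srcs \<Longrightarrow> mini rn i k s \<in> measurable (alg S) (sample_space pb)"
  by (rule measurable_from_events[where src = "Mini i k s"])
    (auto simp: source_events_def vimage_events[OF mini_measurable] subset_iff
      dest: measurable_space[OF mini_measurable])

lemma big_alg: "Big i k s \<in> S \<Longrightarrow> S \<subseteq> srcs \<Longrightarrow> big rn i k s \<in> measurable (alg S) (sample_space pb)"
  by (rule measurable_from_events[where src = "Big i k s"])
    (auto simp: source_events_def vimage_events[OF big_measurable] subset_iff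
      dest: measurable_space[OF big_measurable])

lemma past0_alg:
  assumes "Initial \<in> S" "S \<subseteq> srcs" "f \<in> measurable (past0 rn) N" shows "f \<in> measurable (alg S) N"
  using assms past0_sub
  by (intro measurable_from_events[where src = Initial])
    (auto simp: source_events_def subalgebra_def dest: measurable_space measurable_sets)

text \<open>Tonelli's theorem on the product of \<open>alg S\<close> with the law of
  \<open>Z\<close>. It takes the place of a conditional expectation given \<open>alg S\<close>: all
  that depends on \<open>S\<close> stays fixed while the fresh source is integrated out.\<close>

lemma freeze:
  fixes Z :: "'w \<Rightarrow> 'a"
  assumes src: "src \<in> srcs" "src \<notin> S" "S \<subseteq> srcs"
    and Z: "Z \<in> measurable M N" "evts src = sets (vimage_algebra (space M) Z N)"
    and f: "f \<in> borel_measurable (alg S \<Otimes>\<^sub>M N)"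
  shows "(\<integral>\<^sup>+\<omega>. f (\<omega>, Z \<omega>) \<partial>M) = (\<integral>\<^sup>+\<omega>. \<integral>\<^sup>+z. f (\<omega>, z) \<partial>distr M N Z \<partial>M)"
proof -
  let ?I = "case_bool S {src}"
  have idm: "(\<lambda>\<omega>. \<omega>) \<in> measurable M (alg S)"
    using alg_sub[OF src(3)] by (auto simp: measurable_def sets.sets_into_space[THEN subsetD] intro: sets.Int)
  \<comment> \<open>The sources are grouped into \<open>S\<close> and the single fresh one; the
    generated sigma-algebras of disjoint groups are independent.\<close>
  have "indep_sets (\<lambda>b. sigma_sets (space M) (\<Union>i\<in>?I b. evts i)) UNIV"
  proof (rule indep_sets_collect_sigma)
    show "indep_sets evts (\<Union>b\<in>UNIV. ?I b)"
      by (rule indep_sets_mono_index[OF _ indep]) (use src in \<open>auto simp: UNIV_bool\<close>)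
    show "Int_stable (evts i)" if "i \<in> ?I b" for i b
      using that src by (intro events_Int_stable) (cases b; auto)
    show "disjoint_family_on ?I UNIV" using src by (auto simp: disjoint_family_on_def split: bool.splits)
  qed
  hence pr: "prob (A \<inter> (Z -` B \<inter> space M)) = prob A * prob (Z -` B \<inter> space M)"
    if "A \<in> sets (alg S)" "B \<in> sets N" for A B
    using that Z indep_setsD[of _ UNIV UNIV "case_bool A (Z -` B \<inter> space M)"]
    by (force simp: UNIV_bool sets_alg[OF src(3)] vimage_events Int_commute mult.commute)
  interpret N: prob_space "distr M N Z" by (rule prob_space_distr[OF Z(1)])
  interpret I: prob_space "distr M (alg S) (\<lambda>\<omega>. \<omega>)" by (rule prob_space_distr[OF idm])
  have pm: "(\<lambda>\<omega>. (\<omega>, Z \<omega>)) \<in> measurable M (alg S \<Otimes>\<^sub>M N)"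
    by (rule measurable_Pair[OF idm Z(1)])
  \<comment> \<open>The first coordinate is the outcome itself, seen through the coarser
    sigma-algebra. Independence makes its joint law with \<open>Z\<close> a product.\<close>
  have jd: "distr M (alg S) (\<lambda>\<omega>. \<omega>) \<Otimes>\<^sub>M distr M N Z = distr M (alg S \<Otimes>\<^sub>M N) (\<lambda>\<omega>. (\<omega>, Z \<omega>))"
  proof (rule pair_measure_eqI)
    fix A B assume "A \<in> sets (distr M (alg S) (\<lambda>\<omega>. \<omega>))" "B \<in> sets (distr M N Z)"
    hence AB: "A \<in> sets (alg S)" "B \<in> sets N" by simp_all
    hence A: "A \<in> sets M" "(\<lambda>\<omega>. \<omega>) -` A \<inter> space M = A"
      using alg_sub[OF src(3)] sets.sets_into_space[of A M] by auto
    have "(\<lambda>\<omega>. (\<omega>, Z \<omega>)) -` (A \<times> B) \<inter> space M = A \<inter> (Z -` B \<inter> space M)"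
      using sets.sets_into_space[OF A(1)] by auto
    hence "emeasure (distr M (alg S \<Otimes>\<^sub>M N) (\<lambda>\<omega>. (\<omega>, Z \<omega>))) (A \<times> B) = ennreal (prob A * prob (Z -` B \<inter> space M))"
      using AB by (simp add: emeasure_distr[OF pm] emeasure_eq_measure pr[OF AB])
    thus "emeasure (distr M (alg S) (\<lambda>\<omega>. \<omega>)) A * emeasure (distr M N Z) B
        = emeasure (distr M (alg S \<Otimes>\<^sub>M N) (\<lambda>\<omega>. (\<omega>, Z \<omega>))) (A \<times> B)"
      using AB A by (simp add: emeasure_distr[OF idm] emeasure_distr[OF Z(1)] emeasure_eq_measure ennreal_mult')
  qed (simp_all add: I.sigma_finite_measure_axioms N.sigma_finite_measure_axioms cong: sets_pair_measure_cong)
  have f': "f \<in> borel_measurable (distr M (alg S) (\<lambda>\<omega>. \<omega>) \<Otimes>\<^sub>M distr M N Z)"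
    using f by (simp cong: measurable_cong_sets sets_pair_measure_cong)
  have "(\<integral>\<^sup>+\<omega>. f (\<omega>, Z \<omega>) \<partial>M) = (\<integral>\<^sup>+p. f p \<partial>distr M (alg S \<Otimes>\<^sub>M N) (\<lambda>\<omega>. (\<omega>, Z \<omega>)))"
    using pm f by (subst nn_integral_distr) auto
  also have "\<dots> = (\<integral>\<^sup>+\<omega>. \<integral>\<^sup>+z. f (\<omega>, z) \<partial>distr M N Z \<partial>distr M (alg S) (\<lambda>\<omega>. \<omega>))"
    unfolding jd[symmetric] by (rule N.nn_integral_fst[symmetric, OF f'])
  also have "\<dots> = (\<integral>\<^sup>+\<omega>. \<integral>\<^sup>+z. f (\<omega>, z) \<partial>distr M N Z \<partial>M)"
    using N.borel_measurable_nn_integral_fst[OF f'] idm by (subst nn_integral_distr) auto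
  finally show ?thesis .
qed

text \<open>Separates the two branches of the estimator: a quantity that does not involve the coin
  is only multiplied by the probability of the branch.\<close>

lemma coin_freeze:
  assumes i: "Coin i \<in> srcs" "Coin i \<notin> S" "S \<subseteq> srcs" and F: "F \<in> borel_measurable (alg S)"
    and p: "coin_prob par \<in> {0..1}"
  shows "(\<integral>\<^sup>+\<omega>. indicator {c} (coin rn i \<omega>) * F \<omega> \<partial>M)
    = ennreal (if c then coin_prob par else 1 - coin_prob par) * (\<integral>\<^sup>+\<omega>. F \<omega> \<partial>M)"
proof -
  let ?f = "\<lambda>q. indicator {c} (snd q) * F (fst q) :: ennreal"
  have m: "?f \<in> borel_measurable (alg S \<Otimes>\<^sub>M count_space UNIV)"
    by (intro borel_measurable_times_ennreal measurable_compose[OF measurable_fst F]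
        measurable_compose[OF measurable_snd, of _ "count_space UNIV"]) auto
  have "(\<integral>\<^sup>+\<omega>. ?f (\<omega>, coin rn i \<omega>) \<partial>M)
      = (\<integral>\<^sup>+\<omega>. \<integral>\<^sup>+z. ?f (\<omega>, z) \<partial>distr M (count_space UNIV) (coin rn i) \<partial>M)"
    by (rule freeze[OF i coin_measurable[OF i(1)] _ m]) (simp add: source_events_def)
  also have "\<dots> = (\<integral>\<^sup>+\<omega>. ennreal (if c then coin_prob par else 1 - coin_prob par) * F \<omega> \<partial>M)"
    unfolding coin_distr[OF i(1)] using p
    by (intro nn_integral_cong) (cases c; simp add: emeasure_pmf_single mult.commute)
  also have "\<dots> = ennreal (if c then coin_prob par else 1 - coin_prob par) * (\<integral>\<^sup>+\<omega>. F \<omega> \<partial>M)"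
    by (rule nn_integral_cmult[OF measurable_alg_M[OF F i(3)]])
  finally show ?thesis by simp
qed

text \<open>Adding the samples one at a time, each frozen against all the others, the mixed terms vanish.\<close>

lemma noise_second_moment:
  fixes U :: "'w \<Rightarrow> nat \<Rightarrow> real" and \<psi> :: "'q \<Rightarrow> 'w \<Rightarrow> 'z \<Rightarrow> nat \<Rightarrow> real"
  assumes fin: "finite Q" and inj: "inj_on src Q" and S: "S \<subseteq> srcs"
    and src: "\<And>q. q \<in> Q \<Longrightarrow> src q \<in> srcs" "\<And>q. q \<in> Q \<Longrightarrow> src q \<notin> S"
    and Z: "\<And>q. q \<in> Q \<Longrightarrow> Z q \<in> measurable M (sample_space pb)"
      "\<And>q. q \<in> Q \<Longrightarrow> evts (src q) = sets (vimage_algebra (space M) (Z q) (sample_space pb))"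
      "\<And>q. q \<in> Q \<Longrightarrow> distr M (sample_space pb) (Z q) = law q"
    and A: "A \<in> borel_measurable (alg S)"
    and U: "\<And>j. j < d \<Longrightarrow> (\<lambda>\<omega>. U \<omega> j) \<in> borel_measurable (alg S)"
    and \<psi>: "\<And>q j. q \<in> Q \<Longrightarrow> j < d \<Longrightarrow> (\<lambda>(\<omega>, z). \<psi> q \<omega> z j) \<in> borel_measurable (alg S \<Otimes>\<^sub>M sample_space pb)"
    and V: "\<And>q. q \<in> Q \<Longrightarrow> V q \<in> borel_measurable M"
    and ae: "\<And>q. q \<in> Q \<Longrightarrow> AE \<omega> in M. (\<forall>j<d. integrable (law q) (\<lambda>z. \<psi> q \<omega> z j) \<and> (\<integral>z. \<psi> q \<omega> z j \<partial>law q) = 0)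
      \<and> (\<integral>\<^sup>+z. ennreal (\<Sum>j<d. (\<psi> q \<omega> z j)\<^sup>2) \<partial>law q) \<le> V q \<omega>"
  shows "(\<integral>\<^sup>+\<omega>. A \<omega> * ennreal (\<Sum>j<d. (U \<omega> j + (\<Sum>q\<in>Q. \<psi> q \<omega> (Z q \<omega>) j))\<^sup>2) \<partial>M)
    \<le> (\<integral>\<^sup>+\<omega>. A \<omega> * (ennreal (\<Sum>j<d. (U \<omega> j)\<^sup>2) + (\<Sum>q\<in>Q. V q \<omega>)) \<partial>M)"
  using fin inj src Z \<psi> V ae
proof (induction Q rule: finite_induct)
  case (insert q0 Q)
  define S' where "S' = S \<union> src ` Q"
  have S': "S' \<subseteq> srcs" "S \<subseteq> S'" "src q0 \<notin> S'"
    using S insert.prems(1,2,3) insert.hyps by (auto simp: S'_def inj_on_def)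
  have up: "f \<in> measurable (alg S') N" if "f \<in> measurable (alg S) N" for f :: "'w \<Rightarrow> 'x" and N
    by (rule measurable_alg_mono[OF that S'(2,1)])
  \<comment> \<open>The identity, as a map to the coarser sigma-algebra, transfers measurability
    from \<open>S\<close> to \<open>S'\<close>.\<close>
  have idp: "(\<lambda>p. p) \<in> measurable (alg S' \<Otimes>\<^sub>M sample_space pb) (alg S \<Otimes>\<^sub>M sample_space pb)"
  proof -
    have "(\<lambda>\<omega>. \<omega>) \<in> measurable (alg S') (alg S)" by (rule up) simp
    hence "(\<lambda>p. (fst p, snd p)) \<in> measurable (alg S' \<Otimes>\<^sub>M sample_space pb) (alg S \<Otimes>\<^sub>M sample_space pb)"
      by (intro measurable_Pair measurable_compose[OF measurable_fst] measurable_snd)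
    thus ?thesis by simp
  qed
  have Zm: "Z q \<in> measurable (alg S') (sample_space pb)" if q: "q \<in> Q" for q
  proof (rule measurable_from_events[of "src q"])
    show "src q \<in> S'" using q by (simp add: S'_def)
    show "Z q \<in> space M \<rightarrow> space (sample_space pb)" using measurable_space[OF insert.prems(4)] q by auto
    show "Z q -` B \<inter> space M \<in> evts (src q)" if "B \<in> sets (sample_space pb)" for B
      using insert.prems(4,5) q that by (auto simp: vimage_events)
  qed (rule S'(1))
  have Wm: "(\<lambda>\<omega>. U \<omega> j + (\<Sum>q\<in>Q. \<psi> q \<omega> (Z q \<omega>) j)) \<in> borel_measurable (alg S')" if j: "j < d" for j
  proof (rule borel_measurable_add[OF up[OF U[OF j]] borel_measurable_sum])
    fix q assume q: "q \<in> Q"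
    have "(\<lambda>\<omega>. (\<omega>, Z q \<omega>)) \<in> measurable (alg S') (alg S' \<Otimes>\<^sub>M sample_space pb)"
      using Zm[OF q] by (intro measurable_Pair) auto
    from measurable_compose[OF measurable_compose[OF this idp] insert.prems(7)[of q j]]
    show "(\<lambda>\<omega>. \<psi> q \<omega> (Z q \<omega>) j) \<in> borel_measurable (alg S')" using q j by simp
  qed
  define W where "W \<omega> j = U \<omega> j + (\<Sum>q\<in>Q. \<psi> q \<omega> (Z q \<omega>) j)" for \<omega> j
  have W: "(\<lambda>\<omega>. W \<omega> j) \<in> borel_measurable (alg S')" if "j < d" for j using Wm[OF that] by (simp add: W_def)
  let ?f = "\<lambda>p. A (fst p) * ennreal (\<Sum>j<d. (W (fst p) j + \<psi> q0 (fst p) (snd p) j)\<^sup>2)"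
  have fm: "?f \<in> borel_measurable (alg S' \<Otimes>\<^sub>M sample_space pb)"
  proof -
    have "(\<lambda>p. \<psi> q0 (fst p) (snd p) j) \<in> borel_measurable (alg S' \<Otimes>\<^sub>M sample_space pb)" if "j < d" for j
      using measurable_compose[OF idp insert.prems(7)[of q0 j]] that by (simp add: case_prod_beta)
    moreover have "(\<lambda>p. W (fst p) j) \<in> borel_measurable (alg S' \<Otimes>\<^sub>M sample_space pb)" if "j < d" for j
      by (rule measurable_compose[OF measurable_fst W[OF that]])
    moreover have "(\<lambda>p. A (fst p)) \<in> borel_measurable (alg S' \<Otimes>\<^sub>M sample_space pb)"
      by (rule measurable_compose[OF measurable_fst up[OF A]])
    ultimately show ?thesis
      by (intro borel_measurable_times_ennreal measurable_compose[OF _ measurable_ennreal]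
          borel_measurable_sum borel_measurable_power borel_measurable_add) auto
  qed
  have AM: "A \<in> borel_measurable M" by (rule measurable_alg_M[OF A S])
  have law: "prob_space (law q0)"
    using prob_space_distr[OF insert.prems(4)[of q0]] insert.prems(6)[of q0] by simp
  have "(\<integral>\<^sup>+\<omega>. A \<omega> * ennreal (\<Sum>j<d. (U \<omega> j + (\<Sum>q\<in>insert q0 Q. \<psi> q \<omega> (Z q \<omega>) j))\<^sup>2) \<partial>M)
      = (\<integral>\<^sup>+\<omega>. ?f (\<omega>, Z q0 \<omega>) \<partial>M)"
    using insert.hyps by (simp add: W_def ac_simps)
  also have "\<dots> = (\<integral>\<^sup>+\<omega>. \<integral>\<^sup>+z. ?f (\<omega>, z) \<partial>distr M (sample_space pb) (Z q0) \<partial>M)"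
    by (rule freeze[of "src q0" S', OF _ S'(3,1) _ _ fm]) (use insert.prems in auto)
  also have "\<dots> = (\<integral>\<^sup>+\<omega>. \<integral>\<^sup>+z. ?f (\<omega>, z) \<partial>law q0 \<partial>M)" using insert.prems(6)[of q0] by simp
  also have "\<dots> \<le> (\<integral>\<^sup>+\<omega>. A \<omega> * ennreal (\<Sum>j<d. (W \<omega> j)\<^sup>2) + A \<omega> * V q0 \<omega> \<partial>M)"
  proof (intro nn_integral_mono_AE)
    show "AE \<omega> in M. (\<integral>\<^sup>+z. ?f (\<omega>, z) \<partial>law q0) \<le> A \<omega> * ennreal (\<Sum>j<d. (W \<omega> j)\<^sup>2) + A \<omega> * V q0 \<omega>"
      using insert.prems(9)[of q0, OF insertI1]
    proof (rule AE_mp, intro AE_I2 impI)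
      fix \<omega> assume \<omega>: "\<omega> \<in> space M" and h: "(\<forall>j<d. integrable (law q0) (\<lambda>z. \<psi> q0 \<omega> z j) \<and> (\<integral>z. \<psi> q0 \<omega> z j \<partial>law q0) = 0)
      \<and> (\<integral>\<^sup>+z. ennreal (\<Sum>j<d. (\<psi> q0 \<omega> z j)\<^sup>2) \<partial>law q0) \<le> V q0 \<omega>"
      have "(\<lambda>z. ennreal (\<Sum>j<d. (W \<omega> j + \<psi> q0 \<omega> z j)\<^sup>2)) \<in> borel_measurable (law q0)"
        using h by (intro measurable_compose[OF _ measurable_ennreal] borel_measurable_sum
            borel_measurable_power borel_measurable_add) auto
      hence "(\<integral>\<^sup>+z. ?f (\<omega>, z) \<partial>law q0) = A \<omega> * (\<integral>\<^sup>+z. ennreal (\<Sum>j<d. (W \<omega> j + \<psi> q0 \<omega> z j)\<^sup>2) \<partial>law q0)"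
        by (simp add: nn_integral_cmult)
      also have "\<dots> \<le> A \<omega> * (ennreal (\<Sum>j<d. (W \<omega> j)\<^sup>2) + V q0 \<omega>)"
        by (intro mult_left_mono translated_second_moment[OF law, where f = "\<lambda>j z. \<psi> q0 \<omega> z j"]) (use h in auto)
      finally show "(\<integral>\<^sup>+z. ?f (\<omega>, z) \<partial>law q0) \<le> A \<omega> * ennreal (\<Sum>j<d. (W \<omega> j)\<^sup>2) + A \<omega> * V q0 \<omega>"
        by (simp add: distrib_left)
    qed
  qed
  also have "\<dots> = (\<integral>\<^sup>+\<omega>. A \<omega> * ennreal (\<Sum>j<d. (W \<omega> j)\<^sup>2) \<partial>M) + (\<integral>\<^sup>+\<omega>. A \<omega> * V q0 \<omega> \<partial>M)"
  proof (rule nn_integral_add)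
    show "(\<lambda>\<omega>. A \<omega> * ennreal (\<Sum>j<d. (W \<omega> j)\<^sup>2)) \<in> borel_measurable M"
      using AM measurable_alg_M[OF W S'(1)]
      by (intro borel_measurable_times_ennreal measurable_compose[OF _ measurable_ennreal]
          borel_measurable_sum borel_measurable_power) auto
    show "(\<lambda>\<omega>. A \<omega> * V q0 \<omega>) \<in> borel_measurable M"
      using AM insert.prems(8)[of q0] by (intro borel_measurable_times_ennreal) auto
  qed
  also have "\<dots> \<le> (\<integral>\<^sup>+\<omega>. A \<omega> * (ennreal (\<Sum>j<d. (U \<omega> j)\<^sup>2) + (\<Sum>q\<in>Q. V q \<omega>)) \<partial>M) + (\<integral>\<^sup>+\<omega>. A \<omega> * V q0 \<omega> \<partial>M)"
    unfolding W_def by (intro add_right_mono insert.IH) (use insert.prems in auto)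
  also have "\<dots> = (\<integral>\<^sup>+\<omega>. A \<omega> * (ennreal (\<Sum>j<d. (U \<omega> j)\<^sup>2) + (\<Sum>q\<in>Q. V q \<omega>)) + A \<omega> * V q0 \<omega> \<partial>M)"
  proof (rule nn_integral_add[symmetric])
    show "(\<lambda>\<omega>. A \<omega> * (ennreal (\<Sum>j<d. (U \<omega> j)\<^sup>2) + (\<Sum>q\<in>Q. V q \<omega>))) \<in> borel_measurable M"
      using AM measurable_alg_M[OF U S] insert.prems(8)
      by (intro borel_measurable_times_ennreal borel_measurable_add measurable_compose[OF _ measurable_ennreal]
          borel_measurable_sum borel_measurable_power) auto
    show "(\<lambda>\<omega>. A \<omega> * V q0 \<omega>) \<in> borel_measurable M"
      using AM insert.prems(8)[of q0] by (intro borel_measurable_times_ennreal) auto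
  qed
  also have "\<dots> = (\<integral>\<^sup>+\<omega>. A \<omega> * (ennreal (\<Sum>j<d. (U \<omega> j)\<^sup>2) + (\<Sum>q\<in>insert q0 Q. V q \<omega>)) \<partial>M)"
    using insert.hyps by (intro nn_integral_cong) (simp add: distrib_left ac_simps)
  finally show ?case .
qed simp

end

section \<open>The gradient estimator\<close>

lemma square_add_le: "(x + y)\<^sup>2 \<le> 2 * x\<^sup>2 + 2 * (y::real)\<^sup>2"
proof -
  have "0 \<le> (x - y)\<^sup>2" by simp
  thus ?thesis by (simp add: power2_sum power2_diff)
qed

lemma mean_affine:
  assumes "1 \<le> n"
  shows "(\<Sum>s<n. ((x s - c) - a * (y s - e)) / real n) = ((\<Sum>s<n. x s) / real n - c) - a * ((\<Sum>s<n. y s) / real n - (e::real))"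
proof -
  have "(\<Sum>s<n. ((x s - c) - a * (y s - e)) / real n) = (\<Sum>s<n. (x s - c) - a * (y s - e)) / real n"
    by (rule sum_divide_distrib[symmetric])
  also have "(\<Sum>s<n. (x s - c) - a * (y s - e)) = (\<Sum>s<n. x s) - real n * c - a * ((\<Sum>s<n. y s) - real n * e)"
    by (simp add: sum_subtractf flip: sum_distrib_left)
  also have "\<dots> / real n = ((\<Sum>s<n. x s) / real n - c) - a * ((\<Sum>s<n. y s) / real n - e)"
    using assms by (simp add: field_simps)
  finally show ?thesis .
qed

lemma ennreal_lincomb:
  "0 \<le> a \<Longrightarrow> 0 \<le> c \<Longrightarrow> 0 \<le> x \<Longrightarrow> 0 \<le> y \<Longrightarrow>
    ennreal a * ennreal x + ennreal c * ennreal y = ennreal (a * x + c * y)"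
  by (simp add: ennreal_mult ennreal_plus)

text \<open>With \<open>u\<close> the centred change of the gradient between the two points and
  \<open>v\<close> the centred gradient at the new point, \<psi> equals
  \<open>(1 - b) * u + b * v\<close>. Smoothness controls \<open>u\<close>, as centring does not
  increase a second moment; the variance enters only at the new point and with the factor
  \<open>b\<^sup>2\<close>. This is the variance reduction of the recursive momentum
  estimator.\<close>

lemma (in smooth_problem) centred_moment:
  assumes k: "k < nagents pb" and xy: "x \<in> cx" "y \<in> cy" "x' \<in> cx" "y' \<in> cy"
    and var: "(\<integral>\<^sup>+z. ennreal ((vnorm (cost_grad pb w k x' y' z - pgrad pb w (local_obj pb k) x' y'))\<^sup>2)
      \<partial>sample_law pb k) \<le> ennreal s" and b: "0 \<le> b" "b \<le> 1" "0 \<le> s"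
  defines "\<psi> \<equiv> \<lambda>z j. (cost_grad pb w k x' y' z $ j - pgrad pb w (local_obj pb k) x' y' $ j)
      - (1 - b) * (cost_grad pb w k x y z $ j - pgrad pb w (local_obj pb k) x y $ j)"
  shows "\<And>j. j < vdim pb w \<Longrightarrow> integrable (sample_law pb k) (\<lambda>z. \<psi> z j)"
    "\<And>j. j < vdim pb w \<Longrightarrow> (\<integral>z. \<psi> z j \<partial>sample_law pb k) = 0"
    "(\<integral>\<^sup>+z. ennreal (\<Sum>j<vdim pb w. (\<psi> z j)\<^sup>2) \<partial>sample_law pb k)
      \<le> ennreal (2 * (L\<^sub>f\<^sup>2 * ((vnorm (x' - x))\<^sup>2 + (vnorm (y' - y))\<^sup>2)) + 2 * b\<^sup>2 * s)"
proof -
  interpret prob_space "sample_law pb k" by (rule law_prob[OF k])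
  let ?N = "sample_law pb k"
  define c c' where "c j z = cost_grad pb w k x y z $ j" and "c' j z = cost_grad pb w k x' y' z $ j" for j z
  define l l' where "l j = pgrad pb w (local_obj pb k) x y $ j" and "l' j = pgrad pb w (local_obj pb k) x' y' $ j" for j
  have \<psi>: "\<psi> z j = (c' j z - l' j) - (1 - b) * (c j z - l j)" for z j
    by (simp add: \<psi>_def c_def c'_def l_def l'_def)
  have i: "integrable ?N (c j)" "integrable ?N (c' j)" "(\<integral>z. c j z \<partial>?N) = l j" "(\<integral>z. c' j z \<partial>?N) = l' j"
    if "j < vdim pb w" for j
    unfolding c_def c'_def l_def l'_def
    using cost_grad_integrable[OF k that] unbiased[OF k that] xy by auto
  show "integrable ?N (\<lambda>z. \<psi> z j)" if "j < vdim pb w" for j unfolding \<psi> using i[OF that] by simp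
  show "(\<integral>z. \<psi> z j \<partial>?N) = 0" if "j < vdim pb w" for j
    unfolding \<psi> using i[OF that] by (simp add: prob_space)
  define f where "f j z = c' j z - c j z" for j z
  define m where "m j = l' j - l j" for j
  have f: "integrable ?N (f j)" "integrable ?N (\<lambda>z. (f j z)\<^sup>2)" "(\<integral>z. f j z \<partial>?N) = m j" if "j < vdim pb w" for j
    using cost_diff_integrable[OF k that xy(3,4,1,2)] i[OF that]
    by (simp_all add: f_def[abs_def] m_def c_def[abs_def] c'_def[abs_def])
  have fv: "integrable ?N (\<lambda>z. (f j z - m j)\<^sup>2)" "(\<integral>z. (f j z - m j)\<^sup>2 \<partial>?N) \<le> (\<integral>z. (f j z)\<^sup>2 \<partial>?N)"
    if "j < vdim pb w" for j
  proof -
    show "integrable ?N (\<lambda>z. (f j z - m j)\<^sup>2)" using f[OF that] by (simp add: power2_diff)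
    show "(\<integral>z. (f j z - m j)\<^sup>2 \<partial>?N) \<le> (\<integral>z. (f j z)\<^sup>2 \<partial>?N)"
      using variance_eq[OF f(1,2)[OF that]] f(3)[OF that] by simp
  qed
  have zs: "z \<in> space (sample_space pb)" if "z \<in> space ?N" for z using that k by simp
  have "(\<integral>\<^sup>+z. ennreal (\<Sum>j<vdim pb w. (f j z - m j)\<^sup>2) \<partial>?N) = ennreal (\<integral>z. (\<Sum>j<vdim pb w. (f j z - m j)\<^sup>2) \<partial>?N)"
    by (rule nn_integral_eq_integral) (auto intro!: Bochner_Integration.integrable_sum fv AE_I2 sum_nonneg)
  also have "(\<integral>z. (\<Sum>j<vdim pb w. (f j z - m j)\<^sup>2) \<partial>?N) = (\<Sum>j<vdim pb w. \<integral>z. (f j z - m j)\<^sup>2 \<partial>?N)"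
    by (rule Bochner_Integration.integral_sum) (use fv in auto)
  also have "\<dots> \<le> (\<Sum>j<vdim pb w. \<integral>z. (f j z)\<^sup>2 \<partial>?N)" by (intro sum_mono fv) auto
  also have "\<dots> = (\<integral>z. (\<Sum>j<vdim pb w. (f j z)\<^sup>2) \<partial>?N)"
    by (rule Bochner_Integration.integral_sum[symmetric]) (use f in auto)
  also have "ennreal \<dots> = (\<integral>\<^sup>+z. ennreal (\<Sum>j<vdim pb w. (f j z)\<^sup>2) \<partial>?N)"
    by (rule nn_integral_eq_integral[symmetric])
      (auto intro!: Bochner_Integration.integrable_sum f AE_I2 sum_nonneg)
  also have "\<dots> = (\<integral>\<^sup>+z. ennreal ((vnorm (cost_grad pb w k x' y' z - cost_grad pb w k x y z))\<^sup>2) \<partial>?N)"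
    by (intro nn_integral_cong) (simp add: vnorm_sq_cost_diff[OF k xy(3,4,1,2) zs] f_def c_def c'_def)
  also have "\<dots> \<le> ennreal (L\<^sub>f\<^sup>2 * ((vnorm (x' - x))\<^sup>2 + (vnorm (y' - y))\<^sup>2))" by (rule smooth_le[OF k xy(3,4,1,2)])
  finally have 1: "(\<integral>\<^sup>+z. ennreal (\<Sum>j<vdim pb w. (f j z - m j)\<^sup>2) \<partial>?N)
      \<le> ennreal (L\<^sub>f\<^sup>2 * ((vnorm (x' - x))\<^sup>2 + (vnorm (y' - y))\<^sup>2))" by (simp add: ennreal_leI)
  have 2: "(\<integral>\<^sup>+z. ennreal (\<Sum>j<vdim pb w. (c' j z - l' j)\<^sup>2) \<partial>?N) \<le> ennreal s"
  proof -
    have "(\<integral>\<^sup>+z. ennreal (\<Sum>j<vdim pb w. (c' j z - l' j)\<^sup>2) \<partial>?N)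
      = (\<integral>\<^sup>+z. ennreal ((vnorm (cost_grad pb w k x' y' z - pgrad pb w (local_obj pb k) x' y'))\<^sup>2) \<partial>?N)"
      using local_grad_carrier[OF k xy(3,4), of w]
      by (intro nn_integral_cong) (simp add: vnorm_sq_real c'_def l'_def del: local_grad_carrier)
    thus ?thesis using var by simp
  qed
  have mz: "(\<lambda>z. ennreal (\<Sum>j<vdim pb w. (f j z - m j)\<^sup>2)) \<in> borel_measurable ?N"
    "(\<lambda>z. ennreal (\<Sum>j<vdim pb w. (c' j z - l' j)\<^sup>2)) \<in> borel_measurable ?N"
    using fv(1) i f by (auto intro!: measurable_compose[OF _ measurable_ennreal] borel_measurable_sum)
  have pw: "(\<Sum>j<vdim pb w. (\<psi> z j)\<^sup>2) \<le> 2 * (\<Sum>j<vdim pb w. (f j z - m j)\<^sup>2) + 2 * b\<^sup>2 * (\<Sum>j<vdim pb w. (c' j z - l' j)\<^sup>2)" for z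
  proof -
    have "(\<psi> z j)\<^sup>2 \<le> 2 * (f j z - m j)\<^sup>2 + 2 * b\<^sup>2 * (c' j z - l' j)\<^sup>2" for j
    proof -
      define u v where "u = f j z - m j" and "v = c' j z - l' j"
      have "\<psi> z j = (1 - b) * u + b * v" by (simp add: \<psi> u_def v_def f_def m_def algebra_simps)
      hence "(\<psi> z j)\<^sup>2 \<le> 2 * ((1 - b)\<^sup>2 * u\<^sup>2) + 2 * b\<^sup>2 * v\<^sup>2"
        using square_add_le[of "(1 - b) * u" "b * v"] by (simp add: power_mult_distrib)
      moreover have "(1 - b)\<^sup>2 * u\<^sup>2 \<le> 1 * u\<^sup>2" using b by (intro mult_right_mono) (auto simp: power_le_one)
      ultimately show ?thesis unfolding u_def v_def by simp
    qed
    hence "(\<Sum>j<vdim pb w. (\<psi> z j)\<^sup>2)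
        \<le> (\<Sum>j<vdim pb w. 2 * (f j z - m j)\<^sup>2 + 2 * b\<^sup>2 * (c' j z - l' j)\<^sup>2)" by (rule sum_mono)
    thus ?thesis by (simp only: sum.distrib sum_distrib_left)
  qed
  have "(\<integral>\<^sup>+z. ennreal (\<Sum>j<vdim pb w. (\<psi> z j)\<^sup>2) \<partial>?N)
      \<le> (\<integral>\<^sup>+z. ennreal 2 * ennreal (\<Sum>j<vdim pb w. (f j z - m j)\<^sup>2)
          + ennreal (2 * b\<^sup>2) * ennreal (\<Sum>j<vdim pb w. (c' j z - l' j)\<^sup>2) \<partial>?N)"
  proof (rule nn_integral_mono)
    fix z
    show "ennreal (\<Sum>j<vdim pb w. (\<psi> z j)\<^sup>2) \<le> ennreal 2 * ennreal (\<Sum>j<vdim pb w. (f j z - m j)\<^sup>2)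
          + ennreal (2 * b\<^sup>2) * ennreal (\<Sum>j<vdim pb w. (c' j z - l' j)\<^sup>2)"
      by (subst ennreal_lincomb) (auto intro!: sum_nonneg ennreal_leI pw)
  qed
  also have "\<dots> = ennreal 2 * (\<integral>\<^sup>+z. ennreal (\<Sum>j<vdim pb w. (f j z - m j)\<^sup>2) \<partial>?N)
          + ennreal (2 * b\<^sup>2) * (\<integral>\<^sup>+z. ennreal (\<Sum>j<vdim pb w. (c' j z - l' j)\<^sup>2) \<partial>?N)"
    using mz by (subst nn_integral_add) (auto simp: nn_integral_cmult)
  also have "\<dots> \<le> ennreal 2 * ennreal (L\<^sub>f\<^sup>2 * ((vnorm (x' - x))\<^sup>2 + (vnorm (y' - y))\<^sup>2)) + ennreal (2 * b\<^sup>2) * ennreal s"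
    by (intro add_mono mult_left_mono 1 2) auto
  also have "\<dots> = ennreal (2 * (L\<^sub>f\<^sup>2 * ((vnorm (x' - x))\<^sup>2 + (vnorm (y' - y))\<^sup>2)) + 2 * b\<^sup>2 * s)"
    using b by (subst ennreal_lincomb) auto
  finally show "(\<integral>\<^sup>+z. ennreal (\<Sum>j<vdim pb w. (\<psi> z j)\<^sup>2) \<partial>?N)
      \<le> ennreal (2 * (L\<^sub>f\<^sup>2 * ((vnorm (x' - x))\<^sup>2 + (vnorm (y' - y))\<^sup>2)) + 2 * b\<^sup>2 * s)" .
qed

fun idx :: "source \<Rightarrow> nat" where
  "idx Initial = 0" | "idx (Coin i) = i" | "idx (Mini i k s) = i" | "idx (Big i k s) = i"

section \<open>Measurability of the iterates and the estimates\<close>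

locale sampled_run = smooth_problem pb L\<^sub>f + network_matrices pb nw + sampled_problem pb par rn
  for pb :: "'z problem" and L\<^sub>f :: real and nw :: network and par :: params
    and rn :: "('w, 'z) randomness" +
  fixes \<sigma> :: real
  assumes stoch: "stochastic_gradients pb nw par rn \<sigma>"
    and batches: "1 \<le> batch0 par" "1 \<le> batchb par" "online pb \<Longrightarrow> 1 \<le> batchB par"
    and p01: "coin_prob par \<in> {0..1}" and beta01: "\<And>w. beta par w \<in> {0..1}"
begin

abbreviation "p \<equiv> coin_prob par"
abbreviation "b \<equiv> real (batchb par)"
abbreviation "B \<equiv> real (batchB par)"
abbreviation "st i \<omega> \<equiv> dama pb nw par rn \<omega> i"
abbreviation "it w k i \<omega> \<equiv> local_it pb nw par rn w k i \<omega>"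

declare dama.simps(2) [simp del]

text \<open>What is known once the estimate of iteration \<open>i\<close> has been formed. The
  iterate \<open>i + 1\<close> is already determined by it, since the primal step draws nothing; the
  estimate \<open>i + 1\<close> is not.\<close>

definition past :: "nat \<Rightarrow> source set" where
  "past i = {src \<in> srcs. idx src \<le> i}"

lemma past_sub: "past i \<subseteq> srcs" and past_mono: "i \<le> j \<Longrightarrow> past i \<subseteq> past j"
  by (auto simp: past_def)

lemma sources_mem:
  "Initial \<in> srcs" "1 \<le> i \<Longrightarrow> Coin i \<in> srcs"
  "k < K \<Longrightarrow> s < batch0 par \<Longrightarrow> Mini 0 k s \<in> srcs"
  "k < K \<Longrightarrow> s < batchb par \<Longrightarrow> Mini (Suc i) k s \<in> srcs"
  "online pb \<Longrightarrow> k < K \<Longrightarrow> s < batchB par \<Longrightarrow> Big (Suc i) k s \<in> srcs"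
  by (auto simp: sources_def)

text \<open>No sigma-algebra is put on vectors of varying length, so measurability means the right
  length together with measurable coordinates.\<close>

definition vmeas :: "source set \<Rightarrow> nat \<Rightarrow> ('w \<Rightarrow> real vec) \<Rightarrow> bool" where
  "vmeas S n X \<longleftrightarrow> (\<forall>\<omega>\<in>space M. X \<omega> \<in> carrier_vec n) \<and> (\<forall>j<n. (\<lambda>\<omega>. X \<omega> $ j) \<in> borel_measurable (alg S))"

lemma vmeasD:
  "vmeas S n X \<Longrightarrow> \<omega> \<in> space M \<Longrightarrow> X \<omega> \<in> carrier_vec n"
  "vmeas S n X \<Longrightarrow> j < n \<Longrightarrow> (\<lambda>\<omega>. X \<omega> $ j) \<in> borel_measurable (alg S)"
  by (simp_all add: vmeas_def)

lemma vmeasI: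
  assumes "\<And>\<omega>. \<omega> \<in> space M \<Longrightarrow> X \<omega> \<in> carrier_vec n"
    "\<And>j. j < n \<Longrightarrow> (\<And>\<omega>. \<omega> \<in> space M \<Longrightarrow> X \<omega> $ j = f j \<omega>)"
    "\<And>j. j < n \<Longrightarrow> f j \<in> borel_measurable (alg S)"
  shows "vmeas S n X"
  unfolding vmeas_def
proof (intro conjI ballI allI impI)
  fix j assume j: "j < n"
  show "(\<lambda>\<omega>. X \<omega> $ j) \<in> borel_measurable (alg S)"
    using assms(2,3)[OF j] by (subst measurable_cong[where g = "f j"]) auto
qed (rule assms(1))

lemma vmeas_mono: "vmeas S n X \<Longrightarrow> S \<subseteq> S' \<Longrightarrow> S' \<subseteq> srcs \<Longrightarrow> vmeas S' n X"
  unfolding vmeas_def using measurable_alg_mono by blast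

lemma vmeas_kron:
  assumes "vmeas S (n * d) X" "A \<in> carrier_mat m n" shows "vmeas S (m * d) (\<lambda>\<omega>. kron A d *\<^sub>v X \<omega>)"
proof (rule vmeasI[where f = "\<lambda>j \<omega>. \<Sum>q<n * d. kron A d $$ (j, q) * X \<omega> $ q"])
  fix \<omega> assume w: "\<omega> \<in> space M"
  show "kron A d *\<^sub>v X \<omega> \<in> carrier_vec (m * d)"
    by (rule mult_mat_vec_carrier[OF kron_carrier[OF assms(2)] vmeasD(1)[OF assms(1) w]])
  fix j assume j: "j < m * d"
  show "(kron A d *\<^sub>v X \<omega>) $ j = (\<Sum>q<n * d. kron A d $$ (j, q) * X \<omega> $ q)"
    by (rule index_mult_mat_vec_sum[OF kron_carrier[OF assms(2)] vmeasD(1)[OF assms(1) w] j])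
next
  fix j show "(\<lambda>\<omega>. \<Sum>q<n * d. kron A d $$ (j, q) * X \<omega> $ q) \<in> borel_measurable (alg S)"
    using vmeasD(2)[OF assms(1)] by (intro borel_measurable_sum borel_measurable_times) auto
qed

lemma vmeas_add: "vmeas S n X \<Longrightarrow> vmeas S n Y \<Longrightarrow> vmeas S n (\<lambda>\<omega>. X \<omega> + Y \<omega>)"
  by (rule vmeasI[where f = "\<lambda>j \<omega>. X \<omega> $ j + Y \<omega> $ j"])
    (auto simp: vmeas_def intro!: borel_measurable_add)

lemma vmeas_diff: "vmeas S n X \<Longrightarrow> vmeas S n Y \<Longrightarrow> vmeas S n (\<lambda>\<omega>. X \<omega> - Y \<omega>)"
  by (rule vmeasI[where f = "\<lambda>j \<omega>. X \<omega> $ j - Y \<omega> $ j"])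
    (auto simp: vmeas_def intro!: borel_measurable_diff)

lemma vmeas_smult: "vmeas S n X \<Longrightarrow> vmeas S n (\<lambda>\<omega>. c \<cdot>\<^sub>v X \<omega>)"
  by (rule vmeasI[where f = "\<lambda>j \<omega>. c * X \<omega> $ j"])
    (auto simp: vmeas_def intro!: borel_measurable_times)

lemma vmeas_block: "vmeas S (n * d) X \<Longrightarrow> k < n \<Longrightarrow> vmeas S d (\<lambda>\<omega>. block d k (X \<omega>))"
  by (rule vmeasI[where f = "\<lambda>j \<omega>. X \<omega> $ (k * d + j)"]) (auto simp: vmeas_def block_def block_index_less)

lemma vmeas_stack:
  assumes "\<And>k. k < n \<Longrightarrow> vmeas S d (X k)" shows "vmeas S (n * d) (\<lambda>\<omega>. stack d n (\<lambda>k. X k \<omega>))"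
proof (rule vmeasI[where f = "\<lambda>j \<omega>. X (j div d) \<omega> $ (j mod d)"])
  fix j assume "j < n * d"
  thus "(\<lambda>\<omega>. X (j div d) \<omega> $ (j mod d)) \<in> borel_measurable (alg S)"
    by (intro vmeasD(2)[OF assms] div_less_of_less_mult mod_less_of_less_mult)
qed (simp_all add: stack_def)

lemma vmeas_vmean:
  assumes "\<And>s. s < n \<Longrightarrow> vmeas S d (X s)" shows "vmeas S d (\<lambda>\<omega>. vmean d n (\<lambda>s. X s \<omega>))"
  by (rule vmeasI[where f = "\<lambda>j \<omega>. (\<Sum>s<n. X s \<omega> $ j) / real n"])
    (auto simp: vmean_index intro!: borel_measurable_divide borel_measurable_sum vmeasD(2)[OF assms])

lemma vmeas_if:
  assumes "c \<in> measurable (alg S) (count_space UNIV)" "vmeas S n X" "vmeas S n Y"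
  shows "vmeas S n (\<lambda>\<omega>. if c \<omega> then X \<omega> else Y \<omega>)"
proof (rule vmeasI[where f = "\<lambda>j \<omega>. if c \<omega> then X \<omega> $ j else Y \<omega> $ j"])
  fix j assume "j < n"
  thus "(\<lambda>\<omega>. if c \<omega> then X \<omega> $ j else Y \<omega> $ j) \<in> borel_measurable (alg S)"
    using assms by (intro measurable_If vmeasD(2)[OF assms(2)] vmeasD(2)[OF assms(3)]) (auto simp: pred_def)
qed (use assms in \<open>auto simp: vmeas_def\<close>)

lemma vmeas_cost_grad:
  assumes k: "k < K" and X: "vmeas S (xdim pb) X" and Y: "vmeas S (ydim pb) Y"
    and Z: "Z \<in> measurable (alg S) (sample_space pb)"
  shows "vmeas S (vdim pb w) (\<lambda>\<omega>. cost_grad pb w k (X \<omega>) (Y \<omega>) (Z \<omega>))"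
  unfolding vmeas_def
proof (intro conjI ballI allI impI)
  fix \<omega> assume "\<omega> \<in> space M"
  thus "cost_grad pb w k (X \<omega>) (Y \<omega>) (Z \<omega>) \<in> carrier_vec (vdim pb w)"
    using vmeasD(1)[OF X] vmeasD(1)[OF Y] measurable_space[OF Z] k by (intro cost_grad_carrier) auto
next
  fix j assume "j < vdim pb w"
  thus "(\<lambda>\<omega>. cost_grad pb w k (X \<omega>) (Y \<omega>) (Z \<omega>) $ j) \<in> borel_measurable (alg S)"
    using vmeasD[OF X] vmeasD[OF Y] by (intro cost_grad_measurable k Z) auto
qed

lemma cost_grad_measurable_pair:
  assumes k: "k < K" and X: "vmeas S (xdim pb) X" and Y: "vmeas S (ydim pb) Y" and j: "j < vdim pb w"
  shows "(\<lambda>q. cost_grad pb w k (X (fst q)) (Y (fst q)) (snd q) $ j) \<in> borel_measurable (alg S \<Otimes>\<^sub>M sample_space pb)"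
  using vmeasD[OF X] vmeasD[OF Y]
  by (intro cost_grad_measurable k j measurable_snd)
    (auto simp: space_pair_measure intro: measurable_compose[OF measurable_fst])

text \<open>A gradient given by a definite description is not visibly measurable. Unbiasedness
  writes it as an integral over the sample of a jointly measurable function.\<close>

lemma vmeas_local_grad:
  assumes k: "k < K" and X: "vmeas S (xdim pb) X" and Y: "vmeas S (ydim pb) Y"
  shows "vmeas S (vdim pb w) (\<lambda>\<omega>. pgrad pb w (local_obj pb k) (X \<omega>) (Y \<omega>))"
proof (rule vmeasI[where f = "\<lambda>j \<omega>. \<integral>z. cost_grad pb w k (X \<omega>) (Y \<omega>) z $ j \<partial>sample_law pb k"])
  fix \<omega> assume w: "\<omega> \<in> space M"
  show "pgrad pb w (local_obj pb k) (X \<omega>) (Y \<omega>) \<in> carrier_vec (vdim pb w)"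
    by (rule local_grad_carrier[OF k vmeasD(1)[OF X w] vmeasD(1)[OF Y w]])
  fix j assume j: "j < vdim pb w"
  show "pgrad pb w (local_obj pb k) (X \<omega>) (Y \<omega>) $ j = (\<integral>z. cost_grad pb w k (X \<omega>) (Y \<omega>) z $ j \<partial>sample_law pb k)"
    by (rule unbiased[symmetric, OF k j vmeasD(1)[OF X w] vmeasD(1)[OF Y w]])
next
  fix j assume j: "j < vdim pb w"
  have sf: "sigma_finite_measure (sample_law pb k)"
    by (rule prob_space_imp_sigma_finite[OF law_prob[OF k]])
  have "(\<lambda>q. cost_grad pb w k (X (fst q)) (Y (fst q)) (snd q) $ j) \<in> borel_measurable (alg S \<Otimes>\<^sub>M sample_law pb k)"
    using cost_grad_measurable_pair[OF k X Y j] k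
    by (simp cong: measurable_cong_sets sets_pair_measure_cong)
  thus "(\<lambda>\<omega>. \<integral>z. cost_grad pb w k (X \<omega>) (Y \<omega>) z $ j \<partial>sample_law pb k) \<in> borel_measurable (alg S)"
    by (intro sigma_finite_measure.borel_measurable_lebesgue_integral[OF sf]) (simp add: case_prod_beta)
qed

lemma prim_Suc: "prim (st (Suc i) \<omega>) w = kron (amat nw w) (vdim pb w) *\<^sub>v
    (kron (cmat nw w) (vdim pb w) *\<^sub>v prim (st i \<omega>) w + (dir w * mu par w) \<cdot>\<^sub>v est (st i \<omega>) w)
    - kron (bmat nw w) (vdim pb w) *\<^sub>v dual (st i \<omega>) w"
  by (simp add: dama.simps(2) dama_step_def Let_def)

lemma dual_Suc: "dual (st (Suc i) \<omega>) w = dual (st i \<omega>) w + kron (bmat nw w) (vdim pb w) *\<^sub>v prim (st (Suc i) \<omega>) w"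
  by (simp add: dama.simps(2) dama_step_def Let_def)

lemma est_Suc: "est (st (Suc i) \<omega>) w = stack (vdim pb w) K
    (grace pb par rn \<omega> (Suc i) (est (st i \<omega>)) (prim (st i \<omega>)) (prim (st (Suc i) \<omega>)) w)"
  by (simp add: dama.simps(2) dama_step_def Let_def)

lemma prim_Suc_vmeas:
  assumes "vmeas S (K * vdim pb w) (\<lambda>\<omega>. prim (st i \<omega>) w)" "vmeas S (K * vdim pb w) (\<lambda>\<omega>. dual (st i \<omega>) w)"
    "vmeas S (K * vdim pb w) (\<lambda>\<omega>. est (st i \<omega>) w)"
  shows "vmeas S (K * vdim pb w) (\<lambda>\<omega>. prim (st (Suc i) \<omega>) w)"
  unfolding prim_Suc
  by (intro vmeas_diff vmeas_kron[OF _ mats_carrier(1)] vmeas_kron[OF _ mats_carrier(2)]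
      vmeas_kron[OF _ mats_carrier(3)] vmeas_add vmeas_smult assms)

lemma agent_grad_vmeas:
  assumes "\<And>w. vmeas S (K * vdim pb w) (\<lambda>\<omega>. Z \<omega> w)" "k < K" "z \<in> measurable (alg S) (sample_space pb)"
  shows "vmeas S (vdim pb w) (\<lambda>\<omega>. agent_grad pb w k (Z \<omega>) (z \<omega>))"
  unfolding agent_grad_def
  using vmeas_block[OF assms(1)[of Vx] assms(2)] vmeas_block[OF assms(1)[of Vy] assms(2)]
  by (intro vmeas_cost_grad assms) (simp_all add: vdim_def)

lemma state_vmeas:
  "vmeas (past i) (K * vdim pb w) (\<lambda>\<omega>. prim (st i \<omega>) w) \<and>
   vmeas (past i) (K * vdim pb w) (\<lambda>\<omega>. dual (st i \<omega>) w) \<and>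
   vmeas (past i) (K * vdim pb w) (\<lambda>\<omega>. est (st i \<omega>) w)"
proof (induction i arbitrary: w)
  case 0
  have init: "vmeas (past 0) (vdim pb w) (init rn w)" "vmeas (past 0) (vdim pb w) (dual0 rn w)" for w
  proof -
    have f: "(\<forall>\<omega>\<in>space M. f \<omega> \<in> carrier_vec (vdim pb w)) \<and> (\<forall>j<vdim pb w. (\<lambda>\<omega>. f \<omega> $ j) \<in> borel_measurable (past0 rn))"
      if "f \<in> {init rn w, dual0 rn w}" for f
      using samp that unfolding sampling_def by blast
    have I: "Initial \<in> past 0" using sources_mem(1) by (simp add: past_def)
    show "vmeas (past 0) (vdim pb w) (init rn w)" "vmeas (past 0) (vdim pb w) (dual0 rn w)"
      using f[of "init rn w"] f[of "dual0 rn w"] past0_alg[OF I past_sub] unfolding vmeas_def by blast+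
  qed
  have pr: "vmeas (past 0) (K * vdim pb w) (\<lambda>\<omega>. prim (st 0 \<omega>) w)" for w
    using vmeas_stack[of K "past 0" "vdim pb w" "\<lambda>_. init rn w"] init(1)[of w] by (simp add: init_state_def Let_def)
  moreover have "vmeas (past 0) (K * vdim pb w) (\<lambda>\<omega>. dual (st 0 \<omega>) w)"
    using vmeas_stack[of K "past 0" "vdim pb w" "\<lambda>_. dual0 rn w"] init(2)[of w] by (simp add: init_state_def Let_def)
  moreover have "vmeas (past 0) (K * vdim pb w) (\<lambda>\<omega>. stack (vdim pb w) K (\<lambda>k.
      vmean (vdim pb w) (batch0 par) (\<lambda>s. agent_grad pb w k (prim (st 0 \<omega>)) (mini rn 0 k s \<omega>))))"
    using sources_mem(3)
    by (intro vmeas_stack vmeas_vmean agent_grad_vmeas pr mini_alg past_sub) (auto simp: past_def)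
  hence "vmeas (past 0) (K * vdim pb w) (\<lambda>\<omega>. est (st 0 \<omega>) w)" by (simp add: init_state_def Let_def)
  ultimately show ?case by blast
next
  case (Suc i)
  have ps: "past i \<subseteq> past (Suc i)" "past (Suc i) \<subseteq> srcs" by (auto simp: past_def)
  have old: "vmeas (past (Suc i)) (K * vdim pb w) (\<lambda>\<omega>. prim (st i \<omega>) w)"
    "vmeas (past (Suc i)) (K * vdim pb w) (\<lambda>\<omega>. dual (st i \<omega>) w)"
    "vmeas (past (Suc i)) (K * vdim pb w) (\<lambda>\<omega>. est (st i \<omega>) w)" for w
    using Suc[of w] vmeas_mono[OF _ ps] by blast+
  have new: "vmeas (past (Suc i)) (K * vdim pb w) (\<lambda>\<omega>. prim (st (Suc i) \<omega>) w)" for w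
    by (rule prim_Suc_vmeas[OF old])
  have dn: "vmeas (past (Suc i)) (K * vdim pb w) (\<lambda>\<omega>. dual (st (Suc i) \<omega>) w)" for w
    unfolding dual_Suc by (intro vmeas_add vmeas_kron[OF _ mats_carrier(2)] old new)
  have coinm: "coin rn (Suc i) \<in> measurable (alg (past (Suc i))) (count_space UNIV)"
    using sources_mem(2)[of "Suc i"] by (intro coin_alg ps) (auto simp: past_def)
  have "vmeas (past (Suc i)) (K * vdim pb w) (\<lambda>\<omega>. est (st (Suc i) \<omega>) w)" for w
    unfolding est_Suc grace_def Let_def
  proof (intro vmeas_stack vmeas_if[OF coinm])
    fix k assume k: "k < K"
    show "vmeas (past (Suc i)) (vdim pb w) (\<lambda>\<omega>. if online pb
        then vmean (vdim pb w) (batchB par) (\<lambda>s. agent_grad pb w k (prim (st (Suc i) \<omega>)) (big rn (Suc i) k s \<omega>))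
        else vmean (vdim pb w) (dsize pb k) (\<lambda>s. agent_grad pb w k (prim (st (Suc i) \<omega>)) (dataset pb k s)))"
    proof (cases "online pb")
      case True
      thus ?thesis using sources_mem(5) k
        by (simp only: if_True, intro vmeas_vmean agent_grad_vmeas new big_alg past_sub) (auto simp: past_def)
    next
      case False
      have "dataset pb k s \<in> space (sample_space pb)" if "s < dsize pb k" for s
        using offline_facts(2)[OF False k, of s] that by (simp add: data_def)
      thus ?thesis using False k
        by (simp only: if_False, intro vmeas_vmean agent_grad_vmeas new measurable_const) auto
    qed
    show "vmeas (past (Suc i)) (vdim pb w) (\<lambda>\<omega>. (1 - beta par w) \<cdot>\<^sub>v (block (vdim pb w) k (est (st i \<omega>) w)
            - vmean (vdim pb w) (batchb par) (\<lambda>s. agent_grad pb w k (prim (st i \<omega>)) (mini rn (Suc i) k s \<omega>)))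
          + vmean (vdim pb w) (batchb par) (\<lambda>s. agent_grad pb w k (prim (st (Suc i) \<omega>)) (mini rn (Suc i) k s \<omega>)))"
      using sources_mem(4) k
      by (intro vmeas_add vmeas_smult vmeas_diff vmeas_block[OF old(3)] vmeas_vmean agent_grad_vmeas
          old(1) new mini_alg past_sub) (auto simp: past_def)
  qed
  thus ?case using new dn by blast
qed

lemma prim_next: "vmeas (past i) (K * vdim pb w) (\<lambda>\<omega>. prim (st (Suc i) \<omega>) w)"
  using state_vmeas[of i w] by (intro prim_Suc_vmeas) auto

lemma it_vmeas: "k < K \<Longrightarrow> vmeas (past i) (vdim pb w) (it w k i)"
  and it_next_vmeas: "k < K \<Longrightarrow> vmeas (past i) (vdim pb w) (it w k (Suc i))"
  unfolding local_it_def using state_vmeas[of i w] prim_next[of i w] by (auto intro: vmeas_block)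

lemma it_carrier [simp]: "it w k i \<omega> \<in> carrier_vec (vdim pb w)"
  "it Vx k i \<omega> \<in> cx" "it Vy k i \<omega> \<in> cy"
  by (simp_all add: local_it_def vdim_def)

definition lg :: "var \<Rightarrow> nat \<Rightarrow> nat \<Rightarrow> 'w \<Rightarrow> real vec" where
  "lg w k i \<omega> = pgrad pb w (local_obj pb k) (it Vx k i \<omega>) (it Vy k i \<omega>)"

definition cg :: "var \<Rightarrow> nat \<Rightarrow> nat \<Rightarrow> 'w \<Rightarrow> 'z \<Rightarrow> real vec" where
  "cg w k i \<omega> z = cost_grad pb w k (it Vx k i \<omega>) (it Vy k i \<omega>) z"

definition gk :: "var \<Rightarrow> nat \<Rightarrow> nat \<Rightarrow> 'w \<Rightarrow> real vec" where
  "gk w k i \<omega> = block (vdim pb w) k (est (st i \<omega>) w)"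

text \<open>\<open>er\<close> is the error of the estimate of one agent; given the coin, \<open>xi\<close> is what the fresh samples
  add to it, hence centred and independent over agents.\<close>

definition er :: "var \<Rightarrow> nat \<Rightarrow> nat \<Rightarrow> 'w \<Rightarrow> nat \<Rightarrow> real" where
  "er w k i \<omega> j = gk w k i \<omega> $ j - lg w k i \<omega> $ j"

definition carry :: "var \<Rightarrow> bool \<Rightarrow> real" where
  "carry w c = (if c then 0 else 1 - beta par w)"

definition xi :: "var \<Rightarrow> nat \<Rightarrow> nat \<Rightarrow> 'w \<Rightarrow> nat \<Rightarrow> real" where
  "xi w k i \<omega> j = er w k (Suc i) \<omega> j - carry w (coin rn (Suc i) \<omega>) * er w k i \<omega> j"

lemma agent_grad_cg: "agent_grad pb w k (prim (st i \<omega>)) z = cg w k i \<omega> z"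
  by (simp add: agent_grad_def cg_def local_it_def vdim_def)

lemma it_vmeas': 
  assumes "k < K"
  shows "vmeas (past i) (xdim pb) (it Vx k i)" "vmeas (past i) (ydim pb) (it Vy k i)"
    "vmeas (past i) (xdim pb) (it Vx k (Suc i))" "vmeas (past i) (ydim pb) (it Vy k (Suc i))"
  using it_vmeas[OF assms, of i Vx] it_vmeas[OF assms, of i Vy] it_next_vmeas[OF assms, of i Vx]
    it_next_vmeas[OF assms, of i Vy] by (simp_all add: vdim_def)

lemma lg_vmeas: "k < K \<Longrightarrow> vmeas (past i) (vdim pb w) (lg w k i)"
  and lg_next_vmeas: "k < K \<Longrightarrow> vmeas (past i) (vdim pb w) (lg w k (Suc i))"
  unfolding lg_def[abs_def] using it_vmeas'[of k i] by (auto intro!: vmeas_local_grad)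

lemma gk_vmeas: "k < K \<Longrightarrow> vmeas (past i) (vdim pb w) (gk w k i)"
  unfolding gk_def[abs_def] using state_vmeas[of i w] by (auto intro: vmeas_block)

lemma er_measurable: "k < K \<Longrightarrow> j < vdim pb w \<Longrightarrow> (\<lambda>\<omega>. er w k i \<omega> j) \<in> borel_measurable (alg (past i))"
  unfolding er_def using vmeasD(2)[OF gk_vmeas] vmeasD(2)[OF lg_vmeas] by (intro borel_measurable_diff) auto

lemma gk_carrier: "gk w k i \<omega> \<in> carrier_vec (vdim pb w)"
  by (simp add: gk_def)

lemma gk_init:
  assumes k: "k < K" and j: "j < vdim pb w"
  shows "gk w k 0 \<omega> $ j = (\<Sum>s<batch0 par. cg w k 0 \<omega> (mini rn 0 k s \<omega>) $ j) / real (batch0 par)"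
proof -
  have "gk w k 0 \<omega> = vmean (vdim pb w) (batch0 par) (\<lambda>s. agent_grad pb w k (prim (st 0 \<omega>)) (mini rn 0 k s \<omega>))"
    unfolding gk_def using k by (simp add: init_state_def Let_def block_stack)
  thus ?thesis using j by (simp only: agent_grad_cg vmean_index)
qed

lemma gk_Suc:
  assumes k: "k < K" and j: "j < vdim pb w" and \<omega>: "\<omega> \<in> space M"
  shows "gk w k (Suc i) \<omega> $ j = (if coin rn (Suc i) \<omega> then
      (if online pb then (\<Sum>s<batchB par. cg w k (Suc i) \<omega> (big rn (Suc i) k s \<omega>) $ j) / B
       else lg w k (Suc i) \<omega> $ j)
    else (1 - beta par w) * (gk w k i \<omega> $ j - (\<Sum>s<batchb par. cg w k i \<omega> (mini rn (Suc i) k s \<omega>) $ j) / b)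
      + (\<Sum>s<batchb par. cg w k (Suc i) \<omega> (mini rn (Suc i) k s \<omega>) $ j) / b)"
proof -
  \<comment> \<open>Offline, a restart reads the whole data set and therefore returns the exact
    local gradient.\<close>
  have off: "lg w k (Suc i) \<omega> $ j = (\<Sum>s<dsize pb k. cg w k (Suc i) \<omega> (dataset pb k s) $ j) / real (dsize pb k)"
    if "\<not> online pb"
    unfolding lg_def cg_def
    using unbiased[OF k j it_carrier(2,3)] offline_integral(2)[OF that k cost_grad_measurable_z[OF k j it_carrier(2,3)]]
    by simp
  let ?g = "grace pb par rn \<omega> (Suc i) (est (st i \<omega>)) (prim (st i \<omega>)) (prim (st (Suc i) \<omega>)) w k"
  have gc: "?g \<in> carrier_vec (vdim pb w)" by (simp add: grace_def Let_def)
  have eq: "gk w k (Suc i) \<omega> = ?g"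
    unfolding gk_def est_Suc by (rule block_stack[OF k]) (rule gc)
  have "?g $ j = (if coin rn (Suc i) \<omega> then
      (if online pb then (\<Sum>s<batchB par. cg w k (Suc i) \<omega> (big rn (Suc i) k s \<omega>) $ j) / B
       else lg w k (Suc i) \<omega> $ j)
    else (1 - beta par w) * (gk w k i \<omega> $ j - (\<Sum>s<batchb par. cg w k i \<omega> (mini rn (Suc i) k s \<omega>) $ j) / b)
      + (\<Sum>s<batchb par. cg w k (Suc i) \<omega> (mini rn (Suc i) k s \<omega>) $ j) / b)"
  proof -
    have lin: "(a \<cdot>\<^sub>v (u - v) + v') $ j = a * (u $ j - v $ j) + v' $ j"
      if "u \<in> carrier_vec (vdim pb w)" "v \<in> carrier_vec (vdim pb w)" "v' \<in> carrier_vec (vdim pb w)"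
      for a and u v v' :: "real vec"
      using that j by auto
    consider (big) "coin rn (Suc i) \<omega>" "online pb" | (full) "coin rn (Suc i) \<omega>" "\<not> online pb"
      | (mini) "\<not> coin rn (Suc i) \<omega>" by blast
    thus ?thesis
    proof cases
      case big
      have "?g = vmean (vdim pb w) (batchB par) (\<lambda>s. cg w k (Suc i) \<omega> (big rn (Suc i) k s \<omega>))"
        unfolding grace_def Let_def if_P[OF big(1)] if_P[OF big(2)] agent_grad_cg ..
      thus ?thesis unfolding if_P[OF big(1)] if_P[OF big(2)] by (simp only: vmean_index[OF j])
    next
      case full
      have "?g = vmean (vdim pb w) (dsize pb k) (\<lambda>s. cg w k (Suc i) \<omega> (dataset pb k s))"
        unfolding grace_def Let_def if_P[OF full(1)] if_not_P[OF full(2)] agent_grad_cg ..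
      thus ?thesis unfolding if_P[OF full(1)] if_not_P[OF full(2)] off[OF full(2)]
        by (simp only: vmean_index[OF j])
    next
      case mini
      have "?g = (1 - beta par w) \<cdot>\<^sub>v (gk w k i \<omega>
            - vmean (vdim pb w) (batchb par) (\<lambda>s. cg w k i \<omega> (mini rn (Suc i) k s \<omega>)))
          + vmean (vdim pb w) (batchb par) (\<lambda>s. cg w k (Suc i) \<omega> (mini rn (Suc i) k s \<omega>))"
        unfolding grace_def Let_def if_not_P[OF mini] agent_grad_cg gk_def ..
      thus ?thesis unfolding if_not_P[OF mini]
        by (simp only: lin[OF gk_carrier vmean_carrier vmean_carrier] vmean_index[OF j])
    qed
  qed
  thus ?thesis unfolding eq .
qed

text \<open>The share of one sample in \<open>xi\<close>, before division by the batch size. The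
  outcome \<open>c\<close> of the coin is a parameter, so that both branches have the same
  form.\<close>

definition psi :: "bool \<Rightarrow> var \<Rightarrow> nat \<Rightarrow> nat \<Rightarrow> 'w \<Rightarrow> 'z \<Rightarrow> nat \<Rightarrow> real" where
  "psi c w k i \<omega> z j = (cg w k (Suc i) \<omega> z $ j - lg w k (Suc i) \<omega> $ j)
     - carry w c * (cg w k i \<omega> z $ j - lg w k i \<omega> $ j)"

text \<open>A full pass offline counts as an empty batch: it leaves no error, and the empty sum in
  \<open>xi_eq\<close> says so.\<close>

definition bsize :: "bool \<Rightarrow> nat" where
  "bsize c = (if c then (if online pb then batchB par else 0) else batchb par)"

definition draw :: "bool \<Rightarrow> nat \<Rightarrow> nat \<Rightarrow> nat \<Rightarrow> 'w \<Rightarrow> 'z" where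
  "draw c i k s \<omega> = (if c then big rn i k s \<omega> else mini rn i k s \<omega>)"

lemma xi_eq:
  assumes k: "k < K" and j: "j < vdim pb w" and \<omega>: "\<omega> \<in> space M" and c: "coin rn (Suc i) \<omega> = c"
  shows "xi w k i \<omega> j = (\<Sum>s<bsize c. psi c w k i \<omega> (draw c (Suc i) k s \<omega>) j / real (bsize c))"
proof (cases c)
  case False
  define m m' where "m = (\<Sum>s<batchb par. cg w k i \<omega> (mini rn (Suc i) k s \<omega>) $ j) / b"
    and "m' = (\<Sum>s<batchb par. cg w k (Suc i) \<omega> (mini rn (Suc i) k s \<omega>) $ j) / b"
  have "(\<Sum>s<bsize c. psi c w k i \<omega> (draw c (Suc i) k s \<omega>) j / real (bsize c))
      = (m' - lg w k (Suc i) \<omega> $ j) - (1 - beta par w) * (m - lg w k i \<omega> $ j)"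
    unfolding m_def m'_def psi_def using False batches(2)
    by (simp only: bsize_def draw_def carry_def if_False mean_affine)
  thus ?thesis using False c gk_Suc[OF k j \<omega>, of i]
    by (simp add: xi_def er_def carry_def m_def[symmetric] m'_def[symmetric] algebra_simps)
next
  case True
  show ?thesis
  proof (cases "online pb")
    case on: True
    have "(\<Sum>s<bsize c. psi c w k i \<omega> (draw c (Suc i) k s \<omega>) j / real (bsize c))
      = ((\<Sum>s<batchB par. cg w k (Suc i) \<omega> (big rn (Suc i) k s \<omega>) $ j) / B - lg w k (Suc i) \<omega> $ j)
        - 0 * ((\<Sum>s<batchB par. cg w k i \<omega> (big rn (Suc i) k s \<omega>) $ j) / B - lg w k i \<omega> $ j)"
      unfolding psi_def using True on batches(3)[OF on]
      by (simp only: bsize_def draw_def carry_def if_True mean_affine)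
    thus ?thesis using True on c gk_Suc[OF k j \<omega>, of i] by (simp add: xi_def er_def carry_def)
  next
    case off: False
    thus ?thesis using True c gk_Suc[OF k j \<omega>, of i]
      by (simp add: xi_def er_def carry_def bsize_def)
  qed
qed

definition dist2 :: "nat \<Rightarrow> nat \<Rightarrow> 'w \<Rightarrow> real" where
  "dist2 k i \<omega> = (vnorm (it Vx k (Suc i) \<omega> - it Vx k i \<omega>))\<^sup>2 + (vnorm (it Vy k (Suc i) \<omega> - it Vy k i \<omega>))\<^sup>2"

text \<open>Bounds the second moment of \<open>psi\<close> with the iterates held fixed. A restart
  leaves just the centred new gradient, so its variance appears without the factor 2 that splitting
  causes in \<open>centred_moment\<close>.\<close>

definition nu2 :: "bool \<Rightarrow> var \<Rightarrow> nat \<Rightarrow> nat \<Rightarrow> 'w \<Rightarrow> real" where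
  "nu2 c w k i \<omega> = (if c then \<sigma>\<^sup>2 else 2 * (L\<^sub>f\<^sup>2 * dist2 k i \<omega>) + 2 * (beta par w)\<^sup>2 * \<sigma>\<^sup>2)"

lemma vnorm_sq_measurable:
  assumes "vmeas S n X" shows "(\<lambda>\<omega>. (vnorm (X \<omega>))\<^sup>2) \<in> borel_measurable (alg S)"
proof -
  have "(\<lambda>\<omega>. \<Sum>j<n. (X \<omega> $ j)\<^sup>2) \<in> borel_measurable (alg S)"
    using vmeasD(2)[OF assms] by (intro borel_measurable_sum borel_measurable_power) auto
  moreover have "(vnorm (X \<omega>))\<^sup>2 = (\<Sum>j<n. (X \<omega> $ j)\<^sup>2)" if "\<omega> \<in> space (alg S)" for \<omega>
    using vmeasD(1)[OF assms, of \<omega>] that by (simp add: vnorm_sq_real)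
  ultimately show ?thesis by (subst measurable_cong) auto
qed

lemma dist2_measurable: "k < K \<Longrightarrow> dist2 k i \<in> borel_measurable (alg (past i))"
  unfolding dist2_def[abs_def] using it_vmeas'[of k i]
  by (intro borel_measurable_add vnorm_sq_measurable[OF vmeas_diff]) auto

lemma nu2_measurable: "k < K \<Longrightarrow> nu2 c w k i \<in> borel_measurable (alg (past i))"
  unfolding nu2_def[abs_def] using dist2_measurable[of k i] by (cases c) auto

lemma variance_at_iterate:
  assumes "k < K"
  shows "AE \<omega> in M. (\<integral>\<^sup>+z. ennreal ((vnorm (cost_grad pb w k (it Vx k i \<omega>) (it Vy k i \<omega>) z
      - pgrad pb w (local_obj pb k) (it Vx k i \<omega>) (it Vy k i \<omega>)))\<^sup>2) \<partial>sample_law pb k) \<le> ennreal (\<sigma>\<^sup>2)"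
proof -
  have "AE \<omega> in M. let x = it Vx k i \<omega>; y = it Vy k i \<omega> in
       (\<forall>j<vdim pb w. integrable (sample_law pb k) (\<lambda>z. cost_grad pb w k x y z $ j) \<and>
          (\<integral>z. cost_grad pb w k x y z $ j \<partial>sample_law pb k)
            = pgrad pb w (local_obj pb k) x y $ j) \<and>
       (\<integral>\<^sup>+z. ennreal ((vnorm (cost_grad pb w k x y z - pgrad pb w (local_obj pb k) x y))\<^sup>2)
          \<partial>sample_law pb k) \<le> ennreal (\<sigma>\<^sup>2)"
    using stoch assms unfolding stochastic_gradients_def by blast
  thus ?thesis by (rule eventually_mono) (simp only: Let_def)
qed

lemma psi_moments:
  assumes k: "k < K"
  shows "AE \<omega> in M. (\<forall>j<vdim pb w. integrable (sample_law pb k) (\<lambda>z. psi c w k i \<omega> z j)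
      \<and> (\<integral>z. psi c w k i \<omega> z j \<partial>sample_law pb k) = 0)
    \<and> (\<integral>\<^sup>+z. ennreal (\<Sum>j<vdim pb w. (psi c w k i \<omega> z j)\<^sup>2) \<partial>sample_law pb k) \<le> ennreal (nu2 c w k i \<omega>)"
  using variance_at_iterate[OF k, of w "Suc i"]
proof (rule AE_mp, intro AE_I2 impI)
  fix \<omega> assume v: "(\<integral>\<^sup>+z. ennreal ((vnorm (cost_grad pb w k (it Vx k (Suc i) \<omega>) (it Vy k (Suc i) \<omega>) z
      - pgrad pb w (local_obj pb k) (it Vx k (Suc i) \<omega>) (it Vy k (Suc i) \<omega>)))\<^sup>2) \<partial>sample_law pb k) \<le> ennreal (\<sigma>\<^sup>2)"
  \<comment> \<open>A restart acts like momentum parameter 1, so one application of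
    \<open>centred_moment\<close> serves both outcomes.\<close>
  define q where "q = (if c then 1 else beta par w)"
  have q: "0 \<le> q" "q \<le> 1" using beta01[of w] by (auto simp: q_def)
  have cq: "carry w c = 1 - q" by (simp add: carry_def q_def)
  note m = centred_moment[OF k it_carrier(2)[of k i \<omega>] it_carrier(3)[of k i \<omega>] it_carrier(2,3) v q zero_le_power2,
      folded cg_def lg_def cq]
  have "(\<integral>\<^sup>+z. ennreal (\<Sum>j<vdim pb w. (psi c w k i \<omega> z j)\<^sup>2) \<partial>sample_law pb k) \<le> ennreal (nu2 c w k i \<omega>)"
  proof (cases c)
    case False
    hence "2 * (L\<^sub>f\<^sup>2 * ((vnorm (it Vx k (Suc i) \<omega> - it Vx k i \<omega>))\<^sup>2 + (vnorm (it Vy k (Suc i) \<omega> - it Vy k i \<omega>))\<^sup>2))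
        + 2 * q\<^sup>2 * \<sigma>\<^sup>2 = nu2 c w k i \<omega>" by (simp add: nu2_def dist2_def q_def)
    thus ?thesis using m(3) unfolding psi_def by simp
  next
    case True
    have "(\<integral>\<^sup>+z. ennreal (\<Sum>j<vdim pb w. (psi c w k i \<omega> z j)\<^sup>2) \<partial>sample_law pb k)
      = (\<integral>\<^sup>+z. ennreal ((vnorm (cost_grad pb w k (it Vx k (Suc i) \<omega>) (it Vy k (Suc i) \<omega>) z
      - pgrad pb w (local_obj pb k) (it Vx k (Suc i) \<omega>) (it Vy k (Suc i) \<omega>)))\<^sup>2) \<partial>sample_law pb k)"
      using True local_grad_carrier[OF k it_carrier(2)[of k "Suc i" \<omega>] it_carrier(3)[of k "Suc i" \<omega>], of w]
      by (intro nn_integral_cong) (simp add: vnorm_sq_real psi_def carry_def cg_def lg_def del: local_grad_carrier)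
    thus ?thesis using v True by (simp add: nu2_def)
  qed
  thus "(\<forall>j<vdim pb w. integrable (sample_law pb k) (\<lambda>z. psi c w k i \<omega> z j)
      \<and> (\<integral>z. psi c w k i \<omega> z j \<partial>sample_law pb k) = 0)
    \<and> (\<integral>\<^sup>+z. ennreal (\<Sum>j<vdim pb w. (psi c w k i \<omega> z j)\<^sup>2) \<partial>sample_law pb k) \<le> ennreal (nu2 c w k i \<omega>)"
    using m(1,2) by (simp add: psi_def)
qed

definition srcof :: "bool \<Rightarrow> nat \<Rightarrow> nat \<Rightarrow> nat \<Rightarrow> source" where
  "srcof c i k s = (if c then Big i k s else Mini i k s)"

lemma draw_facts:
  assumes k: "k < K" and s: "s < bsize c"
  shows "srcof c (Suc i) k s \<in> srcs" "srcof c (Suc i) k s \<notin> past i \<union> {Coin (Suc i)}"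
    "draw c (Suc i) k s \<in> measurable M (sample_space pb)"
    "evts (srcof c (Suc i) k s) = sets (vimage_algebra (space M) (draw c (Suc i) k s) (sample_space pb))"
    "distr M (sample_space pb) (draw c (Suc i) k s) = sample_law pb k"
proof -
  show src: "srcof c (Suc i) k s \<in> srcs"
    using sources_mem(4)[OF k, of s i] sources_mem(5)[OF _ k, of s i] s
    by (auto simp: srcof_def bsize_def split: if_splits)
  show "srcof c (Suc i) k s \<notin> past i \<union> {Coin (Suc i)}" by (auto simp: srcof_def past_def)
  show "draw c (Suc i) k s \<in> measurable M (sample_space pb)"
    "evts (srcof c (Suc i) k s) = sets (vimage_algebra (space M) (draw c (Suc i) k s) (sample_space pb))"
    "distr M (sample_space pb) (draw c (Suc i) k s) = sample_law pb k"
    using src mini_measurable[of "Suc i" k s] big_measurable[of "Suc i" k s]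
      mini_distr[of "Suc i" k s] big_distr[of "Suc i" k s]
    by (cases c; simp add: srcof_def draw_def[abs_def] source_events_def)+
qed

lemma psi_measurable:
  assumes k: "k < K" and j: "j < vdim pb w"
  shows "(\<lambda>q. psi c w k i (fst q) (snd q) j) \<in> borel_measurable (alg (past i) \<Otimes>\<^sub>M sample_space pb)"
  unfolding psi_def cg_def
  using it_vmeas'[OF k, of i] vmeasD(2)[OF lg_vmeas[OF k] j] vmeasD(2)[OF lg_next_vmeas[OF k] j]
  by (intro borel_measurable_diff borel_measurable_times cost_grad_measurable_pair k j
      measurable_compose[OF measurable_fst, where g = "\<lambda>\<omega>. lg _ _ _ \<omega> $ j"]) auto

lemma sum_sq_measurable:
  assumes "\<And>j. j < d \<Longrightarrow> (\<lambda>\<omega>. U \<omega> j) \<in> borel_measurable N"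
  shows "(\<lambda>\<omega>. ennreal (\<Sum>j<d. (U \<omega> j :: real)\<^sup>2)) \<in> borel_measurable N"
  using assms by (intro measurable_compose[OF _ measurable_ennreal] borel_measurable_sum borel_measurable_power) auto

abbreviation "prb c \<equiv> (if c then p else 1 - p)"

text \<open>One outcome of the coin at a time. The samples are integrated out while the past and the
  coin are frozen; only quantities of the past remain, and then the coin is integrated out too.
  Independence over agents and positions gives \<open>t\<^sup>2\<close> over the batch size for each
  agent.\<close>

lemma innovation_branch:
  fixes U :: "'w \<Rightarrow> nat \<Rightarrow> real" and t :: real
  assumes A: "A \<subseteq> {..<K}" and U: "\<And>j. j < vdim pb w \<Longrightarrow> (\<lambda>\<omega>. U \<omega> j) \<in> borel_measurable (alg (past i))"
  shows "(\<integral>\<^sup>+\<omega>. indicator {c} (coin rn (Suc i) \<omega>)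
        * ennreal (\<Sum>j<vdim pb w. (U \<omega> j + (\<Sum>k\<in>A. t * xi w k i \<omega> j))\<^sup>2) \<partial>M)
    \<le> ennreal (prb c) * ((\<integral>\<^sup>+\<omega>. ennreal (\<Sum>j<vdim pb w. (U \<omega> j)\<^sup>2) \<partial>M)
        + (\<Sum>k\<in>A. ennreal (t\<^sup>2 / real (bsize c)) * (\<integral>\<^sup>+\<omega>. ennreal (nu2 c w k i \<omega>) \<partial>M)))"
proof -
  let ?d = "vdim pb w"
  define n where "n = bsize c"
  define Q where "Q = A \<times> {..<n}"
  define \<psi> where "\<psi> q \<omega> z j = t / real n * psi c w (fst q) i \<omega> z j" for q :: "nat \<times> nat" and \<omega> z j
  define V where "V q \<omega> = ennreal ((t / real n)\<^sup>2) * ennreal (nu2 c w (fst q) i \<omega>)" for q :: "nat \<times> nat" and \<omega>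
  \<comment> \<open>The coin is frozen together with the past, so that the indicator of its outcome
    is an admissible weight while the samples stay outside.\<close>
  define S where "S = past i \<union> {Coin (Suc i)}"
  have fA: "finite A" using A by (rule finite_subset) simp
  have Qk: "fst q < K" "snd q < bsize c" if "q \<in> Q" for q using that A by (auto simp: Q_def n_def)
  have S: "S \<subseteq> srcs" "past i \<subseteq> S" using sources_mem(2)[of "Suc i"] past_sub by (auto simp: S_def)
  have coinS: "Coin (Suc i) \<in> srcs" "Coin (Suc i) \<notin> past i" using sources_mem(2)[of "Suc i"] by (auto simp: past_def)
  have Vm: "V q \<in> borel_measurable (alg (past i))" if "q \<in> Q" for q
    unfolding V_def[abs_def] using nu2_measurable[OF Qk(1)[OF that]] by (intro borel_measurable_times_ennreal) auto
  have Um: "(\<lambda>\<omega>. ennreal (\<Sum>j<?d. (U \<omega> j)\<^sup>2)) \<in> borel_measurable (alg (past i))"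
    by (rule sum_sq_measurable[OF U])
  have "(\<integral>\<^sup>+\<omega>. indicator {c} (coin rn (Suc i) \<omega>)
        * ennreal (\<Sum>j<?d. (U \<omega> j + (\<Sum>k\<in>A. t * xi w k i \<omega> j))\<^sup>2) \<partial>M)
      = (\<integral>\<^sup>+\<omega>. indicator {c} (coin rn (Suc i) \<omega>)
        * ennreal (\<Sum>j<?d. (U \<omega> j + (\<Sum>q\<in>Q. \<psi> q \<omega> (draw c (Suc i) (fst q) (snd q) \<omega>) j))\<^sup>2) \<partial>M)"
  proof (rule nn_integral_cong)
    fix \<omega> assume \<omega>: "\<omega> \<in> space M"
    have "(\<Sum>k\<in>A. t * xi w k i \<omega> j) = (\<Sum>q\<in>Q. \<psi> q \<omega> (draw c (Suc i) (fst q) (snd q) \<omega>) j)"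
      if c: "coin rn (Suc i) \<omega> = c" and j: "j < ?d" for j
    proof -
      have "(\<Sum>k\<in>A. t * xi w k i \<omega> j)
          = (\<Sum>k\<in>A. \<Sum>s<n. t / real n * psi c w k i \<omega> (draw c (Suc i) k s \<omega>) j)"
        using A by (intro sum.cong refl) (auto simp: xi_eq[OF _ j \<omega> c] n_def sum_distrib_left subset_iff)
      thus ?thesis by (simp add: Q_def \<psi>_def sum.cartesian_product case_prod_beta)
    qed
    thus "indicator {c} (coin rn (Suc i) \<omega>) * ennreal (\<Sum>j<?d. (U \<omega> j + (\<Sum>k\<in>A. t * xi w k i \<omega> j))\<^sup>2)
      = (indicator {c} (coin rn (Suc i) \<omega>)
        * ennreal (\<Sum>j<?d. (U \<omega> j + (\<Sum>q\<in>Q. \<psi> q \<omega> (draw c (Suc i) (fst q) (snd q) \<omega>) j))\<^sup>2) :: ennreal)"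
      by (cases "coin rn (Suc i) \<omega> = c") auto
  qed
  also have "\<dots> \<le> (\<integral>\<^sup>+\<omega>. indicator {c} (coin rn (Suc i) \<omega>) * (ennreal (\<Sum>j<?d. (U \<omega> j)\<^sup>2) + (\<Sum>q\<in>Q. V q \<omega>)) \<partial>M)"
  proof (rule noise_second_moment[where S = S and src = "\<lambda>q. srcof c (Suc i) (fst q) (snd q)"
        and law = "\<lambda>q. sample_law pb (fst q)"])
    show "finite Q" using fA by (simp add: Q_def)
    show "inj_on (\<lambda>q. srcof c (Suc i) (fst q) (snd q)) Q"
      by (auto simp: inj_on_def srcof_def prod_eq_iff split: if_splits)
    show "S \<subseteq> srcs" by (rule S(1))
    show "(\<lambda>\<omega>. indicator {c} (coin rn (Suc i) \<omega>)) \<in> borel_measurable (alg S)"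
      by (rule measurable_compose[OF coin_alg[OF _ S(1)]]) (auto simp: S_def)
    show "(\<lambda>\<omega>. U \<omega> j) \<in> borel_measurable (alg S)" if "j < ?d" for j
      by (rule measurable_alg_mono[OF U[OF that] S(2,1)])
    fix q assume q: "q \<in> Q"
    show "srcof c (Suc i) (fst q) (snd q) \<in> srcs" "srcof c (Suc i) (fst q) (snd q) \<notin> S"
      "draw c (Suc i) (fst q) (snd q) \<in> M \<rightarrow>\<^sub>M sample_space pb"
      "evts (srcof c (Suc i) (fst q) (snd q)) = sets (vimage_algebra (space M) (draw c (Suc i) (fst q) (snd q)) (sample_space pb))"
      "distr M (sample_space pb) (draw c (Suc i) (fst q) (snd q)) = sample_law pb (fst q)"
      using draw_facts[OF Qk[OF q]] by (simp_all add: S_def)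
    show "V q \<in> borel_measurable M" by (rule measurable_alg_M[OF Vm[OF q] past_sub])
    show "(\<lambda>(\<omega>, z). \<psi> q \<omega> z j) \<in> borel_measurable (alg S \<Otimes>\<^sub>M sample_space pb)" if j: "j < ?d" for j
    proof -
      have "(\<lambda>\<omega>. \<omega>) \<in> measurable (alg S) (alg (past i))"
        by (rule measurable_alg_mono[OF _ S(2,1)]) simp
      hence "(\<lambda>p. (fst p, snd p)) \<in> measurable (alg S \<Otimes>\<^sub>M sample_space pb) (alg (past i) \<Otimes>\<^sub>M sample_space pb)"
        by (intro measurable_Pair measurable_compose[OF measurable_fst] measurable_snd)
      hence "(\<lambda>q'. psi c w (fst q) i (fst q') (snd q') j) \<in> borel_measurable (alg S \<Otimes>\<^sub>M sample_space pb)"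
        using measurable_compose[OF _ psi_measurable[OF Qk(1)[OF q] j]] by simp
      thus ?thesis unfolding \<psi>_def case_prod_beta by (intro borel_measurable_times) auto
    qed
    show "AE \<omega> in M. (\<forall>j<?d. integrable (sample_law pb (fst q)) (\<lambda>z. \<psi> q \<omega> z j)
        \<and> (\<integral>z. \<psi> q \<omega> z j \<partial>sample_law pb (fst q)) = 0)
      \<and> (\<integral>\<^sup>+z. ennreal (\<Sum>j<?d. (\<psi> q \<omega> z j)\<^sup>2) \<partial>sample_law pb (fst q)) \<le> V q \<omega>"
      using psi_moments[OF Qk(1)[OF q], of w c i]
    proof (rule AE_mp, intro AE_I2 impI)
      fix \<omega> assume h: "(\<forall>j<?d. integrable (sample_law pb (fst q)) (\<lambda>z. psi c w (fst q) i \<omega> z j)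
        \<and> (\<integral>z. psi c w (fst q) i \<omega> z j \<partial>sample_law pb (fst q)) = 0)
      \<and> (\<integral>\<^sup>+z. ennreal (\<Sum>j<?d. (psi c w (fst q) i \<omega> z j)\<^sup>2) \<partial>sample_law pb (fst q)) \<le> ennreal (nu2 c w (fst q) i \<omega>)"
      have sq: "ennreal (\<Sum>j<?d. (\<psi> q \<omega> z j)\<^sup>2)
          = ennreal ((t / real n)\<^sup>2) * ennreal (\<Sum>j<?d. (psi c w (fst q) i \<omega> z j)\<^sup>2)" for z
        by (subst ennreal_mult[symmetric]) (auto simp: \<psi>_def power_mult_distrib power_divide sum_distrib_left intro!: sum_nonneg)
      have "(\<integral>\<^sup>+z. ennreal (\<Sum>j<?d. (\<psi> q \<omega> z j)\<^sup>2) \<partial>sample_law pb (fst q))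
          = ennreal ((t / real n)\<^sup>2) * (\<integral>\<^sup>+z. ennreal (\<Sum>j<?d. (psi c w (fst q) i \<omega> z j)\<^sup>2) \<partial>sample_law pb (fst q))"
        unfolding sq by (rule nn_integral_cmult, rule sum_sq_measurable) (use h in \<open>auto dest: borel_measurable_integrable\<close>)
      also have "\<dots> \<le> V q \<omega>" unfolding V_def by (rule mult_left_mono) (use h in auto)
      finally show "(\<forall>j<?d. integrable (sample_law pb (fst q)) (\<lambda>z. \<psi> q \<omega> z j)
        \<and> (\<integral>z. \<psi> q \<omega> z j \<partial>sample_law pb (fst q)) = 0)
      \<and> (\<integral>\<^sup>+z. ennreal (\<Sum>j<?d. (\<psi> q \<omega> z j)\<^sup>2) \<partial>sample_law pb (fst q)) \<le> V q \<omega>"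
        using h by (simp add: \<psi>_def)
    qed
  qed
  \<comment> \<open>The integrand is now a function of the past, so the coin leaves only its
    probability.\<close>
  also have "\<dots> = ennreal (prb c) * (\<integral>\<^sup>+\<omega>. ennreal (\<Sum>j<?d. (U \<omega> j)\<^sup>2) + (\<Sum>q\<in>Q. V q \<omega>) \<partial>M)"
    by (rule coin_freeze[OF coinS past_sub _ p01]) (intro borel_measurable_add Um borel_measurable_sum Vm)
  also have "(\<integral>\<^sup>+\<omega>. ennreal (\<Sum>j<?d. (U \<omega> j)\<^sup>2) + (\<Sum>q\<in>Q. V q \<omega>) \<partial>M)
      = (\<integral>\<^sup>+\<omega>. ennreal (\<Sum>j<?d. (U \<omega> j)\<^sup>2) \<partial>M) + (\<Sum>q\<in>Q. \<integral>\<^sup>+\<omega>. V q \<omega> \<partial>M)"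
    using measurable_alg_M[OF Um past_sub] measurable_alg_M[OF Vm past_sub]
    by (subst nn_integral_add) (auto intro!: borel_measurable_sum nn_integral_sum)
  also have "(\<Sum>q\<in>Q. \<integral>\<^sup>+\<omega>. V q \<omega> \<partial>M) = (\<Sum>k\<in>A. \<Sum>s<n. ennreal ((t / real n)\<^sup>2) * (\<integral>\<^sup>+\<omega>. ennreal (nu2 c w k i \<omega>) \<partial>M))"
    unfolding sum.cartesian_product Q_def[symmetric] case_prod_beta V_def
    using measurable_alg_M[OF nu2_measurable past_sub] Qk
    by (intro sum.cong refl nn_integral_cmult) auto
  also have "\<dots> = (\<Sum>k\<in>A. ennreal (t\<^sup>2 / real (bsize c)) * (\<integral>\<^sup>+\<omega>. ennreal (nu2 c w k i \<omega>) \<partial>M))"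
  proof (rule sum.cong[OF refl])
    fix k
    have "(\<Sum>s<n. ennreal ((t / real n)\<^sup>2) * (\<integral>\<^sup>+\<omega>. ennreal (nu2 c w k i \<omega>) \<partial>M))
        = (ennreal (real n) * ennreal ((t / real n)\<^sup>2)) * (\<integral>\<^sup>+\<omega>. ennreal (nu2 c w k i \<omega>) \<partial>M)"
      by (simp add: ennreal_of_nat_eq_real_of_nat mult.assoc)
    \<comment> \<open>For an empty batch both sides are 0, because division by zero gives 0.\<close>
    also have "ennreal (real n) * ennreal ((t / real n)\<^sup>2) = ennreal (t\<^sup>2 / real n)"
      by (subst ennreal_mult[symmetric]) (auto simp: power2_eq_square)
    finally show "(\<Sum>s<n. ennreal ((t / real n)\<^sup>2) * (\<integral>\<^sup>+\<omega>. ennreal (nu2 c w k i \<omega>) \<partial>M))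
        = ennreal (t\<^sup>2 / real (bsize c)) * (\<integral>\<^sup>+\<omega>. ennreal (nu2 c w k i \<omega>) \<partial>M)" by (simp add: n_def)
  qed
  finally show ?thesis .
qed

end

section \<open>Mean square recursions of the estimator\<close>

lemma integral_bound:
  assumes "f \<in> borel_measurable M" "\<And>\<omega>. 0 \<le> f \<omega>" "(\<integral>\<^sup>+\<omega>. ennreal (f \<omega>) \<partial>M) \<le> ennreal c" "0 \<le> c"
  shows "integrable M f" "(\<integral>\<omega>. f \<omega> \<partial>M) \<le> c"
proof -
  show "integrable M f"
    using assms by (intro integrableI_nonneg AE_I2) (auto simp: order_le_less_trans[OF _ ennreal_less_top])
  have "(\<integral>\<omega>. f \<omega> \<partial>M) = enn2real (\<integral>\<^sup>+\<omega>. ennreal (f \<omega>) \<partial>M)"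
    using assms by (intro integral_eq_nn_integral AE_I2) auto
  thus "(\<integral>\<omega>. f \<omega> \<partial>M) \<le> c" using enn2real_mono[OF assms(3)] assms(4) by simp
qed

context sampled_run
begin

lemma er_measurable_M: "k < K \<Longrightarrow> j < vdim pb w \<Longrightarrow> (\<lambda>\<omega>. er w k i \<omega> j) \<in> borel_measurable M"
  by (rule measurable_alg_M[OF er_measurable past_sub])

lemma coin_past: "coin rn (Suc i) \<in> measurable M (count_space UNIV)"
  using sources_mem(2)[of "Suc i"] by (intro coin_measurable) simp

lemma xi_measurable: "k < K \<Longrightarrow> j < vdim pb w \<Longrightarrow> (\<lambda>\<omega>. xi w k i \<omega> j) \<in> borel_measurable M"
  unfolding xi_def
  by (intro borel_measurable_diff borel_measurable_times er_measurable_M measurable_compose[OF coin_past]) auto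

definition lvl :: "var \<Rightarrow> real" where
  "lvl w = \<sigma>\<^sup>2 * ((beta par w)\<^sup>2 / b + p / B * online_ind pb)"

text \<open>What the fresh samples of one agent can add to a mean square error in one iteration: the
  movement of its iterate, divided by the batch size, and the noise floor
  \<open>lvl\<close>.\<close>

definition noise :: "var \<Rightarrow> nat \<Rightarrow> nat \<Rightarrow> real" where
  "noise w k i = 2 * L\<^sub>f\<^sup>2 / b * (\<integral>\<omega>. dist2 k i \<omega> \<partial>M) + 2 * lvl w"

lemma dist2_nonneg: "0 \<le> dist2 k i \<omega>" by (simp add: dist2_def)

lemma nu2_nonneg: "0 \<le> nu2 c w k i \<omega>" by (simp add: nu2_def dist2_nonneg)

lemma nu2_integral:
  assumes "integrable M (dist2 k i)"
  shows "(\<integral>\<^sup>+\<omega>. ennreal (nu2 c w k i \<omega>) \<partial>M)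
    = ennreal (if c then \<sigma>\<^sup>2 else 2 * (L\<^sub>f\<^sup>2 * (\<integral>\<omega>. dist2 k i \<omega> \<partial>M)) + 2 * (beta par w)\<^sup>2 * \<sigma>\<^sup>2)"
proof -
  have "integrable M (nu2 c w k i)" unfolding nu2_def[abs_def] using assms by (cases c) auto
  hence "(\<integral>\<^sup>+\<omega>. ennreal (nu2 c w k i \<omega>) \<partial>M) = ennreal (\<integral>\<omega>. nu2 c w k i \<omega> \<partial>M)"
    by (intro nn_integral_eq_integral AE_I2 nu2_nonneg)
  thus ?thesis unfolding nu2_def using assms by (cases c) (simp_all add: prob_space)
qed

text \<open>The two branches are averaged over the coin. Offline \<open>bsize True\<close> is 0 and
  the quotient is 0 by convention, in agreement with \<open>online_ind\<close>.\<close>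

lemma noise_weights:
  assumes D: "0 \<le> D"
  shows "p * (\<sigma>\<^sup>2 / real (bsize True)) + (1 - p) * ((2 * (L\<^sub>f\<^sup>2 * D) + 2 * (beta par w)\<^sup>2 * \<sigma>\<^sup>2) / real (bsize False))
    \<le> 2 * L\<^sub>f\<^sup>2 / b * D + 2 * lvl w"
proof -
  have b: "0 < b" using batches(2) by simp
  have p: "0 \<le> p" "p \<le> 1" using p01 by auto
  define q where "q = (2 * (L\<^sub>f\<^sup>2 * D) + 2 * (beta par w)\<^sup>2 * \<sigma>\<^sup>2) / b"
  have q: "0 \<le> q" "q = 2 * L\<^sub>f\<^sup>2 / b * D + 2 * ((beta par w)\<^sup>2 / b * \<sigma>\<^sup>2)"
    using b D by (simp_all add: q_def add_divide_distrib)
  have "(1 - p) * q \<le> 1 * q" using p q by (intro mult_right_mono) auto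
  moreover have "p * (\<sigma>\<^sup>2 / real (bsize True)) = \<sigma>\<^sup>2 * (p / B * online_ind pb)"
    by (simp add: bsize_def online_ind_def)
  moreover have "0 \<le> \<sigma>\<^sup>2 * (p / B * online_ind pb)" using p by (simp add: online_ind_def)
  moreover have "lvl w = (beta par w)\<^sup>2 / b * \<sigma>\<^sup>2 + \<sigma>\<^sup>2 * (p / B * online_ind pb)"
    unfolding lvl_def by (simp add: distrib_left mult.commute)
  moreover have e: "(2 * (L\<^sub>f\<^sup>2 * D) + 2 * (beta par w)\<^sup>2 * \<sigma>\<^sup>2) / real (bsize False) = q"
    by (simp add: q_def bsize_def)
  ultimately show ?thesis unfolding e using q(2) by argo
qed

text \<open>The two branches are added. The carried part \<open>U\<close> may depend on the outcome
  of the coin, and \<open>A\<close> and \<open>t\<close> are kept general: one agent with weight 1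
  gives the local errors, all agents with weight \<open>1 / K\<close> the error of the mean.\<close>

lemma innovation_bound:
  fixes U :: "bool \<Rightarrow> 'w \<Rightarrow> nat \<Rightarrow> real" and t :: real
  assumes A: "A \<subseteq> {..<K}"
    and U: "\<And>c j. j < vdim pb w \<Longrightarrow> (\<lambda>\<omega>. U c \<omega> j) \<in> borel_measurable (alg (past i))"
    and iU: "\<And>c. integrable M (\<lambda>\<omega>. \<Sum>j<vdim pb w. (U c \<omega> j)\<^sup>2)"
    and iD: "\<And>k. k \<in> A \<Longrightarrow> integrable M (dist2 k i)"
    and f: "\<And>\<omega>. f \<omega> = (\<Sum>j<vdim pb w. (U (coin rn (Suc i) \<omega>) \<omega> j + (\<Sum>k\<in>A. t * xi w k i \<omega> j))\<^sup>2)"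
  shows "integrable M f"
    "(\<integral>\<omega>. f \<omega> \<partial>M) \<le> p * (\<integral>\<omega>. (\<Sum>j<vdim pb w. (U True \<omega> j)\<^sup>2) \<partial>M)
      + (1 - p) * (\<integral>\<omega>. (\<Sum>j<vdim pb w. (U False \<omega> j)\<^sup>2) \<partial>M) + t\<^sup>2 * (\<Sum>k\<in>A. noise w k i)"
proof -
  let ?d = "vdim pb w"
  have p: "0 \<le> p" "p \<le> 1" using p01 by auto
  define F where "F c \<omega> = (\<Sum>j<?d. (U c \<omega> j + (\<Sum>k\<in>A. t * xi w k i \<omega> j))\<^sup>2)" for c \<omega>
  have Fm: "F c \<in> borel_measurable M" for c
    unfolding F_def[abs_def] using A xi_measurable measurable_alg_M[OF U past_sub]
    by (intro borel_measurable_sum borel_measurable_power borel_measurable_add borel_measurable_times) auto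
  have fF: "f \<omega> = F (coin rn (Suc i) \<omega>) \<omega>" for \<omega> by (simp add: f F_def)
  have fm: "f \<in> borel_measurable M"
  proof -
    have "(\<lambda>\<omega>. if coin rn (Suc i) \<omega> then F True \<omega> else F False \<omega>) \<in> borel_measurable M"
      using coin_past by (intro measurable_If Fm) (auto simp: pred_def)
    moreover have "f = (\<lambda>\<omega>. if coin rn (Suc i) \<omega> then F True \<omega> else F False \<omega>)" by (rule ext) (simp add: fF)
    ultimately show ?thesis by simp
  qed
  have cm: "(\<lambda>\<omega>. indicator {c} (coin rn (Suc i) \<omega>) :: ennreal) \<in> borel_measurable M" for c
    by (rule measurable_compose[OF coin_past]) auto
  define u where "u c = (\<integral>\<omega>. (\<Sum>j<?d. (U c \<omega> j)\<^sup>2) \<partial>M)" for c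
  define n where "n c k = (if c then \<sigma>\<^sup>2 else 2 * (L\<^sub>f\<^sup>2 * (\<integral>\<omega>. dist2 k i \<omega> \<partial>M)) + 2 * (beta par w)\<^sup>2 * \<sigma>\<^sup>2)" for c k
  have D0: "0 \<le> (\<integral>\<omega>. dist2 k i \<omega> \<partial>M)" for k by (intro Bochner_Integration.integral_nonneg dist2_nonneg)
  have u0: "0 \<le> u c" for c unfolding u_def by (intro Bochner_Integration.integral_nonneg sum_nonneg) simp
  have n0: "0 \<le> n c k" for c k using D0 by (simp add: n_def)
  define R where "R c = prb c * (u c + (\<Sum>k\<in>A. t\<^sup>2 / real (bsize c) * n c k))" for c
  have prb0: "0 \<le> prb c" for c using p by simp
  have R0: "0 \<le> R c" for c unfolding R_def using prb0 u0 n0 by (intro mult_nonneg_nonneg add_nonneg_nonneg sum_nonneg) auto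
  have br: "(\<integral>\<^sup>+\<omega>. indicator {c} (coin rn (Suc i) \<omega>) * ennreal (F c \<omega>) \<partial>M) \<le> ennreal (R c)" for c
  proof -
    have "(\<integral>\<^sup>+\<omega>. ennreal (\<Sum>j<?d. (U c \<omega> j)\<^sup>2) \<partial>M) = ennreal (u c)"
      unfolding u_def by (intro nn_integral_eq_integral iU AE_I2 sum_nonneg) simp
    moreover have "(\<Sum>k\<in>A. ennreal (t\<^sup>2 / real (bsize c)) * (\<integral>\<^sup>+\<omega>. ennreal (nu2 c w k i \<omega>) \<partial>M))
        = ennreal (\<Sum>k\<in>A. t\<^sup>2 / real (bsize c) * n c k)"
    proof -
      have "(\<Sum>k\<in>A. ennreal (t\<^sup>2 / real (bsize c)) * (\<integral>\<^sup>+\<omega>. ennreal (nu2 c w k i \<omega>) \<partial>M))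
          = (\<Sum>k\<in>A. ennreal (t\<^sup>2 / real (bsize c) * n c k))"
      proof (rule sum.cong[OF refl])
        fix k assume k: "k \<in> A"
        show "ennreal (t\<^sup>2 / real (bsize c)) * (\<integral>\<^sup>+\<omega>. ennreal (nu2 c w k i \<omega>) \<partial>M) = ennreal (t\<^sup>2 / real (bsize c) * n c k)"
          unfolding nu2_integral[OF iD[OF k]] n_def[symmetric] using n0 by (intro ennreal_mult[symmetric]) auto
      qed
      also have "\<dots> = ennreal (\<Sum>k\<in>A. t\<^sup>2 / real (bsize c) * n c k)"
        by (rule sum_ennreal) (use n0 in simp)
      finally show ?thesis .
    qed
    ultimately show ?thesis
      using innovation_branch[where w = w and i = i and t = t and c = c and U = "U c", OF A U, folded F_def]
        u0[of c] prb0[of c] n0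
      by (simp add: R_def ennreal_mult sum_nonneg del: ennreal_plus flip: ennreal_plus)
  qed
  have "(\<integral>\<^sup>+\<omega>. ennreal (f \<omega>) \<partial>M) = (\<integral>\<^sup>+\<omega>. indicator {True} (coin rn (Suc i) \<omega>) * ennreal (F True \<omega>)
      + indicator {False} (coin rn (Suc i) \<omega>) * ennreal (F False \<omega>) \<partial>M)"
    by (intro nn_integral_cong) (simp add: fF indicator_def)
  also have "\<dots> = (\<integral>\<^sup>+\<omega>. indicator {True} (coin rn (Suc i) \<omega>) * ennreal (F True \<omega>) \<partial>M)
      + (\<integral>\<^sup>+\<omega>. indicator {False} (coin rn (Suc i) \<omega>) * ennreal (F False \<omega>) \<partial>M)"
    by (intro nn_integral_add borel_measurable_times_ennreal cm measurable_compose[OF Fm measurable_ennreal])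
  also have "\<dots> \<le> ennreal (R True) + ennreal (R False)" by (intro add_mono br)
  also have "\<dots> = ennreal (R True + R False)" using R0 by simp
  finally have le: "(\<integral>\<^sup>+\<omega>. ennreal (f \<omega>) \<partial>M) \<le> ennreal (R True + R False)" .
  have f0: "0 \<le> f \<omega>" for \<omega> by (simp add: f sum_nonneg)
  note I = integral_bound[OF fm f0 le add_nonneg_nonneg[OF R0 R0]]
  show "integrable M f" by (rule I(1))
  have "R True + R False = p * u True + (1 - p) * u False
      + t\<^sup>2 * (\<Sum>k\<in>A. p * (n True k / real (bsize True)) + (1 - p) * (n False k / real (bsize False)))"
    unfolding R_def by (simp add: sum.distrib sum_distrib_left distrib_left mult_ac del: sum_constant)
  also have "\<dots> \<le> p * u True + (1 - p) * u False + t\<^sup>2 * (\<Sum>k\<in>A. noise w k i)"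
    using noise_weights[OF D0] by (intro add_left_mono mult_left_mono sum_mono) (auto simp: n_def noise_def)
  finally show "(\<integral>\<omega>. f \<omega> \<partial>M) \<le> p * (\<integral>\<omega>. (\<Sum>j<?d. (U True \<omega> j)\<^sup>2) \<partial>M)
      + (1 - p) * (\<integral>\<omega>. (\<Sum>j<?d. (U False \<omega> j)\<^sup>2) \<partial>M) + t\<^sup>2 * (\<Sum>k\<in>A. noise w k i)"
    using I(2) by (simp add: u_def)
qed

definition ers :: "var \<Rightarrow> nat \<Rightarrow> nat \<Rightarrow> 'w \<Rightarrow> real" where
  "ers w k i \<omega> = (\<Sum>j<vdim pb w. (er w k i \<omega> j)\<^sup>2)"

definition ecs :: "var \<Rightarrow> nat \<Rightarrow> 'w \<Rightarrow> real" where
  "ecs w i \<omega> = (\<Sum>j<vdim pb w. ((\<Sum>k<K. er w k i \<omega> j) / real K)\<^sup>2)"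

definition ginc :: "var \<Rightarrow> nat \<Rightarrow> nat \<Rightarrow> 'w \<Rightarrow> real" where
  "ginc w k i \<omega> = (vnorm (gk w k (Suc i) \<omega> - gk w k i \<omega>))\<^sup>2"

abbreviation "decay w \<equiv> p + beta par w - p * beta par w"

text \<open>The old error survives with probability \<open>1 - p\<close>, and its square is then
  multiplied by the square of \<open>1 - beta par w\<close>, which is at most the number itself. The
  product of the two complements is one minus \<open>decay w\<close>.\<close>

lemma decay_weight:
  assumes "0 \<le> (x::real)" shows "(1 - p) * ((1 - beta par w)\<^sup>2 * x) \<le> (1 - decay w) * x"
proof -
  have "(1 - beta par w)\<^sup>2 \<le> 1 - beta par w"
    using beta01[of w] by (simp add: power2_eq_square mult_left_le)
  hence "(1 - p) * (1 - beta par w)\<^sup>2 \<le> (1 - p) * (1 - beta par w)" using p01 by (intro mult_left_mono) auto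
  hence "(1 - p) * (1 - beta par w)\<^sup>2 * x \<le> (1 - p) * (1 - beta par w) * x" using assms by (rule mult_right_mono)
  thus ?thesis by (simp add: algebra_simps)
qed

lemma er_Suc: "er w k (Suc i) \<omega> j = carry w (coin rn (Suc i) \<omega>) * er w k i \<omega> j + xi w k i \<omega> j"
  by (simp add: xi_def)

lemma local_error_step:
  assumes k: "k < K" and i1: "integrable M (ers w k i)" and i2: "integrable M (dist2 k i)"
  shows "integrable M (ers w k (Suc i))"
    "(\<integral>\<omega>. ers w k (Suc i) \<omega> \<partial>M) \<le> (1 - decay w) * (\<integral>\<omega>. ers w k i \<omega> \<partial>M) + noise w k i"
proof -
  define U where "U c \<omega> j = carry w c * er w k i \<omega> j" for c \<omega> j
  have US: "(\<Sum>j<vdim pb w. (U c \<omega> j)\<^sup>2) = (carry w c)\<^sup>2 * ers w k i \<omega>" for c \<omega>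
    by (simp add: U_def ers_def power_mult_distrib sum_distrib_left)
  have Um: "(\<lambda>\<omega>. U c \<omega> j) \<in> borel_measurable (alg (past i))" if "j < vdim pb w" for c j
    unfolding U_def using er_measurable[OF k that] by (intro borel_measurable_times) auto
  have Ui: "integrable M (\<lambda>\<omega>. \<Sum>j<vdim pb w. (U c \<omega> j)\<^sup>2)" for c unfolding US using i1 by simp
  have E: "ers w k (Suc i) \<omega> = (\<Sum>j<vdim pb w. (U (coin rn (Suc i) \<omega>) \<omega> j + (\<Sum>k\<in>{k}. 1 * xi w k i \<omega> j))\<^sup>2)" for \<omega>
    by (simp add: ers_def er_Suc U_def)
  note I = innovation_bound[where A = "{k}" and t = 1 and U = U and w = w, OF _ Um Ui _ E]
  have "integrable M (ers w k (Suc i)) \<and> (\<integral>\<omega>. ers w k (Suc i) \<omega> \<partial>M) \<le> p * (\<integral>\<omega>. (\<Sum>j<vdim pb w. (U True \<omega> j)\<^sup>2) \<partial>M)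
      + (1 - p) * (\<integral>\<omega>. (\<Sum>j<vdim pb w. (U False \<omega> j)\<^sup>2) \<partial>M) + noise w k i"
    using I k i2 by simp
  thus "integrable M (ers w k (Suc i))"
    "(\<integral>\<omega>. ers w k (Suc i) \<omega> \<partial>M) \<le> (1 - decay w) * (\<integral>\<omega>. ers w k i \<omega> \<partial>M) + noise w k i"
    using decay_weight[of "\<integral>\<omega>. ers w k i \<omega> \<partial>M" w]
    unfolding US by (auto simp: carry_def ers_def sum_nonneg)
qed

text \<open>In the mean each agent has weight \<open>1 / K\<close>, and its square is what
  multiplies the independent innovations. The sum over the agents is therefore divided by
  \<open>K\<^sup>2\<close>.\<close>

lemma mean_error_step:
  assumes i1: "integrable M (ecs w i)" and i2: "\<And>k. k < K \<Longrightarrow> integrable M (dist2 k i)"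
  shows "integrable M (ecs w (Suc i))"
    "(\<integral>\<omega>. ecs w (Suc i) \<omega> \<partial>M) \<le> (1 - decay w) * (\<integral>\<omega>. ecs w i \<omega> \<partial>M) + (\<Sum>k<K. noise w k i) / (real K)\<^sup>2"
proof -
  define U where "U c \<omega> j = carry w c * ((\<Sum>k<K. er w k i \<omega> j) / real K)" for c \<omega> j
  have US: "(\<Sum>j<vdim pb w. (U c \<omega> j)\<^sup>2) = (carry w c)\<^sup>2 * ecs w i \<omega>" for c \<omega>
    unfolding U_def ecs_def power_mult_distrib sum_distrib_left ..
  have E: "(\<Sum>k<K. er w k (Suc i) \<omega> j) / real K = U (coin rn (Suc i) \<omega>) \<omega> j + (\<Sum>k<K. 1 / real K * xi w k i \<omega> j)" for \<omega> j
    unfolding er_Suc U_def by (simp add: sum.distrib add_divide_distrib flip: sum_distrib_left sum_divide_distrib)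
  have Um: "(\<lambda>\<omega>. U c \<omega> j) \<in> borel_measurable (alg (past i))" if "j < vdim pb w" for c j
    unfolding U_def using er_measurable[OF _ that]
    by (intro borel_measurable_times borel_measurable_divide borel_measurable_sum) auto
  have Ui: "integrable M (\<lambda>\<omega>. \<Sum>j<vdim pb w. (U c \<omega> j)\<^sup>2)" for c unfolding US using i1 by simp
  have F: "ecs w (Suc i) \<omega> = (\<Sum>j<vdim pb w. (U (coin rn (Suc i) \<omega>) \<omega> j + (\<Sum>k<K. 1 / real K * xi w k i \<omega> j))\<^sup>2)" for \<omega>
    unfolding ecs_def E ..
  note I = innovation_bound[where A = "{..<K}" and t = "1 / real K" and U = U and w = w, OF order_refl Um Ui _ F]
  have "integrable M (ecs w (Suc i)) \<and> (\<integral>\<omega>. ecs w (Suc i) \<omega> \<partial>M) \<le> p * (\<integral>\<omega>. (\<Sum>j<vdim pb w. (U True \<omega> j)\<^sup>2) \<partial>M)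
      + (1 - p) * (\<integral>\<omega>. (\<Sum>j<vdim pb w. (U False \<omega> j)\<^sup>2) \<partial>M) + (1 / real K)\<^sup>2 * (\<Sum>k<K. noise w k i)"
    using I i2 by simp
  thus "integrable M (ecs w (Suc i))"
    "(\<integral>\<omega>. ecs w (Suc i) \<omega> \<partial>M) \<le> (1 - decay w) * (\<integral>\<omega>. ecs w i \<omega> \<partial>M) + (\<Sum>k<K. noise w k i) / (real K)\<^sup>2"
    using decay_weight[of "\<integral>\<omega>. ecs w i \<omega> \<partial>M" w]
    unfolding US by (auto simp: carry_def ecs_def sum_nonneg power_divide)
qed

text \<open>A restart discards the whole old error, a momentum step the fraction
  \<open>beta par w\<close>. After squaring and averaging over the coin, at most \<open>p\<close>
  plus the square of \<open>beta par w\<close> remains as its weight.\<close>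

lemma estimator_increment:
  assumes k: "k < K" and i1: "integrable M (ers w k i)" and i2: "integrable M (dist2 k i)"
  shows "integrable M (ginc w k i)"
    "(\<integral>\<omega>. ginc w k i \<omega> \<partial>M) \<le> 2 * L\<^sub>f\<^sup>2 * (\<integral>\<omega>. dist2 k i \<omega> \<partial>M)
       + 2 * (p + (beta par w)\<^sup>2) * (\<integral>\<omega>. ers w k i \<omega> \<partial>M) + noise w k i"
proof -
  let ?d = "vdim pb w"
  define dl where "dl \<omega> j = lg w k (Suc i) \<omega> $ j - lg w k i \<omega> $ j" for \<omega> j
  \<comment> \<open>The part of the increment that involves no fresh sample: the change of the true
    gradient minus the discarded part of the old error.\<close>
  define U where "U c \<omega> j = dl \<omega> j - (1 - carry w c) * er w k i \<omega> j" for c \<omega> j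
  define sl where "sl \<omega> = (\<Sum>j<?d. (dl \<omega> j)\<^sup>2)" for \<omega>
  have lgc: "lg w k i' \<omega> \<in> carrier_vec ?d" for i' \<omega> unfolding lg_def by (rule local_grad_carrier[OF k it_carrier(2,3)])
  have sl: "sl \<omega> \<le> L\<^sub>f\<^sup>2 * dist2 k i \<omega>" for \<omega>
  proof -
    have "sl \<omega> = (vnorm (lg w k (Suc i) \<omega> - lg w k i \<omega>))\<^sup>2"
      using lgc[of "Suc i" \<omega>] lgc[of i \<omega>] by (simp add: sl_def dl_def vnorm_sq_real)
    also have "\<dots> \<le> L\<^sub>f\<^sup>2 * dist2 k i \<omega>"
      unfolding lg_def dist2_def by (rule local_grad_lipschitz[OF k it_carrier(2,3) it_carrier(2,3)])
    finally show ?thesis .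
  qed
  have sl0: "0 \<le> sl \<omega>" for \<omega> by (simp add: sl_def sum_nonneg)
  have dlm: "(\<lambda>\<omega>. dl \<omega> j) \<in> borel_measurable (alg (past i))" if "j < ?d" for j
    unfolding dl_def using vmeasD(2)[OF lg_vmeas[OF k] that] vmeasD(2)[OF lg_next_vmeas[OF k] that]
    by (intro borel_measurable_diff) auto
  have Um: "(\<lambda>\<omega>. U c \<omega> j) \<in> borel_measurable (alg (past i))" if "j < ?d" for c j
    unfolding U_def using er_measurable[OF k that] dlm[OF that]
    by (intro borel_measurable_times borel_measurable_diff) auto
  have Ub: "(\<Sum>j<?d. (U c \<omega> j)\<^sup>2) \<le> 2 * (L\<^sub>f\<^sup>2 * dist2 k i \<omega>) + 2 * ((1 - carry w c)\<^sup>2 * ers w k i \<omega>)" for c \<omega>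
  proof -
    have "(U c \<omega> j)\<^sup>2 \<le> 2 * (dl \<omega> j)\<^sup>2 + 2 * ((1 - carry w c)\<^sup>2 * (er w k i \<omega> j)\<^sup>2)" for j
      using square_add_le[of "dl \<omega> j" "- ((1 - carry w c) * er w k i \<omega> j)"] by (simp add: U_def power_mult_distrib)
    hence "(\<Sum>j<?d. (U c \<omega> j)\<^sup>2) \<le> (\<Sum>j<?d. 2 * (dl \<omega> j)\<^sup>2 + 2 * ((1 - carry w c)\<^sup>2 * (er w k i \<omega> j)\<^sup>2))"
      by (rule sum_mono)
    also have "\<dots> = 2 * sl \<omega> + 2 * ((1 - carry w c)\<^sup>2 * ers w k i \<omega>)"
      by (simp only: sum.distrib sum_distrib_left sl_def ers_def)
    finally show ?thesis using sl[of \<omega>] by linarith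
  qed
  have rint: "integrable M (\<lambda>\<omega>. 2 * (L\<^sub>f\<^sup>2 * dist2 k i \<omega>) + 2 * ((1 - carry w c)\<^sup>2 * ers w k i \<omega>))" for c
    using i1 i2 by auto
  have Ui: "integrable M (\<lambda>\<omega>. \<Sum>j<?d. (U c \<omega> j)\<^sup>2)" for c
  proof (rule Bochner_Integration.integrable_bound[OF rint[of c]])
    show "(\<lambda>\<omega>. \<Sum>j<?d. (U c \<omega> j)\<^sup>2) \<in> borel_measurable M"
      using measurable_alg_M[OF Um past_sub] by (intro borel_measurable_sum borel_measurable_power) auto
    show "AE \<omega> in M. norm (\<Sum>j<?d. (U c \<omega> j)\<^sup>2) \<le> norm (2 * (L\<^sub>f\<^sup>2 * dist2 k i \<omega>) + 2 * ((1 - carry w c)\<^sup>2 * ers w k i \<omega>))"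
      using Ub[of c] by (intro AE_I2) (simp add: sum_nonneg abs_of_nonneg order_trans[OF _ abs_ge_self])
  qed
  have UI: "(\<integral>\<omega>. (\<Sum>j<?d. (U c \<omega> j)\<^sup>2) \<partial>M) \<le> 2 * (L\<^sub>f\<^sup>2 * (\<integral>\<omega>. dist2 k i \<omega> \<partial>M))
      + 2 * ((1 - carry w c)\<^sup>2 * (\<integral>\<omega>. ers w k i \<omega> \<partial>M))" for c
  proof -
    have "(\<integral>\<omega>. (\<Sum>j<?d. (U c \<omega> j)\<^sup>2) \<partial>M) \<le> (\<integral>\<omega>. 2 * (L\<^sub>f\<^sup>2 * dist2 k i \<omega>) + 2 * ((1 - carry w c)\<^sup>2 * ers w k i \<omega>) \<partial>M)"
      by (rule integral_mono[OF Ui rint Ub])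
    thus ?thesis using i1 i2 by simp
  qed
  have E: "ginc w k i \<omega> = (\<Sum>j<?d. (U (coin rn (Suc i) \<omega>) \<omega> j + (\<Sum>k\<in>{k}. 1 * xi w k i \<omega> j))\<^sup>2)" for \<omega>
  proof -
    have "ginc w k i \<omega> = (\<Sum>j<?d. (gk w k (Suc i) \<omega> $ j - gk w k i \<omega> $ j)\<^sup>2)"
      using gk_carrier[of w k "Suc i" \<omega>] gk_carrier[of w k i \<omega>] by (simp add: ginc_def vnorm_sq_real)
    thus ?thesis by (simp add: U_def dl_def xi_def er_def algebra_simps)
  qed
  note I = innovation_bound[where A = "{k}" and t = 1 and U = U and w = w, OF _ Um Ui _ E]
  show "integrable M (ginc w k i)" using I(1) k i2 by simp
  define D S where "D = (\<integral>\<omega>. dist2 k i \<omega> \<partial>M)" and "S = (\<integral>\<omega>. ers w k i \<omega> \<partial>M)"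
  have S0: "0 \<le> S" unfolding S_def ers_def by (intro Bochner_Integration.integral_nonneg sum_nonneg) simp
  have p: "0 \<le> p" "p \<le> 1" using p01 by auto
  have "(\<integral>\<omega>. ginc w k i \<omega> \<partial>M) \<le> p * (\<integral>\<omega>. (\<Sum>j<?d. (U True \<omega> j)\<^sup>2) \<partial>M)
      + (1 - p) * (\<integral>\<omega>. (\<Sum>j<?d. (U False \<omega> j)\<^sup>2) \<partial>M) + noise w k i" using I(2) k i2 by simp
  also have "\<dots> \<le> p * (2 * (L\<^sub>f\<^sup>2 * D) + 2 * S) + (1 - p) * (2 * (L\<^sub>f\<^sup>2 * D) + 2 * ((beta par w)\<^sup>2 * S)) + noise w k i"
    using UI[of True] UI[of False] p
    by (intro add_mono mult_left_mono order_refl) (simp_all add: carry_def D_def S_def)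
  also have "\<dots> \<le> 2 * L\<^sub>f\<^sup>2 * D + 2 * (p + (beta par w)\<^sup>2) * S + noise w k i"
  proof -
    have "0 \<le> p * ((beta par w)\<^sup>2 * S)" using p S0 by simp
    thus ?thesis by (simp add: algebra_simps)
  qed
  finally show "(\<integral>\<omega>. ginc w k i \<omega> \<partial>M) \<le> 2 * L\<^sub>f\<^sup>2 * (\<integral>\<omega>. dist2 k i \<omega> \<partial>M)
       + 2 * (p + (beta par w)\<^sup>2) * (\<integral>\<omega>. ers w k i \<omega> \<partial>M) + noise w k i" by (simp add: D_def S_def)
qed

end

section \<open>Measurability of the objective and of its maximum\<close>

text \<open>The variables are moved one after the other, and the \<open>x\<close>-gradient at the
  moved \<open>y\<close> is compared with that at the old one. The bound tends to 0 with both
  increments, which gives joint continuity.\<close>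

lemma (in pl_problem) objective_variation:
  assumes x: "x \<in> cx" and y: "y \<in> cy" and h: "h \<in> cx" and k: "k \<in> cy"
  shows "\<bar>J (x + h) (y + k) - J x y\<bar> \<le> (vnorm (gJ Vx x y) + L\<^sub>f * vnorm k) * vnorm h + L\<^sub>f / 2 * (vnorm h)\<^sup>2
    + vnorm (gJ Vy x y) * vnorm k + L\<^sub>f / 2 * (vnorm k)\<^sup>2"
proof -
  have yk: "y + k \<in> cy" using y k by simp
  have c: "gJ Vx x y \<in> cx" "gJ Vy x y \<in> cy" "gJ Vx x (y + k) \<in> cx"
    using gJ_carrier[OF x y, of Vx] gJ_carrier[OF x y, of Vy] gJ_carrier[OF x yk, of Vx] by (simp_all add: vdim_def)
  have "y + k - y = k" using y k by auto
  hence "vnorm (gJ Vx x (y + k) - gJ Vx x y) \<le> L\<^sub>f * vnorm k"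
    using gJ_lip[OF x y, of "y + k" Vy y Vx] yk y by (simp add: var_defs)
  moreover have "gJ Vx x (y + k) = gJ Vx x y + (gJ Vx x (y + k) - gJ Vx x y)" using c by auto
  hence "vnorm (gJ Vx x (y + k)) \<le> vnorm (gJ Vx x y) + vnorm (gJ Vx x (y + k) - gJ Vx x y)"
    using vnorm_triangle[OF c(1) minus_carrier_vec[OF c(3,1)]] by simp
  ultimately have "vnorm (gJ Vx x (y + k)) * vnorm h \<le> (vnorm (gJ Vx x y) + L\<^sub>f * vnorm k) * vnorm h"
    by (intro mult_right_mono) auto
  hence "\<bar>gJ Vx x (y + k) \<bullet> h\<bar> \<le> (vnorm (gJ Vx x y) + L\<^sub>f * vnorm k) * vnorm h"
    using scalar_prod_le_vnorm[OF c(3) h] by linarith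
  thus ?thesis
    using taylor_x[OF x yk h] taylor_y[OF x y k] scalar_prod_le_vnorm[OF c(2) k] by linarith
qed

lemma tendsto_vnorm_coordinates:
  "((\<lambda>v. vnorm (vec d (\<lambda>i. v (n + i)) - vec d (\<lambda>i. u (n + i)))) \<longlongrightarrow> 0) (at (u :: nat \<Rightarrow> real))"
proof -
  have "continuous_on UNIV (\<lambda>v :: nat \<Rightarrow> real. sqrt (\<Sum>i<d. (v (n + i) - u (n + i))\<^sup>2))"
    by (intro continuous_intros continuous_on_product_coordinates)
  hence "isCont (\<lambda>v :: nat \<Rightarrow> real. sqrt (\<Sum>i<d. (v (n + i) - u (n + i))\<^sup>2)) u"
    by (simp add: continuous_on_eq_continuous_at)
  hence "((\<lambda>v. sqrt (\<Sum>i<d. (v (n + i) - u (n + i))\<^sup>2)) \<longlongrightarrow> 0) (at u)"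
    unfolding isCont_def by simp
  thus ?thesis by (simp add: vnorm_def)
qed

context pl_problem
begin

text \<open>The objective as a function of real sequences, where the product topology makes
  continuous functions Borel measurable. Coordinates of \<open>x\<close> come first, those of
  \<open>y\<close> after them.\<close>

definition coord_J :: "(nat \<Rightarrow> real) \<Rightarrow> real" where
  "coord_J u = J (vec (xdim pb) (\<lambda>i. u (0 + i))) (vec (ydim pb) (\<lambda>i. u (xdim pb + i)))"

lemma coord_J_continuous: "continuous_on UNIV coord_J"
proof -
  have "isCont coord_J u" for u
  proof -
    define X Y where "X u = vec (xdim pb) (\<lambda>i. u (0 + i))" and "Y u = vec (ydim pb) (\<lambda>i. u (xdim pb + i))"
      for u :: "nat \<Rightarrow> real"
    define h k where "h v = vnorm (X v - X u)" and "k v = vnorm (Y v - Y u)" for v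
    have XY: "X v \<in> cx" "Y v \<in> cy" for v by (simp_all add: X_def Y_def)
    have hk: "(h \<longlongrightarrow> 0) (at u)" "(k \<longlongrightarrow> 0) (at u)"
      unfolding h_def[abs_def] k_def[abs_def] X_def Y_def by (rule tendsto_vnorm_coordinates)+
    define gx gy where "gx = vnorm (gJ Vx (X u) (Y u))" and "gy = vnorm (gJ Vy (X u) (Y u))"
    have "((\<lambda>v. (gx + L\<^sub>f * k v) * h v + L\<^sub>f / 2 * (h v)\<^sup>2 + gy * k v + L\<^sub>f / 2 * (k v)\<^sup>2)
        \<longlongrightarrow> (gx + L\<^sub>f * 0) * 0 + L\<^sub>f / 2 * 0\<^sup>2 + gy * 0 + L\<^sub>f / 2 * 0\<^sup>2) (at u)"
      by (intro tendsto_intros hk)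
    hence lim: "((\<lambda>v. (gx + L\<^sub>f * k v) * h v + L\<^sub>f / 2 * (h v)\<^sup>2 + gy * k v + L\<^sub>f / 2 * (k v)\<^sup>2) \<longlongrightarrow> 0) (at u)"
      by simp
    have "norm (coord_J v - coord_J u) \<le> (gx + L\<^sub>f * k v) * h v + L\<^sub>f / 2 * (h v)\<^sup>2 + gy * k v + L\<^sub>f / 2 * (k v)\<^sup>2" for v
    proof -
      have "X u + (X v - X u) = X v" "Y u + (Y v - Y u) = Y v" by (auto simp: X_def Y_def)
      moreover have "coord_J v = J (X v) (Y v)" for v by (simp only: coord_J_def X_def Y_def)
      ultimately show ?thesis
        using objective_variation[OF XY(1)[of u] XY(2)[of u] minus_carrier_vec[OF XY(1)[of v] XY(1)[of u]]
            minus_carrier_vec[OF XY(2)[of v] XY(2)[of u]]]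
        by (simp add: h_def k_def gx_def gy_def)
    qed
    hence "((\<lambda>v. coord_J v - coord_J u) \<longlongrightarrow> 0) (at u)"
      by (intro Lim_null_comparison[OF _ lim] always_eventually) auto
    thus ?thesis unfolding isCont_def by (rule LIM_zero_cancel)
  qed
  thus ?thesis by (simp add: continuous_at_imp_continuous_on)
qed

definition coord :: "real vec \<Rightarrow> real vec \<Rightarrow> nat \<Rightarrow> real" where
  "coord x y i = (if i < xdim pb then x $ i else if i < xdim pb + ydim pb then y $ (i - xdim pb) else 0)"

lemma coord_J: "x \<in> cx \<Longrightarrow> y \<in> cy \<Longrightarrow> coord_J (coord x y) = J x y"
  unfolding coord_J_def by (rule arg_cong2[where f = J]) (auto simp: coord_def)

lemma coord_measurable:
  assumes "\<And>j. j < xdim pb \<Longrightarrow> (\<lambda>\<omega>. X \<omega> $ j) \<in> borel_measurable N"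
    "\<And>j. j < ydim pb \<Longrightarrow> (\<lambda>\<omega>. Y \<omega> $ j) \<in> borel_measurable N"
  shows "(\<lambda>\<omega>. coord (X \<omega>) (Y \<omega>)) \<in> borel_measurable N"
proof (rule measurable_coordinatewise_then_product)
  fix i show "(\<lambda>\<omega>. coord (X \<omega>) (Y \<omega>) i) \<in> borel_measurable N"
    using assms(1)[of i] assms(2)[of "i - xdim pb"]
    by (cases "i < xdim pb"; cases "i < xdim pb + ydim pb") (auto simp: coord_def)
qed

lemma J_measurable:
  assumes c: "\<And>\<omega>. \<omega> \<in> space N \<Longrightarrow> X \<omega> \<in> cx" "\<And>\<omega>. \<omega> \<in> space N \<Longrightarrow> Y \<omega> \<in> cy"
    and "\<And>j. j < xdim pb \<Longrightarrow> (\<lambda>\<omega>. X \<omega> $ j) \<in> borel_measurable N"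
    "\<And>j. j < ydim pb \<Longrightarrow> (\<lambda>\<omega>. Y \<omega> $ j) \<in> borel_measurable N"
  shows "(\<lambda>\<omega>. J (X \<omega>) (Y \<omega>)) \<in> borel_measurable N"
proof -
  have "(\<lambda>\<omega>. coord_J (coord (X \<omega>) (Y \<omega>))) \<in> borel_measurable N"
    using coord_measurable[OF assms(3,4)] borel_measurable_continuous_onI[OF coord_J_continuous] by (rule measurable_compose)
  thus ?thesis by (rule measurable_cong[THEN iffD1, rotated]) (simp add: coord_J c)
qed

lemma primal_gt_iff: "x \<in> cx \<Longrightarrow> a < P x \<longleftrightarrow> (\<exists>y\<in>cy. a < J x y)"
proof
  assume x: "x \<in> cx" and a: "a < P x"
  obtain y where y: "y \<in> cy" "\<forall>y'\<in>cy. J x y' \<le> J x y" using pl x unfolding pl_condition_def by blast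
  have "P x \<le> J x y" unfolding primal_def using y by (intro cSUP_least) auto
  thus "\<exists>y\<in>cy. a < J x y" using y a by (intro bexI[of _ y]) auto
qed (use primal_upper_J in \<open>auto intro: less_le_trans\<close>)

text \<open>A supremum over uncountably many \<open>y\<close> is not measurable in general. Here the
  set where \<open>P\<close> exceeds \<open>a\<close> is a union of open sets, one for each
  \<open>y\<close>, because \<open>J\<close> is continuous: \<open>P\<close> is lower
  semicontinuous.\<close>

lemma P_measurable:
  assumes c: "\<And>\<omega>. \<omega> \<in> space N \<Longrightarrow> X \<omega> \<in> cx"
    and m: "\<And>j. j < xdim pb \<Longrightarrow> (\<lambda>\<omega>. X \<omega> $ j) \<in> borel_measurable N"
  shows "(\<lambda>\<omega>. P (X \<omega>)) \<in> borel_measurable N"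
proof (rule borel_measurableI_greater)
  fix a
  \<comment> \<open>Replaces all coordinates but those of \<open>x\<close> by the ones of a fixed
    \<open>y\<close>, so that only \<open>x\<close> varies.\<close>
  define put where "put y u i = (if i < xdim pb then u i else coord (0\<^sub>v (xdim pb)) y i)" for y and u :: "nat \<Rightarrow> real" and i
  have "continuous_on UNIV (put y)" for y
    unfolding put_def[abs_def]
  proof (rule continuous_on_coordinatewise_then_product)
    fix i show "continuous_on UNIV (\<lambda>u :: nat \<Rightarrow> real. if i < xdim pb then u i else coord (0\<^sub>v (xdim pb)) y i)"
      by (cases "i < xdim pb") (auto intro: continuous_on_product_coordinates)
  qed
  hence "continuous_on UNIV (\<lambda>u. coord_J (put y u))" for y
    using continuous_on_compose2[OF coord_J_continuous] by blast
  hence op: "open (\<Union>y\<in>cy. {u. a < coord_J (put y u)})"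
    by (intro open_UN ballI open_Collect_less continuous_on_const)
  define f where "f \<omega> = coord (X \<omega>) (0\<^sub>v (ydim pb))" for \<omega>
  have f: "f \<in> borel_measurable N" unfolding f_def[abs_def] by (rule coord_measurable[OF m]) auto
  have "a < P (X \<omega>) \<longleftrightarrow> f \<omega> \<in> (\<Union>y\<in>cy. {u. a < coord_J (put y u)})" if w: "\<omega> \<in> space N" for \<omega>
  proof -
    have "coord_J (put y (f \<omega>)) = J (X \<omega>) y" if "y \<in> cy" for y
    proof -
      have "put y (f \<omega>) = coord (X \<omega>) y" by (rule ext) (simp add: put_def f_def coord_def)
      thus ?thesis using coord_J[OF c[OF w] that] by simp
    qed
    thus ?thesis using primal_gt_iff[OF c[OF w]] by auto
  qed
  hence "{\<omega> \<in> space N. a < P (X \<omega>)} = f -` (\<Union>y\<in>cy. {u. a < coord_J (put y u)}) \<inter> space N" by blast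
  also have "\<dots> \<in> sets N" using f borel_open[OF op] by (rule measurable_sets)
  finally show "{\<omega> \<in> space N. a < P (X \<omega>)} \<in> sets N" .
qed

end

section \<open>The initial estimates\<close>

context sampled_run
begin

text \<open>\<open>past 0\<close> already contains the first samples. For these to be integrated
  out, the starting point has to be measurable in the initial source alone.\<close>

lemma it_init_vmeas: "k < K \<Longrightarrow> vmeas {Initial} (vdim pb w) (it w k 0)"
proof -
  assume k: "k < K"
  have "Initial \<in> srcs" by (rule sources_mem(1))
  have f: "(\<forall>\<omega>\<in>space M. init rn w \<omega> \<in> carrier_vec (vdim pb w)) \<and>
      (\<forall>j<vdim pb w. (\<lambda>\<omega>. init rn w \<omega> $ j) \<in> borel_measurable (past0 rn))"
    using samp unfolding sampling_def by blast
  have i: "vmeas {Initial} (vdim pb w) (init rn w)"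
    using f past0_alg[of "{Initial}"] sources_mem(1) unfolding vmeas_def by blast
  have "it w k 0 \<omega> = init rn w \<omega>" if "\<omega> \<in> space M" for \<omega>
    using k f that by (simp add: local_it_def init_state_def Let_def block_stack)
  thus ?thesis using f vmeasD(2)[OF i] by (intro vmeasI[where f = "\<lambda>j \<omega>. init rn w \<omega> $ j"]) auto
qed

text \<open>The first estimates carry no old error, so their error is a sum of fresh centred terms.
  General \<open>A\<close> and \<open>t\<close> again serve one agent as well as the mean.\<close>

lemma initial_error:
  fixes t :: real
  assumes A: "A \<subseteq> {..<K}" and f: "\<And>\<omega>. f \<omega> = (\<Sum>j<vdim pb w. (\<Sum>k\<in>A. t * er w k 0 \<omega> j)\<^sup>2)"
  shows "integrable M f" "(\<integral>\<omega>. f \<omega> \<partial>M) \<le> real (card A) * (t\<^sup>2 * \<sigma>\<^sup>2 / real (batch0 par))"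
proof -
  let ?d = "vdim pb w" and ?n = "batch0 par"
  define Q where "Q = A \<times> {..<?n}"
  define \<psi> where "\<psi> q \<omega> z j = t / real ?n * (cg w (fst q) 0 \<omega> z $ j - lg w (fst q) 0 \<omega> $ j)"
    for q :: "nat \<times> nat" and \<omega> z j
  define V where "V = (t / real ?n)\<^sup>2 * \<sigma>\<^sup>2"
  have fA: "finite A" using A by (rule finite_subset) simp
  have Qk: "fst q < K" "snd q < ?n" if "q \<in> Q" for q using that A by (auto simp: Q_def)
  have S: "{Initial} \<subseteq> srcs" using sources_mem(1) by simp
  have n: "0 < real ?n" using batches(1) by simp
  have lgm: "vmeas {Initial} ?d (lg w k 0)" if "k < K" for k
    unfolding lg_def[abs_def] using it_init_vmeas[OF that, of Vx] it_init_vmeas[OF that, of Vy]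
    by (intro vmeas_local_grad that) (simp_all add: vdim_def)
  have "(\<integral>\<^sup>+\<omega>. ennreal (f \<omega>) \<partial>M)
      = (\<integral>\<^sup>+\<omega>. 1 * ennreal (\<Sum>j<?d. (0 + (\<Sum>q\<in>Q. \<psi> q \<omega> (mini rn 0 (fst q) (snd q) \<omega>) j))\<^sup>2) \<partial>M)"
  proof (rule nn_integral_cong)
    fix \<omega> assume \<omega>: "\<omega> \<in> space M"
    have "(\<Sum>k\<in>A. t * er w k 0 \<omega> j) = (\<Sum>q\<in>Q. \<psi> q \<omega> (mini rn 0 (fst q) (snd q) \<omega>) j)" if j: "j < ?d" for j
    proof -
      have "er w k 0 \<omega> j = (\<Sum>s<?n. (cg w k 0 \<omega> (mini rn 0 k s \<omega>) $ j - lg w k 0 \<omega> $ j) / real ?n)" if "k < K" for k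
        using n gk_init[OF that j, of \<omega>] by (simp add: er_def diff_divide_distrib sum_subtractf sum_divide_distrib)
      hence "(\<Sum>k\<in>A. t * er w k 0 \<omega> j)
          = (\<Sum>k\<in>A. \<Sum>s<?n. t / real ?n * (cg w k 0 \<omega> (mini rn 0 k s \<omega>) $ j - lg w k 0 \<omega> $ j))"
        using A by (intro sum.cong refl) (auto simp: sum_distrib_left subset_iff)
      thus ?thesis by (simp add: Q_def \<psi>_def sum.cartesian_product case_prod_beta)
    qed
    thus "ennreal (f \<omega>) = 1 * ennreal (\<Sum>j<?d. (0 + (\<Sum>q\<in>Q. \<psi> q \<omega> (mini rn 0 (fst q) (snd q) \<omega>) j))\<^sup>2)"
      by (simp add: f)
  qed
  also have "\<dots> \<le> (\<integral>\<^sup>+\<omega>. 1 * (ennreal (\<Sum>j<?d. 0\<^sup>2) + (\<Sum>q\<in>Q. ennreal V)) \<partial>M)"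
  proof (rule noise_second_moment[where S = "{Initial}" and src = "\<lambda>q. Mini 0 (fst q) (snd q)"
        and law = "\<lambda>q. sample_law pb (fst q)"])
    show "finite Q" using fA by (simp add: Q_def)
    show "inj_on (\<lambda>q. Mini 0 (fst q) (snd q)) Q" by (auto simp: inj_on_def prod_eq_iff)
    show "{Initial} \<subseteq> srcs" by (rule S)
    fix q assume q: "q \<in> Q"
    show src: "Mini 0 (fst q) (snd q) \<in> srcs" using sources_mem(3) Qk[OF q] by simp
    show "Mini 0 (fst q) (snd q) \<notin> {Initial}" by simp
    show "mini rn 0 (fst q) (snd q) \<in> M \<rightarrow>\<^sub>M sample_space pb"
      "evts (Mini 0 (fst q) (snd q)) = sets (vimage_algebra (space M) (mini rn 0 (fst q) (snd q)) (sample_space pb))"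
      "distr M (sample_space pb) (mini rn 0 (fst q) (snd q)) = sample_law pb (fst q)"
      using src mini_measurable[OF src] mini_distr[OF src] by (simp_all add: source_events_def)
    show "(\<lambda>(\<omega>, z). \<psi> q \<omega> z j) \<in> borel_measurable (alg {Initial} \<Otimes>\<^sub>M sample_space pb)" if j: "j < ?d" for j
    proof -
      have k: "fst q < K" by (rule Qk(1)[OF q])
      have "(\<lambda>p. cost_grad pb w (fst q) (it Vx (fst q) 0 (fst p)) (it Vy (fst q) 0 (fst p)) (snd p) $ j)
          \<in> borel_measurable (alg {Initial} \<Otimes>\<^sub>M sample_space pb)"
        using it_init_vmeas[OF k, of Vx] it_init_vmeas[OF k, of Vy]
        by (intro cost_grad_measurable_pair k j) (simp_all add: vdim_def)
      moreover have "(\<lambda>p. lg w (fst q) 0 (fst p) $ j) \<in> borel_measurable (alg {Initial} \<Otimes>\<^sub>M sample_space pb)"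
        by (rule measurable_compose[OF measurable_fst vmeasD(2)[OF lgm[OF k] j]])
      ultimately show ?thesis unfolding \<psi>_def cg_def case_prod_beta
        by (intro borel_measurable_times borel_measurable_diff) auto
    qed
    show "AE \<omega> in M. (\<forall>j<?d. integrable (sample_law pb (fst q)) (\<lambda>z. \<psi> q \<omega> z j)
        \<and> (\<integral>z. \<psi> q \<omega> z j \<partial>sample_law pb (fst q)) = 0)
      \<and> (\<integral>\<^sup>+z. ennreal (\<Sum>j<?d. (\<psi> q \<omega> z j)\<^sup>2) \<partial>sample_law pb (fst q)) \<le> ennreal V"
      using variance_at_iterate[OF Qk(1)[OF q], of w 0]
    proof (rule AE_mp, intro AE_I2 impI)
      fix \<omega> assume v: "(\<integral>\<^sup>+z. ennreal ((vnorm (cost_grad pb w (fst q) (it Vx (fst q) 0 \<omega>) (it Vy (fst q) 0 \<omega>) z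
          - pgrad pb w (local_obj pb (fst q)) (it Vx (fst q) 0 \<omega>) (it Vy (fst q) 0 \<omega>)))\<^sup>2) \<partial>sample_law pb (fst q)) \<le> ennreal (\<sigma>\<^sup>2)"
      let ?N = "sample_law pb (fst q)" and ?k = "fst q"
      have k: "?k < K" by (rule Qk(1)[OF q])
      have one: "emeasure ?N (space ?N) = 1" by (rule prob_space.emeasure_space_1[OF law_prob[OF k]])
      have fin: "finite_measure ?N" by (rule prob_space.finite_measure[OF law_prob[OF k]])
      have ci: "integrable ?N (\<lambda>z. cg w ?k 0 \<omega> z $ j)" "(\<integral>z. cg w ?k 0 \<omega> z $ j \<partial>?N) = lg w ?k 0 \<omega> $ j"
        if "j < ?d" for j
        unfolding cg_def lg_def
        by (rule cost_grad_integrable[OF k that it_carrier(2,3)], rule unbiased[OF k that it_carrier(2,3)])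
      have cst: "integrable ?N (\<lambda>z. c :: real)" "(\<integral>z. c \<partial>?N) = c" for c :: real
        using finite_measure.integrable_const[OF fin, of c] one by (simp_all add: measure_def)
      have m: "integrable ?N (\<lambda>z. \<psi> q \<omega> z j)" "(\<integral>z. \<psi> q \<omega> z j \<partial>?N) = 0" if "j < ?d" for j
        unfolding \<psi>_def using ci[OF that] cst by simp_all
      have sq: "ennreal (\<Sum>j<?d. (\<psi> q \<omega> z j)\<^sup>2)
          = ennreal ((t / real ?n)\<^sup>2) * ennreal ((vnorm (cost_grad pb w ?k (it Vx ?k 0 \<omega>) (it Vy ?k 0 \<omega>) z
          - pgrad pb w (local_obj pb ?k) (it Vx ?k 0 \<omega>) (it Vy ?k 0 \<omega>)))\<^sup>2)" for z
        using local_grad_carrier[OF k it_carrier(2)[of ?k 0 \<omega>] it_carrier(3)[of ?k 0 \<omega>], of w]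
        by (subst ennreal_mult[symmetric])
          (auto simp: \<psi>_def cg_def lg_def vnorm_sq_real power_mult_distrib power_divide sum_distrib_left
            intro!: sum_nonneg simp del: local_grad_carrier)
      have cm: "(\<lambda>z. ennreal ((vnorm (cost_grad pb w ?k (it Vx ?k 0 \<omega>) (it Vy ?k 0 \<omega>) z
          - pgrad pb w (local_obj pb ?k) (it Vx ?k 0 \<omega>) (it Vy ?k 0 \<omega>)))\<^sup>2)) \<in> borel_measurable ?N"
      proof -
        have "(\<lambda>z. ennreal (\<Sum>j<?d. (cg w ?k 0 \<omega> z $ j - lg w ?k 0 \<omega> $ j)\<^sup>2)) \<in> borel_measurable ?N"
          using ci(1) by (intro sum_sq_measurable borel_measurable_diff) auto
        thus ?thesis
          using local_grad_carrier[OF k it_carrier(2)[of ?k 0 \<omega>] it_carrier(3)[of ?k 0 \<omega>], of w]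
          by (simp add: vnorm_sq_real cg_def lg_def del: local_grad_carrier)
      qed
      have "(\<integral>\<^sup>+z. ennreal (\<Sum>j<?d. (\<psi> q \<omega> z j)\<^sup>2) \<partial>?N) \<le> ennreal ((t / real ?n)\<^sup>2) * ennreal (\<sigma>\<^sup>2)"
        unfolding sq nn_integral_cmult[OF cm] by (intro mult_left_mono v) simp
      also have "\<dots> = ennreal V" unfolding V_def by (rule ennreal_mult[symmetric]) auto
      finally show "(\<forall>j<?d. integrable ?N (\<lambda>z. \<psi> q \<omega> z j) \<and> (\<integral>z. \<psi> q \<omega> z j \<partial>?N) = 0)
        \<and> (\<integral>\<^sup>+z. ennreal (\<Sum>j<?d. (\<psi> q \<omega> z j)\<^sup>2) \<partial>?N) \<le> ennreal V"
        using m by blast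
    qed
  qed (auto)
  also have "\<dots> = (\<Sum>q\<in>Q. ennreal V)"
    by (simp add: emeasure_space_1 del: sum_constant)
  also have "\<dots> = ennreal (\<Sum>q\<in>Q. V)" by (rule sum_ennreal) (simp add: V_def)
  also have "(\<Sum>q\<in>Q. V) = real (card A) * (t\<^sup>2 * \<sigma>\<^sup>2 / real ?n)"
    using n by (simp add: Q_def V_def card_cartesian_product power_divide power2_eq_square)
  finally have le: "(\<integral>\<^sup>+\<omega>. ennreal (f \<omega>) \<partial>M) \<le> ennreal (real (card A) * (t\<^sup>2 * \<sigma>\<^sup>2 / real ?n))" .
  have fm: "f \<in> borel_measurable M"
  proof -
    have "(\<lambda>\<omega>. \<Sum>j<?d. (\<Sum>k\<in>A. t * er w k 0 \<omega> j)\<^sup>2) \<in> borel_measurable M"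
      using A er_measurable_M
      by (intro borel_measurable_sum borel_measurable_power borel_measurable_times) auto
    moreover have "f = (\<lambda>\<omega>. \<Sum>j<?d. (\<Sum>k\<in>A. t * er w k 0 \<omega> j)\<^sup>2)" by (rule ext) (rule f)
    ultimately show ?thesis by simp
  qed
  have "0 \<le> f \<omega>" for \<omega> by (simp add: f sum_nonneg)
  note I = integral_bound[OF fm this le]
  show "integrable M f" "(\<integral>\<omega>. f \<omega> \<partial>M) \<le> real (card A) * (t\<^sup>2 * \<sigma>\<^sup>2 / real ?n)" using I by simp_all
qed

lemma initial_local_error:
  assumes "k < K"
  shows "integrable M (ers w k 0)" "(\<integral>\<omega>. ers w k 0 \<omega> \<partial>M) \<le> \<sigma>\<^sup>2 / real (batch0 par)"
  using initial_error[where A = "{k}" and f = "ers w k 0" and w = w and t = 1] assms by (simp_all add: ers_def)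

lemma initial_mean_error:
  "integrable M (ecs w 0)" "(\<integral>\<omega>. ecs w 0 \<omega> \<partial>M) \<le> \<sigma>\<^sup>2 / (real K * real (batch0 par))"
proof -
  have "ecs w 0 \<omega> = (\<Sum>j<vdim pb w. (\<Sum>k<K. 1 / real K * er w k 0 \<omega> j)\<^sup>2)" for \<omega>
    by (simp add: ecs_def sum_divide_distrib)
  note I = initial_error[OF order_refl this]
  show "integrable M (ecs w 0)" by (rule I(1))
  show "(\<integral>\<omega>. ecs w 0 \<omega> \<partial>M) \<le> \<sigma>\<^sup>2 / (real K * real (batch0 par))"
    using I(2) agents by (simp add: power_divide power2_eq_square)
qed

end

section \<open>Recursions along a run\<close>

lemma block_diff: "u \<in> carrier_vec (n * d) \<Longrightarrow> v \<in> carrier_vec (n * d) \<Longrightarrow> k < n \<Longrightarrow>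
    block d k (u - v) = block d k u - (block d k v :: real vec)"
  by (intro eq_vecI) (simp_all add: block_def block_index_less)

lemma vmean_block_add:
  assumes "u \<in> carrier_vec (n * d)" "v \<in> carrier_vec (n * d)"
  shows "vmean d n (\<lambda>k. block d k (u + v)) = vmean d n (\<lambda>k. block d k u) + vmean d n (\<lambda>k. block d k v)"
  using assms by (intro eq_vecI)
    (simp_all add: vmean_def block_def block_index_less sum.distrib add_divide_distrib)

lemma vmean_block_diff:
  assumes "u \<in> carrier_vec (n * d)" "v \<in> carrier_vec (n * d)"
  shows "vmean d n (\<lambda>k. block d k (u - v)) = vmean d n (\<lambda>k. block d k u) - vmean d n (\<lambda>k. block d k v)"
  using assms by (intro eq_vecI)
    (simp_all add: vmean_def block_def block_index_less sum_subtractf diff_divide_distrib)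

lemma vmean_block_smult:
  assumes "v \<in> carrier_vec (n * d)"
  shows "vmean d n (\<lambda>k. block d k (c \<cdot>\<^sub>v v)) = c \<cdot>\<^sub>v vmean d n (\<lambda>k. block d k v)"
  using assms by (intro eq_vecI)
    (simp_all add: vmean_def block_def block_index_less sum_distrib_left)

lemma vec_add_diff_cancel: "a \<in> carrier_vec d \<Longrightarrow> c \<in> carrier_vec d \<Longrightarrow> a + c - a = (c :: real vec)"
  by auto

lemma vec_diff_split: "a \<in> carrier_vec d \<Longrightarrow> c \<in> carrier_vec d \<Longrightarrow> e \<in> carrier_vec d \<Longrightarrow>
    a - e = (a - c) + (c - e :: real vec)"
  by auto

text \<open>\<open>m\<close> is \<open>1 / l\<^sub>b\<close>. For a single agent \<open>m = 0\<close>, and then \<open>l\<^sub>b = 1 / 0 = 0\<close>.\<close>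

locale dama_run = sampled_run pb L\<^sub>f nw par rn \<sigma> + pl_problem pb L\<^sub>f \<nu>
  for pb :: "'z problem" and L\<^sub>f :: real and nw :: network and par :: params
    and rn :: "('w, 'z) randomness" and \<sigma> \<nu> :: real +
  fixes m :: real
  assumes bdd: "primal_bounded_below pb"
    and mu_pos: "\<And>w. 0 < mu par w"
    and beta_eq: "beta par Vx = beta par Vy"
    and steps: "mu par Vx * (32 * L) \<le> 1" "mu par Vx * (16 * \<kappa>\<^sup>2) \<le> mu par Vy" "mu par Vy * (2 * L\<^sub>f) \<le> 1"
    and m: "m = sqrt (max ((opnorm (minv (lam_b pb nw Vx)))\<^sup>2) ((opnorm (minv (lam_b pb nw Vy)))\<^sup>2))"
begin

abbreviation "\<mu>\<^sub>x \<equiv> mu par Vx"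
abbreviation "\<mu>\<^sub>y \<equiv> mu par Vy"
abbreviation "\<beta> \<equiv> beta par Vx"
abbreviation "\<rho> \<equiv> rho nw"
abbreviation "l \<equiv> lambda_a pb nw"
abbreviation "v\<^sub>1 \<equiv> v_one nw"
abbreviation "v\<^sub>2 \<equiv> v_two nw"
abbreviation "\<alpha> \<equiv> 16 * \<kappa>\<^sup>2 * \<mu>\<^sub>x / \<mu>\<^sub>y"
abbreviation "ctr w i \<omega> \<equiv> centroid pb nw par rn w i \<omega>"
abbreviation "pr w i \<omega> \<equiv> prim (st i \<omega>) w"
abbreviation "G w i \<omega> \<equiv> est (st i \<omega>) w"

definition gc :: "var \<Rightarrow> nat \<Rightarrow> 'w \<Rightarrow> real vec" where
  "gc w i \<omega> = vmean (vdim pb w) K (\<lambda>k. gk w k i \<omega>)"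

definition gn :: "var \<Rightarrow> nat \<Rightarrow> 'w \<Rightarrow> real" where
  "gn w i \<omega> = (vnorm (gJ w (ctr Vx i \<omega>) (ctr Vy i \<omega>)))\<^sup>2"

text \<open>The consensus majorant of one outcome, driven by the squared increments of the agents'
  estimates. It is a random variable with a linear recursion, so its expectation obeys the same
  recursion.\<close>

definition hb :: "var \<Rightarrow> nat \<Rightarrow> 'w \<Rightarrow> real" where
  "hb w i \<omega> = cons_bound \<rho> ((v\<^sub>2 * (dir w * mu par w) * m * l)\<^sup>2 / (1 - \<rho>))
      ((v\<^sub>2 * (dir w * mu par w) * m)\<^sup>2 * (vnorm ((kron (amat nw w) (vdim pb w) - kron (avg_mat K) (vdim pb w)) *\<^sub>v G w 0 \<omega>))\<^sup>2)
      (\<lambda>i. \<Sum>k<K. ginc w k i \<omega>) i"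

text \<open>Subtracting the infimum of \<open>P\<close> makes the function nonnegative, so its final
  value can be discarded when the decreases are summed.\<close>

definition lyap :: "nat \<Rightarrow> 'w \<Rightarrow> real" where
  "lyap i \<omega> = lyapunov \<alpha> (ctr Vx i \<omega>) (ctr Vy i \<omega>) - primal_inf pb"

lemma mu_le: "\<mu>\<^sub>x \<le> \<mu>\<^sub>y"
proof -
  have "1 \<le> \<kappa>\<^sup>2" using kappa_ge by (rule one_le_power)
  hence "\<mu>\<^sub>x * 1 \<le> \<mu>\<^sub>x * (16 * \<kappa>\<^sup>2)" using mu_pos[of Vx] by (intro mult_left_mono) auto
  thus ?thesis using steps(2) by simp
qed

lemma norm_constants:
  "opnorm (qmat nw w) \<le> v\<^sub>1" "opnorm (minv (qmat nw w)) \<le> v\<^sub>2" "opnorm (tmat nw w) \<le> \<rho>"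
  "\<rho> < 1" "opnorm (minv (lam_b pb nw w)) \<le> m" "opnorm (lam_a pb nw w) \<le> l" "0 \<le> \<rho>" "0 \<le> l"
proof -
  have mx: "a \<le> sqrt (max (a\<^sup>2) (c\<^sup>2))" "a \<le> sqrt (max (c\<^sup>2) (a\<^sup>2))" for a c :: real
    by (rule real_le_rsqrt, simp)+
  show "opnorm (qmat nw w) \<le> v\<^sub>1" "opnorm (minv (qmat nw w)) \<le> v\<^sub>2" "opnorm (minv (lam_b pb nw w)) \<le> m"
    unfolding v_one_def v_two_def m by (cases w; simp add: mx)+
  show "opnorm (tmat nw w) \<le> \<rho>" "opnorm (lam_a pb nw w) \<le> l"
    unfolding rho_def lambda_a_def by (cases w; simp)+
  have "opnorm (tmat nw w) < 1" for w using fact unfolding contractive_factorization_def Let_def by blast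
  thus "\<rho> < 1" by (simp add: rho_def)
  show "0 \<le> \<rho>" "0 \<le> l" by (simp_all add: rho_def lambda_a_def le_max_iff_disj)
qed

lemma state_carrier:
  assumes "\<omega> \<in> space M"
  shows "pr w i \<omega> \<in> carrier_vec (K * vdim pb w)" "dual (st i \<omega>) w \<in> carrier_vec (K * vdim pb w)"
    "G w i \<omega> \<in> carrier_vec (K * vdim pb w)"
  using state_vmeas[of i w] vmeasD(1)[OF _ assms] by blast+

lemma ctr_eq: "ctr w i \<omega> = vmean (vdim pb w) K (\<lambda>k. block (vdim pb w) k (pr w i \<omega>))"
  by (simp add: centroid_def local_it_def)

lemma ctr_carrier [simp]: "ctr w i \<omega> \<in> carrier_vec (vdim pb w)" "ctr Vx i \<omega> \<in> cx" "ctr Vy i \<omega> \<in> cy"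
  by (simp_all add: centroid_def vdim_def)

lemma gc_carrier [simp]: "gc w i \<omega> \<in> carrier_vec (vdim pb w)" by (simp add: gc_def)

lemma ctr_vmeas: "vmeas (past i) (vdim pb w) (ctr w i)"
  unfolding centroid_def[abs_def] by (intro vmeas_vmean it_vmeas)

lemma gc_vmeas: "vmeas (past i) (vdim pb w) (gc w i)"
  unfolding gc_def[abs_def] by (intro vmeas_vmean gk_vmeas)

lemma ginc_sum:
  assumes "\<omega> \<in> space M"
  shows "(\<Sum>k<K. ginc w k i \<omega>) = (vnorm (G w (Suc i) \<omega> - G w i \<omega>))\<^sup>2"
proof -
  note c = state_carrier(3)[OF assms, where w = w]
  show ?thesis
    unfolding vnorm_sq_blocks[OF minus_carrier_vec[OF c[of "Suc i"] c[of i]]] ginc_def gk_def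
    by (intro sum.cong refl) (simp add: block_diff[OF c[of "Suc i"] c[of i]])
qed

text \<open>Column sums 1 of \<open>amat\<close> and \<open>cmat\<close> and 0 of
  \<open>bmat\<close> remove the network from the mean: the centroid makes a plain step along the
  mean of the estimates.\<close>

lemma ctr_Suc:
  assumes w: "\<omega> \<in> space M"
  shows "ctr w (Suc i) \<omega> = ctr w i \<omega> + (dir w * mu par w) \<cdot>\<^sub>v gc w i \<omega>"
proof -
  let ?d = "vdim pb w" and ?s = "dir w * mu par w"
  let ?mn = "\<lambda>v. vmean ?d K (\<lambda>k. block ?d k v)"
  note c = state_carrier[OF w, of i w]
  have k [simp]: "kron N ?d *\<^sub>v v \<in> carrier_vec (K * ?d)" if "N \<in> carrier_mat K K" for N v
    using that by (intro carrier_vecI) simp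
  have u: "kron (cmat nw w) ?d *\<^sub>v pr w i \<omega> + ?s \<cdot>\<^sub>v G w i \<omega> \<in> carrier_vec (K * ?d)"
    using c by (intro add_carrier_vec smult_carrier_vec k) auto
  have "?mn (pr w (Suc i) \<omega>) = ?mn (kron (amat nw w) ?d *\<^sub>v (kron (cmat nw w) ?d *\<^sub>v pr w i \<omega> + ?s \<cdot>\<^sub>v G w i \<omega>))
      - ?mn (kron (bmat nw w) ?d *\<^sub>v dual (st i \<omega>) w)"
    unfolding prim_Suc by (rule vmean_block_diff[OF k k]) simp_all
  also have "?mn (kron (amat nw w) ?d *\<^sub>v (kron (cmat nw w) ?d *\<^sub>v pr w i \<omega> + ?s \<cdot>\<^sub>v G w i \<omega>))
      = 1 \<cdot>\<^sub>v ?mn (kron (cmat nw w) ?d *\<^sub>v pr w i \<omega> + ?s \<cdot>\<^sub>v G w i \<omega>)"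
    by (rule vmean_kron[OF mats_carrier(1) col_sums(1) u])
  also have "?mn (kron (cmat nw w) ?d *\<^sub>v pr w i \<omega> + ?s \<cdot>\<^sub>v G w i \<omega>)
      = ?mn (kron (cmat nw w) ?d *\<^sub>v pr w i \<omega>) + ?mn (?s \<cdot>\<^sub>v G w i \<omega>)"
    using c by (intro vmean_block_add k smult_carrier_vec) simp_all
  also have "?mn (kron (cmat nw w) ?d *\<^sub>v pr w i \<omega>) = 1 \<cdot>\<^sub>v ?mn (pr w i \<omega>)"
    by (rule vmean_kron[OF mats_carrier(3) col_sums(3) c(1)])
  also have "?mn (?s \<cdot>\<^sub>v G w i \<omega>) = ?s \<cdot>\<^sub>v ?mn (G w i \<omega>)" by (rule vmean_block_smult[OF c(3)])
  also have "?mn (kron (bmat nw w) ?d *\<^sub>v dual (st i \<omega>) w) = 0 \<cdot>\<^sub>v ?mn (dual (st i \<omega>) w)"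
    by (rule vmean_kron[OF mats_carrier(2) col_sums(2) c(2)])
  also have "1 \<cdot>\<^sub>v (1 \<cdot>\<^sub>v ?mn (pr w i \<omega>) + ?s \<cdot>\<^sub>v ?mn (G w i \<omega>)) - 0 \<cdot>\<^sub>v ?mn (dual (st i \<omega>) w)
      = ?mn (pr w i \<omega>) + ?s \<cdot>\<^sub>v ?mn (G w i \<omega>)"
    by (intro eq_vecI) (simp_all add: vmean_def)
  finally show ?thesis unfolding ctr_eq gc_def gk_def .
qed

lemma hat_bound:
  assumes w: "\<omega> \<in> space M"
  shows "(vnorm (hat w (pr w i \<omega>)))\<^sup>2 \<le> v\<^sub>1\<^sup>2 * hb w i \<omega>" "(vnorm (hat w (pr w (Suc i) \<omega>)))\<^sup>2 \<le> v\<^sub>1\<^sup>2 * hb w i \<omega>"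
proof -
  have f: "init rn w \<omega> \<in> carrier_vec (vdim pb w)" "dual0 rn w \<omega> \<in> carrier_vec (vdim pb w)"
    using samp w unfolding sampling_def by blast+
  have z: "hat w (pr w 0 \<omega>) = 0\<^sub>v ((K - 1) * vdim pb w)" "hat w (dual (st 0 \<omega>) w) = 0\<^sub>v ((K - 1) * vdim pb w)"
    using hat_stack_const f by (simp_all add: init_state_def Let_def)
  note H = consensus_error_bound[OF state_carrier[OF w] prim_Suc dual_Suc z norm_constants(1-6), of i,
      folded ginc_sum[OF w], folded hb_def]
  show "(vnorm (hat w (pr w i \<omega>)))\<^sup>2 \<le> v\<^sub>1\<^sup>2 * hb w i \<omega>" "(vnorm (hat w (pr w (Suc i) \<omega>)))\<^sup>2 \<le> v\<^sub>1\<^sup>2 * hb w i \<omega>"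
    using H .
qed

lemma hb_step:
  "hb w (Suc i) \<omega> = \<rho> * hb w i \<omega> + (v\<^sub>2 * (dir w * mu par w) * m * l)\<^sup>2 / (1 - \<rho>) * (\<Sum>k<K. ginc w k i \<omega>)"
  by (simp add: hb_def)

lemma ginc_nonneg: "0 \<le> ginc w k i \<omega>" by (simp add: ginc_def)

lemma hb_nonneg: "0 \<le> hb w i \<omega>"
proof (induction i)
  case (Suc i)
  show ?case unfolding hb_step using norm_constants(4,7) Suc
    by (intro add_nonneg_nonneg mult_nonneg_nonneg sum_nonneg divide_nonneg_nonneg ginc_nonneg) auto
qed (simp add: hb_def)

text \<open>The direction only contributes a sign, which squaring removes, and both step sizes are
  at most \<open>\<mu>\<^sub>y\<close>; so both variables get the same coefficient.\<close>

lemma hb_Suc: "hb w (Suc i) \<omega> \<le> \<rho> * hb w i \<omega> + (v\<^sub>2 * \<mu>\<^sub>y * m * l)\<^sup>2 / (1 - \<rho>) * (\<Sum>k<K. ginc w k i \<omega>)"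
proof -
  have "(mu par w)\<^sup>2 \<le> \<mu>\<^sub>y\<^sup>2" using mu_le mu_pos[of w] by (cases w) (auto intro: power_mono)
  hence "(v\<^sub>2 * m * l)\<^sup>2 * (mu par w)\<^sup>2 \<le> (v\<^sub>2 * m * l)\<^sup>2 * \<mu>\<^sub>y\<^sup>2" by (intro mult_left_mono) auto
  moreover have "(dir w)\<^sup>2 = 1" by (cases w) (simp_all add: dir_def)
  ultimately have "(v\<^sub>2 * (dir w * mu par w) * m * l)\<^sup>2 \<le> (v\<^sub>2 * \<mu>\<^sub>y * m * l)\<^sup>2"
    by (simp add: power_mult_distrib ac_simps)
  hence "(v\<^sub>2 * (dir w * mu par w) * m * l)\<^sup>2 / (1 - \<rho>) * (\<Sum>k<K. ginc w k i \<omega>)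
      \<le> (v\<^sub>2 * \<mu>\<^sub>y * m * l)\<^sup>2 / (1 - \<rho>) * (\<Sum>k<K. ginc w k i \<omega>)"
    using norm_constants(4) by (intro mult_right_mono divide_right_mono sum_nonneg) (auto simp: ginc_def)
  thus ?thesis by (simp add: hb_step)
qed

text \<open>The stacked increment splits orthogonally into its mean, which is the step of the
  centroid, and its disagreement. The latter involves two consecutive iterates, and both are bounded
  by \<open>hb w i\<close>.\<close>

lemma dist2_sum:
  assumes w: "\<omega> \<in> space M"
  shows "(\<Sum>k<K. dist2 k i \<omega>) \<le> real K * (\<mu>\<^sub>x\<^sup>2 * (vnorm (gc Vx i \<omega>))\<^sup>2 + \<mu>\<^sub>y\<^sup>2 * (vnorm (gc Vy i \<omega>))\<^sup>2)
    + 4 * v\<^sub>1\<^sup>2 * (hb Vx i \<omega> + hb Vy i \<omega>)"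
proof -
  have one: "(\<Sum>k<K. (vnorm (it w k (Suc i) \<omega> - it w k i \<omega>))\<^sup>2)
      \<le> real K * ((mu par w)\<^sup>2 * (vnorm (gc w i \<omega>))\<^sup>2) + 4 * v\<^sub>1\<^sup>2 * hb w i \<omega>" for w
  proof -
    let ?d = "vdim pb w"
    note c = state_carrier(1)[OF w, where w = w]
    have cd: "pr w (Suc i) \<omega> - pr w i \<omega> \<in> carrier_vec (K * ?d)" by (rule minus_carrier_vec[OF c c])
    have mn: "vmean ?d K (\<lambda>k. block ?d k (pr w (Suc i) \<omega> - pr w i \<omega>)) = (dir w * mu par w) \<cdot>\<^sub>v gc w i \<omega>"
    proof -
      have "vmean ?d K (\<lambda>k. block ?d k (pr w (Suc i) \<omega> - pr w i \<omega>)) = ctr w (Suc i) \<omega> - ctr w i \<omega>"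
        unfolding ctr_eq by (rule vmean_block_diff[OF c c])
      also have "\<dots> = (dir w * mu par w) \<cdot>\<^sub>v gc w i \<omega>"
        unfolding ctr_Suc[OF w] by (rule vec_add_diff_cancel[of _ ?d]) simp_all
      finally show ?thesis .
    qed
    have d1: "(dir w)\<^sup>2 = 1" by (cases w) (simp_all add: dir_def)
    have "(\<Sum>k<K. (vnorm (it w k (Suc i) \<omega> - it w k i \<omega>))\<^sup>2) = (vnorm (pr w (Suc i) \<omega> - pr w i \<omega>))\<^sup>2"
      unfolding vnorm_sq_blocks[OF cd] local_it_def
      by (intro sum.cong refl) (simp add: block_diff[OF c c])
    also have "\<dots> = (vnorm (hat w (pr w (Suc i) \<omega> - pr w i \<omega>)))\<^sup>2 + real K * (vnorm ((dir w * mu par w) \<cdot>\<^sub>v gc w i \<omega>))\<^sup>2"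
      using vnorm_sq_hat[OF cd] unfolding mn by simp
    also have "(vnorm ((dir w * mu par w) \<cdot>\<^sub>v gc w i \<omega>))\<^sup>2 = (mu par w)\<^sup>2 * (vnorm (gc w i \<omega>))\<^sup>2"
      using d1 by (simp add: vnorm_smult power_mult_distrib)
    also have "(vnorm (hat w (pr w (Suc i) \<omega> - pr w i \<omega>)))\<^sup>2
        \<le> 2 * (vnorm (hat w (pr w (Suc i) \<omega>)))\<^sup>2 + 2 * (vnorm (hat w (pr w i \<omega>)))\<^sup>2"
      unfolding hat_diff[OF c c] by (rule vnorm_diff_sq_le) (rule hat_carrier)+
    also have "\<dots> \<le> 4 * v\<^sub>1\<^sup>2 * hb w i \<omega>" using hat_bound[OF w, of w i] by simp
    finally show ?thesis by simp
  qed
  have "(\<Sum>k<K. dist2 k i \<omega>) = (\<Sum>k<K. (vnorm (it Vx k (Suc i) \<omega> - it Vx k i \<omega>))\<^sup>2)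
      + (\<Sum>k<K. (vnorm (it Vy k (Suc i) \<omega> - it Vy k i \<omega>))\<^sup>2)"
    unfolding dist2_def by (rule sum.distrib)
  thus ?thesis using one[of Vx] one[of Vy] by (simp add: distrib_left)
qed

text \<open>The mean of the true local gradients at the iterates is inserted. One side differs from
  it by the error of the mean estimate, the other by at most the Lipschitz constant times the
  distance of the iterates from their centroid.\<close>

lemma centroid_gradient_error:
  assumes w: "\<omega> \<in> space M"
  shows "(vnorm (gc w i \<omega> - gJ w (ctr Vx i \<omega>) (ctr Vy i \<omega>)))\<^sup>2
    \<le> 2 * ecs w i \<omega> + 2 * (L\<^sub>f\<^sup>2 * (v\<^sub>1\<^sup>2 * (hb Vx i \<omega> + hb Vy i \<omega>)) / real K)"
proof -
  let ?d = "vdim pb w"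
  let ?g = "gJ w (ctr Vx i \<omega>) (ctr Vy i \<omega>)"
  define a where "a = vmean ?d K (\<lambda>k. lg w k i \<omega>)"
  have lgc: "lg w k i \<omega> \<in> carrier_vec ?d" if "k < K" for k
    unfolding lg_def by (rule local_grad_carrier[OF that it_carrier(2,3)])
  have gJc: "?g \<in> carrier_vec ?d" by (rule gJ_carrier) simp_all
  have ac: "a \<in> carrier_vec ?d" by (simp add: a_def)
  have "gc w i \<omega> - ?g = (gc w i \<omega> - a) + (a - ?g)" by (rule vec_diff_split[OF gc_carrier ac gJc])
  hence "(vnorm (gc w i \<omega> - ?g))\<^sup>2 \<le> 2 * (vnorm (gc w i \<omega> - a))\<^sup>2 + 2 * (vnorm (a - ?g))\<^sup>2"
    using vnorm_add_sq_le[OF minus_carrier_vec[OF gc_carrier ac] minus_carrier_vec[OF ac gJc]] by simp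
  moreover have "(vnorm (gc w i \<omega> - a))\<^sup>2 = ecs w i \<omega>"
    by (simp add: vnorm_sq_real gc_def a_def ecs_def er_def vmean_def sum_subtractf diff_divide_distrib)
  moreover have "(vnorm (a - ?g))\<^sup>2 \<le> L\<^sub>f\<^sup>2 * (v\<^sub>1\<^sup>2 * (hb Vx i \<omega> + hb Vy i \<omega>)) / real K"
  proof -
    have "(vnorm (a - ?g))\<^sup>2
        \<le> (\<Sum>k<K. (vnorm (lg w k i \<omega> - pgrad pb w (local_obj pb k) (ctr Vx i \<omega>) (ctr Vy i \<omega>)))\<^sup>2) / real K"
      unfolding a_def obj_grad(2)[OF ctr_carrier(2,3)]
      by (rule vmean_diff_sq_le[OF lgc local_grad_carrier[OF _ ctr_carrier(2,3)]])
    also have "\<dots> \<le> (\<Sum>k<K. L\<^sub>f\<^sup>2 * ((vnorm (it Vx k i \<omega> - ctr Vx i \<omega>))\<^sup>2 + (vnorm (it Vy k i \<omega> - ctr Vy i \<omega>))\<^sup>2)) / real K"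
      unfolding lg_def using local_grad_lipschitz[OF _ it_carrier(2,3) ctr_carrier(2,3)]
      by (intro divide_right_mono sum_mono) auto
    also have "(\<Sum>k<K. L\<^sub>f\<^sup>2 * ((vnorm (it Vx k i \<omega> - ctr Vx i \<omega>))\<^sup>2 + (vnorm (it Vy k i \<omega> - ctr Vy i \<omega>))\<^sup>2))
        = L\<^sub>f\<^sup>2 * ((vnorm (hat Vx (pr Vx i \<omega>)))\<^sup>2 + (vnorm (hat Vy (pr Vy i \<omega>)))\<^sup>2)"
      unfolding consensus_eq_hat[OF state_carrier(1)[OF w], symmetric] ctr_eq local_it_def
      by (simp only: sum.distrib sum_distrib_left distrib_left)
    also have "\<dots> / real K \<le> L\<^sub>f\<^sup>2 * (v\<^sub>1\<^sup>2 * (hb Vx i \<omega> + hb Vy i \<omega>)) / real K"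
      using hat_bound(1)[OF w, of Vx i] hat_bound(1)[OF w, of Vy i]
      by (intro divide_right_mono mult_left_mono) (simp_all add: distrib_left)
    finally show ?thesis .
  qed
  ultimately show ?thesis by linarith
qed

lemma lyap_step:
  assumes w: "\<omega> \<in> space M"
  shows "lyap (Suc i) \<omega> + \<mu>\<^sub>x * (gn Vx i \<omega> / 2 + 2 * \<kappa>\<^sup>2 * gn Vy i \<omega>
      + (vnorm (gc Vx i \<omega>))\<^sup>2 / 10 + 2 * \<kappa>\<^sup>2 * (vnorm (gc Vy i \<omega>))\<^sup>2)
    \<le> lyap i \<omega> + \<mu>\<^sub>x * (16 * \<kappa>\<^sup>2 * (ecs Vx i \<omega> + ecs Vy i \<omega>)
        + 17 * \<kappa>\<^sup>2 * (L\<^sub>f\<^sup>2 * v\<^sub>1\<^sup>2 * (hb Vx i \<omega> + hb Vy i \<omega>)) / real K)"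
proof -
  define H where "H = L\<^sub>f\<^sup>2 * (v\<^sub>1\<^sup>2 * (hb Vx i \<omega> + hb Vy i \<omega>)) / real K"
  have H: "0 \<le> H" by (simp add: H_def hb_nonneg)
  have k1: "1 \<le> \<kappa>\<^sup>2" using kappa_ge by (rule one_le_power)
  have e: "0 \<le> ecs w i \<omega>" for w by (simp add: ecs_def sum_nonneg)
  have gc: "gc Vx i \<omega> \<in> cx" "gc Vy i \<omega> \<in> cy"
    using gc_carrier[of Vx i \<omega>] gc_carrier[of Vy i \<omega>] by (simp_all add: vdim_def)
  have c: "ctr Vx (Suc i) \<omega> = ctr Vx i \<omega> - \<mu>\<^sub>x \<cdot>\<^sub>v gc Vx i \<omega>" "ctr Vy (Suc i) \<omega> = ctr Vy i \<omega> + \<mu>\<^sub>y \<cdot>\<^sub>v gc Vy i \<omega>"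
    unfolding ctr_Suc[OF w] using gc ctr_carrier(2,3)[of i \<omega>] by (auto simp: dir_def)
  have "(vnorm (gc Vx i \<omega> - gJ Vx (ctr Vx i \<omega>) (ctr Vy i \<omega>)))\<^sup>2 / 2
      + 8 * \<kappa>\<^sup>2 * (vnorm (gc Vy i \<omega> - gJ Vy (ctr Vx i \<omega>) (ctr Vy i \<omega>)))\<^sup>2
    \<le> (2 * ecs Vx i \<omega> + 2 * H) / 2 + 8 * \<kappa>\<^sup>2 * (2 * ecs Vy i \<omega> + 2 * H)"
    using centroid_gradient_error[OF w, of _ i, folded H_def]
    by (intro add_mono divide_right_mono mult_left_mono) auto
  also have "\<dots> = ecs Vx i \<omega> + H + 16 * \<kappa>\<^sup>2 * (ecs Vy i \<omega> + H)" by (simp add: algebra_simps)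
  \<comment> \<open>As \<kappa> is at least 1, the unit coefficients coming from \<open>x\<close>
    can be raised to \<open>16 * \<kappa>\<^sup>2\<close> and \<open>\<kappa>\<^sup>2\<close>, which
    makes \<open>x\<close> and \<open>y\<close> symmetric in the errors.\<close>
  also have "\<dots> \<le> 16 * \<kappa>\<^sup>2 * ecs Vx i \<omega> + \<kappa>\<^sup>2 * H + 16 * \<kappa>\<^sup>2 * (ecs Vy i \<omega> + H)"
    using mult_right_mono[OF k1 e[of Vx]] mult_right_mono[OF k1 H] mult_nonneg_nonneg[OF zero_le_power2[of \<kappa>] e[of Vx]]
    by simp
  also have "\<dots> = 16 * \<kappa>\<^sup>2 * (ecs Vx i \<omega> + ecs Vy i \<omega>) + 17 * \<kappa>\<^sup>2 * H" by (simp add: algebra_simps)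
  also have "17 * \<kappa>\<^sup>2 * H = 17 * \<kappa>\<^sup>2 * (L\<^sub>f\<^sup>2 * v\<^sub>1\<^sup>2 * (hb Vx i \<omega> + hb Vy i \<omega>)) / real K"
    by (simp add: H_def mult.assoc)
  finally have E: "(vnorm (gc Vx i \<omega> - gJ Vx (ctr Vx i \<omega>) (ctr Vy i \<omega>)))\<^sup>2 / 2
      + 8 * \<kappa>\<^sup>2 * (vnorm (gc Vy i \<omega> - gJ Vy (ctr Vx i \<omega>) (ctr Vy i \<omega>)))\<^sup>2
    \<le> 16 * \<kappa>\<^sup>2 * (ecs Vx i \<omega> + ecs Vy i \<omega>) + 17 * \<kappa>\<^sup>2 * (L\<^sub>f\<^sup>2 * v\<^sub>1\<^sup>2 * (hb Vx i \<omega> + hb Vy i \<omega>)) / real K" .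
  from lyapunov_descent[OF ctr_carrier(2,3)[of i \<omega>] gc mu_pos steps(1,2) mu_pos steps(3), folded c gn_def]
    mult_left_mono[OF E less_imp_le[OF mu_pos[of Vx]]]
  show ?thesis unfolding lyap_def by linarith
qed

lemma primal_gap_nonneg: "x \<in> cx \<Longrightarrow> 0 \<le> P x - primal_inf pb"
  using bdd unfolding primal_bounded_below_def primal_inf_def by (auto intro: cINF_lower)

lemma lyap_nonneg: "0 \<le> lyap i \<omega>"
proof -
  have "0 \<le> \<alpha> * (P (ctr Vx i \<omega>) - J (ctr Vx i \<omega>) (ctr Vy i \<omega>))"
    using primal_upper_J[OF ctr_carrier(2,3)[of i \<omega>]] mu_pos
    by (intro mult_nonneg_nonneg divide_nonneg_nonneg) (auto simp: less_imp_le)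
  thus ?thesis using primal_gap_nonneg[OF ctr_carrier(2)[of i \<omega>]] by (simp add: lyap_def lyapunov_def)
qed

lemma PJ_measurable:
  "(\<lambda>\<omega>. P (ctr Vx i \<omega>)) \<in> borel_measurable M" "(\<lambda>\<omega>. J (ctr Vx i \<omega>) (ctr Vy i \<omega>)) \<in> borel_measurable M"
proof -
  have c: "(\<lambda>\<omega>. ctr w i \<omega> $ j) \<in> borel_measurable M" if "j < vdim pb w" for w j
    by (rule measurable_alg_M[OF vmeasD(2)[OF ctr_vmeas that] past_sub])
  show "(\<lambda>\<omega>. P (ctr Vx i \<omega>)) \<in> borel_measurable M" "(\<lambda>\<omega>. J (ctr Vx i \<omega>) (ctr Vy i \<omega>)) \<in> borel_measurable M"
    using c[of _ Vx] c[of _ Vy] by (auto intro!: P_measurable J_measurable simp: vdim_def)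
qed

lemma lyap_measurable: "lyap i \<in> borel_measurable M"
  unfolding lyap_def[abs_def] lyapunov_def using PJ_measurable by simp

lemma gJ_vmeas: "vmeas (past i) (vdim pb w) (\<lambda>\<omega>. gJ w (ctr Vx i \<omega>) (ctr Vy i \<omega>))"
  unfolding obj_grad(2)[OF ctr_carrier(2,3)]
  using ctr_vmeas[of i Vx] ctr_vmeas[of i Vy] by (intro vmeas_vmean vmeas_local_grad) (simp_all add: vdim_def)

lemma gn_measurable: "gn w i \<in> borel_measurable M"
  unfolding gn_def[abs_def] by (rule measurable_alg_M[OF vnorm_sq_measurable[OF gJ_vmeas] past_sub])

lemma gc_measurable: "(\<lambda>\<omega>. (vnorm (gc w i \<omega>))\<^sup>2) \<in> borel_measurable M"
  by (rule measurable_alg_M[OF vnorm_sq_measurable[OF gc_vmeas] past_sub])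

lemma start_measurable:
  "(\<lambda>\<omega>. (vnorm ((kron (amat nw w) (vdim pb w) - kron (avg_mat K) (vdim pb w)) *\<^sub>v G w 0 \<omega>))\<^sup>2) \<in> borel_measurable M"
proof -
  have a: "amat nw w - avg_mat K \<in> carrier_mat K K" by (intro minus_carrier_mat) (simp add: avg_mat_def)
  have "kron (amat nw w) (vdim pb w) - kron (avg_mat K) (vdim pb w) = kron (amat nw w - avg_mat K) (vdim pb w)"
    by (rule kron_minus[symmetric, OF mats_carrier(1)]) (simp add: avg_mat_def)
  moreover have "vmeas (past 0) (K * vdim pb w) (\<lambda>\<omega>. kron (amat nw w - avg_mat K) (vdim pb w) *\<^sub>v G w 0 \<omega>)"
    using state_vmeas[of 0 w] by (intro vmeas_kron[OF _ a]) auto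
  ultimately show ?thesis using measurable_alg_M[OF vnorm_sq_measurable past_sub] by simp
qed

definition start :: "var \<Rightarrow> 'w \<Rightarrow> real" where
  "start w \<omega> = (vnorm ((kron (amat nw w) (vdim pb w) - kron (avg_mat K) (vdim pb w)) *\<^sub>v G w 0 \<omega>))\<^sup>2"

lemma hb_0: "hb w 0 \<omega> = (v\<^sub>2 * m)\<^sup>2 * (mu par w)\<^sup>2 * start w \<omega>"
proof -
  have "(dir w)\<^sup>2 = 1" by (cases w) (simp_all add: dir_def)
  thus ?thesis by (simp add: hb_def start_def power_mult_distrib)
qed

text \<open>The quantities from whose integrability that of the next iteration follows.\<close>

definition finite_moments :: "nat \<Rightarrow> bool" where
  "finite_moments i \<longleftrightarrow> integrable M (lyap i) \<and> (\<forall>w. integrable M (hb w i) \<and> integrable M (ecs w i)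
     \<and> (\<forall>k<K. integrable M (ers w k i)))"

lemma integrable_dominated:
  assumes "integrable M g" "f \<in> borel_measurable M" "\<And>\<omega>. \<omega> \<in> space M \<Longrightarrow> 0 \<le> f \<omega> \<and> f \<omega> \<le> (g \<omega> :: real)"
  shows "integrable M f"
  using assms(1,2)
proof (rule Bochner_Integration.integrable_bound)
  show "AE \<omega> in M. norm (f \<omega>) \<le> norm (g \<omega>)"
  proof (rule AE_I2)
    fix \<omega> assume "\<omega> \<in> space M"
    thus "norm (f \<omega>) \<le> norm (g \<omega>)" using assms(3)[of \<omega>] by simp
  qed
qed

text \<open>The Lyapunov inequality dominates the gradients, the directions and the next Lyapunov
  value by an integrable function. The directions and the majorant dominate the distances; distances
  and old errors give the increments, the new errors and the next majorant.\<close>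

lemma finite_moments_step:
  assumes s: "finite_moments i"
  shows "integrable M (gn w i)" "integrable M (\<lambda>\<omega>. (vnorm (gc w i \<omega>))\<^sup>2)"
    "k < K \<Longrightarrow> integrable M (dist2 k i)" "k < K \<Longrightarrow> integrable M (ginc w k i)" "finite_moments (Suc i)"
proof -
  have I: "integrable M (lyap i)" "\<And>w. integrable M (hb w i)" "\<And>w. integrable M (ecs w i)"
    "\<And>w k. k < K \<Longrightarrow> integrable M (ers w k i)"
    using s by (auto simp: finite_moments_def)
  \<comment> \<open>The right-hand side of \<open>lyap_step\<close>. All terms on its left are
    nonnegative and have, up to \<open>\<mu>\<^sub>x\<close>, a coefficient of at least 1/10, so
    each of them is dominated.\<close>
  define R where "R \<omega> = lyap i \<omega> + \<mu>\<^sub>x * (16 * \<kappa>\<^sup>2 * (ecs Vx i \<omega> + ecs Vy i \<omega>)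
        + 17 * \<kappa>\<^sup>2 * (L\<^sub>f\<^sup>2 * v\<^sub>1\<^sup>2 * (hb Vx i \<omega> + hb Vy i \<omega>)) / real K)" for \<omega>
  have R: "integrable M R" unfolding R_def[abs_def] using I by simp
  have k1: "1 \<le> \<kappa>\<^sup>2" using kappa_ge by (rule one_le_power)
  have mx: "0 < \<mu>\<^sub>x" by (rule mu_pos)
  have parts: "lyap (Suc i) \<omega> \<le> R \<omega>" "\<mu>\<^sub>x / 10 * gn w i \<omega> \<le> R \<omega>" "\<mu>\<^sub>x / 10 * (vnorm (gc w i \<omega>))\<^sup>2 \<le> R \<omega>"
    if \<omega>: "\<omega> \<in> space M" for w \<omega>
  proof -
    define a b' c e where "a = gn Vx i \<omega>" and "b' = gn Vy i \<omega>" and "c = (vnorm (gc Vx i \<omega>))\<^sup>2" and "e = (vnorm (gc Vy i \<omega>))\<^sup>2"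
    have nn: "0 \<le> a" "0 \<le> b'" "0 \<le> c" "0 \<le> e" by (simp_all add: a_def b'_def c_def e_def gn_def)
    have kb: "b' \<le> \<kappa>\<^sup>2 * b'" "e \<le> \<kappa>\<^sup>2 * e" using mult_right_mono[OF k1 nn(2)] mult_right_mono[OF k1 nn(4)] by simp_all
    have st: "lyap (Suc i) \<omega> + \<mu>\<^sub>x * (a / 2 + 2 * \<kappa>\<^sup>2 * b' + c / 10 + 2 * \<kappa>\<^sup>2 * e) \<le> R \<omega>"
      using lyap_step[OF \<omega>, of i] by (simp only: R_def a_def b'_def c_def e_def)
    have p: "\<mu>\<^sub>x * x \<le> R \<omega>" if "x \<le> a / 2 + 2 * \<kappa>\<^sup>2 * b' + c / 10 + 2 * \<kappa>\<^sup>2 * e" for x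
      using mult_left_mono[OF that less_imp_le[OF mx]] st lyap_nonneg[of "Suc i" \<omega>] by linarith
    show "lyap (Suc i) \<omega> \<le> R \<omega>"
    proof -
      have "0 \<le> \<mu>\<^sub>x * (a / 2 + 2 * \<kappa>\<^sup>2 * b' + c / 10 + 2 * \<kappa>\<^sup>2 * e)" using mx nn by simp
      thus ?thesis using st by linarith
    qed
    have "\<mu>\<^sub>x * (a / 10) \<le> R \<omega>" "\<mu>\<^sub>x * (b' / 10) \<le> R \<omega>" "\<mu>\<^sub>x * (c / 10) \<le> R \<omega>" "\<mu>\<^sub>x * (e / 10) \<le> R \<omega>"
      using nn kb by (intro p; simp add: mult.assoc; linarith)+
    thus "\<mu>\<^sub>x / 10 * gn w i \<omega> \<le> R \<omega>" "\<mu>\<^sub>x / 10 * (vnorm (gc w i \<omega>))\<^sup>2 \<le> R \<omega>"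
      by (cases w; simp add: a_def b'_def c_def e_def)+
  qed
  have R': "integrable M (\<lambda>\<omega>. 10 / \<mu>\<^sub>x * R \<omega>)" using R by (rule integrable_mult_right)
  have scale: "f \<le> 10 / \<mu>\<^sub>x * r" if "\<mu>\<^sub>x / 10 * f \<le> r" for f r using that mx by (simp add: field_simps)
  have ig: "integrable M (gn w i)" for w
    by (rule integrable_dominated[OF R' gn_measurable]) (use scale[OF parts(2)] in \<open>auto simp: gn_def\<close>)
  show "integrable M (gn w i)" by (rule ig)
  have ic: "integrable M (\<lambda>\<omega>. (vnorm (gc w i \<omega>))\<^sup>2)" for w
    by (rule integrable_dominated[OF R' gc_measurable]) (use scale[OF parts(3)] in auto)
  show "integrable M (\<lambda>\<omega>. (vnorm (gc w i \<omega>))\<^sup>2)" by (rule ic)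
  have il: "integrable M (lyap (Suc i))"
    by (rule integrable_dominated[OF R lyap_measurable]) (use parts(1) lyap_nonneg in auto)
  have id: "integrable M (dist2 k i)" if k: "k < K" for k
  proof (rule integrable_dominated)
    show "integrable M (\<lambda>\<omega>. real K * (\<mu>\<^sub>x\<^sup>2 * (vnorm (gc Vx i \<omega>))\<^sup>2 + \<mu>\<^sub>y\<^sup>2 * (vnorm (gc Vy i \<omega>))\<^sup>2)
        + 4 * v\<^sub>1\<^sup>2 * (hb Vx i \<omega> + hb Vy i \<omega>))" using ic I(2) by simp
    show "dist2 k i \<in> borel_measurable M" by (rule measurable_alg_M[OF dist2_measurable[OF k] past_sub])
    fix \<omega> assume w: "\<omega> \<in> space M"
    have "dist2 k i \<omega> \<le> (\<Sum>k<K. dist2 k i \<omega>)" using k by (intro member_le_sum dist2_nonneg) auto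
    thus "0 \<le> dist2 k i \<omega> \<and> dist2 k i \<omega> \<le> real K * (\<mu>\<^sub>x\<^sup>2 * (vnorm (gc Vx i \<omega>))\<^sup>2 + \<mu>\<^sub>y\<^sup>2 * (vnorm (gc Vy i \<omega>))\<^sup>2)
        + 4 * v\<^sub>1\<^sup>2 * (hb Vx i \<omega> + hb Vy i \<omega>)"
      using dist2_sum[OF w, of i] dist2_nonneg[of k i \<omega>] by linarith
  qed
  show "k < K \<Longrightarrow> integrable M (dist2 k i)" by (rule id)
  have ii: "integrable M (ginc w k i)" if "k < K" for w k
    by (rule estimator_increment(1)[OF that I(4)[OF that] id[OF that]])
  show "k < K \<Longrightarrow> integrable M (ginc w k i)" by (rule ii)
  have "integrable M (hb w (Suc i))" for w
    unfolding hb_step using I(2) ii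
    by (intro Bochner_Integration.integrable_add integrable_mult_right Bochner_Integration.integrable_sum) auto
  thus "finite_moments (Suc i)" unfolding finite_moments_def
    using il mean_error_step(1)[OF I(3) id] local_error_step(1)[OF _ I(4) id] by blast
qed

lemma all_finite_moments:
  assumes "integrable M (lyap 0)" "\<And>w. integrable M (hb w 0)"
  shows "finite_moments i"
proof (induction i)
  case 0
  show ?case unfolding finite_moments_def using assms initial_mean_error(1) initial_local_error(1) by blast
qed (rule finite_moments_step(5))

end

section \<open>The recursions in expectation, and their sum\<close>

context dama_run
begin

abbreviation "\<beta>\<^sub>m \<equiv> p + \<beta> - p * \<beta>"
abbreviation "\<beta>\<^sub>q \<equiv> p + \<beta>\<^sup>2"
abbreviation "b\<^sub>0 \<equiv> real (batch0 par)"
abbreviation "N \<equiv> \<sigma>\<^sup>2 * (\<beta>\<^sup>2 / b + p / B * online_ind pb)"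

lemma beta_any: "beta par w = \<beta>" by (cases w) (simp_all add: beta_eq)

lemma noise_eq: "noise w k i = 2 * L\<^sub>f\<^sup>2 / b * (\<integral>\<omega>. dist2 k i \<omega> \<partial>M) + 2 * N"
  by (simp add: noise_def lvl_def beta_any[of w])

lemma noise_sum: "(\<Sum>k<K. noise w k i) = 2 * L\<^sub>f\<^sup>2 * (\<Sum>k<K. \<integral>\<omega>. dist2 k i \<omega> \<partial>M) / b + 2 * real K * N"
  unfolding noise_eq by (simp add: sum.distrib sum_distrib_left sum_divide_distrib)

text \<open>Checks the premises of \<open>summed_recursions\<close> for the expectations, the
  contributions of \<open>x\<close> and \<open>y\<close> being added. When \<open>m = 0\<close> the
  majorant starts at 0 whatever the first estimates are, so their second moment is required to be
  finite only for nonzero \<open>m\<close>.\<close>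

lemma gradient_sum_bound:
  assumes gap: "integrable M (\<lambda>\<omega>. P (ctr Vx 0 \<omega>) - primal_inf pb)"
    and del: "integrable M (\<lambda>\<omega>. P (ctr Vx 0 \<omega>) - J (ctr Vx 0 \<omega>) (ctr Vy 0 \<omega>))"
    and sta: "\<And>w. m \<noteq> 0 \<Longrightarrow> integrable M (start w)"
    and Z: "0 \<le> Z" "m \<noteq> 0 \<Longrightarrow> (\<integral>\<omega>. start Vx \<omega> \<partial>M) + (\<integral>\<omega>. start Vy \<omega> \<partial>M) = real K * Z"
    and bm: "0 < \<beta>\<^sub>m"
    and eps: "(v\<^sub>1 * v\<^sub>2 * \<mu>\<^sub>y * l * L\<^sub>f * m)\<^sup>2 / (1 - \<rho>)\<^sup>2 \<le> 1 / 620"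
      "(v\<^sub>1 * v\<^sub>2 * \<mu>\<^sub>y * l * L\<^sub>f * m)\<^sup>2 / (1 - \<rho>)\<^sup>2 * \<beta>\<^sub>q \<le> b * \<beta>\<^sub>m / 576"
    and E: "\<mu>\<^sub>y\<^sup>2 * L\<^sub>f\<^sup>2 \<le> real K * b * \<beta>\<^sub>m / 144" "\<kappa>\<^sup>2 * \<mu>\<^sub>x\<^sup>2 * L\<^sub>f\<^sup>2 \<le> real K * b * \<beta>\<^sub>m / 1728"
      "real K * (b * \<beta>\<^sub>m) \<le> 1"
  shows "finite_moments i"
    "(\<Sum>i<T. (\<integral>\<omega>. gn Vx i \<omega> \<partial>M) + (\<integral>\<omega>. gn Vy i \<omega> \<partial>M)) \<le> 13120 * (1 + v\<^sub>1\<^sup>2 * v\<^sub>2\<^sup>2) *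
    ((\<integral>\<omega>. P (ctr Vx 0 \<omega>) - primal_inf pb \<partial>M) / \<mu>\<^sub>x
      + \<kappa>\<^sup>2 * (\<integral>\<omega>. P (ctr Vx 0 \<omega>) - J (ctr Vx 0 \<omega>) (ctr Vy 0 \<omega>) \<partial>M) / \<mu>\<^sub>y
      + \<kappa>\<^sup>2 * (L\<^sub>f\<^sup>2 * m\<^sup>2 / (b * real K * \<beta>\<^sub>m * (1 - \<rho>))) * \<mu>\<^sub>y\<^sup>2 * Z
      + \<kappa>\<^sup>2 * (L\<^sub>f\<^sup>2 * l\<^sup>2 * \<beta>\<^sub>q * m\<^sup>2 / (b * b\<^sub>0 * real K * \<beta>\<^sub>m\<^sup>2 * (1 - \<rho>)\<^sup>2)) * \<mu>\<^sub>y\<^sup>2 * \<sigma>\<^sup>2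
      + \<kappa>\<^sup>2 * (L\<^sub>f\<^sup>2 * l\<^sup>2 * m\<^sup>2 / (b * real K * \<beta>\<^sub>m * (1 - \<rho>)\<^sup>2)) * \<mu>\<^sub>y\<^sup>2 * (real T * N)
      + \<kappa>\<^sup>2 * (\<sigma>\<^sup>2 / (b\<^sub>0 * \<beta>\<^sub>m * real K) + real T * N / (real K * \<beta>\<^sub>m)))"
proof -
  have lyap0: "lyap 0 \<omega> = (P (ctr Vx 0 \<omega>) - primal_inf pb)
      + \<alpha> * (P (ctr Vx 0 \<omega>) - J (ctr Vx 0 \<omega>) (ctr Vy 0 \<omega>))" for \<omega>
    by (simp add: lyap_def lyapunov_def)
  have il: "integrable M (lyap 0)"
    unfolding lyap0[abs_def] by (intro Bochner_Integration.integrable_add integrable_mult_right gap del)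
  have ih: "integrable M (hb w 0)" for w
    unfolding hb_0[abs_def] by (cases "m = 0") (use sta[of w] in auto)
  have S: "finite_moments i" for i by (rule all_finite_moments[OF il ih])
  show "finite_moments i" by (rule S)
  have I: "integrable M (lyap i)" "integrable M (hb w i)" "integrable M (ecs w i)"
    "k < K \<Longrightarrow> integrable M (ers w k i)" for w k i
    using S[of i] by (auto simp: finite_moments_def)
  note J' = finite_moments_step(1-4)[OF S]
  have K: "1 \<le> real K" using agents by simp
  have b: "1 \<le> b" and b0: "1 \<le> b\<^sub>0" using batches by simp_all
  have p: "0 \<le> p" "p \<le> 1" using p01 by auto
  have be: "0 \<le> \<beta>" "\<beta> \<le> 1" using beta01[of Vx] by auto
  have N0: "0 \<le> N" using p by (simp add: online_ind_def)
  have e0: "0 \<le> ecs w i \<omega>" "0 \<le> ers w k i \<omega>" for w k i \<omega> by (simp_all add: ecs_def ers_def sum_nonneg)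
  define dd where "dd i = (\<Sum>k<K. \<integral>\<omega>. dist2 k i \<omega> \<partial>M)" for i
  have dd0: "0 \<le> dd i" for i unfolding dd_def by (intro sum_nonneg Bochner_Integration.integral_nonneg dist2_nonneg)
  define es where "es w i = (\<Sum>k<K. \<integral>\<omega>. ers w k i \<omega> \<partial>M)" for w i
  define gi where "gi w i = (\<Sum>k<K. \<integral>\<omega>. ginc w k i \<omega> \<partial>M)" for w i
  show "(\<Sum>i<T. (\<integral>\<omega>. gn Vx i \<omega> \<partial>M) + (\<integral>\<omega>. gn Vy i \<omega> \<partial>M)) \<le> 13120 * (1 + v\<^sub>1\<^sup>2 * v\<^sub>2\<^sup>2) *
    ((\<integral>\<omega>. P (ctr Vx 0 \<omega>) - primal_inf pb \<partial>M) / \<mu>\<^sub>x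
      + \<kappa>\<^sup>2 * (\<integral>\<omega>. P (ctr Vx 0 \<omega>) - J (ctr Vx 0 \<omega>) (ctr Vy 0 \<omega>) \<partial>M) / \<mu>\<^sub>y
      + \<kappa>\<^sup>2 * (L\<^sub>f\<^sup>2 * m\<^sup>2 / (b * real K * \<beta>\<^sub>m * (1 - \<rho>))) * \<mu>\<^sub>y\<^sup>2 * Z
      + \<kappa>\<^sup>2 * (L\<^sub>f\<^sup>2 * l\<^sup>2 * \<beta>\<^sub>q * m\<^sup>2 / (b * b\<^sub>0 * real K * \<beta>\<^sub>m\<^sup>2 * (1 - \<rho>)\<^sup>2)) * \<mu>\<^sub>y\<^sup>2 * \<sigma>\<^sup>2
      + \<kappa>\<^sup>2 * (L\<^sub>f\<^sup>2 * l\<^sup>2 * m\<^sup>2 / (b * real K * \<beta>\<^sub>m * (1 - \<rho>)\<^sup>2)) * \<mu>\<^sub>y\<^sup>2 * (real T * N)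
      + \<kappa>\<^sup>2 * (\<sigma>\<^sup>2 / (b\<^sub>0 * \<beta>\<^sub>m * real K) + real T * N / (real K * \<beta>\<^sub>m)))"
  proof (rule summed_recursions[where V = "\<lambda>i. \<integral>\<omega>. lyap i \<omega> \<partial>M"
        and gx = "\<lambda>i. \<integral>\<omega>. (vnorm (gc Vx i \<omega>))\<^sup>2 \<partial>M" and gy = "\<lambda>i. \<integral>\<omega>. (vnorm (gc Vy i \<omega>))\<^sup>2 \<partial>M"
        and cc = "\<lambda>i. (\<integral>\<omega>. ecs Vx i \<omega> \<partial>M) + (\<integral>\<omega>. ecs Vy i \<omega> \<partial>M)"
        and ss = "\<lambda>i. es Vx i + es Vy i" and hr = "\<lambda>i. (\<integral>\<omega>. hb Vx i \<omega> \<partial>M) + (\<integral>\<omega>. hb Vy i \<omega> \<partial>M)"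
        and dd = dd and dG = "\<lambda>i. gi Vx i + gi Vy i"])
    fix i
    show "0 \<le> (\<integral>\<omega>. lyap i \<omega> \<partial>M)" "0 \<le> (\<integral>\<omega>. (vnorm (gc Vx i \<omega>))\<^sup>2 \<partial>M)" "0 \<le> (\<integral>\<omega>. (vnorm (gc Vy i \<omega>))\<^sup>2 \<partial>M)"
      "0 \<le> (\<integral>\<omega>. ecs Vx i \<omega> \<partial>M) + (\<integral>\<omega>. ecs Vy i \<omega> \<partial>M)" "0 \<le> es Vx i + es Vy i"
      "0 \<le> (\<integral>\<omega>. hb Vx i \<omega> \<partial>M) + (\<integral>\<omega>. hb Vy i \<omega> \<partial>M)"
      unfolding es_def
      by (intro add_nonneg_nonneg sum_nonneg Bochner_Integration.integral_nonneg lyap_nonneg hb_nonneg e0 zero_le_power2)+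
    show "0 \<le> dd i" by (rule dd0)
    show "0 \<le> (\<integral>\<omega>. gn Vx i \<omega> \<partial>M)" "0 \<le> (\<integral>\<omega>. gn Vy i \<omega> \<partial>M)"
      by (intro Bochner_Integration.integral_nonneg; simp add: gn_def)+
    show "(\<integral>\<omega>. lyap (Suc i) \<omega> \<partial>M) + \<mu>\<^sub>x * ((\<integral>\<omega>. gn Vx i \<omega> \<partial>M) / 2 + 2 * \<kappa>\<^sup>2 * (\<integral>\<omega>. gn Vy i \<omega> \<partial>M)
        + (\<integral>\<omega>. (vnorm (gc Vx i \<omega>))\<^sup>2 \<partial>M) / 10 + 2 * \<kappa>\<^sup>2 * (\<integral>\<omega>. (vnorm (gc Vy i \<omega>))\<^sup>2 \<partial>M))
      \<le> (\<integral>\<omega>. lyap i \<omega> \<partial>M) + \<mu>\<^sub>x * (16 * \<kappa>\<^sup>2 * ((\<integral>\<omega>. ecs Vx i \<omega> \<partial>M) + (\<integral>\<omega>. ecs Vy i \<omega> \<partial>M))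
        + 17 * \<kappa>\<^sup>2 * (L\<^sub>f\<^sup>2 * v\<^sub>1\<^sup>2 * ((\<integral>\<omega>. hb Vx i \<omega> \<partial>M) + (\<integral>\<omega>. hb Vy i \<omega> \<partial>M))) / real K)"
    proof -
      have "(\<integral>\<omega>. lyap (Suc i) \<omega> + \<mu>\<^sub>x * (gn Vx i \<omega> / 2 + 2 * \<kappa>\<^sup>2 * gn Vy i \<omega>
          + (vnorm (gc Vx i \<omega>))\<^sup>2 / 10 + 2 * \<kappa>\<^sup>2 * (vnorm (gc Vy i \<omega>))\<^sup>2) \<partial>M)
        \<le> (\<integral>\<omega>. lyap i \<omega> + \<mu>\<^sub>x * (16 * \<kappa>\<^sup>2 * (ecs Vx i \<omega> + ecs Vy i \<omega>)
        + 17 * \<kappa>\<^sup>2 * (L\<^sub>f\<^sup>2 * v\<^sub>1\<^sup>2 * (hb Vx i \<omega> + hb Vy i \<omega>)) / real K) \<partial>M)"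
      proof (rule integral_mono)
        show "integrable M (\<lambda>\<omega>. lyap (Suc i) \<omega> + \<mu>\<^sub>x * (gn Vx i \<omega> / 2 + 2 * \<kappa>\<^sup>2 * gn Vy i \<omega>
          + (vnorm (gc Vx i \<omega>))\<^sup>2 / 10 + 2 * \<kappa>\<^sup>2 * (vnorm (gc Vy i \<omega>))\<^sup>2))"
          by (intro Bochner_Integration.integrable_add integrable_mult_right integrable_divide I J')
        show "integrable M (\<lambda>\<omega>. lyap i \<omega> + \<mu>\<^sub>x * (16 * \<kappa>\<^sup>2 * (ecs Vx i \<omega> + ecs Vy i \<omega>)
        + 17 * \<kappa>\<^sup>2 * (L\<^sub>f\<^sup>2 * v\<^sub>1\<^sup>2 * (hb Vx i \<omega> + hb Vy i \<omega>)) / real K))"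
          by (intro Bochner_Integration.integrable_add integrable_mult_right integrable_divide I J')
      qed (rule lyap_step)
      thus ?thesis using I J'
        by (simp add: Bochner_Integration.integral_add)
    qed
    show "(\<integral>\<omega>. hb Vx (Suc i) \<omega> \<partial>M) + (\<integral>\<omega>. hb Vy (Suc i) \<omega> \<partial>M)
        \<le> \<rho> * ((\<integral>\<omega>. hb Vx i \<omega> \<partial>M) + (\<integral>\<omega>. hb Vy i \<omega> \<partial>M)) + (v\<^sub>2 * \<mu>\<^sub>y * m * l)\<^sup>2 / (1 - \<rho>) * (gi Vx i + gi Vy i)"
    proof -
      define c where "c = (v\<^sub>2 * \<mu>\<^sub>y * m * l)\<^sup>2 / (1 - \<rho>)"
      have "(\<integral>\<omega>. hb w (Suc i) \<omega> \<partial>M) \<le> \<rho> * (\<integral>\<omega>. hb w i \<omega> \<partial>M) + c * gi w i" for w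
      proof -
        have "(\<integral>\<omega>. hb w (Suc i) \<omega> \<partial>M) \<le> (\<integral>\<omega>. \<rho> * hb w i \<omega> + c * (\<Sum>k<K. ginc w k i \<omega>) \<partial>M)"
          unfolding c_def
          by (intro integral_mono Bochner_Integration.integrable_add integrable_mult_right
              Bochner_Integration.integrable_sum I J' hb_Suc) auto
        also have "\<dots> = \<rho> * (\<integral>\<omega>. hb w i \<omega> \<partial>M) + c * (\<integral>\<omega>. (\<Sum>k<K. ginc w k i \<omega>) \<partial>M)"
          using I J' by (subst Bochner_Integration.integral_add) auto
        also have "(\<integral>\<omega>. (\<Sum>k<K. ginc w k i \<omega>) \<partial>M) = gi w i"
          unfolding gi_def by (rule Bochner_Integration.integral_sum) (use J' in auto)
        finally show ?thesis .
      qed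
      from add_mono[OF this[of Vx] this[of Vy]] show ?thesis by (simp add: c_def distrib_left)
    qed
    define A where "A = L\<^sub>f\<^sup>2 * dd i"
    define NN where "NN = real K * N"
    have ns: "(\<Sum>k<K. noise w k i) = 2 * (A / b) + 2 * NN" for w
      unfolding noise_sum dd_def[symmetric] A_def NN_def by (simp only: mult.assoc times_divide_eq_right)
    show "gi Vx i + gi Vy i \<le> 8 * L\<^sub>f\<^sup>2 * dd i + 2 * \<beta>\<^sub>q * (es Vx i + es Vy i) + 4 * real K * N"
    proof -
      have "gi w i \<le> 2 * L\<^sub>f\<^sup>2 * dd i + 2 * \<beta>\<^sub>q * es w i + (\<Sum>k<K. noise w k i)" for w
      proof -
        have "gi w i \<le> (\<Sum>k<K. 2 * L\<^sub>f\<^sup>2 * (\<integral>\<omega>. dist2 k i \<omega> \<partial>M) + 2 * \<beta>\<^sub>q * (\<integral>\<omega>. ers w k i \<omega> \<partial>M) + noise w k i)"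
          unfolding gi_def using estimator_increment(2)[where w = w and i = i, OF _ I(4) J'(3), unfolded beta_any[of w]]
          by (intro sum_mono) auto
        thus ?thesis by (simp only: dd_def es_def sum.distrib sum_distrib_left)
      qed
      from add_mono[OF this[of Vx] this[of Vy]]
      have "gi Vx i + gi Vy i \<le> 4 * A + (2 * \<beta>\<^sub>q * es Vx i + 2 * \<beta>\<^sub>q * es Vy i) + 4 * (A / b) + 4 * NN"
        unfolding ns A_def[symmetric] mult.assoc[of 2 "L\<^sub>f\<^sup>2"] by linarith
      \<comment> \<open>As \<open>b\<close> is at least 1, the smoothness part of the noise merges
        with the change of the true gradients, and 4 + 4 gives the 8.\<close>
      moreover have "A / b \<le> A / 1"
        using b dd0[of i] by (intro divide_left_mono) (auto simp: A_def)
      hence "A / b \<le> A" by simp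
      moreover have "8 * L\<^sub>f\<^sup>2 * dd i = 8 * A" "4 * real K * N = 4 * NN" by (simp_all only: A_def NN_def mult.assoc)
      moreover have "2 * \<beta>\<^sub>q * (es Vx i + es Vy i) = 2 * \<beta>\<^sub>q * es Vx i + 2 * \<beta>\<^sub>q * es Vy i" by (rule distrib_left)
      ultimately show ?thesis by linarith
    qed
    have lin: "x + y \<le> a * (u + v) + 2 * f" if "x + y \<le> (a * u + f) + (a * v + f)" for x y a u v f :: real
      using that by (simp add: distrib_left)
    have fl: "4 * L\<^sub>f\<^sup>2 * dd i / b + 4 * real K * N = 2 * (2 * (A / b) + 2 * NN)"
      unfolding A_def NN_def by simp
    show "es Vx (Suc i) + es Vy (Suc i) \<le> (1 - \<beta>\<^sub>m) * (es Vx i + es Vy i) + (4 * L\<^sub>f\<^sup>2 * dd i / b + 4 * real K * N)"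
    proof -
      have "es w (Suc i) \<le> (1 - \<beta>\<^sub>m) * es w i + (\<Sum>k<K. noise w k i)" for w
      proof -
        have "es w (Suc i) \<le> (\<Sum>k<K. (1 - \<beta>\<^sub>m) * (\<integral>\<omega>. ers w k i \<omega> \<partial>M) + noise w k i)"
          unfolding es_def using local_error_step(2)[where w = w and i = i, OF _ I(4) J'(3), unfolded beta_any[of w]]
          by (intro sum_mono) auto
        thus ?thesis by (simp only: es_def sum.distrib sum_distrib_left)
      qed
      from lin[OF add_mono[OF this[of Vx] this[of Vy], unfolded ns]] show ?thesis unfolding fl .
    qed
    show "(\<integral>\<omega>. ecs Vx (Suc i) \<omega> \<partial>M) + (\<integral>\<omega>. ecs Vy (Suc i) \<omega> \<partial>M)
        \<le> (1 - \<beta>\<^sub>m) * ((\<integral>\<omega>. ecs Vx i \<omega> \<partial>M) + (\<integral>\<omega>. ecs Vy i \<omega> \<partial>M))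
          + (4 * L\<^sub>f\<^sup>2 * dd i / b + 4 * real K * N) / (real K)\<^sup>2"
    proof -
      define X where "X = (2 * (A / b) + 2 * NN) / (real K)\<^sup>2"
      have "(\<integral>\<omega>. ecs w (Suc i) \<omega> \<partial>M) \<le> (1 - \<beta>\<^sub>m) * (\<integral>\<omega>. ecs w i \<omega> \<partial>M) + X" for w
        unfolding X_def ns[of w, symmetric]
        using mean_error_step(2)[where w = w and i = i, OF I(3) J'(3), unfolded beta_any[of w]] by simp
      from lin[OF add_mono[OF this[of Vx] this[of Vy]]] show ?thesis
        unfolding fl X_def times_divide_eq_right .
    qed
    show "dd i \<le> real K * (\<mu>\<^sub>x\<^sup>2 * (\<integral>\<omega>. (vnorm (gc Vx i \<omega>))\<^sup>2 \<partial>M) + \<mu>\<^sub>y\<^sup>2 * (\<integral>\<omega>. (vnorm (gc Vy i \<omega>))\<^sup>2 \<partial>M))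
        + 4 * v\<^sub>1\<^sup>2 * ((\<integral>\<omega>. hb Vx i \<omega> \<partial>M) + (\<integral>\<omega>. hb Vy i \<omega> \<partial>M))"
    proof -
      have "dd i = (\<integral>\<omega>. (\<Sum>k<K. dist2 k i \<omega>) \<partial>M)"
        unfolding dd_def by (rule Bochner_Integration.integral_sum[symmetric]) (use J' in auto)
      also have "\<dots> \<le> (\<integral>\<omega>. real K * (\<mu>\<^sub>x\<^sup>2 * (vnorm (gc Vx i \<omega>))\<^sup>2 + \<mu>\<^sub>y\<^sup>2 * (vnorm (gc Vy i \<omega>))\<^sup>2)
          + 4 * v\<^sub>1\<^sup>2 * (hb Vx i \<omega> + hb Vy i \<omega>) \<partial>M)"
        by (intro integral_mono Bochner_Integration.integrable_add integrable_mult_right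
            Bochner_Integration.integrable_sum I J' dist2_sum) auto
      also have "\<dots> = real K * (\<mu>\<^sub>x\<^sup>2 * (\<integral>\<omega>. (vnorm (gc Vx i \<omega>))\<^sup>2 \<partial>M) + \<mu>\<^sub>y\<^sup>2 * (\<integral>\<omega>. (vnorm (gc Vy i \<omega>))\<^sup>2 \<partial>M))
        + 4 * v\<^sub>1\<^sup>2 * ((\<integral>\<omega>. hb Vx i \<omega> \<partial>M) + (\<integral>\<omega>. hb Vy i \<omega> \<partial>M))"
        using I J' by (simp add: Bochner_Integration.integral_add)
      finally show ?thesis .
    qed
  next
    show "(\<integral>\<omega>. lyap 0 \<omega> \<partial>M) \<le> (\<integral>\<omega>. P (ctr Vx 0 \<omega>) - primal_inf pb \<partial>M)
        + 16 * \<kappa>\<^sup>2 * \<mu>\<^sub>x / \<mu>\<^sub>y * (\<integral>\<omega>. P (ctr Vx 0 \<omega>) - J (ctr Vx 0 \<omega>) (ctr Vy 0 \<omega>) \<partial>M)"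
      unfolding lyap0[abs_def]
      by (simp only: Bochner_Integration.integral_add[OF gap integrable_mult_right[OF del]] integral_mult_right_zero order_refl)
    show "(\<integral>\<omega>. hb Vx 0 \<omega> \<partial>M) + (\<integral>\<omega>. hb Vy 0 \<omega> \<partial>M) \<le> (v\<^sub>2 * \<mu>\<^sub>y * m)\<^sup>2 * (real K * Z)"
    proof (cases "m = 0")
      case True
      thus ?thesis unfolding hb_0[abs_def] by simp
    next
      case False
      have st0: "0 \<le> (\<integral>\<omega>. start w \<omega> \<partial>M)" for w
        by (intro Bochner_Integration.integral_nonneg) (simp add: start_def)
      have "(\<integral>\<omega>. hb w 0 \<omega> \<partial>M) \<le> (v\<^sub>2 * m)\<^sup>2 * \<mu>\<^sub>y\<^sup>2 * (\<integral>\<omega>. start w \<omega> \<partial>M)" for w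
      proof -
        have "(mu par w)\<^sup>2 \<le> \<mu>\<^sub>y\<^sup>2" using mu_le mu_pos[of w] by (cases w) (auto intro: power_mono)
        hence "(v\<^sub>2 * m)\<^sup>2 * (mu par w)\<^sup>2 * (\<integral>\<omega>. start w \<omega> \<partial>M) \<le> (v\<^sub>2 * m)\<^sup>2 * \<mu>\<^sub>y\<^sup>2 * (\<integral>\<omega>. start w \<omega> \<partial>M)"
          by (intro mult_right_mono mult_left_mono st0) auto
        thus ?thesis unfolding hb_0[abs_def] by simp
      qed
      from add_mono[OF this[of Vx] this[of Vy]]
      have "(\<integral>\<omega>. hb Vx 0 \<omega> \<partial>M) + (\<integral>\<omega>. hb Vy 0 \<omega> \<partial>M) \<le> (v\<^sub>2 * m)\<^sup>2 * \<mu>\<^sub>y\<^sup>2 * (real K * Z)"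
        unfolding Z(2)[OF False, symmetric] by (simp only: distrib_left)
      thus ?thesis by (simp add: power_mult_distrib ac_simps)
    qed
    show "es Vx 0 + es Vy 0 \<le> 2 * real K * \<sigma>\<^sup>2 / b\<^sub>0"
    proof -
      have "es w 0 \<le> (\<Sum>k<K. \<sigma>\<^sup>2 / b\<^sub>0)" for w
        unfolding es_def by (rule sum_mono) (rule initial_local_error(2), simp)
      from add_mono[OF this[of Vx] this[of Vy]] show ?thesis by simp
    qed
    show "(\<integral>\<omega>. ecs Vx 0 \<omega> \<partial>M) + (\<integral>\<omega>. ecs Vy 0 \<omega> \<partial>M) \<le> 2 * \<sigma>\<^sup>2 / (real K * b\<^sub>0)"
      using initial_mean_error(2)[of Vx] initial_mean_error(2)[of Vy] by simp
    show "1 \<le> real K" "1 \<le> b" "1 \<le> b\<^sub>0" "0 < \<beta>\<^sub>m" "0 \<le> \<beta>\<^sub>q" "\<rho> < 1" "1 \<le> \<kappa>" "0 < \<mu>\<^sub>x" "0 < \<mu>\<^sub>y"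
      "0 \<le> \<sigma>\<^sup>2" "0 \<le> Z"
      using K b b0 bm p norm_constants(4) kappa_ge mu_pos Z(1) by auto
    show "0 \<le> N" by (rule N0)
    show "0 \<le> (\<integral>\<omega>. P (ctr Vx 0 \<omega>) - primal_inf pb \<partial>M)"
      by (intro Bochner_Integration.integral_nonneg primal_gap_nonneg ctr_carrier)
    show "0 \<le> (\<integral>\<omega>. P (ctr Vx 0 \<omega>) - J (ctr Vx 0 \<omega>) (ctr Vy 0 \<omega>) \<partial>M)"
      using primal_upper_J[OF ctr_carrier(2,3)] by (intro Bochner_Integration.integral_nonneg) simp
    show "(v\<^sub>1 * v\<^sub>2 * \<mu>\<^sub>y * l * L\<^sub>f * m)\<^sup>2 / (1 - \<rho>)\<^sup>2 = (v\<^sub>1 * v\<^sub>2 * \<mu>\<^sub>y * l * L\<^sub>f * m)\<^sup>2 / (1 - \<rho>)\<^sup>2" ..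
    show "(v\<^sub>1 * v\<^sub>2 * \<mu>\<^sub>y * l * L\<^sub>f * m)\<^sup>2 / (1 - \<rho>)\<^sup>2 \<le> 1 / 620"
      "(v\<^sub>1 * v\<^sub>2 * \<mu>\<^sub>y * l * L\<^sub>f * m)\<^sup>2 / (1 - \<rho>)\<^sup>2 * \<beta>\<^sub>q \<le> b * \<beta>\<^sub>m / 576"
      "\<mu>\<^sub>y\<^sup>2 * L\<^sub>f\<^sup>2 \<le> real K * b * \<beta>\<^sub>m / 144" "\<kappa>\<^sup>2 * \<mu>\<^sub>x\<^sup>2 * L\<^sub>f\<^sup>2 \<le> real K * b * \<beta>\<^sub>m / 1728"
      "real K * (b * \<beta>\<^sub>m) \<le> 1" by (rule eps E)+
    \<comment> \<open>\<open>\<beta>\<^sup>2\<close> is at most \<beta>, and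
      \<open>p * \<beta>\<close> is at most each of its factors.\<close>
    show "\<beta>\<^sub>q \<le> 2 * \<beta>\<^sub>m"
    proof -
      have "\<beta>\<^sup>2 \<le> \<beta>" using be by (simp add: power2_eq_square mult_left_le)
      moreover have "p * \<beta> \<le> p * 1" "p * \<beta> \<le> 1 * \<beta>" using p be by (intro mult_left_mono mult_right_mono; simp)+
      ultimately show ?thesis using p be by (simp add: algebra_simps)
    qed
  qed
qed

end

section \<open>Extended expectations and the step-size conditions\<close>

lemma nn_integral_finite_integrable:
  fixes f :: "'a \<Rightarrow> real"
  assumes "f \<in> borel_measurable M" "\<And>\<omega>. 0 \<le> f \<omega>" "(\<integral>\<^sup>+\<omega>. ennreal (f \<omega>) \<partial>M) \<noteq> \<infinity>"
  shows "integrable M f" "(\<integral>\<^sup>+\<omega>. ennreal (f \<omega>) \<partial>M) = ennreal (\<integral>\<omega>. f \<omega> \<partial>M)"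
proof -
  show i: "integrable M f" using assms by (intro integrableI_nonneg AE_I2) (auto simp: less_top)
  show "(\<integral>\<^sup>+\<omega>. ennreal (f \<omega>) \<partial>M) = ennreal (\<integral>\<omega>. f \<omega> \<partial>M)"
    using assms(2) by (intro nn_integral_eq_integral i AE_I2)
qed

text \<open>Clearing denominators stays valid if the denominator vanishes: the quotient is then
  infinite and says nothing about \<open>x\<close>, but the product to be bounded is 0.\<close>

lemma quot_bound:
  assumes "ereal x \<le> quot a c" "0 \<le> c" "0 \<le> a" shows "x * c \<le> a"
  using assms by (cases "c = 0") (simp_all add: quot_def pos_le_divide_eq)

lemma le_Min_imp_le:
  fixes a :: "'a::linorder"
  assumes "a \<le> Min S" "finite S" "x \<in> S" shows "a \<le> x"
  using assms Min_le order_trans by blast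

context dama_run
begin

abbreviation "l\<^sub>b \<equiv> lambda_b pb nw"

text \<open>If one of the initial quantities is infinite while its coefficient is positive, the
  right-hand side is infinite. Otherwise all of them are real expectations and
  \<open>gradient_sum_bound\<close> applies.\<close>

lemma convergence:
  assumes bm: "0 < \<beta>\<^sub>m"
    and eps: "(v\<^sub>1 * v\<^sub>2 * \<mu>\<^sub>y * l * L\<^sub>f * m)\<^sup>2 / (1 - \<rho>)\<^sup>2 \<le> 1 / 620"
      "(v\<^sub>1 * v\<^sub>2 * \<mu>\<^sub>y * l * L\<^sub>f * m)\<^sup>2 / (1 - \<rho>)\<^sup>2 * \<beta>\<^sub>q \<le> b * \<beta>\<^sub>m / 576"
    and E: "\<mu>\<^sub>y\<^sup>2 * L\<^sub>f\<^sup>2 \<le> real K * b * \<beta>\<^sub>m / 144" "\<kappa>\<^sup>2 * \<mu>\<^sub>x\<^sup>2 * L\<^sub>f\<^sup>2 \<le> real K * b * \<beta>\<^sub>m / 1728"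
      "real K * (b * \<beta>\<^sub>m) \<le> 1"
    and T: "1 \<le> T"
  shows "ennreal (1 / real T) * (\<Sum>i<T. exp_grad_sq pb nw par rn Vx i + exp_grad_sq pb nw par rn Vy i)
    \<le> ennreal (13120 * (1 + v\<^sub>1\<^sup>2 * v\<^sub>2\<^sup>2)) *
      (ennreal (1 / (real T * \<mu>\<^sub>x)) * exp_gap0 pb nw par rn
       + ennreal (\<kappa>\<^sup>2 / (real T * \<mu>\<^sub>y)) * exp_delta0 pb nw par rn
       + ennreal (\<kappa>\<^sup>2 * (L\<^sub>f\<^sup>2 / (b * real K * \<beta>\<^sub>m * (1 - \<rho>) * l\<^sub>b\<^sup>2)
           + L\<^sub>f ^ 4 * l\<^sup>2 * \<beta>\<^sub>q / (b\<^sup>2 * real K * \<beta>\<^sub>m\<^sup>2 * (1 - \<rho>)\<^sup>2 * l\<^sub>b ^ 4) * \<mu>\<^sub>y\<^sup>2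
           + L\<^sub>f\<^sup>2 / (b * real K * \<beta>\<^sub>m * l\<^sub>b\<^sup>2)) * \<mu>\<^sub>y\<^sup>2 / real T) * zeta0_sq pb nw par rn
       + ennreal (\<kappa>\<^sup>2 * (L\<^sub>f\<^sup>2 * l\<^sup>2 * \<beta>\<^sub>q / (b * b\<^sub>0 * real K * \<beta>\<^sub>m\<^sup>2 * (1 - \<rho>)\<^sup>2 * l\<^sub>b\<^sup>2)) * \<mu>\<^sub>y\<^sup>2 * \<sigma>\<^sup>2 / real T)
       + ennreal (\<kappa>\<^sup>2 * (L\<^sub>f\<^sup>2 * l\<^sup>2 / (b * real K * \<beta>\<^sub>m * (1 - \<rho>)\<^sup>2 * l\<^sub>b\<^sup>2) * (p / B * online_ind pb + \<beta>\<^sup>2 / b) * \<mu>\<^sub>y\<^sup>2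
           + (1 / (b\<^sub>0 * \<beta>\<^sub>m * real K * real T) + \<beta>\<^sup>2 / (real K * b * \<beta>\<^sub>m)
             + p / (real K * B * \<beta>\<^sub>m) * online_ind pb)) * \<sigma>\<^sup>2))"
    (is "?lhs \<le> ennreal ?C * (ennreal ?c1 * ?G + ennreal ?c2 * ?D + ennreal ?c3 * ?Z + ennreal ?c4 + ennreal ?c5)")
proof -
  define C c1 c2 c3 c4 c5 where "C = ?C" and "c1 = ?c1" and "c2 = ?c2" and "c3 = ?c3" and "c4 = ?c4" and "c5 = ?c5"
  have lb: "l\<^sub>b = 1 / m" unfolding lambda_b_def m ..
  have K: "0 < real K" and T0: "0 < real T" and b: "0 < b" using agents T batches(2) by auto
  have mx: "0 < \<mu>\<^sub>x" and my: "0 < \<mu>\<^sub>y" by (rule mu_pos)+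
  have k1: "0 < \<kappa>\<^sup>2" using kappa_ge by (intro zero_less_power) linarith
  have r: "0 < 1 - \<rho>" using norm_constants(4) by simp
  have p: "0 \<le> p" using p01 by simp
  have C: "0 < C" unfolding C_def by (intro mult_pos_pos add_pos_nonneg) auto
  define a' where "a' = L\<^sub>f\<^sup>2 / (b * real K * \<beta>\<^sub>m * (1 - \<rho>) * l\<^sub>b\<^sup>2)"
  define rest where "rest = L\<^sub>f ^ 4 * l\<^sup>2 * \<beta>\<^sub>q / (b\<^sup>2 * real K * \<beta>\<^sub>m\<^sup>2 * (1 - \<rho>)\<^sup>2 * l\<^sub>b ^ 4) * \<mu>\<^sub>y\<^sup>2
      + L\<^sub>f\<^sup>2 / (b * real K * \<beta>\<^sub>m * l\<^sub>b\<^sup>2)"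
  have c3: "c3 = \<kappa>\<^sup>2 * (a' + rest) * \<mu>\<^sub>y\<^sup>2 / real T" by (simp only: c3_def a'_def rest_def add.assoc)
  have rest: "0 \<le> rest" unfolding rest_def using b K bm r p by simp
  have a': "0 \<le> a'" unfolding a'_def using b K bm r by simp
  have a'_pos: "0 < a'" if "m \<noteq> 0" unfolding a'_def lb using b K bm r that Lf_pos by simp
  have cs: "0 < c1" "0 < c2" "0 \<le> c3" "0 \<le> c4" "0 \<le> c5"
  proof -
    show "0 < c1" "0 < c2" unfolding c1_def c2_def using T0 mx my k1 by simp_all
    show "0 \<le> c3" unfolding c3 using T0 rest a' by simp
    show "0 \<le> c4" unfolding c4_def using b K bm r p T0 by simp
    show "0 \<le> c5" unfolding c5_def using b K bm r p T0 by (simp add: online_ind_def)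
  qed
  have gm: "(\<lambda>\<omega>. P (ctr Vx 0 \<omega>) - primal_inf pb) \<in> borel_measurable M"
    "(\<lambda>\<omega>. P (ctr Vx 0 \<omega>) - J (ctr Vx 0 \<omega>) (ctr Vy 0 \<omega>)) \<in> borel_measurable M"
    using PJ_measurable by simp_all
  have gn0: "0 \<le> P (ctr Vx 0 \<omega>) - primal_inf pb" "0 \<le> P (ctr Vx 0 \<omega>) - J (ctr Vx 0 \<omega>) (ctr Vy 0 \<omega>)" for \<omega>
    using primal_gap_nonneg[OF ctr_carrier(2)] primal_upper_J[OF ctr_carrier(2,3)] by simp_all
  have sm: "start w \<in> borel_measurable M" "\<And>\<omega>. 0 \<le> start w \<omega>" for w
    unfolding start_def[abs_def] using start_measurable by simp_all
  have zeta: "?Z = ennreal (1 / real K) * (\<integral>\<^sup>+\<omega>. ennreal (start Vx \<omega>) \<partial>M) + ennreal (1 / real K) * (\<integral>\<^sup>+\<omega>. ennreal (start Vy \<omega>) \<partial>M)"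
    by (simp add: zeta0_sq_def start_def)
  show ?thesis
  proof (cases "?G = \<infinity> \<or> ?D = \<infinity> \<or> (m \<noteq> 0 \<and> ?Z = \<infinity>)")
    case True
    have c3p: "0 < c3" if "m \<noteq> 0" unfolding c3 using a'_pos[OF that] rest T0 my k1 by simp
    from True have "ennreal c1 * ?G = \<infinity> \<or> ennreal c2 * ?D = \<infinity> \<or> ennreal c3 * ?Z = \<infinity>"
      using cs c3p by (auto simp: ennreal_mult_top ennreal_mult_eq_top_iff)
    hence "ennreal c1 * ?G + ennreal c2 * ?D + ennreal c3 * ?Z + ennreal c4 + ennreal c5 = \<infinity>" by auto
    hence top: "ennreal C * (ennreal c1 * ?G + ennreal c2 * ?D + ennreal c3 * ?Z + ennreal c4 + ennreal c5) = \<infinity>"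
      using C by (simp only: ennreal_mult_top infinity_ennreal_def ennreal_eq_0_iff) simp
    have "?lhs \<le> ennreal C * (ennreal c1 * ?G + ennreal c2 * ?D + ennreal c3 * ?Z + ennreal c4 + ennreal c5)"
      unfolding top by simp
    thus ?thesis unfolding C_def c1_def c2_def c3_def c4_def c5_def .
  next
    case False
    note G = nn_integral_finite_integrable[OF gm(1) gn0(1)] and D = nn_integral_finite_integrable[OF gm(2) gn0(2)]
    define g d where "g = (\<integral>\<omega>. P (ctr Vx 0 \<omega>) - primal_inf pb \<partial>M)"
      and "d = (\<integral>\<omega>. P (ctr Vx 0 \<omega>) - J (ctr Vx 0 \<omega>) (ctr Vy 0 \<omega>) \<partial>M)"
    have Gi: "integrable M (\<lambda>\<omega>. P (ctr Vx 0 \<omega>) - primal_inf pb)" "?G = ennreal g"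
      using G False unfolding exp_gap0_def g_def by auto
    have Di: "integrable M (\<lambda>\<omega>. P (ctr Vx 0 \<omega>) - J (ctr Vx 0 \<omega>) (ctr Vy 0 \<omega>))" "?D = ennreal d"
      using D False unfolding exp_delta0_def d_def by auto
    have gd: "0 \<le> g" "0 \<le> d" unfolding g_def d_def by (intro Bochner_Integration.integral_nonneg gn0)+
    have si: "integrable M (start w)" "(\<integral>\<^sup>+\<omega>. ennreal (start w \<omega>) \<partial>M) = ennreal (\<integral>\<omega>. start w \<omega> \<partial>M)" if "m \<noteq> 0" for w
    proof -
      have "(\<integral>\<^sup>+\<omega>. ennreal (start w \<omega>) \<partial>M) \<noteq> \<infinity>"
        using False that K unfolding zeta by (cases w) (auto simp: ennreal_mult_eq_top_iff)
      thus "integrable M (start w)" "(\<integral>\<^sup>+\<omega>. ennreal (start w \<omega>) \<partial>M) = ennreal (\<integral>\<omega>. start w \<omega> \<partial>M)"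
        using nn_integral_finite_integrable[OF sm] by blast+
    qed
    have s0: "0 \<le> (\<integral>\<omega>. start w \<omega> \<partial>M)" for w by (intro Bochner_Integration.integral_nonneg sm)
    \<comment> \<open>For \<open>m = 0\<close> the coefficient of \<open>zeta0_sq\<close> is 0 while
      its value may be infinite; the real number 0 takes its place.\<close>
    define Z where "Z = (if m = 0 then 0 else ((\<integral>\<omega>. start Vx \<omega> \<partial>M) + (\<integral>\<omega>. start Vy \<omega> \<partial>M)) / real K)"
    have Z0: "0 \<le> Z" unfolding Z_def using s0 K by simp
    have Zle: "ennreal Z \<le> ?Z"
    proof (cases "m = 0")
      case False
      have "?Z = ennreal (1 / real K * (\<integral>\<omega>. start Vx \<omega> \<partial>M) + 1 / real K * (\<integral>\<omega>. start Vy \<omega> \<partial>M))"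
        unfolding zeta si(2)[OF False] using K s0 by (intro ennreal_lincomb) auto
      thus ?thesis using False by (simp add: Z_def add_divide_distrib)
    qed (simp add: Z_def)
    have ZK: "m \<noteq> 0 \<Longrightarrow> (\<integral>\<omega>. start Vx \<omega> \<partial>M) + (\<integral>\<omega>. start Vy \<omega> \<partial>M) = real K * Z"
      using K by (simp add: Z_def)
    note B = gradient_sum_bound[OF Gi(1) Di(1) si(1) Z0 ZK bm eps E, folded g_def d_def]
    have ng: "exp_grad_sq pb nw par rn w i = ennreal (\<integral>\<omega>. gn w i \<omega> \<partial>M)" for w i
      unfolding exp_grad_sq_def gn_def[symmetric]
      by (intro nn_integral_eq_integral finite_moments_step(1) B(1) AE_I2) (simp_all add: gn_def)
    have n0: "0 \<le> (\<integral>\<omega>. gn w i \<omega> \<partial>M)" for w i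
      by (intro Bochner_Integration.integral_nonneg) (simp add: gn_def)
    define S where "S = (\<Sum>i<T. (\<integral>\<omega>. gn Vx i \<omega> \<partial>M) + (\<integral>\<omega>. gn Vy i \<omega> \<partial>M))"
    have S0: "0 \<le> S" unfolding S_def by (intro sum_nonneg add_nonneg_nonneg n0)
    have "(\<Sum>i<T. exp_grad_sq pb nw par rn Vx i + exp_grad_sq pb nw par rn Vy i) = ennreal S"
      unfolding ng S_def using n0 by (simp add: sum_ennreal flip: ennreal_plus)
    hence lhs: "?lhs = ennreal (S / real T)"
      using S0 T0 by (simp add: ennreal_mult[symmetric])
    have "S / real T \<le> C * (c1 * g + c2 * d + c3 * Z + c4 + c5)"
    proof -
      define s1 s2 s3 s4 s5 s6 where "s1 = g / \<mu>\<^sub>x" and "s2 = \<kappa>\<^sup>2 * d / \<mu>\<^sub>y"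
        and "s3 = \<kappa>\<^sup>2 * (L\<^sub>f\<^sup>2 * m\<^sup>2 / (b * real K * \<beta>\<^sub>m * (1 - \<rho>))) * \<mu>\<^sub>y\<^sup>2 * Z"
        and "s4 = \<kappa>\<^sup>2 * (L\<^sub>f\<^sup>2 * l\<^sup>2 * \<beta>\<^sub>q * m\<^sup>2 / (b * b\<^sub>0 * real K * \<beta>\<^sub>m\<^sup>2 * (1 - \<rho>)\<^sup>2)) * \<mu>\<^sub>y\<^sup>2 * \<sigma>\<^sup>2"
        and "s5 = \<kappa>\<^sup>2 * (L\<^sub>f\<^sup>2 * l\<^sup>2 * m\<^sup>2 / (b * real K * \<beta>\<^sub>m * (1 - \<rho>)\<^sup>2)) * \<mu>\<^sub>y\<^sup>2 * (real T * N)"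
        and "s6 = \<kappa>\<^sup>2 * (\<sigma>\<^sup>2 / (b\<^sub>0 * \<beta>\<^sub>m * real K) + real T * N / (real K * \<beta>\<^sub>m))"
      have "S \<le> C * (s1 + s2 + s3 + s4 + s5 + s6)"
        using B(2)[of T] unfolding S_def C_def s1_def s2_def s3_def s4_def s5_def s6_def .
      hence "S / real T \<le> C * (s1 + s2 + s3 + s4 + s5 + s6) / real T" using T0 by (intro divide_right_mono) auto
      also have "\<dots> = C * (s1 / real T + s2 / real T + s3 / real T + s4 / real T + (s5 / real T + s6 / real T))"
        by (simp only: times_divide_eq_right[symmetric] add_divide_distrib add.assoc)
      also have "\<dots> \<le> C * (c1 * g + c2 * d + c3 * Z + c4 + c5)"
      proof (intro mult_left_mono add_mono)
        show "s1 / real T \<le> c1 * g" by (simp add: s1_def c1_def mult.commute)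
        show "s2 / real T \<le> c2 * d" by (simp add: s2_def c2_def mult.commute)
        \<comment> \<open>The summed recursions produce the coefficient \<open>a'\<close>. The rest
          of \<open>c3\<close> is nonnegative and only enlarges the bound.\<close>
        show "s3 / real T \<le> c3 * Z"
        proof -
          have "L\<^sub>f\<^sup>2 * m\<^sup>2 / (b * real K * \<beta>\<^sub>m * (1 - \<rho>)) = a'" by (simp add: a'_def lb power_divide)
          hence "s3 / real T = \<kappa>\<^sup>2 * a' * (\<mu>\<^sub>y\<^sup>2 / real T * Z)" by (simp add: s3_def)
          also have "\<dots> \<le> \<kappa>\<^sup>2 * (a' + rest) * (\<mu>\<^sub>y\<^sup>2 / real T * Z)"
            using rest Z0 T0 by (intro mult_right_mono mult_left_mono) auto
          finally show ?thesis by (simp add: c3)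
        qed
        have b': "L\<^sub>f\<^sup>2 * l\<^sup>2 * \<beta>\<^sub>q * m\<^sup>2 / (b * b\<^sub>0 * real K * \<beta>\<^sub>m\<^sup>2 * (1 - \<rho>)\<^sup>2)
            = L\<^sub>f\<^sup>2 * l\<^sup>2 * \<beta>\<^sub>q / (b * b\<^sub>0 * real K * \<beta>\<^sub>m\<^sup>2 * (1 - \<rho>)\<^sup>2 * l\<^sub>b\<^sup>2)"
          by (simp add: lb power_divide)
        show "s4 / real T \<le> c4" unfolding s4_def c4_def b' by simp
        show "s5 / real T + s6 / real T \<le> c5"
        proof -
          define d0 where "d0 = L\<^sub>f\<^sup>2 * l\<^sup>2 / (b * real K * \<beta>\<^sub>m * (1 - \<rho>)\<^sup>2 * l\<^sub>b\<^sup>2)"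
          have d0: "L\<^sub>f\<^sup>2 * l\<^sup>2 * m\<^sup>2 / (b * real K * \<beta>\<^sub>m * (1 - \<rho>)\<^sup>2) = d0"
            by (simp add: d0_def lb power_divide)
          define n where "n = p / B * online_ind pb + \<beta>\<^sup>2 / b"
          have gen: "c * (s / w + t * (s * n) / z) / t = c * (1 / (w * t) + n / z) * s" if "0 < t" for c s w t n z :: real
            using that by (simp add: add_divide_distrib distrib_left distrib_right)
          have gen': "(u / x * v + w / y) / (t * z) = w / (t * y * z) + u / (t * x * z) * v" for t u v w x y z :: real
            by (simp add: add_divide_distrib mult_ac)
          have Nn: "N = \<sigma>\<^sup>2 * n" by (simp add: n_def add.commute)
          have "s5 / real T = \<kappa>\<^sup>2 * (d0 * n * \<mu>\<^sub>y\<^sup>2) * \<sigma>\<^sup>2"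
            unfolding s5_def d0 Nn using T0 by simp
          moreover have "s6 / real T = \<kappa>\<^sup>2 * (1 / (b\<^sub>0 * \<beta>\<^sub>m * real K * real T) + n / (real K * \<beta>\<^sub>m)) * \<sigma>\<^sup>2"
            unfolding s6_def Nn by (rule gen[OF T0])
          moreover have "n / (real K * \<beta>\<^sub>m) = \<beta>\<^sup>2 / (real K * b * \<beta>\<^sub>m) + p / (real K * B * \<beta>\<^sub>m) * online_ind pb"
            unfolding n_def by (rule gen')
          ultimately have "s5 / real T + s6 / real T = c5"
            unfolding c5_def d0_def[symmetric] n_def[symmetric] by (simp only: distrib_left distrib_right add.assoc)
          thus ?thesis by simp
        qed
        show "0 \<le> C" using C by simp
      qed
      finally show ?thesis .
    qed
    hence "?lhs \<le> ennreal (C * (c1 * g + c2 * d + c3 * Z + c4 + c5))" unfolding lhs by (rule ennreal_leI)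
    also have "\<dots> = ennreal C * (ennreal c1 * ennreal g + ennreal c2 * ennreal d + ennreal c3 * ennreal Z + ennreal c4 + ennreal c5)"
      using C cs gd Z0 by (simp add: ennreal_mult less_imp_le)
    also have "\<dots> \<le> ennreal C * (ennreal c1 * ?G + ennreal c2 * ?D + ennreal c3 * ?Z + ennreal c4 + ennreal c5)"
      unfolding Gi(2) Di(2) by (intro mult_left_mono add_mono Zle order_refl) auto
    finally show ?thesis unfolding C_def c1_def c2_def c3_def c4_def c5_def .
  qed
qed

end

text \<open>Squares the step-size bounds into the smallness conditions of \<open>convergence\<close>
  and provides the base point of \<open>smooth_problem\<close>.\<close>

lemma convergence_bound:
  fixes pb :: "'z problem" and nw :: network and par :: params and rn :: "('w, 'z) randomness"
    and \<nu> L\<^sub>f \<sigma> \<beta> :: real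
  defines "\<kappa> \<equiv> L\<^sub>f / \<nu>" and "\<mu>\<^sub>x \<equiv> mu par Vx" and "\<mu>\<^sub>y \<equiv> mu par Vy" and "\<rho> \<equiv> rho nw"
    and "K \<equiv> real (nagents pb)" and "b \<equiv> real (batchb par)" and "b\<^sub>0 \<equiv> real (batch0 par)" and "B \<equiv> real (batchB par)"
    and "p \<equiv> coin_prob par" and "l\<^sub>a \<equiv> lambda_a pb nw" and "l\<^sub>b \<equiv> lambda_b pb nw" and "v\<^sub>1 \<equiv> v_one nw" and "v\<^sub>2 \<equiv> v_two nw"
  defines "L \<equiv> L\<^sub>f + \<kappa> * L\<^sub>f / 2" and "\<beta>\<^sub>m \<equiv> p + \<beta> - p * \<beta>" and "\<beta>\<^sub>q \<equiv> p + \<beta>\<^sup>2"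
  assumes reg: "regular_problem pb" and pl: "pl_condition pb \<nu>" and nu: "\<nu> \<le> L\<^sub>f" and bdd: "primal_bounded_below pb"
    and smooth: "expected_smooth pb L\<^sub>f" and comb: "combination_matrices (nagents pb) nw"
    and eig: "reduced_eigenbasis (nagents pb) nw" and fact: "contractive_factorization pb nw"
    and samp: "sampling pb par rn" and stoch: "stochastic_gradients pb nw par rn \<sigma>"
    and batches: "1 \<le> batch0 par" "1 \<le> batchb par" "online pb \<longrightarrow> 1 \<le> batchB par"
    and mx: "0 < \<mu>\<^sub>x" and my: "0 < \<mu>\<^sub>y" and bx: "beta par Vx = \<beta>" and by': "beta par Vy = \<beta>"
    and b01: "\<beta> \<in> {0..1}" and p01: "p \<in> {0..1}" and bm: "0 < \<beta>\<^sub>m"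
    and stepx: "ereal \<mu>\<^sub>x \<le> Min {quot 1 (32 * L), quot \<mu>\<^sub>y (16 * \<kappa>\<^sup>2),
                    quot (sqrt (K * b * \<beta>\<^sub>m)) (24 * sqrt 3 * \<kappa> * L\<^sub>f)}"
    and stepy: "ereal \<mu>\<^sub>y \<le> Min {quot 1 \<nu>, quot 1 (2 * L\<^sub>f), quot (sqrt (K * b * \<beta>\<^sub>m)) (12 * L\<^sub>f),
                    quot ((1 - \<rho>) * l\<^sub>b) (sqrt 620 * L\<^sub>f * v\<^sub>1 * v\<^sub>2 * l\<^sub>a),
                    quot ((1 - \<rho>) * l\<^sub>b) (12 * L\<^sub>f * v\<^sub>1 * v\<^sub>2 * l\<^sub>a),
                    quot ((1 - \<rho>) * l\<^sub>b * sqrt (b * \<beta>\<^sub>m / (p + \<beta>\<^sup>2))) (24 * L\<^sub>f * v\<^sub>1 * v\<^sub>2 * l\<^sub>a),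
                    X}"
    and bK: "b * \<beta>\<^sub>m \<le> 1 / K" and T: "1 \<le> T"
  shows "ennreal (1 / real T) * (\<Sum>i<T. exp_grad_sq pb nw par rn Vx i + exp_grad_sq pb nw par rn Vy i)
    \<le> ennreal (13120 * (1 + v\<^sub>1\<^sup>2 * v\<^sub>2\<^sup>2)) *
      (ennreal (1 / (real T * \<mu>\<^sub>x)) * exp_gap0 pb nw par rn
       + ennreal (\<kappa>\<^sup>2 / (real T * \<mu>\<^sub>y)) * exp_delta0 pb nw par rn
       + ennreal (\<kappa>\<^sup>2 * (L\<^sub>f\<^sup>2 / (b * K * \<beta>\<^sub>m * (1 - \<rho>) * l\<^sub>b\<^sup>2)
           + L\<^sub>f ^ 4 * l\<^sub>a\<^sup>2 * \<beta>\<^sub>q / (b\<^sup>2 * K * \<beta>\<^sub>m\<^sup>2 * (1 - \<rho>)\<^sup>2 * l\<^sub>b ^ 4) * \<mu>\<^sub>y\<^sup>2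
           + L\<^sub>f\<^sup>2 / (b * K * \<beta>\<^sub>m * l\<^sub>b\<^sup>2)) * \<mu>\<^sub>y\<^sup>2 / real T) * zeta0_sq pb nw par rn
       + ennreal (\<kappa>\<^sup>2 * (L\<^sub>f\<^sup>2 * l\<^sub>a\<^sup>2 * \<beta>\<^sub>q / (b * b\<^sub>0 * K * \<beta>\<^sub>m\<^sup>2 * (1 - \<rho>)\<^sup>2 * l\<^sub>b\<^sup>2)) * \<mu>\<^sub>y\<^sup>2 * \<sigma>\<^sup>2 / real T)
       + ennreal (\<kappa>\<^sup>2 * (L\<^sub>f\<^sup>2 * l\<^sub>a\<^sup>2 / (b * K * \<beta>\<^sub>m * (1 - \<rho>)\<^sup>2 * l\<^sub>b\<^sup>2) * (p / B * online_ind pb + \<beta>\<^sup>2 / b) * \<mu>\<^sub>y\<^sup>2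
           + (1 / (b\<^sub>0 * \<beta>\<^sub>m * K * real T) + \<beta>\<^sup>2 / (K * b * \<beta>\<^sub>m) + p / (K * B * \<beta>\<^sub>m) * online_ind pb)) * \<sigma>\<^sup>2))"
proof -
  define m where "m = sqrt (max ((opnorm (minv (lam_b pb nw Vx)))\<^sup>2) ((opnorm (minv (lam_b pb nw Vy)))\<^sup>2))"
  have agents: "1 \<le> nagents pb" using reg by (simp add: regular_problem_def)
  have base: "\<exists>x\<in>carrier_vec (xdim pb). \<exists>y\<in>carrier_vec (ydim pb).
      \<forall>j<vdim pb w. integrable (sample_law pb k) (\<lambda>z. cost_grad pb w k x y z $ j)" if k: "k < nagents pb" for k w
  proof -
    let ?x = "\<lambda>\<omega>. local_it pb nw par rn Vx k 0 \<omega>" and ?y = "\<lambda>\<omega>. local_it pb nw par rn Vy k 0 \<omega>"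
    have ps: "prob_space (probM rn)" using samp by (simp add: sampling_def)
    have "AE \<omega> in probM rn. let x = ?x \<omega>; y = ?y \<omega> in
       (\<forall>j<vdim pb w. integrable (sample_law pb k) (\<lambda>z. cost_grad pb w k x y z $ j) \<and>
          (\<integral>z. cost_grad pb w k x y z $ j \<partial>sample_law pb k) = pgrad pb w (local_obj pb k) x y $ j) \<and>
       (\<integral>\<^sup>+z. ennreal ((vnorm (cost_grad pb w k x y z - pgrad pb w (local_obj pb k) x y))\<^sup>2)
          \<partial>sample_law pb k) \<le> ennreal (\<sigma>\<^sup>2)"
      using stoch k unfolding stochastic_gradients_def by blast
    hence "AE \<omega> in probM rn. \<forall>j<vdim pb w. integrable (sample_law pb k) (\<lambda>z. cost_grad pb w k (?x \<omega>) (?y \<omega>) z $ j)"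
      by (rule eventually_mono) (simp only: Let_def, blast)
    \<comment> \<open>What holds almost surely in a probability space holds for some outcome; the
      initial iterate of that outcome is the base point.\<close>
    from eventually_happens'[OF prob_space.ae_filter_bot[OF ps] this]
    obtain \<omega> where "\<forall>j<vdim pb w. integrable (sample_law pb k) (\<lambda>z. cost_grad pb w k (?x \<omega>) (?y \<omega>) z $ j)" by blast
    moreover have "?x \<omega> \<in> carrier_vec (xdim pb)" "?y \<omega> \<in> carrier_vec (ydim pb)"
      by (simp_all add: local_it_def vdim_def)
    ultimately show ?thesis by blast
  qed
  have nupos: "0 < \<nu>" using pl by (simp add: pl_condition_def)
  have Lf: "0 < L\<^sub>f" using nupos nu by simp
  have kap: "0 < \<kappa>" unfolding \<kappa>_def using nupos Lf by simp
  have K: "0 < K" and b: "0 < b" using agents batches(2) by (simp_all add: K_def b_def)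
  have q: "0 \<le> K * b * \<beta>\<^sub>m" using K b bm by simp
  have sx: "\<mu>\<^sub>x * (32 * L) \<le> 1" "\<mu>\<^sub>x * (16 * \<kappa>\<^sup>2) \<le> \<mu>\<^sub>y" "\<mu>\<^sub>x * (24 * sqrt 3 * \<kappa> * L\<^sub>f) \<le> sqrt (K * b * \<beta>\<^sub>m)"
  proof -
    have "ereal \<mu>\<^sub>x \<le> quot 1 (32 * L)" "ereal \<mu>\<^sub>x \<le> quot \<mu>\<^sub>y (16 * \<kappa>\<^sup>2)"
      "ereal \<mu>\<^sub>x \<le> quot (sqrt (K * b * \<beta>\<^sub>m)) (24 * sqrt 3 * \<kappa> * L\<^sub>f)"
      by (rule le_Min_imp_le[OF stepx]; blast)+
    thus "\<mu>\<^sub>x * (32 * L) \<le> 1" "\<mu>\<^sub>x * (16 * \<kappa>\<^sup>2) \<le> \<mu>\<^sub>y" "\<mu>\<^sub>x * (24 * sqrt 3 * \<kappa> * L\<^sub>f) \<le> sqrt (K * b * \<beta>\<^sub>m)"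
      using kap Lf my q by (auto intro!: quot_bound simp: L_def)
  qed
  have sub: "sampled_problem pb par rn" "smooth_problem pb L\<^sub>f" "network_matrices pb nw"
    using samp reg smooth base comb eig fact agents by unfold_locales auto
  have yq: "ereal \<mu>\<^sub>y \<le> quot 1 (2 * L\<^sub>f)" "ereal \<mu>\<^sub>y \<le> quot (sqrt (K * b * \<beta>\<^sub>m)) (12 * L\<^sub>f)"
      "ereal \<mu>\<^sub>y \<le> quot ((1 - \<rho>) * l\<^sub>b) (sqrt 620 * L\<^sub>f * v\<^sub>1 * v\<^sub>2 * l\<^sub>a)"
      "ereal \<mu>\<^sub>y \<le> quot ((1 - \<rho>) * l\<^sub>b * sqrt (b * \<beta>\<^sub>m / (p + \<beta>\<^sup>2))) (24 * L\<^sub>f * v\<^sub>1 * v\<^sub>2 * l\<^sub>a)"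
    by (rule le_Min_imp_le[OF stepy]; blast)+
  have sy: "\<mu>\<^sub>y * (2 * L\<^sub>f) \<le> 1" "\<mu>\<^sub>y * (12 * L\<^sub>f) \<le> sqrt (K * b * \<beta>\<^sub>m)"
    using yq(1,2) Lf q by (auto intro!: quot_bound)
  have run: "dama_run pb L\<^sub>f nw par rn \<sigma> \<nu> m"
  proof -
    have "beta par w \<in> {0..1}" for w using b01 bx by' by (cases w) auto
    moreover have "0 < mu par w" for w using mx my by (cases w) (auto simp: \<mu>\<^sub>x_def \<mu>\<^sub>y_def)
    ultimately show ?thesis
      using sub stoch batches p01 pl nu bdd bx by' sx(1,2) sy(1)
      unfolding p_def \<mu>\<^sub>x_def \<mu>\<^sub>y_def \<kappa>_def L_def
      by (intro dama_run.intro sampled_run.intro sampled_run_axioms.intro pl_problem.intro pl_problem_axioms.intro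
          dama_run_axioms.intro m_def) auto
  qed
  have lb: "l\<^sub>b = 1 / m" unfolding l\<^sub>b_def lambda_b_def m_def ..
  have rho: "0 < 1 - \<rho>" unfolding \<rho>_def using dama_run.norm_constants(4)[OF run] by simp
  have m0: "0 \<le> m" by (simp add: m_def le_max_iff_disj)
  have nn: "0 \<le> v\<^sub>1" "0 \<le> v\<^sub>2" "0 \<le> l\<^sub>a" "0 \<le> l\<^sub>b"
    unfolding lb using m0 by (simp_all add: v\<^sub>1_def v\<^sub>2_def l\<^sub>a_def v_one_def v_two_def lambda_a_def le_max_iff_disj)
  have bq: "0 \<le> p + \<beta>\<^sup>2" using p01 by simp
  define Y where "Y = v\<^sub>1 * v\<^sub>2 * \<mu>\<^sub>y * l\<^sub>a * L\<^sub>f * m"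
  have Y0: "0 \<le> Y" unfolding Y_def using nn my Lf m0 by simp
  \<comment> \<open>\<open>l\<^sub>b\<close> is \<open>1 / m\<close>, so
    \<open>l\<^sub>b * m\<close> is 1, or 0 when \<open>m = 0\<close>. Multiplying a step-size bound
    by \<open>m\<close> thus bounds \<open>Y\<close> in the degenerate case as well.\<close>
  have scale: "c * Y \<le> (1 - \<rho>) * s"
    if h: "\<mu>\<^sub>y * (c * L\<^sub>f * v\<^sub>1 * v\<^sub>2 * l\<^sub>a) \<le> (1 - \<rho>) * l\<^sub>b * s" and s: "0 \<le> s" for c s
  proof -
    have "l\<^sub>b * m \<le> 1" unfolding lb by (cases "m = 0") auto
    have "c * Y = \<mu>\<^sub>y * (c * L\<^sub>f * v\<^sub>1 * v\<^sub>2 * l\<^sub>a) * m" by (simp add: Y_def)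
    also have "\<dots> \<le> (1 - \<rho>) * l\<^sub>b * s * m" using h m0 by (rule mult_right_mono)
    also have "\<dots> = (1 - \<rho>) * s * (l\<^sub>b * m)" by simp
    also have "\<dots> \<le> (1 - \<rho>) * s * 1" using \<open>l\<^sub>b * m \<le> 1\<close> rho s by (intro mult_left_mono) auto
    finally show ?thesis by simp
  qed
  have eps1: "Y\<^sup>2 / (1 - \<rho>)\<^sup>2 \<le> 1 / 620"
  proof -
    have "\<mu>\<^sub>y * (sqrt 620 * L\<^sub>f * v\<^sub>1 * v\<^sub>2 * l\<^sub>a) \<le> (1 - \<rho>) * l\<^sub>b"
      by (rule quot_bound[OF yq(3)]) (use nn Lf rho in auto)
    hence "sqrt 620 * Y \<le> 1 - \<rho>" using scale[of "sqrt 620" 1] by simp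
    hence "(sqrt 620 * Y)\<^sup>2 \<le> (1 - \<rho>)\<^sup>2" using Y0 by (intro power_mono) auto
    thus ?thesis using rho by (simp add: power_mult_distrib field_simps)
  qed
  \<comment> \<open>The 576 is the square of 24. If \<open>p + \<beta>\<^sup>2\<close> vanishes, so
    does the left-hand side.\<close>
  have eps2: "Y\<^sup>2 / (1 - \<rho>)\<^sup>2 * (p + \<beta>\<^sup>2) \<le> b * \<beta>\<^sub>m / 576"
  proof (cases "p + \<beta>\<^sup>2 = 0")
    case True thus ?thesis using b bm by simp
  next
    case False
    define s where "s = sqrt (b * \<beta>\<^sub>m / (p + \<beta>\<^sup>2))"
    have s: "0 \<le> s" "s\<^sup>2 = b * \<beta>\<^sub>m / (p + \<beta>\<^sup>2)" unfolding s_def using b bm bq by auto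
    have "\<mu>\<^sub>y * (24 * L\<^sub>f * v\<^sub>1 * v\<^sub>2 * l\<^sub>a) \<le> (1 - \<rho>) * l\<^sub>b * s"
      unfolding s_def by (rule quot_bound[OF yq(4)]) (use nn Lf rho s(1) in \<open>auto simp: s_def\<close>)
    hence "24 * Y \<le> (1 - \<rho>) * s" using scale s(1) by blast
    hence "(24 * Y)\<^sup>2 \<le> ((1 - \<rho>) * s)\<^sup>2" using Y0 by (intro power_mono) auto
    hence "576 * Y\<^sup>2 \<le> (1 - \<rho>)\<^sup>2 * s\<^sup>2" by (simp add: power_mult_distrib)
    hence "Y\<^sup>2 / (1 - \<rho>)\<^sup>2 \<le> s\<^sup>2 / 576" using rho by (simp add: divide_le_eq mult.commute)
    hence "Y\<^sup>2 / (1 - \<rho>)\<^sup>2 * (p + \<beta>\<^sup>2) \<le> s\<^sup>2 / 576 * (p + \<beta>\<^sup>2)" using bq by (rule mult_right_mono)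
    also have "s\<^sup>2 / 576 * (p + \<beta>\<^sup>2) = b * \<beta>\<^sub>m / 576" 
    proof -
      have "x / z / 576 * z = x / 576" if "z \<noteq> 0" for x z :: real using that by simp
      from this[OF False] show ?thesis unfolding s(2) .
    qed
    finally show ?thesis .
  qed
  have E1: "\<mu>\<^sub>y\<^sup>2 * L\<^sub>f\<^sup>2 \<le> K * b * \<beta>\<^sub>m / 144"
  proof -
    have "(\<mu>\<^sub>y * (12 * L\<^sub>f))\<^sup>2 \<le> (sqrt (K * b * \<beta>\<^sub>m))\<^sup>2" using sy(2) my Lf by (intro power_mono) auto
    thus ?thesis using q by (simp add: power_mult_distrib)
  qed
  \<comment> \<open>1728 is the square of \<open>24 * sqrt 3\<close>.\<close>
  have E2: "\<kappa>\<^sup>2 * \<mu>\<^sub>x\<^sup>2 * L\<^sub>f\<^sup>2 \<le> K * b * \<beta>\<^sub>m / 1728"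
  proof -
    have "(\<mu>\<^sub>x * (24 * sqrt 3 * \<kappa> * L\<^sub>f))\<^sup>2 \<le> (sqrt (K * b * \<beta>\<^sub>m))\<^sup>2" using sx(3) mx Lf kap by (intro power_mono) auto
    thus ?thesis using q by (simp add: power_mult_distrib mult_ac)
  qed
  have E3: "K * (b * \<beta>\<^sub>m) \<le> 1" using bK K by (simp add: pos_le_divide_eq mult.commute)
  note defs = \<kappa>_def \<mu>\<^sub>x_def \<mu>\<^sub>y_def \<rho>_def K_def b_def b\<^sub>0_def B_def p_def l\<^sub>a_def l\<^sub>b_def v\<^sub>1_def v\<^sub>2_def \<beta>\<^sub>m_def \<beta>\<^sub>q_def
  show ?thesis
    using dama_run.convergence[OF run, unfolded bx, of T] bm eps1 eps2 E1 E2 E3 T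
    unfolding Y_def defs by blast
qed

theorem theorem1:
  "\<exists>C :: real \<Rightarrow> real \<Rightarrow> real.
   \<forall>(pb :: 'z problem) (nw :: network) (par :: params) (rn :: ('w, 'z) randomness)
     (\<nu> :: real) (L\<^sub>f :: real) (\<sigma> :: real) (\<beta> :: real).
   let K = real (nagents pb); b = real (batchb par); b\<^sub>0 = real (batch0 par);
       B = real (batchB par); p = coin_prob par; \<mu>\<^sub>x = mu par Vx; \<mu>\<^sub>y = mu par Vy;
       \<rho> = rho nw; l\<^sub>a = lambda_a pb nw; l\<^sub>b = lambda_b pb nw; v\<^sub>1 = v_one nw; v\<^sub>2 = v_two nw;
       \<kappa> = L\<^sub>f / \<nu>; L = L\<^sub>f + \<kappa> * L\<^sub>f / 2;
       \<beta>\<^sub>m = p + \<beta> - p * \<beta>; \<beta>\<^sub>q = p + \<beta>\<^sup>2;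
       a' = L\<^sub>f\<^sup>2 / (b * K * \<beta>\<^sub>m * (1 - \<rho>) * l\<^sub>b\<^sup>2);
       b' = L\<^sub>f\<^sup>2 * l\<^sub>a\<^sup>2 * \<beta>\<^sub>q / (b * b\<^sub>0 * K * \<beta>\<^sub>m\<^sup>2 * (1 - \<rho>)\<^sup>2 * l\<^sub>b\<^sup>2);
       c' = L\<^sub>f ^ 4 * l\<^sub>a\<^sup>2 * \<beta>\<^sub>q / (b\<^sup>2 * K * \<beta>\<^sub>m\<^sup>2 * (1 - \<rho>)\<^sup>2 * l\<^sub>b ^ 4);
       d' = L\<^sub>f\<^sup>2 * l\<^sub>a\<^sup>2 / (b * K * \<beta>\<^sub>m * (1 - \<rho>)\<^sup>2 * l\<^sub>b\<^sup>2)
              * (p / B * online_ind pb + \<beta>\<^sup>2 / b);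
       f' = L\<^sub>f\<^sup>2 / (b * K * \<beta>\<^sub>m * l\<^sub>b\<^sup>2)
   in
     regular_problem pb \<longrightarrow>
     pl_condition pb \<nu> \<longrightarrow>
     \<nu> \<le> L\<^sub>f \<longrightarrow>
     primal_bounded_below pb \<longrightarrow>
     expected_smooth pb L\<^sub>f \<longrightarrow>
     combination_matrices (nagents pb) nw \<longrightarrow>
     reduced_eigenbasis (nagents pb) nw \<longrightarrow>
     contractive_factorization pb nw \<longrightarrow>
     sampling pb par rn \<longrightarrow>
     stochastic_gradients pb nw par rn \<sigma> \<longrightarrow>
     1 \<le> batch0 par \<longrightarrow> 1 \<le> batchb par \<longrightarrow> (online pb \<longrightarrow> 1 \<le> batchB par) \<longrightarrow>
     0 < \<mu>\<^sub>x \<longrightarrow> 0 < \<mu>\<^sub>y \<longrightarrow>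
     beta par Vx = \<beta> \<longrightarrow> beta par Vy = \<beta> \<longrightarrow> \<beta> \<in> {0..1} \<longrightarrow> p \<in> {0..1} \<longrightarrow> 0 < \<beta>\<^sub>m \<longrightarrow>
     ereal \<mu>\<^sub>x \<le> Min {quot 1 (32 * L), quot \<mu>\<^sub>y (16 * \<kappa>\<^sup>2),
                    quot (sqrt (K * b * \<beta>\<^sub>m)) (24 * sqrt 3 * \<kappa> * L\<^sub>f)} \<longrightarrow>
     ereal \<mu>\<^sub>y \<le> Min {quot 1 \<nu>, quot 1 (2 * L\<^sub>f), quot (sqrt (K * b * \<beta>\<^sub>m)) (12 * L\<^sub>f),
                    quot ((1 - \<rho>) * l\<^sub>b) (sqrt 620 * L\<^sub>f * v\<^sub>1 * v\<^sub>2 * l\<^sub>a),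
                    quot ((1 - \<rho>) * l\<^sub>b) (12 * L\<^sub>f * v\<^sub>1 * v\<^sub>2 * l\<^sub>a),
                    quot ((1 - \<rho>) * l\<^sub>b * sqrt (b * \<beta>\<^sub>m / (p + \<beta>\<^sup>2))) (24 * L\<^sub>f * v\<^sub>1 * v\<^sub>2 * l\<^sub>a),
                    quot ((1 - \<rho>) powr (2/3) * l\<^sub>b powr (2/3) * (b * K * \<beta>\<^sub>m) powr (1/3))
                         (90 * L\<^sub>f * \<kappa> powr (1/3) * v\<^sub>1 powr (2/3) * v\<^sub>2 powr (2/3)
                            * l\<^sub>a powr (2/3))} \<longrightarrow>
     \<beta>\<^sub>m \<le> \<nu> * \<mu>\<^sub>y / 2 \<longrightarrow> b * \<beta>\<^sub>m \<le> 1 / K \<longrightarrow> p + \<beta> \<le> 1 \<longrightarrow> \<beta> + b * p \<le> b \<longrightarrow> \<beta>\<^sub>m \<le> 1 \<longrightarrow>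
     (\<forall>T::nat. 1 \<le> T \<longrightarrow>
       (let e' = 1 / (b\<^sub>0 * \<beta>\<^sub>m * K * real T) + \<beta>\<^sup>2 / (K * b * \<beta>\<^sub>m)
                   + p / (K * B * \<beta>\<^sub>m) * online_ind pb
        in
         ennreal (1 / real T) *
           (\<Sum>i<T. exp_grad_sq pb nw par rn Vx i + exp_grad_sq pb nw par rn Vy i)
         \<le> ennreal (C v\<^sub>1 v\<^sub>2) *
            (ennreal (1 / (real T * \<mu>\<^sub>x)) * exp_gap0 pb nw par rn
             + ennreal (\<kappa>\<^sup>2 / (real T * \<mu>\<^sub>y)) * exp_delta0 pb nw par rn
             + ennreal (\<kappa>\<^sup>2 * (a' + c' * \<mu>\<^sub>y\<^sup>2 + f') * \<mu>\<^sub>y\<^sup>2 / real T) * zeta0_sq pb nw par rn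
             + ennreal (\<kappa>\<^sup>2 * b' * \<mu>\<^sub>y\<^sup>2 * \<sigma>\<^sup>2 / real T)
             + ennreal (\<kappa>\<^sup>2 * (d' * \<mu>\<^sub>y\<^sup>2 + e') * \<sigma>\<^sup>2))))"
  \<comment> \<open>The witness is the factor of \<open>summed_recursions\<close>; it is fixed
    before the problem, the network and the parameters.\<close>
  unfolding Let_def by (rule exI[of _ "\<lambda>v\<^sub>1 v\<^sub>2. 13120 * (1 + v\<^sub>1\<^sup>2 * v\<^sub>2\<^sup>2)"], intro allI impI, rule convergence_bound; assumption)

end
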